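(* For all $p>0$, there exists $C_p>0$ such that for all $T\ge\sqrt2$, $$\mathbb{E}\left[\left\|\tilde{\mathcal{C}}(T)^{-1}\right\|^p\right]\le C_p .$$ Moreover, for all $p>0$, $$\mathbb{E}\left[\left\|\tilde{\mathcal{C}}(T)^{-1}\right\|^p\right]\xrightarrow[T\to\infty]{}\mathbb{E}\left[\left\|\mathcal{G}^{-1}\right\|^p\right].$$
   Context: Let $(\tilde B_s)_{0\le s\le1}$ be a standard real Brownian motion. For $T>0$ and $r\in[0,1]$ let $$\tilde I_T(r)=\begin{pmatrix}1\\ \sqrt T\int_0^r\sin(\sqrt T\tilde B_s)\,ds\\ -\sqrt T\int_0^r\cos(\sqrt T\tilde B_s)\,ds\end{pmatrix},\qquad\tilde{\mathcal{C}}(T)=\int_0^1\tilde I_T(r)\tilde I_T(r)^{*}\,dr,$$ a random $3\times3$ matrix ($*$ is transposition), which is almost surely invertible (it is the renormalised reduced Malliavin matrix of the kinetic Brownian motion). Let $\mathscr{W}^1,\mathscr{W}^2$ be independent standard real Brownian motions and $$\mathcal{G}=\int_0^1\tilde I_\infty(r)\tilde I_\infty(r)^{*}\,dr,\qquad\tilde I_\infty(r)=\begin{pmatrix}1\\ \sqrt2\,\mathscr{W}^1_r\\ \sqrt2\,\mathscr{W}^2_r\end{pmatrix}.$$ $\|\cdot\|$ is a (fixed) matrix norm. *)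

theory Defs
  imports "HOL-Probability.Probability"
begin

text \<open>
  Standard real Brownian motion with time set $[0,1]$; the values of \<open>B\<close> at other times are
  irrelevant. Note that \<^const>\<open>normal_density\<close> takes the standard deviation, not the variance.
\<close>

locale brownian_motion = prob_space M
  for M :: "'a measure" and B :: "real \<Rightarrow> 'a \<Rightarrow> real" +
  assumes random_variable: "\<And>t. t \<in> {0..1} \<Longrightarrow> random_variable borel (B t)"
    and start: "AE \<omega> in M. B 0 \<omega> = 0"
    and independent_increments:
      "\<And>(t :: nat \<Rightarrow> real) n. mono_on {..n} t \<Longrightarrow> 0 \<le> t 0 \<Longrightarrow> t n \<le> 1 \<Longrightarrow>
         indep_vars (\<lambda>_. borel) (\<lambda>i \<omega>. B (t (Suc i)) \<omega> - B (t i) \<omega>) {..<n}"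
    and gaussian_increments:
      "\<And>s t. 0 \<le> s \<Longrightarrow> s < t \<Longrightarrow> t \<le> 1 \<Longrightarrow>
         distributed M lborel (\<lambda>\<omega>. B t \<omega> - B s \<omega>) (normal_density 0 (sqrt (t - s)))"
    and continuous_paths: "AE \<omega> in M. continuous_on {0..1} (\<lambda>t. B t \<omega>)"

text \<open>Independence of two processes as random elements of \<open>\<real>\<^bsup>[0,1]\<^esup>\<close> with the product sigma-algebra.\<close>

definition indep_processes ::
    "'a measure \<Rightarrow> (real \<Rightarrow> 'a \<Rightarrow> real) \<Rightarrow> (real \<Rightarrow> 'a \<Rightarrow> real) \<Rightarrow> bool" where
  "indep_processes M X Y \<longleftrightarrow>
     prob_space.indep_var M
       (\<Pi>\<^sub>M t\<in>{0..1}. borel) (\<lambda>\<omega>. \<lambda>t\<in>{0..1}. X t \<omega>)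
       (\<Pi>\<^sub>M t\<in>{0..1}. borel) (\<lambda>\<omega>. \<lambda>t\<in>{0..1}. Y t \<omega>)"

definition outer_square :: "real ^ 3 \<Rightarrow> real ^ 3 ^ 3" where
  "outer_square v = (\<chi> i j. v $ i * v $ j)"

definition I_tilde :: "(real \<Rightarrow> 'a \<Rightarrow> real) \<Rightarrow> real \<Rightarrow> real \<Rightarrow> 'a \<Rightarrow> real ^ 3" where
  "I_tilde B T r \<omega> = vector
     [1,
      sqrt T * (LBINT s:{0..r}. sin (sqrt T * B s \<omega>)),
      - sqrt T * (LBINT s:{0..r}. cos (sqrt T * B s \<omega>))]"

definition C_tilde :: "(real \<Rightarrow> 'a \<Rightarrow> real) \<Rightarrow> real \<Rightarrow> 'a \<Rightarrow> real ^ 3 ^ 3" where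
  "C_tilde B T \<omega> = (LBINT r:{0..1}. outer_square (I_tilde B T r \<omega>))"

definition I_infinity ::
    "(real \<Rightarrow> 'a \<Rightarrow> real) \<Rightarrow> (real \<Rightarrow> 'a \<Rightarrow> real) \<Rightarrow> real \<Rightarrow> 'a \<Rightarrow> real ^ 3" where
  "I_infinity W1 W2 r \<omega> = vector [1, sqrt 2 * W1 r \<omega>, sqrt 2 * W2 r \<omega>]"

definition G_limit ::
    "(real \<Rightarrow> 'a \<Rightarrow> real) \<Rightarrow> (real \<Rightarrow> 'a \<Rightarrow> real) \<Rightarrow> 'a \<Rightarrow> real ^ 3 ^ 3" where
  "G_limit W1 W2 \<omega> = (LBINT r:{0..1}. outer_square (I_infinity W1 W2 r \<omega>))"

text \<open>An arbitrary norm on the space of matrices; submultiplicativity is not required.\<close>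

definition matrix_norm :: "(real ^ 3 ^ 3 \<Rightarrow> real) \<Rightarrow> bool" where
  "matrix_norm nrm \<longleftrightarrow>
     (\<forall>A. 0 \<le> nrm A) \<and>
     (\<forall>A. nrm A = 0 \<longleftrightarrow> A = 0) \<and>
     (\<forall>c A. nrm (c *\<^sub>R A) = \<bar>c\<bar> * nrm A) \<and>
     (\<forall>A A'. nrm (A + A') \<le> nrm A + nrm A')"

text \<open>
  The moment $E[\|A^{-1}\|^p]$ in $[0,\infty]$. \<^const>\<open>matrix_inv\<close> is unspecified on singular
  matrices, so these are given the value \<open>\<infinity>\<close>; a finite moment thus entails that \<open>A\<close> is almost
  surely invertible.
\<close>

definition inverse_moment ::
    "'a measure \<Rightarrow> (real ^ 3 ^ 3 \<Rightarrow> real) \<Rightarrow> real \<Rightarrow> ('a \<Rightarrow> real ^ 3 ^ 3) \<Rightarrow> ennreal" where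
  "inverse_moment M nrm p A =
     (\<integral>\<^sup>+ \<omega>. (if invertible (A \<omega>) then ennreal (nrm (matrix_inv (A \<omega>)) powr p) else \<infinity>) \<partial>M)"

end

theory Submission
  imports Defs "HOL-Real_Asymp.Real_Asymp"
begin

text \<open>
  Everything is estimated in a discrete model: the Brownian path on a grid of \<open>N\<close> points is a Gaussian
  random walk, the phase integrals become sums of \<open>cis\<close> of its partial sums, and the matrix becomes the
  Gram matrix of \<open>1, X, Y\<close>; the bounds do not depend on \<open>N \<ge> T\<close>, and path continuity allows \<open>N \<rightarrow> \<infinity>\<close>.

  For the uniform bound, the determinant is by Cauchy--Binet a sum of squares of wedge products, and it
  dominates the sum of the contributions of \<open>n\<close> independent time blocks. By Paley--Zygmund each block is
  of size \<open>n\<close> to a fixed negative power with probability bounded below, so the determinant is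
  polynomially small in \<open>n\<close> only with probability exponentially small in \<open>n\<close>, and all its inverse
  moments are bounded uniformly in \<open>T \<ge> 1\<close>.

  For the limit, the characteristic functions of the finite-dimensional distributions of the phase integrals
  converge to those of \<open>\<surd>2\<close> times a planar Brownian motion (martingale central limit theorem by a
  telescoping argument). Integrating against Gaussian weights gives the Laplace transforms of nonnegative
  quadratic functionals of the path, hence by Stone--Weierstrass weak convergence of the matrices. The uniform
  moments of order \<open>2 p\<close> make the truncation of \<open>A \<mapsto> \<parallel>A\<^sup>-\<^sup>1\<parallel>\<^sup>p\<close> uniformly harmless.
\<close>

section \<open>Gaussian integrals and the Gaussian random walk\<close>

text \<open>The sums of \<open>cis\<close> are tractable because \<open>cis\<close> is an
  eigenfunction of the Gaussian transition kernel, with eigenvalue \<open>damp s\<close>: division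
  by \<open>1 - damp s\<close> makes the phase integral a martingale up to two boundary terms of
  order 1 / sqrt T.

  Inverse moments ask for n blocks with n tending to infinity at fixed T, hence also for blocks much
  shorter than the decorrelation time 1 / T of the phase. On a block of length h the path is
  diffusive if T h \<ge> 1, but almost straight if T h < 1, and its wedge products are then smaller
  by powers of T h. The factor min 1 (T h) records this and keeps mean and second moment of a block
  on one scale, as Paley--Zygmund requires. Blocks are independent although the path enters each
  with a random direction: this direction only rotates the block, and wedge products are invariant
  under rotations.

  In the limit theorem a coarse grid of n points is fixed while T tends to infinity; the error it
  causes in the Laplace transforms is of order 1 / sqrt n, uniformly in T \<ge> n.\<close>

definition gauss :: "real \<Rightarrow> real measure" where
  "gauss s = density lborel (\<lambda>x. ennreal (normal_density 0 s x))"

lemma cis_measurable [measurable]: "cis \<in> borel_measurable borel"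
  by (intro borel_measurable_continuous_onI continuous_intros)

lemma cosh_measurable [measurable]: "(cosh :: real \<Rightarrow> real) \<in> borel_measurable borel"
  by (intro borel_measurable_continuous_onI continuous_intros)

lemma sets_gauss [simp, measurable_cong]: "sets (gauss s) = sets borel"
  by (simp add: gauss_def)

lemma space_gauss [simp]: "space (gauss s) = UNIV"
  by (simp add: gauss_def)

lemma prob_space_gauss: "0 < s \<Longrightarrow> prob_space (gauss s)"
  unfolding gauss_def by (rule prob_space_normal_density)

text \<open>Scaling brings a Gaussian integral to the standard normal law, whose characteristic
  function is known.\<close>

lemma gauss_distr_std: "0 < s \<Longrightarrow> gauss s = distr (gauss 1) borel (\<lambda>x. s * x)"
proof -
  assume s: "0 < s"
  interpret prob_space "gauss 1" by (simp add: prob_space_gauss)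
  have "distributed (gauss 1) lborel (\<lambda>x. x) (\<lambda>x. ennreal (normal_density 0 1 x))"
    unfolding distributed_def by (auto simp: gauss_def intro!: measure_eqI) (simp add: emeasure_distr)
  from normal_density_affine[OF this, of s 0] s
  have "distributed (gauss 1) lborel (\<lambda>x. s * x) (\<lambda>x. ennreal (normal_density 0 s x))" by simp
  from distributed_distr_eq_density[OF this]
  have "distr (gauss 1) lborel (\<lambda>x. s * x) = gauss s" by (simp add: gauss_def)
  moreover have "distr (gauss 1) borel (\<lambda>x. s * x) = distr (gauss 1) lborel (\<lambda>x. s * x)"
    by (rule distr_cong) auto
  ultimately show ?thesis by simp
qed

lemma gauss_cis:
  assumes s: "0 < s"
  shows "(\<integral>y. cis (c * y) \<partial>gauss s) = of_real (exp (- (s\<^sup>2 * c\<^sup>2) / 2))"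
proof -
  have "(\<integral>y. cis (c * y) \<partial>gauss s) = (\<integral>y. cis (c * (s * y)) \<partial>gauss 1)"
    by (subst gauss_distr_std[OF s], subst integral_distr) auto
  also have "\<dots> = char std_normal_distribution (c * s)"
    by (simp add: char_def gauss_def cis_conv_exp mult_ac)
  also have "\<dots> = of_real (exp (- (s\<^sup>2 * c\<^sup>2) / 2))"
    by (simp add: char_std_normal_distribution power_mult_distrib mult_ac exp_of_real)
  finally show ?thesis .
qed

lemma gauss_exp:
  assumes s: "0 < s"
  shows "has_bochner_integral (gauss s) (\<lambda>y. exp (c * y)) (exp (s\<^sup>2 * c\<^sup>2 / 2))"
proof -
  \<comment> \<open>Completing the square: the tilt by exp (c y) only shifts the mean to s^2
    c.\<close>
  have eq: "normal_density 0 s y * exp (c * y) = exp (s\<^sup>2 * c\<^sup>2 / 2) * normal_density (s\<^sup>2 * c) s y" for y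
  proof -
    have "- y\<^sup>2 / (2 * s\<^sup>2) + c * y = s\<^sup>2 * c\<^sup>2 / 2 - (y - s\<^sup>2 * c)\<^sup>2 / (2 * s\<^sup>2)"
      using s by (simp add: field_simps power2_eq_square)
    then show ?thesis
      by (simp add: normal_density_def mult_ac flip: exp_add)
  qed
  have "has_bochner_integral lborel (\<lambda>y. exp (s\<^sup>2 * c\<^sup>2 / 2) * normal_density (s\<^sup>2 * c) s y) (exp (s\<^sup>2 * c\<^sup>2 / 2) * 1)"
    by (intro has_bochner_integral_mult_right) (use s in \<open>simp add: has_bochner_integral_iff\<close>)
  then show ?thesis
    unfolding gauss_def by (subst has_bochner_integral_density) (auto simp: eq)
qed

lemma gauss_pow4:
  assumes s: "0 < s"
  shows "has_bochner_integral (gauss s) (\<lambda>y. y^4) (3 * s^4)"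
  using normal_moment_even[OF s, of 0 2] s unfolding gauss_def
  by (subst has_bochner_integral_density) (auto simp: fact_numeral field_simps)

lemma integrable_gauss_bounded:
  fixes f :: "real \<Rightarrow> 'b::{banach, second_countable_topology}"
  assumes "0 < s" "f \<in> borel_measurable borel" "\<And>y. norm (f y) \<le> B"
  shows "integrable (gauss s) f"
proof -
  interpret prob_space "gauss s" using assms by (simp add: prob_space_gauss)
  show ?thesis by (rule integrable_const_bound[of _ B]) (use assms in auto)
qed

section \<open>Gaussian concentration for Lipschitz functions\<close>

lemma cosh_mono_abs: "\<bar>x\<bar> \<le> \<bar>y\<bar> \<Longrightarrow> cosh x \<le> cosh (y::real)"
  by (metis abs_ge_zero cosh_real_abs cosh_real_nonneg_le_iff abs_ge_zero)

text \<open>Symmetrisation by an independent copy. Jensen replaces the factor exp (- E f) by E (exp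
  (- f)), and the product of the two expectations is the mean of cosh (f y - f z) over independent y
  and z. The Lipschitz bound passes to cosh (L (y - z)), where y - z has variance 2 s^2; the
  exponent is therefore twice the sharp value s^2 L^2 / 2, which is harmless here.\<close>

lemma gauss_lipschitz_exp:
  fixes f :: "real \<Rightarrow> real"
  assumes s: "0 < s" and [measurable]: "f \<in> borel_measurable borel"
    and B: "\<And>y. \<bar>f y\<bar> \<le> B" and L: "\<And>y z. \<bar>f y - f z\<bar> \<le> L * \<bar>y - z\<bar>"
  shows "(\<integral>y. exp (f y - (\<integral>z. f z \<partial>gauss s)) \<partial>gauss s) \<le> exp (s\<^sup>2 * L\<^sup>2)"
proof -
  interpret prob_space "gauss s" using s by (simp add: prob_space_gauss)
  interpret pp: pair_prob_space "gauss s" "gauss s" ..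
  have B0: "0 \<le> B" using B[of 0] by simp
  have L0: "0 \<le> L" using L[of 1 0] by simp
  have i0: "integrable (gauss s) (\<lambda>y. exp (f y))" "integrable (gauss s) (\<lambda>y. exp (- f y))"
    using B by (auto intro!: integrable_gauss_bounded[OF s, where B="exp B"] simp: abs_le_iff)
  have "integrable (gauss s) f"
    by (rule integrable_gauss_bounded[OF s, where B=B]) (use B in auto)
  note i1 = i0 this
  have jensen: "exp (- (\<integral>z. f z \<partial>gauss s)) \<le> (\<integral>z. exp (- f z) \<partial>gauss s)"
    using jensens_inequality[where X="\<lambda>z. - f z" and I=UNIV and q=exp] i1 exp_convex by simp
  let ?p = "(\<integral>y. exp (f y) \<partial>gauss s)" and ?q = "(\<integral>y. exp (- f y) \<partial>gauss s)"
  have "(\<integral>y. exp (f y - (\<integral>z. f z \<partial>gauss s)) \<partial>gauss s) = ?p * exp (- (\<integral>z. f z \<partial>gauss s))"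
    by (simp add: exp_diff exp_minus field_simps)
  also have "\<dots> \<le> ?p * ?q" by (intro mult_left_mono jensen) auto
  \<comment> \<open>The mixed products exp (f y) exp (- f z) and exp (- f y) exp (f z) have the same
    mean, and cosh is half their sum.\<close>
  also have "\<dots> = (\<integral>y. (\<integral>z. cosh (f y - f z) \<partial>gauss s) \<partial>gauss s)"
  proof -
    have ce: "cosh (f y - f z) = (exp (f y) * exp (- f z) + exp (- f y) * exp (f z)) / 2" for y z
      by (simp add: cosh_def flip: exp_add)
    have "(\<integral>y. (\<integral>z. cosh (f y - f z) \<partial>gauss s) \<partial>gauss s)
      = (\<integral>y. (exp (f y) * ?q + exp (- f y) * ?p) / 2 \<partial>gauss s)"
      unfolding ce using i1 by simp
    also have "\<dots> = ?p * ?q" using i1 by simp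
    finally show ?thesis by simp
  qed
  also have "\<dots> \<le> (\<integral>y. (\<integral>z. cosh (L * (y - z)) \<partial>gauss s) \<partial>gauss s)"
  proof -
    have e: "integrable (gauss s) (\<lambda>y. exp (c * y))" for c
      using gauss_exp[OF s] by (simp add: has_bochner_integral_iff)
    have ce: "cosh (L * (y - z)) = (exp (L * y) * exp (- L * z) + exp (- L * y) * exp (L * z)) / 2" for y z
      by (simp add: cosh_def right_diff_distrib flip: exp_add)
    have i2: "integrable (gauss s) (\<lambda>z. cosh (L * (y - z)))" for y
      unfolding ce using e[of L] e[of "-L"] by simp
    have i3: "integrable (gauss s) (\<lambda>y. \<integral>z. cosh (L * (y - z)) \<partial>gauss s)"
      unfolding ce using e[of L] e[of "-L"] by simp
    have bb: "\<bar>f y - f z\<bar> \<le> 2 * B" for y z using B[of y] B[of z] by linarith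
    have cb: "cosh (f y - f z) \<le> cosh (2 * B)" for y z
      by (rule cosh_mono_abs) (use bb[of y z] B0 in simp)
    have i4: "integrable (gauss s) (\<lambda>z. cosh (f y - f z))" for y
      by (rule integrable_gauss_bounded[OF s, of _ "cosh (2*B)"]) (auto simp: cb)
    have i5: "integrable (gauss s) (\<lambda>y. \<integral>z. cosh (f y - f z) \<partial>gauss s)"
    proof (rule integrable_gauss_bounded[OF s, of _ "cosh (2*B)"])
      show "norm (\<integral>z. cosh (f y - f z) \<partial>gauss s) \<le> cosh (2 * B)" for y
      proof -
        have "(\<integral>z. cosh (f y - f z) \<partial>gauss s) \<le> (\<integral>z. cosh (2*B) \<partial>gauss s)"
          by (intro integral_mono i4 integrable_const cb)
        moreover have "0 \<le> (\<integral>z. cosh (f y - f z) \<partial>gauss s)"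
          by (intro integral_nonneg_AE) (simp add: less_imp_le)
        ultimately show ?thesis using prob_space by simp
      qed
    qed measurable
    show ?thesis
      by (intro integral_mono i2 i3 i4 i5 cosh_mono_abs) (use L L0 in \<open>auto simp: abs_mult\<close>)
  qed
  also have "\<dots> = exp (s\<^sup>2 * L\<^sup>2)"
  proof -
    have e: "integrable (gauss s) (\<lambda>y. exp (c * y))" for c
      using gauss_exp[OF s] by (simp add: has_bochner_integral_iff)
    have v: "(\<integral>y. exp (c * y) \<partial>gauss s) = exp (s\<^sup>2 * c\<^sup>2 / 2)" for c
      using gauss_exp[OF s] by (simp add: has_bochner_integral_iff)
    have ce: "cosh (L * (y - z)) = (exp (L * y) * exp (- L * z) + exp (- L * y) * exp (L * z)) / 2" for y z
      by (simp add: cosh_def right_diff_distrib flip: exp_add)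
    show ?thesis unfolding ce
      using e[of L] e[of "-L"] v[of L] v[of "-L"] by simp (simp flip: exp_add)
  qed
  finally show ?thesis .
qed

section \<open>The Gaussian random walk and its phases\<close>

definition walk :: "real \<Rightarrow> nat \<Rightarrow> (nat \<Rightarrow> real) measure" where
  "walk s n = PiM {..<n} (\<lambda>_. gauss s)"

text \<open>The step x i is excluded: \<open>phase i\<close> depends only on the steps before i and
  is independent of x i, which makes weights built from it predictable.\<close>

definition phase :: "nat \<Rightarrow> (nat \<Rightarrow> real) \<Rightarrow> real" where
  "phase i x = (\<Sum>l<i. x l)"

lemma prob_space_walk: "0 < s \<Longrightarrow> prob_space (walk s n)"
  unfolding walk_def by (intro prob_space_PiM prob_space_gauss)

lemma sets_walk [measurable_cong]: "sets (walk s n) = sets (PiM {..<n} (\<lambda>_. borel))"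
  unfolding walk_def by (intro sets_PiM_cong) auto

lemma walk_component_measurable [measurable (raw)]: "i < n \<Longrightarrow> (\<lambda>x. x i) \<in> borel_measurable (walk s n)"
  by (subst measurable_cong_sets[OF sets_walk refl]) (rule measurable_component_singleton, simp)

lemma phase_measurable [measurable (raw)]: "i \<le> n \<Longrightarrow> phase i \<in> borel_measurable (walk s n)"
  unfolding phase_def by (intro borel_measurable_sum walk_component_measurable) auto

lemma phase_measurable' [measurable (raw)]: "i \<le> n \<Longrightarrow> (\<lambda>x. phase i x) \<in> borel_measurable (walk s n)"
  by (rule phase_measurable)

lemma phase_Suc: "phase (Suc i) x = phase i x + x i"
  by (simp add: phase_def)

lemma phase_upd: "i \<le> n \<Longrightarrow> phase i (x(n := y)) = phase i x"
  by (simp add: phase_def)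

lemma product_sigma_finite_gauss: "0 < s \<Longrightarrow> product_sigma_finite (\<lambda>_. gauss s)"
  by (simp add: product_sigma_finite_def prob_space_gauss prob_space_imp_sigma_finite)

text \<open>Fubini in the form of conditioning on the first n steps. The inductions over the length
  of the walk rest on this and on its Bochner version.\<close>

lemma walk_Suc_nn_integral:
  assumes s: "0 < s" and f: "f \<in> borel_measurable (walk s (Suc n))"
  shows "(\<integral>\<^sup>+x. f x \<partial>walk s (Suc n)) = (\<integral>\<^sup>+x. (\<integral>\<^sup>+y. f (x(n := y)) \<partial>gauss s) \<partial>walk s n)"
  using product_sigma_finite.product_nn_integral_insert[OF product_sigma_finite_gauss[OF s], of "{..<n}" n f] f
  by (simp add: walk_def lessThan_Suc)

lemma walk_Suc_integral:
  fixes f :: "_ \<Rightarrow> 'b::{banach, second_countable_topology}"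
  assumes s: "0 < s" and f: "integrable (walk s (Suc n)) f"
  shows "(\<integral>x. f x \<partial>walk s (Suc n)) = (\<integral>x. (\<integral>y. f (x(n := y)) \<partial>gauss s) \<partial>walk s n)"
  using product_sigma_finite.product_integral_insert[OF product_sigma_finite_gauss[OF s], of "{..<n}" n f] f
  by (simp add: walk_def lessThan_Suc)

lemma integrable_walk_bounded:
  fixes f :: "_ \<Rightarrow> 'b::{banach, second_countable_topology}"
  assumes "0 < s" "f \<in> borel_measurable (walk s n)" "\<And>y. norm (f y) \<le> B"
  shows "integrable (walk s n) f"
proof -
  interpret prob_space "walk s n" using assms by (simp add: prob_space_walk)
  show ?thesis by (rule integrable_const_bound[of _ B]) (use assms in auto)
qed

lemma walk_cis:
  assumes s: "0 < s"
  shows "(\<integral>x. cis (\<Sum>l<n. c l * x l) \<partial>walk s n) = of_real (exp (- (s\<^sup>2 / 2) * (\<Sum>l<n. (c l)\<^sup>2)))"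
proof -
  have "cis (\<Sum>l\<in>A. f l) = (\<Prod>l\<in>A. cis (f l))" if "finite A" for f and A :: "nat set"
    using that by induction (auto simp: cis_mult[symmetric])
  then have "(\<integral>x. cis (\<Sum>l<n. c l * x l) \<partial>walk s n) = (\<integral>x. (\<Prod>l<n. cis (c l * x l)) \<partial>walk s n)"
    by simp
  also have "\<dots> = (\<Prod>l<n. \<integral>y. cis (c l * y) \<partial>gauss s)"
    unfolding walk_def
    by (rule product_sigma_finite.product_integral_prod[OF product_sigma_finite_gauss[OF s]])
       (auto intro!: integrable_gauss_bounded[OF s, where B=1])
  also have "\<dots> = of_real (\<Prod>l<n. exp (- (s\<^sup>2 / 2) * (c l)\<^sup>2))"
    unfolding of_real_prod by (intro prod.cong refl) (simp add: gauss_cis[OF s])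
  also have "(\<Prod>l<n. exp (- (s\<^sup>2 / 2) * (c l)\<^sup>2)) = exp (- (s\<^sup>2 / 2) * (\<Sum>l<n. (c l)\<^sup>2))"
    unfolding sum_distrib_left by (rule exp_sum[symmetric]) simp
  finally show ?thesis .
qed

lemma walk_cos:
  assumes s: "0 < s"
  shows "(\<integral>x. cos (\<Sum>l<n. c l * x l) \<partial>walk s n) = exp (- (s\<^sup>2 / 2) * (\<Sum>l<n. (c l)\<^sup>2))"
proof -
  have "integrable (walk s n) (\<lambda>x. cis (\<Sum>l<n. c l * x l))"
    by (rule integrable_walk_bounded[OF s, where B=1]) auto
  from integral_Re[OF this] show ?thesis
    by (simp add: walk_cis[OF s])
qed

section \<open>Exponential martingale bounds for the phase\<close>

lemma norm_cis_diff_le: "norm (cis x - cis y) \<le> \<bar>x - y\<bar>"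
proof -
  have "(norm (cis x - cis y))\<^sup>2 = (2 * sin ((x - y) / 2))\<^sup>2"
  proof -
    have "(norm (cis x - cis y))\<^sup>2 = 2 - 2 * cos (x - y)"
      unfolding cmod_power2 cos_diff 
      by (simp add: power2_diff sin_squared_eq)
    also have "cos (x - y) = 1 - 2 * (sin ((x - y) / 2))\<^sup>2"
      using cos_double_sin[of "(x - y)/2"] by (simp only: times_divide_eq_right nonzero_mult_div_cancel_left[of 2 "x - y", OF zero_neq_numeral[symmetric]])
    finally show ?thesis by (simp add: power_mult_distrib)
  qed
  also have "\<dots> = (2 * \<bar>sin ((x - y) / 2)\<bar>)\<^sup>2" by (simp add: power_mult_distrib)
  also have "\<dots> \<le> \<bar>x - y\<bar>\<^sup>2"
    using abs_sin_x_le_abs_x[of "(x - y)/2"] by (intro power_mono) auto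
  finally show ?thesis by (rule power2_le_imp_le) simp
qed

text \<open>The mean of \<open>cis\<close> under \<open>gauss s\<close>, hence the factor by which
  one step of the walk contracts the conditional mean of \<open>cis (phase j)\<close>.\<close>

abbreviation damp :: "real \<Rightarrow> real" where "damp s \<equiv> exp (- s\<^sup>2 / 2)"

text \<open>The map from y to Re (z cis y) is Lipschitz with constant \<open>norm z\<close> and has
  mean Re (z damp s), so Gaussian concentration applies to it.\<close>

lemma gauss_cis_step_exp:
  assumes s: "0 < s"
  shows "(\<integral>\<^sup>+y. ennreal (exp (Re (z * (cis y - damp s)))) \<partial>gauss s) \<le> ennreal (exp (s\<^sup>2 * (norm z)\<^sup>2))"
proof -
  interpret prob_space "gauss s" using s by (rule prob_space_gauss)
  let ?f = "\<lambda>y. Re (z * cis y)"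
  have bd: "norm (z * cis y) \<le> norm z" for y by (simp add: norm_mult)
  have i: "integrable (gauss s) (\<lambda>y. z * cis y)"
    by (rule integrable_gauss_bounded[OF s, where B="norm z"]) (auto simp: norm_mult)
  have m: "(\<integral>y. ?f y \<partial>gauss s) = Re (z * damp s)"
    using integral_Re[OF i] gauss_cis[OF s, of 1] i by simp
  have b: "\<bar>?f y\<bar> \<le> norm z" for y
    using abs_Re_le_cmod[of "z * cis y"] bd[of y] by linarith
  have l: "\<bar>?f y - ?f y'\<bar> \<le> norm z * \<bar>y - y'\<bar>" for y y'
  proof -
    have "\<bar>?f y - ?f y'\<bar> = \<bar>Re (z * (cis y - cis y'))\<bar>" by (simp add: algebra_simps)
    also have "\<dots> \<le> norm z * norm (cis y - cis y')"
      using abs_Re_le_cmod[of "z * (cis y - cis y')"] by (simp add: norm_mult)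
    also have "\<dots> \<le> norm z * \<bar>y - y'\<bar>" by (intro mult_left_mono norm_cis_diff_le) simp
    finally show ?thesis .
  qed
  have "(\<integral>y. exp (?f y - (\<integral>y. ?f y \<partial>gauss s)) \<partial>gauss s) \<le> exp (s\<^sup>2 * (norm z)\<^sup>2)"
    by (rule gauss_lipschitz_exp[OF s _ b l]) measurable
  also have "(\<lambda>y. exp (?f y - (\<integral>y. ?f y \<partial>gauss s))) = (\<lambda>y. exp (Re (z * (cis y - damp s))))"
    unfolding m by (simp add: right_diff_distrib)
  finally have *: "(\<integral>y. exp (Re (z * (cis y - damp s))) \<partial>gauss s) \<le> exp (s\<^sup>2 * (norm z)\<^sup>2)" .
  have "integrable (gauss s) (\<lambda>y. exp (Re (z * (cis y - damp s))))"
  proof (rule integrable_gauss_bounded[OF s, where B="exp (norm z - Re (z * damp s))"])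
    show "norm (exp (Re (z * (cis y - damp s)))) \<le> exp (norm z - Re (z * damp s))" for y
      using b[of y] by (simp add: right_diff_distrib)
  qed measurable
  from nn_integral_eq_integral[OF this] * show ?thesis by (simp add: ennreal_leI)
qed

text \<open>The summands \<open>cis (phase j x) * (cis (x j) - damp s)\<close> are the martingale differences
  \<open>cis (phase (j + 1)) - E[cis (phase (j + 1)) | F\<^sub>j]\<close>.\<close>

lemma walk_azuma:
  assumes s: "0 < s"
  shows "(\<integral>\<^sup>+x. ennreal (exp (\<Sum>j<n. Re (w j * cis (phase j x) * (cis (x j) - damp s)))) \<partial>walk s n)
    \<le> ennreal (exp (s\<^sup>2 * (\<Sum>j<n. (norm (w j))\<^sup>2)))"
proof (induction n)
  case 0
  interpret prob_space "walk s 0" using s by (rule prob_space_walk)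
  show ?case by (simp add: emeasure_space_1)
next
  case (Suc n)
  let ?S = "\<lambda>n x. (\<Sum>j<n. Re (w j * cis (phase j x) * (cis (x j) - damp s)))"
  have upd: "?S (Suc n) (x(n := y)) = ?S n x + Re (w n * cis (phase n x) * (cis y - damp s))" for x y
    by (simp add: phase_upd)
  have "(\<integral>\<^sup>+x. ennreal (exp (?S (Suc n) x)) \<partial>walk s (Suc n))
      = (\<integral>\<^sup>+x. (\<integral>\<^sup>+y. ennreal (exp (?S (Suc n) (x(n := y)))) \<partial>gauss s) \<partial>walk s n)"
    by (rule walk_Suc_nn_integral[OF s]) measurable
  also have "\<dots> = (\<integral>\<^sup>+x. ennreal (exp (?S n x)) *
      (\<integral>\<^sup>+y. ennreal (exp (Re (w n * cis (phase n x) * (cis y - damp s)))) \<partial>gauss s) \<partial>walk s n)"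
    unfolding upd exp_add
    by (intro nn_integral_cong) (simp add: ennreal_mult nn_integral_cmult)
  \<comment> \<open>The conditional bound does not depend on the past, since the rotation by
    \<open>cis (phase n x)\<close> leaves the norm of \<open>w n\<close> unchanged.\<close>
  also have "\<dots> \<le> (\<integral>\<^sup>+x. ennreal (exp (?S n x)) * ennreal (exp (s\<^sup>2 * (norm (w n))\<^sup>2)) \<partial>walk s n)"
    by (intro nn_integral_mono mult_left_mono order_trans[OF gauss_cis_step_exp[OF s]]) (auto simp: norm_mult)
  also have "\<dots> = (\<integral>\<^sup>+x. ennreal (exp (?S n x)) \<partial>walk s n) * ennreal (exp (s\<^sup>2 * (norm (w n))\<^sup>2))"
    by (intro nn_integral_multc) measurable
  also have "\<dots> \<le> ennreal (exp (s\<^sup>2 * (\<Sum>j<n. (norm (w j))\<^sup>2))) * ennreal (exp (s\<^sup>2 * (norm (w n))\<^sup>2))"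
    by (intro mult_right_mono Suc) simp
  finally show ?case
    by (simp add: distrib_left exp_add ennreal_mult)
qed

text \<open>A Poisson equation: \<open>1 - damp s\<close> times \<open>cis (phase j x)\<close> is a
  martingale difference minus an increment of \<open>cis (phase j x)\<close>, and the increments
  telescope to the boundary terms.\<close>

lemma sum_cis_phase:
  assumes "0 < s" "r \<le> t"
  shows "(\<Sum>j\<in>{r..<t}. cis (phase j x)) =
    (1 / (1 - damp s)) * (\<Sum>j\<in>{r..<t}. cis (phase j x) * (cis (x j) - damp s))
    - (1 / (1 - damp s)) * (cis (phase t x) - cis (phase r x))"
proof -
  have d: "1 - complex_of_real (damp s) \<noteq> 0"
  proof -
    have "damp s < 1" using assms by simp
    then have "complex_of_real (1 - damp s) \<noteq> 0" by (simp only: of_real_eq_0_iff)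
    then show ?thesis by simp
  qed
  have "(\<Sum>j\<in>{r..<t}. cis (phase (Suc j) x) - cis (phase j x)) = cis (phase t x) - cis (phase r x)"
    using assms(2) by (rule sum_Suc_diff')
  moreover have "(\<Sum>j\<in>{r..<t}. cis (phase j x) * (cis (x j) - damp s))
    = (\<Sum>j\<in>{r..<t}. (cis (phase (Suc j) x) - cis (phase j x)) + (1 - damp s) * cis (phase j x))"
    by (intro sum.cong refl) (simp add: phase_Suc cis_mult[symmetric] algebra_simps)
  ultimately have "(\<Sum>j\<in>{r..<t}. cis (phase j x) * (cis (x j) - damp s))
    = (cis (phase t x) - cis (phase r x)) + (1 - damp s) * (\<Sum>j\<in>{r..<t}. cis (phase j x))"
    by (simp add: sum.distrib sum_distrib_left)
  moreover have "S = (1 / q) * A - (1 / q) * D" if "A = D + q * S" "q \<noteq> 0" for S A D q :: complex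
    using that by (simp add: field_simps)
  ultimately show ?thesis using d by simp
qed

section \<open>Moments of the phase integrals\<close>

lemma one_minus_exp_ge:
  fixes x :: real
  assumes "0 \<le> x" "x \<le> 1"
  shows "x / 2 \<le> 1 - exp (- x)"
proof -
  have "exp (- x) \<le> 1 / (1 + x)"
    using exp_ge_add_one_self[of x] assms by (simp add: exp_minus field_simps)
  moreover have "x / 2 \<le> 1 - 1 / (1 + x)"
  proof -
    have "x * x \<le> x" using assms mult_left_le[of x x] by simp
    then show ?thesis using assms by (simp add: field_simps)
  qed
  ultimately show ?thesis by linarith
qed

text \<open>A single term of the exponential series; it turns exponential moments into polynomial
  ones.\<close>

lemma power_le_fact_exp:
  fixes x :: real
  assumes "0 \<le> x"
  shows "x ^ p \<le> fact p * exp x"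
proof -
  have "(\<Sum>n\<in>{p}. inverse (fact n) * x ^ n) \<le> (\<Sum>n. inverse (fact n) * x ^ n)"
    by (rule sum_le_suminf) (use assms in \<open>auto simp: summable_exp\<close>)
  then have "x ^ p / fact p \<le> exp x"
    by (simp add: exp_def field_simps)
  then show ?thesis by (simp add: field_simps)
qed

text \<open>The weights are z / (1 - damp s) on {r..<t} and zero elsewhere. The first summand of the
  exponent is the bound of \<open>walk_azuma\<close>, the second that of the two boundary terms. The
  factor k = 1 / (1 - damp s) is at most 4 / s^2 because s^2 \<le> 1, which gives 16 = 4^2 and 8 = 2
  * 4.\<close>

lemma walk_exp_moment:
  assumes s: "0 < s" "s\<^sup>2 \<le> 1" and rt: "r \<le> t" "t \<le> n"
  shows "(\<integral>\<^sup>+x. ennreal (exp (Re (z * (\<Sum>j\<in>{r..<t}. cis (phase j x))))) \<partial>walk s n)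
    \<le> ennreal (exp (16 / s\<^sup>2 * (norm z)\<^sup>2 * (real t - real r) + 8 / s\<^sup>2 * norm z))"
proof -
  define k where "k = 1 / (1 - damp s)"
  have d1: "damp s < 1" using s by simp
  have k0: "0 < k" using d1 by (simp add: k_def)
  have k4: "k \<le> 4 / s\<^sup>2"
  proof -
    have "s\<^sup>2 / 4 \<le> 1 - damp s"
      using one_minus_exp_ge[of "s\<^sup>2 / 2"] s by simp
    then show ?thesis using s by (simp add: k_def field_simps)
  qed
  define w where "w = (\<lambda>j. if j \<in> {r..<t} then z * k else 0)"
  have id: "Re (z * (\<Sum>j\<in>{r..<t}. cis (phase j x))) =
     (\<Sum>j<n. Re (w j * cis (phase j x) * (cis (x j) - damp s))) - Re (z * k * (cis (phase t x) - cis (phase r x)))" for x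
  proof -
    have "(\<Sum>j<n. w j * cis (phase j x) * (cis (x j) - damp s)) = z * k * (\<Sum>j\<in>{r..<t}. cis (phase j x) * (cis (x j) - damp s))"
    proof -
      have "(\<Sum>j<n. w j * cis (phase j x) * (cis (x j) - damp s)) = (\<Sum>j\<in>{r..<t}. w j * cis (phase j x) * (cis (x j) - damp s))"
        by (rule sum.mono_neutral_right) (use rt in \<open>auto simp: w_def\<close>)
      also have "\<dots> = (\<Sum>j\<in>{r..<t}. z * k * (cis (phase j x) * (cis (x j) - damp s)))"
        by (intro sum.cong) (auto simp: w_def)
      finally show ?thesis by (simp add: sum_distrib_left)
    qed
    then have "z * (\<Sum>j\<in>{r..<t}. cis (phase j x)) =
      (\<Sum>j<n. w j * cis (phase j x) * (cis (x j) - damp s)) - z * k * (cis (phase t x) - cis (phase r x))"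
      unfolding sum_cis_phase[OF s(1) rt(1)] by (simp add: k_def algebra_simps)
    then show ?thesis by (simp add: Re_sum)
  qed
  have le: "Re (z * (\<Sum>j\<in>{r..<t}. cis (phase j x))) \<le>
     (\<Sum>j<n. Re (w j * cis (phase j x) * (cis (x j) - damp s))) + 2 * k * norm z" for x
  proof -
    have "norm (z * k * (cis (phase t x) - cis (phase r x))) \<le> norm z * k * 2"
      unfolding norm_mult using k0 norm_triangle_ineq4[of "cis (phase t x)" "cis (phase r x)"]
      by (intro mult_mono) auto
    with abs_Re_le_cmod[of "z * k * (cis (phase t x) - cis (phase r x))"] show ?thesis
      unfolding id by (simp add: mult_ac)
  qed
  have "(\<integral>\<^sup>+x. ennreal (exp (Re (z * (\<Sum>j\<in>{r..<t}. cis (phase j x))))) \<partial>walk s n)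
    \<le> (\<integral>\<^sup>+x. ennreal (exp (2 * k * norm z)) * ennreal (exp (\<Sum>j<n. Re (w j * cis (phase j x) * (cis (x j) - damp s)))) \<partial>walk s n)"
  proof (rule nn_integral_mono)
    fix x
    show "ennreal (exp (Re (z * (\<Sum>j\<in>{r..<t}. cis (phase j x))))) \<le>
      ennreal (exp (2 * k * norm z)) * ennreal (exp (\<Sum>j<n. Re (w j * cis (phase j x) * (cis (x j) - damp s))))"
      unfolding ennreal_mult[symmetric, OF exp_ge_zero exp_ge_zero] exp_add[symmetric]
      by (rule ennreal_leI) (use le[of x] in simp)
  qed
  also have "\<dots> = ennreal (exp (2 * k * norm z)) * (\<integral>\<^sup>+x. ennreal (exp (\<Sum>j<n. Re (w j * cis (phase j x) * (cis (x j) - damp s)))) \<partial>walk s n)"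
    by (intro nn_integral_cmult) measurable
  also have "\<dots> \<le> ennreal (exp (2 * k * norm z)) * ennreal (exp (s\<^sup>2 * (\<Sum>j<n. (norm (w j))\<^sup>2)))"
    by (intro mult_left_mono walk_azuma s) simp
  also have "\<dots> = ennreal (exp (2 * k * norm z + s\<^sup>2 * (k\<^sup>2 * (norm z)\<^sup>2 * (real t - real r))))"
  proof -
    have "(\<Sum>j<n. (norm (w j))\<^sup>2) = (\<Sum>j\<in>{r..<t}. (norm (w j))\<^sup>2)"
      by (rule sum.mono_neutral_right) (use rt in \<open>auto simp: w_def\<close>)
    also have "\<dots> = (\<Sum>j\<in>{r..<t}. k\<^sup>2 * (norm z)\<^sup>2)"
      by (intro sum.cong) (auto simp: w_def norm_mult power_mult_distrib)
    also have "\<dots> = k\<^sup>2 * (norm z)\<^sup>2 * (real t - real r)" using rt by (simp add: of_nat_diff)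
    finally show ?thesis by (simp add: ennreal_mult exp_add)
  qed
  also have "\<dots> \<le> ennreal (exp (16 / s\<^sup>2 * (norm z)\<^sup>2 * (real t - real r) + 8 / s\<^sup>2 * norm z))"
  proof -
    have "2 * k * norm z \<le> 8 / s\<^sup>2 * norm z"
      using mult_right_mono[OF k4, of "2 * norm z"] by (simp add: mult_ac)
    moreover have "s\<^sup>2 * (k\<^sup>2 * (norm z)\<^sup>2 * (real t - real r)) \<le> 16 / s\<^sup>2 * (norm z)\<^sup>2 * (real t - real r)"
    proof -
      have "k\<^sup>2 \<le> (4 / s\<^sup>2)\<^sup>2" using k0 k4 by (intro power_mono) auto
      then have "s\<^sup>2 * k\<^sup>2 \<le> s\<^sup>2 * (4 / s\<^sup>2)\<^sup>2" by (intro mult_left_mono) auto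
      also have "\<dots> = 16 / s\<^sup>2" using s by (simp add: power_divide field_simps)
      finally have "s\<^sup>2 * k\<^sup>2 * ((norm z)\<^sup>2 * (real t - real r)) \<le> 16 / s\<^sup>2 * ((norm z)\<^sup>2 * (real t - real r))"
        using rt by (intro mult_right_mono) auto
      then show ?thesis by (simp add: mult_ac)
    qed
    ultimately show ?thesis by (intro ennreal_leI) simp
  qed
  finally show ?thesis .
qed

text \<open>Up to two boundary terms, \<open>(1 - damp s)\<close> times the sum of \<open>cis (phase j x)\<close> is a martingale with
  bounded differences, to which \<open>walk_azuma\<close> applies.\<close>

lemma walk_increment_moment:
  fixes \<zeta> :: complex
  assumes T: "0 < T" "T \<le> real N" and s: "s = sqrt (T / real N)" and z: "norm \<zeta> = 1"
    and rt: "r \<le> t" "t \<le> n" and H: "(real t - real r) / real N \<le> H" "1 / T \<le> H"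
  shows "(\<integral>x. \<bar>sqrt T / real N * Re (\<zeta> * (\<Sum>j\<in>{r..<t}. cis (phase j x)))\<bar> ^ p \<partial>walk s n)
     \<le> 2 * fact p * exp 24 * (sqrt H) ^ p"
proof -
  have N: "0 < real N" using T by linarith
  have s0: "0 < s" using T N by (simp add: s)
  have s2: "s\<^sup>2 = T / real N" using T N by (simp add: s)
  have s1: "s\<^sup>2 \<le> 1" using T N by (simp add: s2)
  have H0: "0 < H" using H T by (smt (verit) zero_less_divide_1_iff)
  interpret prob_space "walk s n" using s0 by (rule prob_space_walk)
  \<comment> \<open>Division by sqrt H normalises both parts: H dominates the time span, which
    controls the martingale, and 1 / T, which controls the boundary terms.\<close>
  define Y where "Y = (\<lambda>x. sqrt T / real N * Re (\<zeta> * (\<Sum>j\<in>{r..<t}. cis (phase j x))) / sqrt H)"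
  have [measurable]: "Y \<in> borel_measurable (walk s n)"
  proof -
    have "(\<lambda>x. \<Sum>j\<in>{r..<t}. cis (phase j x)) \<in> borel_measurable (walk s n)"
      by (intro borel_measurable_sum measurable_compose[OF phase_measurable' cis_measurable]) (use rt in auto)
    note [measurable] = this
    show ?thesis unfolding Y_def by measurable
  qed
  \<comment> \<open>The martingale part contributes 16 to the exponent and the boundary terms
    8.\<close>
  have e: "(\<integral>\<^sup>+x. ennreal (exp (c * Y x)) \<partial>walk s n) \<le> ennreal (exp 24)" if c: "\<bar>c\<bar> = 1" for c :: real
  proof -
    let ?z = "of_real (c * sqrt T / real N / sqrt H) * \<zeta>"
    have "(\<integral>\<^sup>+x. ennreal (exp (c * Y x)) \<partial>walk s n) = (\<integral>\<^sup>+x. ennreal (exp (Re (?z * (\<Sum>j\<in>{r..<t}. cis (phase j x))))) \<partial>walk s n)"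
      unfolding Y_def mult.assoc by (intro nn_integral_cong) (simp del: sum_distrib_left add: Re_divide_of_real)
    also have "\<dots> \<le> ennreal (exp (16 / s\<^sup>2 * (norm ?z)\<^sup>2 * (real t - real r) + 8 / s\<^sup>2 * norm ?z))"
      by (rule walk_exp_moment[OF s0 s1 rt])
    also have "\<dots> \<le> ennreal (exp 24)"
    proof -
      have nz: "norm ?z = sqrt T / real N / sqrt H"
        using c z T N H0 by (simp add: norm_mult norm_divide)
      have "16 / s\<^sup>2 * (norm ?z)\<^sup>2 * (real t - real r) = 16 * ((real t - real r) / real N) / H"
        unfolding nz s2 using T N H0 by (simp add: power_divide field_simps power2_eq_square)
      also have "\<dots> \<le> 16 * H / H" by (intro divide_right_mono mult_left_mono H) (use H0 in auto)
      also have "\<dots> = 16" using H0 by simp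
      finally have 1: "16 / s\<^sup>2 * (norm ?z)\<^sup>2 * (real t - real r) \<le> 16" .
      have "8 / s\<^sup>2 * norm ?z = 8 * (1 / (sqrt T * sqrt H))"
        unfolding nz s2 using T N H0 by (simp add: field_simps)
      also have "\<dots> \<le> 8"
      proof -
        have "1 \<le> T * H" using H T by (simp add: field_simps)
        then have "1 \<le> sqrt T * sqrt H" by (simp add: real_sqrt_mult[symmetric])
        then show ?thesis by (simp add: field_simps)
      qed
      finally show ?thesis using 1 by (intro ennreal_leI) simp
    qed
    finally show ?thesis .
  qed
  have "(\<integral>x. \<bar>Y x\<bar> ^ p \<partial>walk s n) \<le> 2 * fact p * exp 24"
  proof (rule integral_real_bounded)
    have "(\<integral>\<^sup>+x. ennreal (\<bar>Y x\<bar> ^ p) \<partial>walk s n) \<le> (\<integral>\<^sup>+x. ennreal (fact p) * (ennreal (exp (1 * Y x)) + ennreal (exp ((-1) * Y x))) \<partial>walk s n)"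
    proof (rule nn_integral_mono)
      fix x
      have "\<bar>Y x\<bar> ^ p \<le> fact p * exp \<bar>Y x\<bar>" by (rule power_le_fact_exp) simp
      also have "\<dots> \<le> fact p * (exp (1 * Y x) + exp ((-1) * Y x))"
        by (intro mult_left_mono) (auto simp: abs_if)
      finally show "ennreal (\<bar>Y x\<bar> ^ p) \<le> ennreal (fact p) * (ennreal (exp (1 * Y x)) + ennreal (exp ((-1) * Y x)))"
        by (subst ennreal_plus[symmetric], simp, simp, subst ennreal_mult[symmetric]) (auto intro: ennreal_leI)
    qed
    also have "\<dots> = ennreal (fact p) * ((\<integral>\<^sup>+x. ennreal (exp (1 * Y x)) \<partial>walk s n) + (\<integral>\<^sup>+x. ennreal (exp ((-1) * Y x)) \<partial>walk s n))"
      by (subst nn_integral_cmult, measurable) (subst nn_integral_add, auto)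
    also have "\<dots> \<le> ennreal (fact p) * (ennreal (exp 24) + ennreal (exp 24))"
      by (intro mult_left_mono add_mono e) auto
    also have "\<dots> = ennreal (2 * fact p * exp 24)"
      by (subst ennreal_plus[symmetric], simp, simp, subst ennreal_mult[symmetric]) (auto simp: algebra_simps)
    finally show "(\<integral>\<^sup>+x. ennreal (\<bar>Y x\<bar> ^ p) \<partial>walk s n) \<le> ennreal (2 * fact p * exp 24)" .
  qed simp
  moreover have "(\<lambda>x. \<bar>sqrt T / real N * Re (\<zeta> * (\<Sum>j\<in>{r..<t}. cis (phase j x)))\<bar> ^ p) = (\<lambda>x. (sqrt H) ^ p * \<bar>Y x\<bar> ^ p)"
    using H0 by (intro ext) (simp add: Y_def power_mult_distrib[symmetric] abs_mult)
  ultimately show ?thesis using H0 by (simp add: mult_ac)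
qed

section \<open>A central limit theorem for oscillating phases\<close>

declare times_complex.sel [simp del]

lemma norm_integral_le:
  fixes f :: "'a \<Rightarrow> 'b::{banach, second_countable_topology}"
  assumes "integrable M f" "integrable M g" "\<And>x. norm (f x) \<le> g x"
  shows "norm (\<integral>x. f x \<partial>M) \<le> (\<integral>x. g x \<partial>M)"
  by (rule order_trans[OF integral_norm_bound integral_mono]) (use assms in auto)

section \<open>Moments of one centred step\<close>

lemma gauss_quadratic:
  assumes s: "0 < s" and f: "integrable (gauss s) f" "integrable (gauss s) (\<lambda>y. (f y)\<^sup>2)"
  shows "integrable (gauss s) (\<lambda>y. 1 + \<i> * complex_of_real (f y) - of_real ((f y)\<^sup>2 / 2))"
    "(\<integral>y. 1 + \<i> * complex_of_real (f y) - of_real ((f y)\<^sup>2 / 2) \<partial>gauss s)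
      = 1 + \<i> * of_real (\<integral>y. f y \<partial>gauss s) - of_real ((\<integral>y. (f y)\<^sup>2 \<partial>gauss s) / 2)"
proof -
  interpret prob_space "gauss s" using s by (intro prob_space_gauss)
  have i: "integrable (gauss s) (\<lambda>y. complex_of_real (f y))" "integrable (gauss s) (\<lambda>y. complex_of_real ((f y)\<^sup>2))"
    using f by (auto simp del: of_real_power)
  have e: "complex_of_real ((f y)\<^sup>2 / 2) = complex_of_real ((f y)\<^sup>2) / 2" for y by simp
  have v: "(\<integral>y. complex_of_real ((f y)\<^sup>2) \<partial>gauss s) = of_real (\<integral>y. (f y)\<^sup>2 \<partial>gauss s)" 
     "(\<integral>y. complex_of_real (f y) \<partial>gauss s) = of_real (\<integral>y. f y \<partial>gauss s)"
    by (rule integral_complex_of_real)+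
  show "integrable (gauss s) (\<lambda>y. 1 + \<i> * complex_of_real (f y) - of_real ((f y)\<^sup>2 / 2))"
    unfolding e using i by (simp del: of_real_power)
  show "(\<integral>y. 1 + \<i> * complex_of_real (f y) - of_real ((f y)\<^sup>2 / 2) \<partial>gauss s)
      = 1 + \<i> * of_real (\<integral>y. f y \<partial>gauss s) - of_real ((\<integral>y. (f y)\<^sup>2 \<partial>gauss s) / 2)"
    unfolding e using i v prob_space by (simp del: of_real_power)
qed

lemma gauss_cis_int:
  assumes s: "0 < s"
  shows "(\<integral>y. cis (of_int m * y) \<partial>gauss s) = of_real (damp s ^ (nat (m\<^sup>2)))"
proof -
  have "exp (- (s\<^sup>2 * (of_int m)\<^sup>2) / 2) = damp s ^ (nat (m\<^sup>2))"
    unfolding exp_of_nat_mult[symmetric] by (simp add: mult_ac of_nat_nat)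
  then show ?thesis using gauss_cis[OF s, of "of_int m"] by simp
qed

text \<open>Harmonics up to the third occur: the second in the second moment of the step, the third
  where mode 2 meets a first-order term.\<close>

lemma gauss_cis_numeral:
  assumes s: "0 < s"
  shows "(\<integral>y. cis y \<partial>gauss s) = damp s" "(\<integral>y. cis (- y) \<partial>gauss s) = damp s"
    "(\<integral>y. cis (2 * y) \<partial>gauss s) = damp s ^ 4" "(\<integral>y. cis (- (2 * y)) \<partial>gauss s) = damp s ^ 4"
    "(\<integral>y. cis (3 * y) \<partial>gauss s) = damp s ^ 9" "(\<integral>y. cis (- (3 * y)) \<partial>gauss s) = damp s ^ 9"
  using gauss_cis_int[OF s, of 1] gauss_cis_int[OF s, of "-1"] gauss_cis_int[OF s, of 2]
    gauss_cis_int[OF s, of "-2"] gauss_cis_int[OF s, of 3] gauss_cis_int[OF s, of "-3"]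
  by (simp_all add: power2_eq_square)

lemma integrable_gauss_cis [simp]:
  assumes s: "0 < s"
  shows "integrable (gauss s) (\<lambda>y. cis y)" "integrable (gauss s) (\<lambda>y. cis (- y))"
    "integrable (gauss s) (\<lambda>y. cis (c * y))"  "integrable (gauss s) (\<lambda>y. cis (- (c * y)))"
  by (rule integrable_gauss_bounded[OF s, where B=1]; simp)+

text \<open>The centred step \<open>D\<close>: first and second moments are explicit, since \<open>E[cis (m y)] = damp s ^ m\<^sup>2\<close>.\<close>

context
  fixes s :: real and D :: "real \<Rightarrow> complex" and q :: real
  assumes s: "0 < s" "s\<^sup>2 \<le> 1"
  defines "q \<equiv> damp s" and "D \<equiv> (\<lambda>y. cis y - of_real q)"
begin

lemma q_bounds: "0 < q" "q < 1" "1 - q \<le> s\<^sup>2 / 2" "1 - q\<^sup>2 \<le> s\<^sup>2" "0 \<le> 1 - q\<^sup>2"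
proof -
  show "0 < q" "q < 1" using s by (auto simp: q_def)
  show "1 - q \<le> s\<^sup>2 / 2" using exp_ge_add_one_self[of "- s\<^sup>2 / 2"] by (simp add: q_def)
  have "q\<^sup>2 = exp (- s\<^sup>2)" unfolding q_def exp_of_nat_mult[symmetric] by simp
  then show "1 - q\<^sup>2 \<le> s\<^sup>2" using exp_ge_add_one_self[of "- s\<^sup>2"] by simp
  show "0 \<le> 1 - q\<^sup>2" using \<open>0 < q\<close> \<open>q < 1\<close> by (simp add: power_le_one)
qed

lemma D_measurable [measurable]: "D \<in> borel_measurable borel"
  unfolding D_def by measurable

lemma D_norm_le: "norm (D y) \<le> 2"
  using norm_triangle_ineq4[of "cis y" "of_real q"] q_bounds by (simp add: D_def)

lemma D_norm_le': "norm (D y) \<le> \<bar>y\<bar> + s\<^sup>2 / 2"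
proof -
  have "norm (D y) \<le> norm (cis y - cis 0) + norm (1 - complex_of_real q)"
    unfolding D_def using norm_triangle_ineq[of "cis y - 1" "1 - complex_of_real q"] by simp
  also have "norm (1 - complex_of_real q) = 1 - q"
    using q_bounds by (metis abs_of_nonneg diff_ge_0_iff_ge less_imp_le norm_of_real of_real_1 of_real_diff)
  also have "norm (cis y - cis 0) \<le> \<bar>y\<bar>" using norm_cis_diff_le[of y 0] by simp
  finally show ?thesis using q_bounds by linarith
qed

lemma D_integrable: "integrable (gauss s) (\<lambda>y. Re (z * D y))" "integrable (gauss s) (\<lambda>y. (Re (z * D y))\<^sup>2)"
   "integrable (gauss s) (\<lambda>y. \<bar>Re (z * D y)\<bar> ^ 3)"
proof -
  have b: "\<bar>Re (z * D y)\<bar> \<le> norm z * 2" for y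
    using abs_Re_le_cmod[of "z * D y"] mult_left_mono[OF D_norm_le[of y], of "norm z"] by (simp add: norm_mult)
  have bk: "\<bar>Re (z * D y)\<bar> ^ k \<le> (norm z * 2) ^ k" for y k by (intro power_mono b) simp
  show "integrable (gauss s) (\<lambda>y. Re (z * D y))"
    by (rule integrable_gauss_bounded[OF s(1), where B="norm z * 2"]) (use b in auto)
  show "integrable (gauss s) (\<lambda>y. (Re (z * D y))\<^sup>2)"
    by (rule integrable_gauss_bounded[OF s(1), where B="(norm z * 2)^2"]) (use bk[of _ 2] in \<open>auto simp: power2_abs\<close>)
  show "integrable (gauss s) (\<lambda>y. \<bar>Re (z * D y)\<bar> ^ 3)"
    by (rule integrable_gauss_bounded[OF s(1), where B="(norm z * 2)^3"]) (use bk[of _ 3] in \<open>auto simp: power_abs\<close>)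
qed

lemma D_mean: "(\<integral>y. Re (z * D y) \<partial>gauss s) = 0"
proof -
  interpret prob_space "gauss s" using s by (intro prob_space_gauss)
  have i: "integrable (gauss s) (\<lambda>y. z * D y)" using s by (simp add: D_def)
  have "(\<integral>y. z * D y \<partial>gauss s) = 0"
    using s prob_space by (simp add: D_def gauss_cis_numeral[OF s(1), folded q_def])
  then have "Re (\<integral>y. z * D y \<partial>gauss s) = 0" by (simp only: zero_complex.sel)
  then show ?thesis by (simp only: integral_Re[OF i])
qed

text \<open>By (Re w)^2 = Re (w^2 + w cnj w) / 2 it suffices to know E D^2 = - q^2 (1 - q^2) and E
  |D|^2 = 1 - q^2. The term with Re (z^2) is the anisotropy of the step; along the walk z carries
  the phase, so this term oscillates with frequency 2 and has to be averaged out.\<close>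

lemma D_second_moment:
  "(\<integral>y. (Re (z * D y))\<^sup>2 \<partial>gauss s) = (1 - q\<^sup>2) / 2 * ((norm z)\<^sup>2 - q\<^sup>2 * Re (z\<^sup>2))"
proof -
  interpret prob_space "gauss s" using s by (intro prob_space_gauss)
  let ?c = complex_of_real
  have cc: "(Re w)\<^sup>2 = Re (w\<^sup>2 + w * cnj w) / 2" for w
    by (cases w) (simp add: power2_eq_square times_complex.sel)
  have e: "(z * D y)\<^sup>2 + (z * D y) * cnj (z * D y) =
     z\<^sup>2 * (cis (2 * y) - 2 * q * cis y + ?c (q\<^sup>2)) + z * cnj z * (1 - q * cis y - q * cis (- y) + ?c (q\<^sup>2))" for y
    by (simp add: D_def power2_eq_square algebra_simps cis_mult cis_cnj flip: cis_mult)
      (simp add: cis_mult algebra_simps)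
  have i: "integrable (gauss s) (\<lambda>y. (z * D y)\<^sup>2 + (z * D y) * cnj (z * D y))"
    unfolding e using s by simp
  have "(\<integral>y. (z * D y)\<^sup>2 + (z * D y) * cnj (z * D y) \<partial>gauss s)
    = z\<^sup>2 * (?c (q^4) - 2 * q * q + ?c (q\<^sup>2)) + z * cnj z * (1 - q * q - q * q + ?c (q\<^sup>2))"
    unfolding e using s prob_space by (simp add: gauss_cis_numeral[OF s(1), folded q_def])
  also have "\<dots> = ?c (1 - q\<^sup>2) * (?c ((norm z)\<^sup>2) - ?c (q\<^sup>2) * z\<^sup>2)"
    unfolding complex_norm_square by (simp add: algebra_simps power2_eq_square power4_eq_xxxx)
  finally have v: "(\<integral>y. (z * D y)\<^sup>2 + (z * D y) * cnj (z * D y) \<partial>gauss s) = \<dots>" .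
  have "(\<integral>y. (Re (z * D y))\<^sup>2 \<partial>gauss s) = Re (\<integral>y. (z * D y)\<^sup>2 + (z * D y) * cnj (z * D y) \<partial>gauss s) / 2"
    unfolding cc[of "z * D _"] integral_Re[OF i, symmetric] by simp
  moreover have "Re (complex_of_real a * (complex_of_real b - complex_of_real c * z\<^sup>2)) = a * (b - c * Re (z\<^sup>2))" for a b c
    by (simp add: times_complex.sel)
  ultimately show ?thesis unfolding v by (simp only:)
qed

lemma D_second_moment_le: "(\<integral>y. (Re (z * D y))\<^sup>2 \<partial>gauss s) \<le> (1 - q\<^sup>2) * (norm z)\<^sup>2"
proof -
  have "\<bar>Re (z\<^sup>2)\<bar> \<le> (norm z)\<^sup>2" using abs_Re_le_cmod[of "z\<^sup>2"] by (simp only: norm_power)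
  then have "\<bar>q\<^sup>2 * Re (z\<^sup>2)\<bar> \<le> 1 * (norm z)\<^sup>2"
    unfolding abs_mult using q_bounds by (intro mult_mono) auto
  then have "(norm z)\<^sup>2 - q\<^sup>2 * Re (z\<^sup>2) \<le> 2 * (norm z)\<^sup>2" by simp
  then have "(1 - q\<^sup>2) / 2 * ((norm z)\<^sup>2 - q\<^sup>2 * Re (z\<^sup>2)) \<le> (1 - q\<^sup>2) / 2 * (2 * (norm z)\<^sup>2)"
    using q_bounds by (intro mult_left_mono) auto
  then show ?thesis unfolding D_second_moment by simp
qed

text \<open>In the variable u = |y / s| the step is at most s (u + 1 / 2), and the cube of u + 1 / 2
  is at most 13 (u^4 + 1) / 2, whose mean is 26 because the standard normal fourth moment is
  3.\<close>

lemma D_third_moment_le: "(\<integral>y. \<bar>Re (z * D y)\<bar> ^ 3 \<partial>gauss s) \<le> 26 * ((norm z) ^ 3 * s ^ 3)"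
proof -
  interpret prob_space "gauss s" using s by (intro prob_space_gauss)
  have p: "\<bar>Re (z * D y)\<bar> ^ 3 \<le> (norm z)^3 * s ^ 3 * 13 * ((y/s)^4 / 2 + 1 / 2)" for y
  proof -
    have "\<bar>Re (z * D y)\<bar> \<le> norm z * (\<bar>y\<bar> + s\<^sup>2 / 2)"
      using abs_Re_le_cmod[of "z * D y"] mult_left_mono[OF D_norm_le'[of y], of "norm z"] by (simp add: norm_mult)
    also have "\<bar>y\<bar> + s\<^sup>2 / 2 \<le> s * (\<bar>y / s\<bar> + 1 / 2)"
    proof -
      have "s \<le> 1" by (rule power2_le_imp_le) (use s in auto)
      then have "s * s \<le> s" using s by (simp add: mult_left_le)
      then show ?thesis using s by (simp add: field_simps power2_eq_square)
    qed
    finally have "\<bar>Re (z * D y)\<bar> \<le> norm z * s * (\<bar>y / s\<bar> + 1 / 2)" by (simp add: mult_left_mono mult.assoc)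
    then have "\<bar>Re (z * D y)\<bar> ^ 3 \<le> (norm z * s * (\<bar>y / s\<bar> + 1 / 2)) ^ 3" by (intro power_mono) auto
    also have "\<dots> = norm z ^ 3 * s ^ 3 * (\<bar>y / s\<bar> + 1 / 2) ^ 3" by (simp add: power_mult_distrib)
    also have "(\<bar>y / s\<bar> + 1 / 2) ^ 3 \<le> 13 * ((y/s)^4 / 2 + 1 / 2)"
    proof -
      have "(u + 1/2)^3 \<le> 13 * (u^4 / 2 + 1/2)" if "0 \<le> u" for u :: real
      proof (cases "u \<le> 1")
        case True
        then have "(u + 1/2)^3 \<le> (3/2)^3" using that by (intro power_mono) auto
        also have "\<dots> \<le> 13 * (1/2)" by (simp add: power3_eq_cube)
        also have "\<dots> \<le> 13 * (u^4 / 2 + 1/2)" by simp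
        finally show ?thesis .
      next
        case False
        then have "(u + 1/2)^3 \<le> (3/2 * u)^3" by (intro power_mono) auto
        also have "\<dots> = 27/8 * u^3" by (simp add: power_mult_distrib power3_eq_cube)
        also have "u^3 \<le> u^4" using False by (intro power_increasing) auto
        also have "27/8 * u^4 \<le> 13 * (u^4 / 2 + 1/2)" using False by simp
        finally show ?thesis by simp
      qed
      from this[of "\<bar>y/s\<bar>"] show ?thesis using power_even_abs[of 4 "y / s"] by (simp del: abs_divide)
    qed
    finally show ?thesis using s by (simp add: mult_left_mono mult.assoc)
  qed
  have m4: "integrable (gauss s) (\<lambda>y. y ^ 4)" "(\<integral>y. y ^ 4 \<partial>gauss s) = 3 * s ^ 4"
    using gauss_pow4[OF s(1)] by (auto simp: has_bochner_integral_iff)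
  have "(\<integral>y. \<bar>Re (z * D y)\<bar> ^ 3 \<partial>gauss s) \<le> (\<integral>y. (norm z)^3 * s ^ 3 * 13 * ((y/s)^4 / 2 + 1 / 2) \<partial>gauss s)"
    by (intro integral_mono D_integrable p) (use m4 in \<open>simp add: power_divide\<close>)
  also have "\<dots> = (norm z)^3 * s ^ 3 * 13 * 2"
    using m4 s prob_space by (simp add: power_divide)
  finally show ?thesis by simp
qed

text \<open>Second-order Taylor expansion of \<open>cis\<close>: the linear term has mean zero, the
  quadratic one is \<open>D_second_moment\<close>, and the remainder |x|^3 / 6 costs 26 / 6 \<le>
  5.\<close>

lemma D_cis_approx:
  "norm ((\<integral>y. cis (Re (z * D y)) \<partial>gauss s) - of_real (1 - (1 - q\<^sup>2) / 4 * ((norm z)\<^sup>2 - q\<^sup>2 * Re (z\<^sup>2)))) \<le> 5 * ((norm z) ^ 3 * s ^ 3)"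
proof -
  interpret prob_space "gauss s" using s by (intro prob_space_gauss)
  let ?x = "\<lambda>y. Re (z * D y)"
  have ap0: "norm (cis u - (1 + \<i> * u - of_real (u\<^sup>2 / 2))) \<le> \<bar>u\<bar> ^ 3 / 6" for u
  proof -
    have "(\<Sum>k\<le>2. (\<i> * complex_of_real u) ^ k / fact k) = 1 + \<i> * u - of_real (u\<^sup>2 / 2)"
      by (simp add: numeral_2_eq_2 power_mult_distrib)
    then show ?thesis using iexp_approx1[of u 2]
      by (simp add: cis_conv_exp fact_numeral numeral_3_eq_3)
  qed
  note ap = ap0[of "Re (z * D _)"]
  have i1: "integrable (gauss s) (\<lambda>y. cis (?x y))"
    by (rule integrable_gauss_bounded[OF s(1), where B=1]) auto
  note i2 = gauss_quadratic(1)[OF s(1) D_integrable(1,2)[of z]]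
  have e: "(\<integral>y. 1 + \<i> * complex_of_real (?x y) - of_real ((?x y)\<^sup>2 / 2) \<partial>gauss s)
     = of_real (1 - (1 - q\<^sup>2) / 4 * ((norm z)\<^sup>2 - q\<^sup>2 * Re (z\<^sup>2)))"
    unfolding gauss_quadratic(2)[OF s(1) D_integrable(1,2)[of z]] D_mean D_second_moment by simp
  have "norm ((\<integral>y. cis (?x y) \<partial>gauss s) - (\<integral>y. 1 + \<i> * complex_of_real (?x y) - of_real ((?x y)\<^sup>2 / 2) \<partial>gauss s))
    = norm (\<integral>y. cis (?x y) - (1 + \<i> * complex_of_real (?x y) - of_real ((?x y)\<^sup>2 / 2)) \<partial>gauss s)"
    using i1 i2 by (subst Bochner_Integration.integral_diff) auto
  also have "\<dots> \<le> (\<integral>y. \<bar>?x y\<bar> ^ 3 / 6 \<partial>gauss s)"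
    by (rule norm_integral_le) (use i1 i2 D_integrable(3)[of z] ap in auto)
  also have "\<dots> \<le> 5 * ((norm z) ^ 3 * s ^ 3)"
  proof -
    have "0 \<le> norm z ^ 3 * s ^ 3" using s by simp
    then show ?thesis using D_third_moment_le[of z] by simp
  qed
  finally show ?thesis unfolding e .
qed

text \<open>What matters is the factor 1 - q^4 in the error. It matches the contraction q^4 of the
  modes 2 and -2, so the errors accumulated over any number of steps stay bounded. For the
  first-order term it comes from the exact differences q^9 - q^5 and q - q^5, for the remainder from
  the second moment and 1 - q^2 \<le> 1 - q^4.\<close>

lemma D_cis_tilt:
  assumes m: "m = 2 \<or> m = - 2"
  shows "norm ((\<integral>y. cis (Re (z * D y)) * cis (m * y) \<partial>gauss s) - of_real (q ^ 4)) \<le> (1 - q ^ 4) * (norm z + (norm z)\<^sup>2 / 2)"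
proof -
  interpret prob_space "gauss s" using s by (intro prob_space_gauss)
  let ?x = "\<lambda>y. Re (z * D y)"
  have q4: "1 - q\<^sup>2 \<le> 1 - q ^ 4" using q_bounds by (simp add: power_decreasing)
  have ap0: "norm ((cis u - (1 + \<i> * u)) * cis t) \<le> u\<^sup>2 / 2" for u t :: real
    using iexp_approx1[of u 1]
    by (simp add: cis_conv_exp[of u] numeral_2_eq_2 norm_mult)
  note ap = ap0[of "Re (z * D _)"]
  have i1: "integrable (gauss s) (\<lambda>y. cis (?x y) * cis (m * y))"
    by (rule integrable_gauss_bounded[OF s(1), where B=1]) (auto simp: norm_mult)
  have xe: "complex_of_real (?x y) = (z * D y + cnj (z * D y)) / 2" for y
    using complex_add_cnj[of "z * D y"] by simp
  \<comment> \<open>The linear term shifts frequency m to m + 1 and m - 1.\<close>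
  have e2: "of_real (?x y) * cis (m * y) = z / 2 * (cis ((m + 1) * y) - q * cis (m * y)) + cnj z / 2 * (cis ((m - 1) * y) - q * cis (m * y))" for y
  proof -
    have "cis ((m + 1) * y) = cis y * cis (m * y)" "cis ((m - 1) * y) = cis (- y) * cis (m * y)"
      by (simp_all add: cis_mult algebra_simps)
    then show ?thesis unfolding xe unfolding D_def by (simp add: cis_cnj field_simps)
  qed
  have i2: "integrable (gauss s) (\<lambda>y. of_real (?x y) * cis (m * y))"
    unfolding e2 using s by simp
  have v2: "norm (\<integral>y. of_real (?x y) * cis (m * y) \<partial>gauss s) \<le> (1 - q ^ 4) * norm z"
  proof -
    have E: "(\<integral>y. of_real (?x y) * cis (m * y) \<partial>gauss s) =
      (if m = 2 then z / 2 * of_real (q ^ 9 - q ^ 5) + cnj z / 2 * of_real (q - q ^ 5)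
        else z / 2 * of_real (q - q ^ 5) + cnj z / 2 * of_real (q ^ 9 - q ^ 5))"
      unfolding e2 using m s by (auto simp: gauss_cis_numeral[OF s(1), folded q_def] eval_nat_numeral)
    have a: "\<bar>q ^ 9 - q ^ 5\<bar> \<le> 1 - q ^ 4" "\<bar>q - q ^ 5\<bar> \<le> 1 - q ^ 4"
    proof -
      have c: "0 \<le> 1 - q ^ 4" using q_bounds by (simp add: power_le_one)
      have "q ^ 5 - q ^ 9 = q ^ 5 * (1 - q ^ 4)" "q - q ^ 5 = q * (1 - q ^ 4)" by (simp_all add: algebra_simps eval_nat_numeral)
      moreover have "q ^ 5 * (1 - q ^ 4) \<le> 1 - q ^ 4" "q * (1 - q ^ 4) \<le> 1 - q ^ 4"
        "0 \<le> q ^ 5 * (1 - q ^ 4)" "0 \<le> q * (1 - q ^ 4)"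
        using q_bounds c by (auto intro!: mult_left_le_one_le power_le_one)
      ultimately show "\<bar>q ^ 9 - q ^ 5\<bar> \<le> 1 - q ^ 4" "\<bar>q - q ^ 5\<bar> \<le> 1 - q ^ 4" by linarith+
    qed
    have nn: "norm (z1 / 2 * of_real u + z2 / 2 * of_real v) \<le> C * norm z"
      if "norm z1 = norm z" "norm z2 = norm z" "\<bar>u\<bar> \<le> C" "\<bar>v\<bar> \<le> C" for z1 z2 :: complex and u v C
    proof -
      have "norm (z1 / 2 * of_real u + z2 / 2 * of_real v) \<le> norm z / 2 * \<bar>u\<bar> + norm z / 2 * \<bar>v\<bar>"
        by (rule order_trans[OF norm_triangle_ineq]) (simp add: norm_mult norm_divide that)
      also have "\<dots> \<le> norm z / 2 * C + norm z / 2 * C"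
        using that by (intro add_mono mult_left_mono) auto
      finally show ?thesis by (simp add: mult.commute)
    qed
    show ?thesis
    proof (cases "m = 2")
      case True
      show ?thesis unfolding E if_P[OF True] by (rule nn[OF _ _ a]) auto
    next
      case False
      show ?thesis unfolding E if_not_P[OF False] by (rule nn[OF _ _ a(2,1)]) auto
    qed
  qed
  have i3: "integrable (gauss s) (\<lambda>y. (1 + \<i> * ?x y) * cis (m * y))"
    unfolding distrib_right mult.assoc using i2 s by simp
  have v3: "(\<integral>y. (1 + \<i> * ?x y) * cis (m * y) \<partial>gauss s) = of_real (q ^ 4) + \<i> * (\<integral>y. of_real (?x y) * cis (m * y) \<partial>gauss s)"
    unfolding distrib_right mult.assoc using i2 s m by (auto simp: gauss_cis_numeral[OF s(1), folded q_def])
  have "norm ((\<integral>y. cis (?x y) * cis (m * y) \<partial>gauss s) - (\<integral>y. (1 + \<i> * ?x y) * cis (m * y) \<partial>gauss s))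
     = norm (\<integral>y. (cis (?x y) - (1 + \<i> * ?x y)) * cis (m * y) \<partial>gauss s)"
    using i1 i3 by (subst Bochner_Integration.integral_diff[symmetric]) (auto simp: left_diff_distrib)
  also have "\<dots> \<le> (\<integral>y. (?x y)\<^sup>2 / 2 \<partial>gauss s)"
    by (rule norm_integral_le) (use i1 i3 D_integrable(2)[of z] ap in \<open>auto simp: left_diff_distrib\<close>)
  also have "\<dots> \<le> (1 - q\<^sup>2) * (norm z)\<^sup>2 / 2" using D_second_moment_le[of z] by simp
  also have "\<dots> \<le> (1 - q ^ 4) * (norm z)\<^sup>2 / 2" using q4 by (intro divide_right_mono mult_right_mono) auto
  finally have "norm ((\<integral>y. cis (?x y) * cis (m * y) \<partial>gauss s) - (of_real (q ^ 4) + \<i> * (\<integral>y. of_real (?x y) * cis (m * y) \<partial>gauss s)))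
    \<le> (1 - q ^ 4) * (norm z)\<^sup>2 / 2" unfolding v3 .
  moreover have "norm (\<i> * (\<integral>y. of_real (?x y) * cis (m * y) \<partial>gauss s)) \<le> (1 - q ^ 4) * norm z"
    using v2 by (simp add: norm_mult)
  moreover have "norm (a - b) \<le> X + Y" if "norm (a - (b + c)) \<le> X" "norm c \<le> Y" for a b c :: complex and X Y
    using norm_triangle_ineq[of "a - (b + c)" c] that by simp
  ultimately have "norm ((\<integral>y. cis (?x y) * cis (m * y) \<partial>gauss s) - of_real (q ^ 4)) \<le> (1 - q ^ 4) * (norm z)\<^sup>2 / 2 + (1 - q ^ 4) * norm z"
    by blast
  then show ?thesis by (simp add: distrib_left add.commute)
qed

section \<open>Recursion for the tilted expectations\<close>

context
  fixes w :: "nat \<Rightarrow> complex" and W :: real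
  assumes W: "\<And>j. norm (w j) \<le> W"
begin

text \<open>The exponential of \<i> times the martingale with weights w; its expectation
  \<open>tiltE 0 n\<close> is the characteristic function sought.\<close>

definition "tilt n x = cis (\<Sum>j<n. Re (w j * cis (phase j x) * (cis (x j) - of_real q)))"

text \<open>In one step of the characteristic function only the modes \<open>m = \<plusminus>2\<close> appear as errors, and these contract
  by the factor \<open>q ^ 4\<close> per step.\<close>

definition "tiltE m n = (\<integral>x. tilt n x * cis (m * phase n x) \<partial>walk s n)"

lemma W_nonneg: "0 \<le> W" using W[of 0] norm_ge_zero order_trans by blast

lemma tilt_measurable [measurable]: "n \<le> k \<Longrightarrow> tilt n \<in> borel_measurable (walk s k)"
  unfolding tilt_def by measurable

text \<open>Conditioning on the first n steps: for given m the inner integral is a function of the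
  rotated weight w n cis (phase n x) alone, to which the estimates for one step apply.\<close>

lemma tilt_integral_Suc:
  assumes [measurable]: "g \<in> borel_measurable borel" and g: "\<And>u. norm (g u) \<le> 1"
    and "g = (\<lambda>u. cis (m * u))"
  shows "tiltE m (Suc n) = (\<integral>x. tilt n x * cis (m * phase n x) *
     (\<integral>y. cis (Re (w n * cis (phase n x) * D y)) * cis (m * y) \<partial>gauss s) \<partial>walk s n)"
proof -
  have "tiltE m (Suc n) = (\<integral>x. (\<integral>y. tilt (Suc n) (x(n := y)) * cis (m * phase (Suc n) (x(n := y))) \<partial>gauss s) \<partial>walk s n)"
    unfolding tiltE_def
    by (rule walk_Suc_integral[OF s(1)], rule integrable_walk_bounded[OF s(1), where B=1])
       (auto simp: norm_mult tilt_def)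
  also have "\<dots> = (\<integral>x. (\<integral>y. (tilt n x * cis (m * phase n x)) * (cis (Re (w n * cis (phase n x) * D y)) * cis (m * y)) \<partial>gauss s) \<partial>walk s n)"
    by (intro Bochner_Integration.integral_cong refl)
      (simp add: tilt_def phase_Suc phase_upd D_def cis_mult algebra_simps)
  finally show ?thesis by simp
qed

lemma kernel_measurable: "(\<lambda>z. (\<integral>y. cis (Re (z * D y)) * cis (m * y) \<partial>gauss s)) \<in> borel_measurable borel"
proof -
  interpret prob_space "gauss s" using s by (intro prob_space_gauss)
  show ?thesis by measurable
qed

lemma kernel_bound: "norm (\<integral>y. cis (Re (z * D y)) * cis (m * y) \<partial>gauss s) \<le> 1"
proof -
  interpret prob_space "gauss s" using s by (intro prob_space_gauss)
  have "norm (\<integral>y. cis (Re (z * D y)) * cis (m * y) \<partial>gauss s) \<le> (\<integral>y. 1 \<partial>gauss s)"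
    by (rule norm_integral_le)
      (auto intro!: integrable_gauss_bounded[OF s(1), where B=1] simp: norm_mult)
  then show ?thesis using prob_space by simp
qed

lemma tilt_norm [simp]: "norm (tilt n x) = 1"
  by (simp add: tilt_def)

lemma tilt_integrable:
  assumes "h \<in> borel_measurable (walk s n)" "\<And>x. norm (h x) \<le> B"
  shows "integrable (walk s n) (\<lambda>x. tilt n x * h x)"
  by (rule integrable_walk_bounded[OF s(1), where B=B]) (use assms in \<open>auto simp: norm_mult\<close>)

lemma tilt_integral_bound:
  assumes "h \<in> borel_measurable (walk s n)" "\<And>x. norm (h x) \<le> B"
  shows "norm (\<integral>x. tilt n x * h x \<partial>walk s n) \<le> B"
proof -
  interpret prob_space "walk s n" using s by (intro prob_space_walk)
  have "norm (\<integral>x. tilt n x * h x \<partial>walk s n) \<le> (\<integral>x. B \<partial>walk s n)"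
    by (rule norm_integral_le)
      (use assms in \<open>auto intro!: tilt_integrable[where B=B] simp: norm_mult\<close>)
  then show ?thesis using prob_space by simp
qed

lemma tiltE_bound1: "norm (tiltE m n) \<le> 1"
  unfolding tiltE_def by (rule tilt_integral_bound) auto

lemma tiltE_step:
  assumes m: "m = 2 \<or> m = - 2"
  shows "norm (tiltE m (Suc n) - of_real (q ^ 4) * tiltE m n) \<le> (1 - q ^ 4) * (W + W\<^sup>2 / 2)"
proof -
  note [measurable] = kernel_measurable
  let ?G = "\<lambda>x. (\<integral>y. cis (Re (w n * cis (phase n x) * D y)) * cis (m * y) \<partial>gauss s)"
  have [measurable]: "?G \<in> borel_measurable (walk s n)"
    by (rule measurable_compose[OF _ kernel_measurable]) measurable
  have "tiltE m (Suc n) - of_real (q ^ 4) * tiltE m n =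
     (\<integral>x. tilt n x * (cis (m * phase n x) * ?G x) \<partial>walk s n) - (\<integral>x. of_real (q ^ 4) * (tilt n x * cis (m * phase n x)) \<partial>walk s n)"
    by (subst tilt_integral_Suc[OF _ _ refl]) (auto simp: tiltE_def mult.assoc)
  also have "\<dots> = (\<integral>x. tilt n x * (cis (m * phase n x) * ?G x) - of_real (q ^ 4) * (tilt n x * cis (m * phase n x)) \<partial>walk s n)"
    using kernel_bound
    by (intro Bochner_Integration.integral_diff[symmetric] integrable_mult_right tilt_integrable[where B=1])
      (auto simp: norm_mult)
  also have "\<dots> = (\<integral>x. tilt n x * (cis (m * phase n x) * (?G x - of_real (q ^ 4))) \<partial>walk s n)"
    by (simp add: algebra_simps)
  finally have e: "tiltE m (Suc n) - of_real (q ^ 4) * tiltE m n = \<dots>" .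
  have q4: "0 \<le> 1 - q ^ 4" using q_bounds by (simp add: power_le_one)
  have "norm (?G x - of_real (q ^ 4)) \<le> (1 - q ^ 4) * (W + W\<^sup>2 / 2)" for x
    using W[of n] W_nonneg q4
    by (intro order_trans[OF D_cis_tilt[OF m]] mult_left_mono add_mono divide_right_mono power_mono)
      (auto simp: norm_mult)
  then show ?thesis unfolding e by (intro tilt_integral_bound) (auto simp: norm_mult)
qed

text \<open>The recursion x' \<le> q^4 x + (1 - q^4) c has the fixed point c = W + W^2 / 2, and the
  initial value 1 decays geometrically.\<close>

lemma tiltE_bound:
  assumes m: "m = 2 \<or> m = - 2"
  shows "norm (tiltE m n) \<le> (q ^ 4) ^ n + (W + W\<^sup>2 / 2)"
proof (induction n)
  case 0
  show ?case using tiltE_bound1[of m 0] W_nonneg by (auto intro: order_trans)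
next
  case (Suc n)
  have "norm (tiltE m (Suc n)) \<le> norm (tiltE m (Suc n) - of_real (q ^ 4) * tiltE m n) + norm (of_real (q ^ 4) * tiltE m n)"
    using norm_triangle_ineq[of "tiltE m (Suc n) - of_real (q ^ 4) * tiltE m n" "of_real (q ^ 4) * tiltE m n"] by simp
  also have "\<dots> \<le> (1 - q ^ 4) * (W + W\<^sup>2 / 2) + q ^ 4 * ((q ^ 4) ^ n + (W + W\<^sup>2 / 2))"
    using q_bounds Suc by (intro add_mono tiltE_step m) (auto simp: norm_mult norm_power intro!: mult_left_mono)
  also have "\<dots> = (q ^ 4) ^ Suc n + (W + W\<^sup>2 / 2)" by (simp add: field_simps)
  finally show ?case .
qed

text \<open>The first summand is the anisotropic part of the variance, weighted by the bound on the
  modes 2 and -2; the second is the Taylor remainder of one step.\<close>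

definition "step_err n = (1 - q\<^sup>2) / 4 * W\<^sup>2 * ((q ^ 4) ^ n + (W + W\<^sup>2 / 2)) + 5 * (W ^ 3 * s ^ 3)"

lemma tiltE0_step:
  "norm (tiltE 0 (Suc n) - of_real (1 - (1 - q\<^sup>2) / 4 * (norm (w n))\<^sup>2) * tiltE 0 n) \<le> step_err n"
proof -
  let ?b = "(1 - q\<^sup>2) / 4"
  let ?G = "\<lambda>x. (\<integral>y. cis (Re (w n * cis (phase n x) * D y)) * cis (0 * y) \<partial>gauss s)"
  let ?z = "\<lambda>x. w n * cis (phase n x)"
  let ?H = "\<lambda>x. complex_of_real (1 - ?b * ((norm (?z x))\<^sup>2 - q\<^sup>2 * Re ((?z x)\<^sup>2)))"
  let ?K = "complex_of_real (1 - ?b * (norm (w n))\<^sup>2)"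
  have b0: "0 \<le> ?b" using q_bounds by simp
  have [measurable]: "?G \<in> borel_measurable (walk s n)"
    by (rule measurable_compose[OF _ kernel_measurable]) measurable
  \<comment> \<open>The anisotropy Re (z^2) splits into the modes 2 and -2 of the phase; this is how
    \<open>tiltE 2\<close> and \<open>tiltE (- 2)\<close> enter the recursion for
    \<open>tiltE 0\<close>.\<close>
  have H: "?H x = ?K + of_real (?b * q\<^sup>2 / 2) * ((w n)\<^sup>2 * cis (2 * phase n x) + cnj ((w n)\<^sup>2) * cis ((- 2) * phase n x))" for x
  proof -
    have zz: "(?z x)\<^sup>2 = (w n)\<^sup>2 * cis (2 * phase n x)"
      unfolding power_mult_distrib power2_eq_square[of "cis (phase n x)"] cis_mult by (simp flip: mult_2)
    have ru: "complex_of_real (Re u) = (u + cnj u) / 2" for u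
      unfolding complex_add_cnj by simp
    have cn: "cnj ((?z x)\<^sup>2) = cnj ((w n)\<^sup>2) * cis ((- 2) * phase n x)"
      unfolding zz complex_cnj_mult cis_cnj by simp
    have r: "complex_of_real (Re ((?z x)\<^sup>2)) = ((w n)\<^sup>2 * cis (2 * phase n x) + cnj ((w n)\<^sup>2) * cis ((- 2) * phase n x)) / 2"
      by (simp only: ru[of "(?z x)\<^sup>2"] cn) (simp only: zz)
    have "complex_of_real (1 - b * (N - c * R)) = complex_of_real (1 - b * N) + complex_of_real (b * c) * of_real R" for b N c R :: real
      by (simp add: algebra_simps)
    then have "?H x = of_real (1 - ?b * (norm (?z x))\<^sup>2) + of_real (?b * q\<^sup>2) * complex_of_real (Re ((?z x)\<^sup>2))" .
    moreover have "norm (?z x) = norm (w n)" by (simp add: norm_mult)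
    ultimately show ?thesis unfolding r by simp
  qed
  have GH: "norm (?G x - ?H x) \<le> 5 * (W ^ 3 * s ^ 3)" for x
  proof -
    have "norm (?G x - ?H x) \<le> 5 * (norm (?z x) ^ 3 * s ^ 3)" using D_cis_approx[of "?z x"] by simp
    also have "\<dots> \<le> 5 * (W ^ 3 * s ^ 3)"
      using W[of n] s by (intro mult_left_mono mult_right_mono power_mono) (auto simp: norm_mult)
    finally show ?thesis .
  qed
  obtain B where B: "\<And>x. norm (?H x) \<le> B"
  proof
    show "norm (?H x) \<le> norm ?K + norm (complex_of_real (?b * q\<^sup>2 / 2)) * (norm ((w n)\<^sup>2) + norm ((w n)\<^sup>2))" for x
      unfolding H by (intro norm_triangle_le add_mono order_refl order_trans[OF norm_mult_ineq] mult_left_mono)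
         (auto simp: norm_mult norm_power intro!: norm_triangle_le)
  qed
  have "tiltE 0 (Suc n) = (\<integral>x. tilt n x * ?G x \<partial>walk s n)"
    by (subst tilt_integral_Suc[OF _ _ refl]) auto
  also have "\<dots> = (\<integral>x. tilt n x * (?G x - ?H x) + tilt n x * ?H x \<partial>walk s n)"
    by (intro Bochner_Integration.integral_cong refl) (simp only: right_diff_distrib diff_add_cancel)
  also have "\<dots> = (\<integral>x. tilt n x * (?G x - ?H x) \<partial>walk s n) + (\<integral>x. tilt n x * ?H x \<partial>walk s n)"
  proof (rule Bochner_Integration.integral_add)
    show "integrable (walk s n) (\<lambda>x. tilt n x * (?G x - ?H x))"
      by (rule tilt_integrable[OF _ GH]) measurable
    show "integrable (walk s n) (\<lambda>x. tilt n x * ?H x)"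
      by (rule tilt_integrable[OF _ B]) measurable
  qed
  also have "(\<integral>x. tilt n x * ?H x \<partial>walk s n) = ?K * tiltE 0 n +
     of_real (?b * q\<^sup>2 / 2) * ((w n)\<^sup>2 * tiltE 2 n + cnj ((w n)\<^sup>2) * tiltE (- 2) n)"
  proof -
    have i: "integrable (walk s n) (\<lambda>x. tilt n x)" "integrable (walk s n) (\<lambda>x. tilt n x * cis (2 * phase n x))"
      "integrable (walk s n) (\<lambda>x. tilt n x * cis ((-2) * phase n x))"
      using tilt_integrable[of "\<lambda>_. 1" n 1] by (auto intro!: tilt_integrable[where B=1])
    have "tilt n x * ?H x = ?K * tilt n x + of_real (?b * q\<^sup>2 / 2) * ((w n)\<^sup>2 * (tilt n x * cis (2 * phase n x)) + cnj ((w n)\<^sup>2) * (tilt n x * cis ((-2) * phase n x)))" for x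
    proof -
      have "t * (K + c * (a * g + d * h)) = K * t + c * (a * (t * g) + d * (t * h))" for t K c a g d h :: complex
        by (simp add: algebra_simps)
      then show ?thesis unfolding H .
    qed
    moreover have "(\<integral>x. K * f x + c * (a * g x + d * h x) \<partial>walk s n)
        = K * (\<integral>x. f x \<partial>walk s n) + c * (a * (\<integral>x. g x \<partial>walk s n) + d * (\<integral>x. h x \<partial>walk s n))"
      if "integrable (walk s n) f" "integrable (walk s n) g" "integrable (walk s n) h"
      for f g h :: "(nat \<Rightarrow> real) \<Rightarrow> complex" and K c a d
      using that by simp
    note this[OF i, of ?K "of_real (?b * q\<^sup>2 / 2)" "(w n)\<^sup>2" "cnj ((w n)\<^sup>2)"]
    moreover have "tiltE 0 n = (\<integral>x. tilt n x \<partial>walk s n)" by (simp add: tiltE_def)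
    ultimately show ?thesis unfolding tiltE_def[of 2] tiltE_def[of "-2"] by (simp only:)
  qed
  finally have eq: "tiltE 0 (Suc n) - ?K * tiltE 0 n = (\<integral>x. tilt n x * (?G x - ?H x) \<partial>walk s n) +
     of_real (?b * q\<^sup>2 / 2) * ((w n)\<^sup>2 * tiltE 2 n + cnj ((w n)\<^sup>2) * tiltE (- 2) n)" by simp
  have 1: "norm (\<integral>x. tilt n x * (?G x - ?H x) \<partial>walk s n) \<le> 5 * (W ^ 3 * s ^ 3)"
    by (rule tilt_integral_bound[OF _ GH]) measurable
  let ?A = "(q ^ 4) ^ n + (W + W\<^sup>2 / 2)"
  have 2: "norm (of_real (?b * q\<^sup>2 / 2) * ((w n)\<^sup>2 * tiltE 2 n + cnj ((w n)\<^sup>2) * tiltE (- 2) n)) \<le> ?b * W\<^sup>2 * ?A"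
  proof -
    have A0: "0 \<le> ?A" using q_bounds W_nonneg by simp
    have w2: "norm ((w n)\<^sup>2) \<le> W\<^sup>2" "norm (cnj ((w n)\<^sup>2)) \<le> W\<^sup>2" using W[of n] by (auto simp: norm_power intro!: power_mono)
    have "norm ((w n)\<^sup>2 * tiltE 2 n + cnj ((w n)\<^sup>2) * tiltE (- 2) n) \<le> W\<^sup>2 * ?A + W\<^sup>2 * ?A"
      by (intro norm_triangle_le add_mono order_trans[OF norm_mult_ineq] mult_mono w2 tiltE_bound) (auto simp: A0)
    moreover have "?b * q\<^sup>2 / 2 \<le> ?b / 2"
      using b0 q_bounds by (intro divide_right_mono mult_left_le power_le_one) auto
    ultimately have "norm (complex_of_real (?b * q\<^sup>2 / 2)) * norm ((w n)\<^sup>2 * tiltE 2 n + cnj ((w n)\<^sup>2) * tiltE (- 2) n) \<le> ?b / 2 * (W\<^sup>2 * ?A + W\<^sup>2 * ?A)"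
      using b0 by (intro mult_mono) (auto simp del: of_real_mult of_real_divide of_real_diff)
    also have "\<dots> = ?b * W\<^sup>2 * ?A" by (simp add: field_simps)
    finally show ?thesis unfolding norm_mult .
  qed
  show ?thesis unfolding eq step_err_def
    by (rule order_trans[OF norm_triangle_ineq]) (use 1 2 in linarith)
qed

text \<open>Telescoping over the steps. The errors merely add up, because \<open>tiltE 0 n\<close>
  and the factors exp (- u) have modulus at most one; replacing 1 - u by exp (- u) costs u^2 / 2 per
  step.\<close>

lemma tiltE0_approx:
  "norm (tiltE 0 n - of_real (exp (- ((1 - q\<^sup>2) / 4 * (\<Sum>j<n. (norm (w j))\<^sup>2))))) \<le> (\<Sum>j<n. step_err j + ((1 - q\<^sup>2) / 4)\<^sup>2 * W ^ 4 / 2)"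
proof (induction n)
  case 0
  interpret prob_space "walk s 0" using s by (intro prob_space_walk)
  show ?case using prob_space by (simp add: tiltE_def tilt_def phase_def)
next
  case (Suc n)
  let ?b = "(1 - q\<^sup>2) / 4"
  let ?u = "?b * (norm (w n))\<^sup>2"
  let ?P = "exp (- (?b * (\<Sum>j<n. (norm (w j))\<^sup>2)))"
  have b0: "0 \<le> ?b" using q_bounds by simp
  have u0: "0 \<le> ?u" using b0 by simp
  have P: "exp (- (?b * (\<Sum>j<Suc n. (norm (w j))\<^sup>2))) = exp (- ?u) * ?P"
    by (simp add: distrib_left flip: exp_add)
  have ex: "\<bar>1 - u - exp (- u)\<bar> \<le> u\<^sup>2 / 2" if "0 \<le> u" for u :: real
  proof -
    have "1 - u \<le> exp (- u)" using exp_ge_add_one_self[of "-u"] by simp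
    moreover have "exp (- u) \<le> 1 - u + u\<^sup>2 / 2"
    proof (cases "u = 0")
      case False
      show ?thesis
      proof -
        have "\<exists>t. 0 < t \<and> t < u \<and> exp (- u) = 1 - u + exp (- t) / 2 * u\<^sup>2"
        proof -
          have "\<exists>t>0. t < u \<and> exp (-u) = (\<Sum>m<2. ((-1)^m * exp (-0)) / fact m * u ^ m) + (-1)^2 * exp (-t) / fact 2 * u ^ 2"
            by (rule Maclaurin[where diff = "\<lambda>m t. (-1)^m * exp (-t)"])
               (use that False in \<open>auto intro!: derivative_eq_intros\<close>)
          then show ?thesis by (auto simp: numeral_2_eq_2)
        qed
        then obtain t where t: "0 < t" "exp (- u) = 1 - u + exp (- t) / 2 * u\<^sup>2" by blast
        have "exp (- t) / 2 * u\<^sup>2 \<le> 1 / 2 * u\<^sup>2" using t by (intro mult_right_mono) auto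
        with t show ?thesis by simp
      qed
    qed simp
    ultimately show ?thesis by (simp add: abs_le_iff)
  qed
  have u2: "?u\<^sup>2 / 2 \<le> ?b\<^sup>2 * W ^ 4 / 2"
  proof -
    have "(norm (w n)) ^ 4 \<le> W ^ 4" using W[of n] by (intro power_mono) auto
    then have "?b\<^sup>2 * (norm (w n)) ^ 4 \<le> ?b\<^sup>2 * W ^ 4" by (intro mult_left_mono) auto
    moreover have "?u\<^sup>2 = ?b\<^sup>2 * (norm (w n)) ^ 4" by (simp only: power_mult_distrib power_mult[symmetric]) simp
    ultimately show ?thesis by simp
  qed
  have eq: "tiltE 0 (Suc n) - of_real (exp (- ?u) * ?P) = (tiltE 0 (Suc n) - of_real (1 - ?u) * tiltE 0 n)
     + of_real (1 - ?u - exp (- ?u)) * tiltE 0 n + of_real (exp (- ?u)) * (tiltE 0 n - of_real ?P)"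
    by (simp add: algebra_simps)
  have "norm ((tiltE 0 (Suc n) - of_real (1 - ?u) * tiltE 0 n)
     + of_real (1 - ?u - exp (- ?u)) * tiltE 0 n + of_real (exp (- ?u)) * (tiltE 0 n - of_real ?P)) \<le> step_err n + ?b\<^sup>2 * W ^ 4 / 2 + (\<Sum>j<n. step_err j + ?b\<^sup>2 * W ^ 4 / 2)"
  proof (intro norm_triangle_le add_mono tiltE0_step)
    have "norm (complex_of_real (1 - ?u - exp (- ?u)) * tiltE 0 n) \<le> (?u\<^sup>2 / 2) * 1"
      unfolding norm_mult norm_of_real using u0 by (intro mult_mono ex tiltE_bound1) auto
    then show "norm (complex_of_real (1 - ?u - exp (- ?u)) * tiltE 0 n) \<le> ?b\<^sup>2 * W ^ 4 / 2" using u2 by linarith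
    have "norm (complex_of_real (exp (- ?u)) * (tiltE 0 n - of_real ?P)) \<le> 1 * norm (tiltE 0 n - of_real ?P)"
      unfolding norm_mult norm_of_real using u0 by (intro mult_right_mono) auto
    then show "norm (complex_of_real (exp (- ?u)) * (tiltE 0 n - of_real ?P)) \<le> (\<Sum>j<n. step_err j + ?b\<^sup>2 * W ^ 4 / 2)"
      using Suc by simp
  qed
  then show ?case unfolding P unfolding eq unfolding sum.lessThan_Suc by linarith
qed

text \<open>The geometrically decaying part of the modes 2 and -2 sums to at most W^2 / 4, whatever
  n and s are. In the application n s^2 = T and W is of order 1 / sqrt T, so every other term is at
  most of order T W^3, that is 1 / sqrt T.\<close>

lemma tilt_clt:
  "norm ((\<integral>x. cis (\<Sum>j<n. Re (w j * cis (phase j x) * (cis (x j) - of_real q))) \<partial>walk s n)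
     - of_real (exp (- ((1 - q\<^sup>2) / 4 * (\<Sum>j<n. (norm (w j))\<^sup>2)))))
   \<le> W\<^sup>2 / 4 + real n * (s\<^sup>2 * (W ^ 3 + W ^ 4) + 5 * (W ^ 3 * s ^ 3) + s ^ 4 * W ^ 4)"
proof -
  let ?b = "(1 - q\<^sup>2) / 4"
  have b: "0 \<le> ?b" "?b \<le> s\<^sup>2" using q_bounds s by auto
  have W3: "0 \<le> W ^ 3" "0 \<le> W ^ 4" using W_nonneg by auto
  have "(\<Sum>j<n. step_err j + ?b\<^sup>2 * W ^ 4 / 2) =
    (\<Sum>j<n. W\<^sup>2 * (?b * (q ^ 4) ^ j)) + real n * (?b * (W ^ 3 + W ^ 4 / 2) + 5 * (W ^ 3 * s ^ 3) + ?b\<^sup>2 * W ^ 4 / 2)"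
  proof -
    have "step_err j + ?b\<^sup>2 * W ^ 4 / 2 = W\<^sup>2 * (?b * (q ^ 4) ^ j) + (?b * (W ^ 3 + W ^ 4 / 2) + 5 * (W ^ 3 * s ^ 3) + ?b\<^sup>2 * W ^ 4 / 2)" for j
    proof -
      have "b * W\<^sup>2 * (a + (W + W\<^sup>2 / 2)) = W\<^sup>2 * (b * a) + b * (W ^ 3 + W ^ 4 / 2)" for a b
        by (simp add: algebra_simps power2_eq_square power3_eq_cube power4_eq_xxxx)
      from this[of ?b "(q ^ 4) ^ j"] show ?thesis unfolding step_err_def by linarith
    qed
    then show ?thesis by (simp only: sum.distrib sum_constant card_lessThan distrib_left)
  qed
  also have "(\<Sum>j<n. W\<^sup>2 * (?b * (q ^ 4) ^ j)) \<le> W\<^sup>2 * (1 / 4)"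
  proof -
    have "(1 - q\<^sup>2) * (\<Sum>j<n. (q ^ 4) ^ j) \<le> (1 - q ^ 4) * (\<Sum>j<n. (q ^ 4) ^ j)"
      using q_bounds by (intro mult_right_mono sum_nonneg) (auto simp: power_decreasing)
    also have "\<dots> = 1 - (q ^ 4) ^ n" by (rule one_diff_power_eq[symmetric])
    also have "\<dots> \<le> 1" using q_bounds by simp
    finally have "?b * (\<Sum>j<n. (q ^ 4) ^ j) \<le> 1 / 4" by simp
    then have "W\<^sup>2 * (?b * (\<Sum>j<n. (q ^ 4) ^ j)) \<le> W\<^sup>2 * (1 / 4)" by (intro mult_left_mono) auto
    then show ?thesis by (simp add: sum_distrib_left)
  qed
  also have "real n * (?b * (W ^ 3 + W ^ 4 / 2) + 5 * (W ^ 3 * s ^ 3) + ?b\<^sup>2 * W ^ 4 / 2)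
     \<le> real n * (s\<^sup>2 * (W ^ 3 + W ^ 4) + 5 * (W ^ 3 * s ^ 3) + s ^ 4 * W ^ 4)"
  proof (intro mult_left_mono[where c="real n"] add_mono order_refl)
    show "?b * (W ^ 3 + W ^ 4 / 2) \<le> s\<^sup>2 * (W ^ 3 + W ^ 4)" using b W3 by (intro mult_mono) auto
    have "?b\<^sup>2 \<le> (s\<^sup>2)\<^sup>2" using b by (intro power_mono) auto
    then have "?b\<^sup>2 * W ^ 4 \<le> s ^ 4 * W ^ 4" using W3 by (intro mult_right_mono) auto
    moreover have "0 \<le> ?b\<^sup>2 * W ^ 4" using W3 by simp
    ultimately show "?b\<^sup>2 * W ^ 4 / 2 \<le> s ^ 4 * W ^ 4" by linarith
  qed simp
  finally have "(\<Sum>j<n. step_err j + ?b\<^sup>2 * W ^ 4 / 2)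
    \<le> W\<^sup>2 / 4 + real n * (s\<^sup>2 * (W ^ 3 + W ^ 4) + 5 * (W ^ 3 * s ^ 3) + s ^ 4 * W ^ 4)" by simp
  from order_trans[OF tiltE0_approx this] show ?thesis
    unfolding tiltE_def tilt_def by simp
qed

end

end

text \<open>The ratio of the discrete variance to its continuum limit, as a function of the variance
  v = T / N of one step. With q = exp (- v / 2) it reads (v / 4) (1 + q) / (1 - q).\<close>

definition var_ratio :: "real \<Rightarrow> real" where
  "var_ratio v = (v / 4) * (1 + exp (- v / 2)) / (1 - exp (- v / 2))"

lemma var_ratio_tendsto: "(var_ratio \<longlongrightarrow> 1) (at_right 0)"
  unfolding var_ratio_def by real_asymp

text \<open>The error is uniform in the number L of grid points per block, so L can tend to infinity
  before T does. The last summand, 8 n \<Xi>, comes from the boundary terms of the n blocks.\<close>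

lemma walk_fdd_clt:
  fixes \<xi> :: "nat \<Rightarrow> complex"
  assumes n: "0 < n" "0 < L" and T: "1 \<le> T" "T \<le> real (n * L)" and s: "s = sqrt (T / real (n * L))"
    and \<Xi>: "\<And>k. norm (\<xi> k) \<le> \<Xi>"
  shows "norm ((\<integral>x. cis (sqrt T / real (n * L) * (\<Sum>k<n. Re (\<xi> k * (\<Sum>j\<in>{k*L..<k*L+L}. cis (phase j x))))) \<partial>walk s (n * L))
     - of_real (exp (- (var_ratio (T / real (n * L)) / real n * (\<Sum>k<n. (norm (\<xi> k))\<^sup>2)))))
     \<le> (4 * \<Xi>\<^sup>2 + 384 * \<Xi> ^ 3 + 512 * \<Xi> ^ 4 + 8 * real n * \<Xi>) / sqrt T"
proof -
  define N where "N = n * L"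
  have N: "0 < real N" "T \<le> real N" using n T by (auto simp: N_def)
  have s0: "0 < s" using N T by (simp add: s flip: N_def)
  have s2: "s\<^sup>2 = T / real N" using T N by (simp add: s flip: N_def)
  have s1: "s\<^sup>2 \<le> 1" using N T by (simp add: s2)
  have s1': "s \<le> 1" by (rule power2_le_imp_le) (use s1 in auto)
  have \<Xi>0: "0 \<le> \<Xi>" using \<Xi>[of 0] norm_ge_zero order_trans by blast
  interpret prob_space "walk s N" using s0 by (rule prob_space_walk)
  define q where "q = damp s"
  have q: "0 < q" "q < 1" using s0 by (auto simp: q_def)
  define a where "a = sqrt T / real N"
  \<comment> \<open>The scale sqrt T / N of the phase integral combined with the factor 1 / (1 - q)
    of the Poisson equation; the result is of order 1 / sqrt T however fine the grid is.\<close>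
  define b where "b = a / (1 - q)"
  have a0: "0 < a" using T N by (simp add: a_def)
  have b0: "0 < b" using a0 q by (simp add: b_def)
  have b4: "b \<le> 4 / sqrt T"
  proof -
    have "s\<^sup>2 / 4 \<le> 1 - q"
      using one_minus_exp_ge[of "s\<^sup>2 / 2"] s1 by (simp add: q_def)
    then have "b \<le> a / (s\<^sup>2 / 4)" unfolding b_def using a0 s0 q by (intro divide_left_mono) auto
    also have "\<dots> = 4 / sqrt T" using N T by (simp add: a_def s2 field_simps)
    finally show ?thesis .
  qed
  define w where "w = (\<lambda>j. of_real b * \<xi> (j div L))"
  define W where "W = 4 * \<Xi> / sqrt T"
  have W: "norm (w j) \<le> W" for j
    using mult_mono[OF b4 \<Xi>[of "j div L"]] b0 T by (simp add: w_def norm_mult W_def)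
  have W0: "0 \<le> W" using W[of 0] norm_ge_zero order_trans by blast
  let ?M = "\<lambda>x. \<Sum>j<N. Re (w j * cis (phase j x) * (cis (x j) - of_real q))"
  let ?Z = "\<lambda>x. a * (\<Sum>k<n. Re (\<xi> k * (\<Sum>j\<in>{k*L..<k*L+L}. cis (phase j x))))"
  let ?R = "\<lambda>x. \<Sum>k<n. Re (of_real b * \<xi> k * (cis (phase (k*L+L) x) - cis (phase (k*L) x)))"
  \<comment> \<open>On each block the weight is constant, so the Poisson equation applies block by
    block; \<open>?M\<close> collects the martingale differences and \<open>?R\<close> the boundary
    terms.\<close>
  have ZM: "?Z x = ?M x - ?R x" for x
  proof -
    have "?M x = (\<Sum>k<n. \<Sum>j\<in>{k*L..<k*L+L}. Re (w j * cis (phase j x) * (cis (x j) - of_real q)))"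
      unfolding N_def by (rule sum.nat_group[symmetric])
    also have "\<dots> = (\<Sum>k<n. Re (of_real b * \<xi> k * (\<Sum>j\<in>{k*L..<k*L+L}. cis (phase j x) * (cis (x j) - of_real q))))"
    proof (intro sum.cong refl)
      fix k
      have "w j = of_real b * \<xi> k" if "j \<in> {k*L..<k*L+L}" for j
      proof -
        have "j div L = k"
        proof (rule div_nat_eqI)
          show "L * k \<le> j" using that by (simp add: mult.commute)
          show "j < L * Suc k" using that by (simp add: mult.commute)
        qed
        then show ?thesis by (simp add: w_def)
      qed
      then show "(\<Sum>j\<in>{k*L..<k*L+L}. Re (w j * cis (phase j x) * (cis (x j) - of_real q)))
         = Re (of_real b * \<xi> k * (\<Sum>j\<in>{k*L..<k*L+L}. cis (phase j x) * (cis (x j) - of_real q)))"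
        unfolding sum_distrib_left Re_sum by (intro sum.cong refl) (simp add: mult.assoc)
    qed
    finally have M: "?M x = \<dots>" .
    have "?Z x = (\<Sum>k<n. Re (of_real a * \<xi> k * (\<Sum>j\<in>{k*L..<k*L+L}. cis (phase j x))))"
    proof -
      have "a * Re z = Re (of_real a * z)" for z by (simp add: times_complex.sel)
      then show ?thesis by (subst sum_distrib_left) (simp only: mult.assoc)
    qed
    also have "\<dots> = (\<Sum>k<n. Re (of_real b * \<xi> k * (\<Sum>j\<in>{k*L..<k*L+L}. cis (phase j x) * (cis (x j) - of_real q)))
       - Re (of_real b * \<xi> k * (cis (phase (k*L+L) x) - cis (phase (k*L) x))))"
    proof (intro sum.cong refl)
      fix k
      have "(\<Sum>j\<in>{k*L..<k*L+L}. cis (phase j x)) =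
        of_real (1 / (1 - q)) * (\<Sum>j\<in>{k*L..<k*L+L}. cis (phase j x) * (cis (x j) - of_real q))
        - of_real (1 / (1 - q)) * (cis (phase (k*L+L) x) - cis (phase (k*L) x))"
        using sum_cis_phase[OF s0, of "k*L" "k*L+L" x] by (simp add: q_def)
      then have "of_real a * \<xi> k * (\<Sum>j\<in>{k*L..<k*L+L}. cis (phase j x)) =
         of_real a * \<xi> k * (of_real (1 / (1 - q)) * (\<Sum>j\<in>{k*L..<k*L+L}. cis (phase j x) * (cis (x j) - of_real q))
        - of_real (1 / (1 - q)) * (cis (phase (k*L+L) x) - cis (phase (k*L) x)))" by (simp only:)
      also have "\<dots> = of_real b * \<xi> k * (\<Sum>j\<in>{k*L..<k*L+L}. cis (phase j x) * (cis (x j) - of_real q))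
        - of_real b * \<xi> k * (cis (phase (k*L+L) x) - cis (phase (k*L) x))"
      proof -
        have "complex_of_real b = of_real a * of_real (1 / (1 - q))" by (simp add: b_def)
        then show ?thesis by (simp only: right_diff_distrib mult_ac)
      qed
      finally show "Re (of_real a * \<xi> k * (\<Sum>j\<in>{k*L..<k*L+L}. cis (phase j x))) =
         Re (of_real b * \<xi> k * (\<Sum>j\<in>{k*L..<k*L+L}. cis (phase j x) * (cis (x j) - of_real q)))
        - Re (of_real b * \<xi> k * (cis (phase (k*L+L) x) - cis (phase (k*L) x)))" by (simp only: minus_complex.sel)
    qed
    finally show ?thesis unfolding M by (simp only: sum_subtractf)
  qed
  have R: "\<bar>?R x\<bar> \<le> 8 * real n * \<Xi> / sqrt T" for x
  proof -
    have "\<bar>?R x\<bar> \<le> (\<Sum>k<n. \<bar>Re (of_real b * \<xi> k * (cis (phase (k*L+L) x) - cis (phase (k*L) x)))\<bar>)" by (rule sum_abs)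
    also have "\<dots> \<le> (\<Sum>k<n. W * 2)"
    proof (intro sum_mono)
      fix k
      have "norm (of_real b * \<xi> k * (cis (phase (k*L+L) x) - cis (phase (k*L) x))) \<le> W * 2"
        unfolding norm_mult[of "of_real b * \<xi> k"]
      proof (intro mult_mono W0)
        show "norm (of_real b * \<xi> k) \<le> W" using W[of "k * L"] n by (simp add: w_def)
        show "norm (cis (phase (k*L+L) x) - cis (phase (k*L) x)) \<le> 2"
          using norm_triangle_ineq4[of "cis (phase (k*L+L) x)" "cis (phase (k*L) x)"] by simp
      qed auto
      then show "\<bar>Re (of_real b * \<xi> k * (cis (phase (k*L+L) x) - cis (phase (k*L) x)))\<bar> \<le> W * 2"
        using abs_Re_le_cmod order_trans by blast
    qed
    finally show ?thesis by (simp add: W_def mult.left_commute mult.commute)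
  qed
  have mM: "?M \<in> borel_measurable (walk s N)"
    by measurable
  have mZ: "?Z \<in> borel_measurable (walk s N)"
  proof -
    have "(\<lambda>x. \<Sum>j\<in>{k*L..<k*L+L}. cis (phase j x)) \<in> borel_measurable (walk s N)" if "k < n" for k
    proof (intro borel_measurable_sum measurable_compose[OF phase_measurable' cis_measurable])
      fix j assume "j \<in> {k*L..<k*L+L}"
      moreover have "Suc k * L \<le> n * L" using that by (intro mult_le_mono1) simp
      ultimately show "j \<le> N" by (simp add: N_def)
    qed
    then have "(\<lambda>x. Re (\<xi> k * (\<Sum>j\<in>{k*L..<k*L+L}. cis (phase j x)))) \<in> borel_measurable (walk s N)" if "k < n" for k
      using that by (intro measurable_compose[OF _ borel_measurable_Re] borel_measurable_times) auto
    then show ?thesis by (intro borel_measurable_times borel_measurable_sum) auto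
  qed
  have d1: "norm ((\<integral>x. cis (?Z x) \<partial>walk s N) - (\<integral>x. cis (?M x) \<partial>walk s N)) \<le> 8 * real n * \<Xi> / sqrt T"
  proof -
    have i: "integrable (walk s N) (\<lambda>x. cis (?Z x))" "integrable (walk s N) (\<lambda>x. cis (?M x))"
      using measurable_compose[OF mM cis_measurable] measurable_compose[OF mZ cis_measurable]
      by (auto intro!: integrable_walk_bounded[OF s0, where B=1])
    have "norm (\<integral>x. cis (?Z x) - cis (?M x) \<partial>walk s N) \<le> (\<integral>x. 8 * real n * \<Xi> / sqrt T \<partial>walk s N)"
    proof (rule norm_integral_le)
      show "norm (cis (?Z x) - cis (?M x)) \<le> 8 * real n * \<Xi> / sqrt T" for x
        using norm_cis_diff_le[of "?Z x" "?M x"] R[of x] unfolding ZM by simp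
    qed (use i in auto)
    then show ?thesis unfolding Bochner_Integration.integral_diff[OF i] by (simp add: prob_space)
  qed
  have "norm ((\<integral>x. cis (?M x) \<partial>walk s N) - of_real (exp (- ((1 - q\<^sup>2) / 4 * (\<Sum>j<N. (norm (w j))\<^sup>2)))))
    \<le> W\<^sup>2 / 4 + real N * (s\<^sup>2 * (W ^ 3 + W ^ 4) + 5 * (W ^ 3 * s ^ 3) + s ^ 4 * W ^ 4)"
    unfolding q_def by (rule tilt_clt[OF s0 s1 W])
  also have "\<dots> \<le> (4 * \<Xi>\<^sup>2 + 384 * \<Xi> ^ 3 + 512 * \<Xi> ^ 4) / sqrt T"
  proof -
    define u where "u = 1 / sqrt T"
    have u: "0 < u" "u \<le> 1" "T * u\<^sup>2 = 1" using T by (auto simp: u_def power_divide)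
    have Wu: "W = 4 * \<Xi> * u" by (simp add: W_def u_def)
    have Ns: "real N * s\<^sup>2 = T" using N by (simp add: s2)
    have W34: "0 \<le> W ^ 3" "0 \<le> W ^ 4" using W0 by auto
    have t1: "real N * (5 * (W ^ 3 * s ^ 3)) \<le> 5 * T * W ^ 3"
    proof -
      have "real N * (5 * (W ^ 3 * s ^ 3)) = 5 * (real N * s\<^sup>2) * W ^ 3 * s" by (simp add: power2_eq_square power3_eq_cube)
      also have "\<dots> \<le> 5 * T * W ^ 3" unfolding Ns using s0 s1' W34 T by (intro mult_right_le_one_le) auto
      finally show ?thesis .
    qed
    have t2: "real N * (s ^ 4 * W ^ 4) \<le> T * W ^ 4"
    proof -
      have "real N * (s ^ 4 * W ^ 4) = (real N * s\<^sup>2) * W ^ 4 * s\<^sup>2" by (simp add: power2_eq_square power4_eq_xxxx)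
      also have "\<dots> \<le> T * W ^ 4" unfolding Ns using s0 s1 W34 T by (intro mult_right_le_one_le) auto
      finally show ?thesis .
    qed
    have t3: "real N * (s\<^sup>2 * (W ^ 3 + W ^ 4)) = T * W ^ 3 + T * W ^ 4"
      using Ns by (simp add: distrib_left flip: mult.assoc)
    have "W\<^sup>2 / 4 + real N * (s\<^sup>2 * (W ^ 3 + W ^ 4) + 5 * (W ^ 3 * s ^ 3) + s ^ 4 * W ^ 4) \<le> W\<^sup>2 / 4 + (6 * (T * W ^ 3) + 2 * (T * W ^ 4))"
      unfolding distrib_left[of "real N"] using t1 t2 t3 by linarith
    \<comment> \<open>From W = 4 \<Xi> u: 4 = 16 / 4, 384 = 6 * 64 and 512 = 2 * 256.\<close>
    also have "\<dots> = 4 * \<Xi>\<^sup>2 * (u * u) + 384 * \<Xi> ^ 3 * ((T * u\<^sup>2) * u) + 512 * \<Xi> ^ 4 * ((T * u\<^sup>2) * (u * u))"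
      unfolding Wu by (simp add: power_mult_distrib power2_eq_square power3_eq_cube power4_eq_xxxx)
    also have "\<dots> \<le> 4 * \<Xi>\<^sup>2 * u + 384 * \<Xi> ^ 3 * u + 512 * \<Xi> ^ 4 * u"
      unfolding u(3) using u \<Xi>0 by (intro add_mono mult_left_mono) (auto intro: mult_left_le_one_le)
    also have "\<dots> = (4 * \<Xi>\<^sup>2 + 384 * \<Xi> ^ 3 + 512 * \<Xi> ^ 4) / sqrt T" by (simp add: u_def add_divide_distrib)
    finally show ?thesis .
  qed
  finally have d2: "norm ((\<integral>x. cis (?M x) \<partial>walk s N) - of_real (exp (- ((1 - q\<^sup>2) / 4 * (\<Sum>j<N. (norm (w j))\<^sup>2)))))
    \<le> (4 * \<Xi>\<^sup>2 + 384 * \<Xi> ^ 3 + 512 * \<Xi> ^ 4) / sqrt T" .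
  \<comment> \<open>The L equal weights in a block add up to L b^2 times the squared norm of \<xi>
    k; together with N = n L this produces \<open>var_ratio\<close> divided by n.\<close>
  have v: "(1 - q\<^sup>2) / 4 * (\<Sum>j<N. (norm (w j))\<^sup>2) = var_ratio (T / real N) / real n * (\<Sum>k<n. (norm (\<xi> k))\<^sup>2)"
  proof -
    have "(\<Sum>j<N. (norm (w j))\<^sup>2) = (\<Sum>k<n. \<Sum>j\<in>{k*L..<k*L+L}. (norm (w j))\<^sup>2)"
      unfolding N_def by (rule sum.nat_group[symmetric])
    also have "\<dots> = (\<Sum>k<n. real L * b\<^sup>2 * (norm (\<xi> k))\<^sup>2)"
    proof (intro sum.cong refl)
      fix k
      have "(norm (w j))\<^sup>2 = b\<^sup>2 * (norm (\<xi> k))\<^sup>2" if "j \<in> {k*L..<k*L+L}" for j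
      proof -
        have "j div L = k"
        proof (rule div_nat_eqI)
          show "L * k \<le> j" using that by (simp add: mult.commute)
          show "j < L * Suc k" using that by (simp add: mult.commute)
        qed
        then show ?thesis by (simp add: w_def norm_mult power_mult_distrib)
      qed
      then show "(\<Sum>j\<in>{k*L..<k*L+L}. (norm (w j))\<^sup>2) = real L * b\<^sup>2 * (norm (\<xi> k))\<^sup>2" by simp
    qed
    finally have "(\<Sum>j<N. (norm (w j))\<^sup>2) = real L * b\<^sup>2 * (\<Sum>k<n. (norm (\<xi> k))\<^sup>2)" by (simp add: sum_distrib_left)
    moreover have "(1 - q\<^sup>2) / 4 * (real L * b\<^sup>2) = var_ratio (T / real N) / real n"
    proof -
      have "q = exp (- (T / real N) / 2)" unfolding q_def s2 by simp
      then have vr: "var_ratio (T / real N) = (T / real N / 4) * (1 + q) / (1 - q)" by (simp add: var_ratio_def)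
      have e: "1 - q\<^sup>2 = (1 - q) * (1 + q)" by (simp add: power2_eq_square algebra_simps)
      have "b\<^sup>2 = T / (real N)\<^sup>2 / (1 - q)\<^sup>2" using T by (simp add: b_def a_def power_divide power_mult_distrib)
      then have "(1 - q\<^sup>2) / 4 * (real L * b\<^sup>2) = ((1 - q) * (1 + q)) / 4 * (real L * (T / (real N)\<^sup>2 / (1 - q)\<^sup>2))"
        unfolding e by simp
      also have "\<dots> = (T / real N / 4) * (1 + q) / (1 - q) / (real N / real L)"
        using q N n by (simp add: power2_eq_square divide_simps)
      also have "real N / real L = real n" using n by (simp add: N_def)
      finally show ?thesis unfolding vr .
    qed
    ultimately show ?thesis by (simp flip: mult.assoc)
  qed
  have "norm ((\<integral>x. cis (?Z x) \<partial>walk s N) - of_real (exp (- (var_ratio (T / real N) / real n * (\<Sum>k<n. (norm (\<xi> k))\<^sup>2)))))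
     \<le> 8 * real n * \<Xi> / sqrt T + (4 * \<Xi>\<^sup>2 + 384 * \<Xi> ^ 3 + 512 * \<Xi> ^ 4) / sqrt T"
    using d1 d2[unfolded v] by (rule norm_diff_triangle_le)
  then show ?thesis unfolding a_def N_def by (simp add: add_divide_distrib)
qed

section \<open>The probability that the wedge products are small\<close>

definition xpath :: "nat \<Rightarrow> (nat \<Rightarrow> real) \<Rightarrow> real" where
  "xpath k x = (\<Sum>i<k. sin (phase i x))"

definition ypath :: "nat \<Rightarrow> (nat \<Rightarrow> real) \<Rightarrow> real" where
  "ypath k x = - (\<Sum>i<k. cos (phase i x))"

text \<open>Twice the signed area of the triangle formed by the points of the path at the times r, s
  and t.\<close>

definition wedge :: "nat \<Rightarrow> nat \<Rightarrow> nat \<Rightarrow> (nat \<Rightarrow> real) \<Rightarrow> real" where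
  "wedge r s t x = (xpath s x - xpath r x) * (ypath t x - ypath r x) - (xpath t x - xpath r x) * (ypath s x - ypath r x)"

lemma path_measurable [measurable (raw)]:
  "k \<le> Suc n \<Longrightarrow> xpath k \<in> borel_measurable (walk s n)" "k \<le> Suc n \<Longrightarrow> ypath k \<in> borel_measurable (walk s n)"
  unfolding xpath_def ypath_def
  by (auto intro!: borel_measurable_sum borel_measurable_uminus measurable_compose[OF phase_measurable' borel_measurable_sin]
      measurable_compose[OF phase_measurable' borel_measurable_cos])

lemma wedge_measurable [measurable (raw)]:
  "r \<le> n \<Longrightarrow> s \<le> n \<Longrightarrow> t \<le> n \<Longrightarrow> wedge r s t \<in> borel_measurable (walk \<sigma> n)"
  unfolding wedge_def[abs_def] by measurable

text \<open>For ordered times the wedge is the cross product of two consecutive increments, and the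
  addition theorem turns it into sines of phase differences, which are Gaussian with explicit
  covariances.\<close>

lemma wedge_ordered:
  assumes "r \<le> s" "s \<le> t"
  shows "wedge r s t x = (\<Sum>i\<in>{r..<s}. \<Sum>j\<in>{s..<t}. sin (phase j x - phase i x))"
proof -
  have d: "f b - f a = (\<Sum>i\<in>{a..<b}. g i)" if "a \<le> b" "\<And>k. f k = (\<Sum>i<k. g i)" for f g :: "nat \<Rightarrow> real" and a b
    using sum_diff_nat_ivl[of 0 a b g] that by (simp add: atLeast0LessThan)
  have x: "xpath s x - xpath r x = (\<Sum>i\<in>{r..<s}. sin (phase i x))" "xpath t x - xpath s x = (\<Sum>i\<in>{s..<t}. sin (phase i x))"
    using assms by (auto intro!: d simp: xpath_def)
  have y: "ypath s x - ypath r x = - (\<Sum>i\<in>{r..<s}. cos (phase i x))" "ypath t x - ypath s x = - (\<Sum>i\<in>{s..<t}. cos (phase i x))"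
    using assms d[of r s "\<lambda>k. - ypath k x" "\<lambda>i. cos (phase i x)"] d[of s t "\<lambda>k. - ypath k x" "\<lambda>i. cos (phase i x)"] by (auto simp: ypath_def)
  have "wedge r s t x = (xpath s x - xpath r x) * (ypath t x - ypath s x) - (xpath t x - xpath s x) * (ypath s x - ypath r x)"
    by (simp add: wedge_def algebra_simps)
  also have "\<dots> = (\<Sum>i\<in>{r..<s}. \<Sum>j\<in>{s..<t}. sin (phase j x) * cos (phase i x)) - (\<Sum>i\<in>{r..<s}. \<Sum>j\<in>{s..<t}. cos (phase j x) * sin (phase i x))"
    unfolding x y minus_mult_right[symmetric] sum_product
    by (subst (2) sum.swap) (simp add: mult.commute)
  also have "\<dots> = (\<Sum>i\<in>{r..<s}. \<Sum>j\<in>{s..<t}. sin (phase j x - phase i x))"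
    by (simp add: sin_diff sum_subtractf)
  finally show ?thesis .
qed

lemma phase_diff:
  assumes "i \<le> j" "j \<le> n"
  shows "phase j x - phase i x = (\<Sum>l<n. of_bool (i \<le> l \<and> l < j) * x l)"
proof -
  have "phase j x - phase i x = (\<Sum>l\<in>{i..<j}. x l)"
    using sum_diff_nat_ivl[of 0 i j x] assms by (simp add: phase_def atLeast0LessThan)
  also have "\<dots> = (\<Sum>l\<in>{i..<j}. of_bool (i \<le> l \<and> l < j) * x l)" by (intro sum.cong) auto
  also have "\<dots> = (\<Sum>l<n. of_bool (i \<le> l \<and> l < j) * x l)"
    by (rule sum.mono_neutral_left) (use assms in auto)
  finally show ?thesis .
qed

lemma sum_of_bool_interval:
  assumes "j \<le> n"
  shows "(\<Sum>l<n. of_bool (i \<le> l \<and> l < j)) = real (j - i)"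
proof -
  have "(\<Sum>l<n. of_bool (i \<le> l \<and> l < j)) = (\<Sum>l\<in>{i..<j}. 1 :: real)"
    by (rule sum.mono_neutral_cong_right) (use assms in auto)
  then show ?thesis by simp
qed

text \<open>Product to sum: both cosines have Gaussian arguments. For the difference of the two
  phase differences only the symmetric difference of the intervals {i..<j} and {i'..<j'} counts; for
  the sum the overlap counts four times in addition. Both intervals contain m - 1, so they overlap.
  The value is nonnegative, which is used below to drop terms from sums of such
  correlations.\<close>

lemma walk_sin_sin:
  assumes s: "0 < s" and ij: "i < m" "i' < m" "m \<le> j" "m \<le> j'" "j \<le> n" "j' \<le> n"
  defines "k \<equiv> max i i'" and "l \<equiv> min j j'"
  shows "(\<integral>x. sin (phase j x - phase i x) * sin (phase j' x - phase i' x) \<partial>walk s n)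
     = damp s ^ ((max i i' - min i i') + (max j j' - min j j')) * (1 - exp (- 2 * s\<^sup>2 * real (l - k))) / 2"
proof -
  let ?c = "\<lambda>l. of_bool (i \<le> l \<and> l < j) :: real" and ?c' = "\<lambda>l. of_bool (i' \<le> l \<and> l < j') :: real"
  have cc: "?c u * ?c' u = of_bool (k \<le> u \<and> u < l)" for u
    by (auto simp: k_def l_def)
  have sq: "?c u * ?c u = ?c u" "?c' u * ?c' u = ?c' u" for u by auto
  \<comment> \<open>The squared indicators count the two intervals and the cross term their overlap;
    only e = 1 and e = -1 are used.\<close>
  have S: "(\<Sum>u<n. (?c u + e * ?c' u)\<^sup>2) = real (j - i) + e\<^sup>2 * real (j' - i') + 2 * e * real (l - k)" for e :: real
  proof -
    have "(?c u + e * ?c' u)\<^sup>2 = ?c u + e\<^sup>2 * ?c' u + 2 * e * of_bool (k \<le> u \<and> u < l)" for u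
    proof -
      have "(?c u + e * ?c' u)\<^sup>2 = ?c u * ?c u + e\<^sup>2 * (?c' u * ?c' u) + 2 * e * (?c u * ?c' u)"
        by (simp only: power2_eq_square algebra_simps)
      then show ?thesis unfolding sq cc .
    qed
    moreover have "l \<le> n" using ij by (simp add: l_def)
    ultimately show ?thesis
      using sum_of_bool_interval[of j n i] sum_of_bool_interval[of j' n i'] sum_of_bool_interval[of l n k] ij
      by (simp only: sum.distrib sum_distrib_left[symmetric])
  qed
  have cosE: "(\<integral>x. cos ((phase j x - phase i x) + e * (phase j' x - phase i' x)) \<partial>walk s n)
      = exp (- (s\<^sup>2 / 2) * (real (j - i) + e\<^sup>2 * real (j' - i') + 2 * e * real (l - k)))" for e
  proof -
    have "(phase j x - phase i x) + e * (phase j' x - phase i' x) = (\<Sum>u<n. (?c u + e * ?c' u) * x u)" for x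
    proof -
      have pd: "phase j x - phase i x = (\<Sum>u<n. ?c u * x u)" "phase j' x - phase i' x = (\<Sum>u<n. ?c' u * x u)"
        by (rule phase_diff; use ij in simp)+
      show ?thesis unfolding pd by (simp only: distrib_right sum.distrib sum_distrib_left mult.assoc)
    qed
    then show ?thesis using walk_cos[OF s, of n "\<lambda>u. ?c u + e * ?c' u"] by (simp only: S)
  qed
  have i: "integrable (walk s n) (\<lambda>x. cos ((phase j x - phase i x) + e * (phase j' x - phase i' x)))" for e
  proof (rule integrable_walk_bounded[OF s, where B=1])
    have [measurable]: "phase j \<in> borel_measurable (walk s n)" "phase i \<in> borel_measurable (walk s n)"
      "phase j' \<in> borel_measurable (walk s n)" "phase i' \<in> borel_measurable (walk s n)"
      using ij by (auto intro!: phase_measurable)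
    show "(\<lambda>x. cos ((phase j x - phase i x) + e * (phase j' x - phase i' x))) \<in> borel_measurable (walk s n)" by measurable
  qed simp
  have pr: "sin (phase j x - phase i x) * sin (phase j' x - phase i' x) =
     (cos ((phase j x - phase i x) + (-1) * (phase j' x - phase i' x)) - cos ((phase j x - phase i x) + 1 * (phase j' x - phase i' x))) / 2" for x
  proof -
    have "sin A * sin B = (cos (A + (-1) * B) - cos (A + 1 * B)) / 2" for A B :: real
      by (simp add: sin_times_sin)
    then show ?thesis .
  qed
  let ?d = "(max i i' - min i i') + (max j j' - min j j')"
  have kl: "k \<le> l" using ij by (auto simp: k_def l_def)
  have e0: "real (j - i) + real (j' - i') - 2 * real (l - k) = real ?d"
    unfolding of_nat_diff[OF kl] using ij by (cases "i \<le> i'"; cases "j \<le> j'") (simp_all add: k_def l_def of_nat_diff)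
  have e1: "real (j - i) + (-1)\<^sup>2 * real (j' - i') + 2 * (-1) * real (l - k) = real ?d"
    unfolding power2_eq_square using e0 by linarith
  have e2: "real (j - i) + 1\<^sup>2 * real (j' - i') + 2 * 1 * real (l - k) = real ?d + 4 * real (l - k)"
    unfolding power2_eq_square using e0 by linarith
  have ex: "exp (- (s\<^sup>2 / 2) * real ?d) = damp s ^ ?d"
    unfolding exp_of_nat_mult[symmetric] by (simp add: mult.commute)
  have "(\<integral>x. sin (phase j x - phase i x) * sin (phase j' x - phase i' x) \<partial>walk s n) =
    (exp (- (s\<^sup>2 / 2) * real ?d) - exp (- (s\<^sup>2 / 2) * (real ?d + 4 * real (l - k)))) / 2"
    unfolding pr by (simp only: integral_divide_zero Bochner_Integration.integral_diff[OF i i] cosE e1 e2)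
  also have "exp (- (s\<^sup>2 / 2) * (real ?d + 4 * real (l - k))) = exp (- (s\<^sup>2 / 2) * real ?d) * exp (- 2 * s\<^sup>2 * real (l - k))"
  proof -
    have "exp (- (s\<^sup>2 / 2) * (D + 4 * K)) = exp (- (s\<^sup>2 / 2) * D) * exp (- 2 * s\<^sup>2 * K)" for D K
      by (simp add: algebra_simps flip: exp_add)
    then show ?thesis .
  qed
  finally show ?thesis unfolding ex by (simp only: right_diff_distrib mult_1_right)
qed

lemma integral_sum4:
  fixes f :: "nat \<Rightarrow> nat \<Rightarrow> nat \<Rightarrow> nat \<Rightarrow> 'a \<Rightarrow> real"
  assumes "\<And>i j k l. i \<in> A \<Longrightarrow> j \<in> B \<Longrightarrow> k \<in> C \<Longrightarrow> l \<in> D \<Longrightarrow> integrable M (f i j k l)"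
  shows "(\<integral>x. (\<Sum>i\<in>A. \<Sum>j\<in>B. \<Sum>k\<in>C. \<Sum>l\<in>D. f i j k l x) \<partial>M) = (\<Sum>i\<in>A. \<Sum>j\<in>B. \<Sum>k\<in>C. \<Sum>l\<in>D. \<integral>x. f i j k l x \<partial>M)"
  apply (subst Bochner_Integration.integral_sum, (intro Bochner_Integration.integrable_sum assms; assumption), rule sum.cong[OF refl])+
  apply (rule refl)
  done

text \<open>The inner index sets of the smaller sum may depend on i and j; this allows windows along
  the diagonals.\<close>

lemma sum4_subset_mono:
  fixes f :: "nat \<Rightarrow> nat \<Rightarrow> nat \<Rightarrow> nat \<Rightarrow> real"
  assumes fin: "finite A'" "finite B'" "finite C'" "finite D'"
    and sub: "A \<subseteq> A'" "B \<subseteq> B'" "\<And>i. i \<in> A \<Longrightarrow> C i \<subseteq> C'" "\<And>j. j \<in> B \<Longrightarrow> D j \<subseteq> D'"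
    and nn: "\<And>i j k l. i \<in> A' \<Longrightarrow> j \<in> B' \<Longrightarrow> k \<in> C' \<Longrightarrow> l \<in> D' \<Longrightarrow> 0 \<le> f i j k l"
  shows "(\<Sum>i\<in>A. \<Sum>j\<in>B. \<Sum>k\<in>C i. \<Sum>l\<in>D j. f i j k l) \<le> (\<Sum>i\<in>A'. \<Sum>j\<in>B'. \<Sum>k\<in>C'. \<Sum>l\<in>D'. f i j k l)"
proof -
  have 1: "(\<Sum>l\<in>D j. f i j k l) \<le> (\<Sum>l\<in>D'. f i j k l)" if "i \<in> A'" "j \<in> B" "k \<in> C'" for i j k
    by (rule sum_mono2) (use that sub fin nn in blast)+
  have 2: "(\<Sum>k\<in>C i. \<Sum>l\<in>D j. f i j k l) \<le> (\<Sum>k\<in>C'. \<Sum>l\<in>D'. f i j k l)" if ij: "i \<in> A" "j \<in> B" for i j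
  proof -
    have "(\<Sum>k\<in>C i. \<Sum>l\<in>D j. f i j k l) \<le> (\<Sum>k\<in>C i. \<Sum>l\<in>D'. f i j k l)"
      by (rule sum_mono, rule 1) (use ij sub in blast)+
    also have "\<dots> \<le> (\<Sum>k\<in>C'. \<Sum>l\<in>D'. f i j k l)"
      by (rule sum_mono2[OF fin(3) sub(3)[OF ij(1)]], rule sum_nonneg, rule nn) (use ij sub in blast)+
    finally show ?thesis .
  qed
  have 3: "(\<Sum>j\<in>B. \<Sum>k\<in>C i. \<Sum>l\<in>D j. f i j k l) \<le> (\<Sum>j\<in>B'. \<Sum>k\<in>C'. \<Sum>l\<in>D'. f i j k l)" if i: "i \<in> A" for i
  proof -
    have "(\<Sum>j\<in>B. \<Sum>k\<in>C i. \<Sum>l\<in>D j. f i j k l) \<le> (\<Sum>j\<in>B. \<Sum>k\<in>C'. \<Sum>l\<in>D'. f i j k l)"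
      by (rule sum_mono, rule 2[OF i])
    also have "\<dots> \<le> (\<Sum>j\<in>B'. \<Sum>k\<in>C'. \<Sum>l\<in>D'. f i j k l)"
      by (rule sum_mono2[OF fin(2) sub(2)], rule sum_nonneg, rule sum_nonneg, rule nn) (use i sub in blast)+
    finally show ?thesis .
  qed
  have "(\<Sum>i\<in>A. \<Sum>j\<in>B. \<Sum>k\<in>C i. \<Sum>l\<in>D j. f i j k l) \<le> (\<Sum>i\<in>A. \<Sum>j\<in>B'. \<Sum>k\<in>C'. \<Sum>l\<in>D'. f i j k l)"
    by (rule sum_mono, rule 3)
  also have "\<dots> \<le> (\<Sum>i\<in>A'. \<Sum>j\<in>B'. \<Sum>k\<in>C'. \<Sum>l\<in>D'. f i j k l)"
    by (rule sum_mono2[OF fin(1) sub(1)], (rule sum_nonneg)+, rule nn) (use sub in blast)+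
  finally show ?thesis .
qed

text \<open>As all correlations are nonnegative, the quadruple sum may be restricted to windows i'
  in {i..<i+m} and j' in {j..<j+m}. There the correlation decays geometrically in i' - i and j' - j,
  so the two window sums supply two factors of order 1 / s^2, while the overlap j - i' \<ge> m
  supplies the third factor. The block has seven parts so that the windows fit between r, t and
  u.\<close>

lemma walk_wedge_sq_lower:
  assumes s: "0 < s" and m: "0 < m" and n: "7 * m \<le> n"
    and r: "r < m" and t: "3 * m \<le> t" "t < 4 * m" and u: "6 * m \<le> u" "u < 7 * m"
  shows "2 * real m ^ 2 / (s\<^sup>2)\<^sup>2 * (1 - exp (- s\<^sup>2 * real m / 2)) ^ 3 \<le> (\<integral>x. (wedge r t u x)\<^sup>2 \<partial>walk s n)"
proof -
  define E where "E = (\<lambda>i j i' j'. (\<integral>x. sin (phase j x - phase i x) * sin (phase j' x - phase i' x) \<partial>walk s n))"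
  define q where "q = damp s"
  have q: "0 < q" "q < 1" using s by (auto simp: q_def)
  have Eeq: "E i j i' j' = q ^ ((max i i' - min i i') + (max j j' - min j j')) * (1 - exp (- 2 * s\<^sup>2 * real (min j j' - max i i'))) / 2"
    if "i < t" "i' < t" "t \<le> j" "t \<le> j'" "j < u" "j' < u" for i j i' j'
    unfolding E_def q_def by (rule walk_sin_sin[OF s, of i t]) (use that u n in auto)
  have E0: "0 \<le> E i j i' j'" if "i < t" "i' < t" "t \<le> j" "t \<le> j'" "j < u" "j' < u" for i j i' j'
    unfolding Eeq[OF that] using q by simp
  have [measurable]: "phase i \<in> borel_measurable (walk s n)" if "i < u" for i
    using that u n by (intro phase_measurable) auto
  have ii: "integrable (walk s n) (\<lambda>x. sin (phase j x - phase i x) * sin (phase j' x - phase i' x))"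
    if "i < u" "i' < u" "j < u" "j' < u" for i j i' j'
    by (rule integrable_walk_bounded[OF s, where B=1]) (use that in \<open>auto simp: abs_mult intro!: mult_le_one\<close>)
  have sqr: "(wedge r t u x)\<^sup>2 = (\<Sum>i\<in>{r..<t}. \<Sum>j\<in>{t..<u}. \<Sum>i'\<in>{r..<t}. \<Sum>j'\<in>{t..<u}. sin (phase j x - phase i x) * sin (phase j' x - phase i' x))" for x
  proof -
    have "wedge r t u x = (\<Sum>i\<in>{r..<t}. \<Sum>j\<in>{t..<u}. sin (phase j x - phase i x))"
      by (rule wedge_ordered) (use r t u in auto)
    then show ?thesis unfolding power2_eq_square by (simp only: sum_distrib_right) (simp only: sum_distrib_left)
  qed
  have "(\<integral>x. (wedge r t u x)\<^sup>2 \<partial>walk s n) = (\<Sum>i\<in>{r..<t}. \<Sum>j\<in>{t..<u}. \<Sum>i'\<in>{r..<t}. \<Sum>j'\<in>{t..<u}. E i j i' j')"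
    unfolding sqr E_def by (rule integral_sum4) (rule ii; use r t u in auto)
  also have "\<dots> \<ge> (\<Sum>i\<in>{m..<2*m}. \<Sum>j\<in>{4*m..<5*m}. \<Sum>i'\<in>{i..<i+m}. \<Sum>j'\<in>{j..<j+m}. E i j i' j')"
  proof (rule sum4_subset_mono)
    show "{m..<2*m} \<subseteq> {r..<t}" "{4*m..<5*m} \<subseteq> {t..<u}" using r t u by auto
    show "{i..<i+m} \<subseteq> {r..<t}" if "i \<in> {m..<2*m}" for i using that r t u by auto
    show "{j..<j+m} \<subseteq> {t..<u}" if "j \<in> {4*m..<5*m}" for j using that r t u by auto
    show "0 \<le> E i j i' j'" if "i \<in> {r..<t}" "j \<in> {t..<u}" "i' \<in> {r..<t}" "j' \<in> {t..<u}" for i j i' j'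
      by (rule E0) (use that in auto)
  qed auto
  also (xtrans) have "(\<Sum>i\<in>{m..<2*m}. \<Sum>j\<in>{4*m..<5*m}. \<Sum>i'\<in>{i..<i+m}. \<Sum>j'\<in>{j..<j+m}. E i j i' j')
     \<ge> (\<Sum>i\<in>{m..<2*m}. \<Sum>j\<in>{4*m..<5*m}. \<Sum>i'\<in>{i..<i+m}. \<Sum>j'\<in>{j..<j+m}. q ^ (i' - i) * q ^ (j' - j) * ((1 - exp (- 2 * s\<^sup>2 * real m)) / 2))"
  proof (intro sum_mono)
    fix i j i' j' assume a: "i \<in> {m..<2*m}" "j \<in> {4*m..<5*m}" "i' \<in> {i..<i+m}" "j' \<in> {j..<j+m}"
    have "E i j i' j' = q ^ ((max i i' - min i i') + (max j j' - min j j')) * (1 - exp (- 2 * s\<^sup>2 * real (min j j' - max i i'))) / 2"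
      by (rule Eeq) (use a t u in auto)
    also have "(max i i' - min i i') + (max j j' - min j j') = (i' - i) + (j' - j)" using a by (auto simp: max_def min_def)
    also have "min j j' - max i i' = j - i'" using a by (auto simp: max_def min_def)
    finally have e: "E i j i' j' = q ^ ((i' - i) + (j' - j)) * (1 - exp (- 2 * s\<^sup>2 * real (j - i'))) / 2" .
    have "m \<le> j - i'" using a by auto
    then have "s\<^sup>2 * real m \<le> s\<^sup>2 * real (j - i')" by (intro mult_left_mono) auto
    then have "1 - exp (- 2 * s\<^sup>2 * real m) \<le> 1 - exp (- 2 * s\<^sup>2 * real (j - i'))" by simp
    then have "q ^ ((i' - i) + (j' - j)) * (1 - exp (- 2 * s\<^sup>2 * real m)) \<le> q ^ ((i' - i) + (j' - j)) * (1 - exp (- 2 * s\<^sup>2 * real (j - i')))"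
      using q by (intro mult_left_mono) auto
    then show "q ^ (i' - i) * q ^ (j' - j) * ((1 - exp (- 2 * s\<^sup>2 * real m)) / 2) \<le> E i j i' j'"
      unfolding e by (simp add: power_add)
  qed
  also (xtrans) have "(\<Sum>i\<in>{m..<2*m}. \<Sum>j\<in>{4*m..<5*m}. \<Sum>i'\<in>{i..<i+m}. \<Sum>j'\<in>{j..<j+m}. q ^ (i' - i) * q ^ (j' - j) * ((1 - exp (- 2 * s\<^sup>2 * real m)) / 2))
     = real m ^ 2 * (\<Sum>d<m. q ^ d)\<^sup>2 * ((1 - exp (- 2 * s\<^sup>2 * real m)) / 2)"
  proof -
    have g: "(\<Sum>i'\<in>{i..<i+m}. q ^ (i' - i)) = (\<Sum>d<m. q ^ d)" for i
      by (rule sum.reindex_bij_witness[of _ "\<lambda>d. i + d" "\<lambda>i'. i' - i"]) auto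
    have h: "(\<Sum>i'\<in>{i..<i+m}. \<Sum>j'\<in>{j..<j+m}. q ^ (i' - i) * q ^ (j' - j) * c) = (\<Sum>d<m. q ^ d)\<^sup>2 * c" for i j c
      unfolding sum_distrib_right[symmetric] sum_distrib_left[symmetric] g by (simp add: power2_eq_square)
    show ?thesis unfolding h by (simp add: power2_eq_square)
  qed
  \<comment> \<open>A geometric sum with 1 - q \<le> s^2 / 2; the rate 2 s^2 m in the last factor is
    weakened to s^2 m / 2 so that three equal factors result.\<close>
  also (xtrans) have "real m ^ 2 * (\<Sum>d<m. q ^ d)\<^sup>2 * ((1 - exp (- 2 * s\<^sup>2 * real m)) / 2)
      \<ge> real m ^ 2 * (2 / s\<^sup>2 * (1 - exp (- s\<^sup>2 * real m / 2)))\<^sup>2 * ((1 - exp (- s\<^sup>2 * real m / 2)) / 2)"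
  proof (intro mult_mono mult_left_mono power_mono divide_right_mono)
    have "(1 - q) * (\<Sum>d<m. q ^ d) = 1 - q ^ m" by (rule one_diff_power_eq[symmetric])
    also have "q ^ m = exp (- s\<^sup>2 * real m / 2)" unfolding q_def exp_of_nat_mult[symmetric] by (simp add: mult.commute)
    finally have e: "(1 - q) * (\<Sum>d<m. q ^ d) = 1 - exp (- s\<^sup>2 * real m / 2)" .
    have "1 - q \<le> s\<^sup>2 / 2" using exp_ge_add_one_self[of "- s\<^sup>2 / 2"] by (simp add: q_def)
    then have "(1 - q) * (\<Sum>d<m. q ^ d) \<le> s\<^sup>2 / 2 * (\<Sum>d<m. q ^ d)"
      using q by (intro mult_right_mono sum_nonneg) auto
    then have "1 - exp (- s\<^sup>2 * real m / 2) \<le> s\<^sup>2 / 2 * (\<Sum>d<m. q ^ d)" unfolding e .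
    then show "2 / s\<^sup>2 * (1 - exp (- s\<^sup>2 * real m / 2)) \<le> (\<Sum>d<m. q ^ d)"
      using s by (simp add: field_simps)
    have "s\<^sup>2 * real m / 2 \<le> 2 * s\<^sup>2 * real m" by simp
    then show "1 - exp (- s\<^sup>2 * real m / 2) \<le> 1 - exp (- 2 * s\<^sup>2 * real m)" by simp
  qed (use q in \<open>auto intro!: sum_nonneg\<close>)
  also (xtrans) have "real m ^ 2 * (2 / s\<^sup>2 * (1 - exp (- s\<^sup>2 * real m / 2)))\<^sup>2 * ((1 - exp (- s\<^sup>2 * real m / 2)) / 2)
     = 2 * real m ^ 2 / (s\<^sup>2)\<^sup>2 * (1 - exp (- s\<^sup>2 * real m / 2)) ^ 3"
  proof -
    have "real m ^ 2 * (2 / v * g)\<^sup>2 * (g / 2) = 2 * real m ^ 2 / v\<^sup>2 * g ^ 3" for v g :: real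
      by (simp add: power_mult_distrib power_divide power3_eq_cube power2_eq_square)
    then show ?thesis .
  qed
  finally show ?thesis .
qed

section \<open>Upper moment bounds and the Paley--Zygmund inequality\<close>

lemma walk_exp_sum:
  assumes s: "0 < s"
  shows "(\<integral>\<^sup>+x. ennreal (exp (\<Sum>l<n. c l * x l)) \<partial>walk s n) = ennreal (exp (s\<^sup>2 / 2 * (\<Sum>l<n. (c l)\<^sup>2)))"
proof -
  have g: "(\<integral>\<^sup>+y. ennreal (exp (c * y)) \<partial>gauss s) = ennreal (exp (s\<^sup>2 / 2 * c\<^sup>2))" for c
    using gauss_exp[OF s, of c] by (subst nn_integral_eq_integral) (auto simp: has_bochner_integral_iff)
  have "(\<integral>\<^sup>+x. ennreal (exp (\<Sum>l<n. c l * x l)) \<partial>walk s n) = (\<integral>\<^sup>+x. (\<Prod>l<n. ennreal (exp (c l * x l))) \<partial>walk s n)"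
    by (simp add: exp_sum prod_ennreal)
  also have "\<dots> = (\<Prod>l<n. \<integral>\<^sup>+y. ennreal (exp (c l * y)) \<partial>gauss s)"
    unfolding walk_def
    by (rule product_sigma_finite.product_nn_integral_prod[OF product_sigma_finite_gauss[OF s]]) auto
  also have "\<dots> = (\<Prod>l<n. ennreal (exp (s\<^sup>2 / 2 * (c l)\<^sup>2)))" by (simp only: g)
  also have "\<dots> = ennreal (exp (s\<^sup>2 / 2 * (\<Sum>l<n. (c l)\<^sup>2)))"
    by (simp add: prod_ennreal exp_sum sum_distrib_left)
  finally show ?thesis .
qed

text \<open>After division by s sqrt n the difference has exponential moments at most exp 1 at the
  arguments 1 and -1; 48 is twice 4!. The case i > j reduces to i \<le> j, the fourth power being
  even.\<close>

lemma walk_phase_diff_pow4: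
  assumes s: "0 < s" and ij: "i < n" "j < n" and n: "0 < n"
  shows "(\<integral>\<^sup>+x. ennreal ((phase j x - phase i x) ^ 4) \<partial>walk s n) \<le> ennreal (48 * exp 1 * (s\<^sup>2 * real n)\<^sup>2)"
proof -
  have *: "(\<integral>\<^sup>+x. ennreal ((phase j x - phase i x) ^ 4) \<partial>walk s n) \<le> ennreal (48 * exp 1 * (s\<^sup>2 * real n)\<^sup>2)"
    if ij: "i \<le> j" "j < n" for i j
  proof -
    define u where "u = s * sqrt (real n)"
    have u: "0 < u" "u\<^sup>2 = s\<^sup>2 * real n" using s n by (auto simp: u_def power_mult_distrib)
    define Y where "Y = (\<lambda>x. (phase j x - phase i x) / u)"
    have [measurable]: "Y \<in> borel_measurable (walk s n)"
      unfolding Y_def using ij by (intro borel_measurable_divide borel_measurable_diff phase_measurable') auto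
    have e: "(\<integral>\<^sup>+x. ennreal (exp (c * Y x)) \<partial>walk s n) \<le> ennreal (exp 1)" if "c\<^sup>2 = 1" for c
    proof -
      have "c * Y x = (\<Sum>l<n. (c / u * of_bool (i \<le> l \<and> l < j)) * x l)" for x
      proof -
        have pd: "phase j x - phase i x = (\<Sum>l<n. of_bool (i \<le> l \<and> l < j) * x l)"
          by (rule phase_diff) (use ij in auto)
        show ?thesis unfolding Y_def pd sum_divide_distrib sum_distrib_left by (intro sum.cong refl) simp
      qed
      then have "(\<integral>\<^sup>+x. ennreal (exp (c * Y x)) \<partial>walk s n) = ennreal (exp (s\<^sup>2 / 2 * (\<Sum>l<n. (c / u * of_bool (i \<le> l \<and> l < j))\<^sup>2)))"
        using walk_exp_sum[OF s, of n "\<lambda>l. c / u * of_bool (i \<le> l \<and> l < j)"] by simp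
      also have "\<dots> \<le> ennreal (exp 1)"
      proof (intro ennreal_leI)
        have "(\<Sum>l<n. (c / u * of_bool (i \<le> l \<and> l < j))\<^sup>2) \<le> (\<Sum>l<n. 1 / u\<^sup>2)"
          using that by (intro sum_mono) (auto simp: power_mult_distrib power_divide)
        also have "\<dots> = 1 / s\<^sup>2" using n s by (simp add: u)
        finally have "s\<^sup>2 / 2 * (\<Sum>l<n. (c / u * of_bool (i \<le> l \<and> l < j))\<^sup>2) \<le> s\<^sup>2 / 2 * (1 / s\<^sup>2)"
          by (intro mult_left_mono) auto
        also have "\<dots> \<le> 1" using s by simp
        finally show "exp (s\<^sup>2 / 2 * (\<Sum>l<n. (c / u * of_bool (i \<le> l \<and> l < j))\<^sup>2)) \<le> exp 1" by simp
      qed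
      finally show ?thesis .
    qed
    have "(\<integral>\<^sup>+x. ennreal ((phase j x - phase i x) ^ 4) \<partial>walk s n) \<le>
      (\<integral>\<^sup>+x. ennreal (24 * u ^ 4) * (ennreal (exp (1 * Y x)) + ennreal (exp ((-1) * Y x))) \<partial>walk s n)"
    proof (rule nn_integral_mono)
      fix x
      have "(phase j x - phase i x) ^ 4 = u ^ 4 * \<bar>Y x\<bar> ^ 4" using u(1) by (simp add: Y_def power_divide power_even_abs)
      also have "\<dots> \<le> u ^ 4 * (fact 4 * exp \<bar>Y x\<bar>)" by (intro mult_left_mono power_le_fact_exp) auto
      also have "\<dots> = 24 * u ^ 4 * exp \<bar>Y x\<bar>" by (simp add: fact_numeral)
      also have "\<dots> \<le> 24 * u ^ 4 * (exp (1 * Y x) + exp ((-1) * Y x))"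
        by (intro mult_left_mono) (auto simp: abs_if)
      finally show "ennreal ((phase j x - phase i x) ^ 4) \<le> ennreal (24 * u ^ 4) * (ennreal (exp (1 * Y x)) + ennreal (exp ((-1) * Y x)))"
        by (subst ennreal_plus[symmetric], simp, simp, subst ennreal_mult[symmetric]) (auto intro: ennreal_leI)
    qed
    also have "\<dots> = ennreal (24 * u ^ 4) * ((\<integral>\<^sup>+x. ennreal (exp (1 * Y x)) \<partial>walk s n) + (\<integral>\<^sup>+x. ennreal (exp ((-1) * Y x)) \<partial>walk s n))"
      by (subst nn_integral_cmult, measurable) (subst nn_integral_add, auto)
    also have "\<dots> \<le> ennreal (24 * u ^ 4) * (ennreal (exp 1) + ennreal (exp 1))"
      by (intro mult_left_mono add_mono e) auto
    also have "\<dots> = ennreal (48 * exp 1 * (u\<^sup>2)\<^sup>2)"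
      by (subst ennreal_plus[symmetric], simp, simp, subst ennreal_mult[symmetric]) (auto simp: algebra_simps)
    finally show ?thesis unfolding u(2) .
  qed
  show ?thesis
  proof (cases "i \<le> j")
    case True then show ?thesis using * ij by blast
  next
    case False
    then have "(\<integral>\<^sup>+x. ennreal ((phase i x - phase j x) ^ 4) \<partial>walk s n) \<le> ennreal (48 * exp 1 * (s\<^sup>2 * real n)\<^sup>2)"
      using * ij by simp
    moreover have "(phase i x - phase j x) ^ 4 = (phase j x - phase i x) ^ 4" for x
      by (metis abs_minus_commute even_numeral power_even_abs)
    ultimately show ?thesis by simp
  qed
qed

text \<open>Cauchy--Schwarz in linearised form: on the event f < m / 2, and off it f \<le> c f^2 / 2
  + 1 / (2 c). With c = m / (2 q) the quadratic term integrates to at most m / 4, which leaves m / 4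
  for the probability of the complement.\<close>

lemma (in prob_space) paley_zygmund:
  fixes f :: "'a \<Rightarrow> real"
  assumes i: "integrable M f" "integrable M (\<lambda>x. (f x)\<^sup>2)" and f0: "\<And>x. 0 \<le> f x"
    and m: "0 < m" "m \<le> expectation f" and q: "expectation (\<lambda>x. (f x)\<^sup>2) \<le> q"
  shows "prob {x \<in> space M. f x < m / 2} \<le> 1 - m\<^sup>2 / (4 * q)"
proof -
  have [measurable]: "f \<in> borel_measurable M" using i(1) by simp
  define A where "A = {x \<in> space M. f x < m / 2}"
  have A: "A \<in> events" unfolding A_def by measurable
  have iA: "integrable M (indicator A :: 'a \<Rightarrow> real)"
    by (rule integrable_real_indicator[OF A]) (simp add: emeasure_eq_measure)
  have "(expectation f)\<^sup>2 \<le> expectation (\<lambda>x. (f x)\<^sup>2)"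
    using variance_positive[of f] variance_eq[OF i] by simp
  then have "m\<^sup>2 \<le> q" using q m power_mono[OF m(2), of 2] by linarith
  then have q0: "0 < q" using m by (meson less_le_trans zero_less_power)
  define c where "c = m / (2 * q)"
  have c: "0 < c" using m q0 by (simp add: c_def)
  have pt: "f x \<le> m / 2 + (c * (f x)\<^sup>2 / 2 + (1 - indicator A x) / (2 * c))" if "x \<in> space M" for x
  proof (cases "x \<in> A")
    case True
    then have "f x < m / 2" "x \<in> A" by (auto simp: A_def)
    moreover have "0 \<le> c * (f x)\<^sup>2" using c by simp
    ultimately show ?thesis by simp
  next
    case False
    have "0 \<le> (c * f x - 1)\<^sup>2 / (2 * c)" using c by simp
    also have "\<dots> = c * (f x)\<^sup>2 / 2 + 1 / (2 * c) - f x" using c by (simp add: power2_eq_square field_simps)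
    finally have "f x \<le> c * (f x)\<^sup>2 / 2 + 1 / (2 * c)" by simp
    then show ?thesis using False m by simp
  qed
  have ind: "expectation (indicator A) = prob A" using A by simp
  have "m \<le> expectation (\<lambda>x. m / 2 + (c * (f x)\<^sup>2 / 2 + (1 - indicator A x) / (2 * c)))"
    by (rule order_trans[OF m(2)], rule integral_mono) (use i iA pt in auto)
  also have "\<dots> = m / 2 + (c * expectation (\<lambda>x. (f x)\<^sup>2) / 2 + (1 - prob A) / (2 * c))"
    using i iA A by (simp add: prob_space)
  also have "\<dots> \<le> m / 2 + (c * q / 2 + (1 - prob A) / (2 * c))" using q c by simp
  also have "c * q / 2 = m / 4" using q0 by (simp add: c_def)
  finally have "m \<le> m / 2 + (m / 4 + (1 - prob A) / (2 * c))" .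
  then have "m / 4 \<le> (1 - prob A) / (2 * c)" by linarith
  then have "m / 4 * (2 * c) \<le> 1 - prob A" using c by (simp add: field_simps)
  moreover have "m / 4 * (2 * c) = m\<^sup>2 / (4 * q)" using q0 by (simp add: c_def power2_eq_square)
  ultimately show ?thesis unfolding A_def[symmetric] by simp
qed

text \<open>By Cauchy--Binet this is 6 l^3 times the determinant of the Gram matrix of a block of l
  grid points.\<close>

definition block_sum :: "nat \<Rightarrow> (nat \<Rightarrow> real) \<Rightarrow> real" where
  "block_sum l x = (\<Sum>r<l. \<Sum>t<l. \<Sum>u<l. (wedge r t u x)\<^sup>2)"

lemma block_sum_measurable [measurable]: "block_sum l \<in> borel_measurable (walk s l)"
  unfolding block_sum_def[abs_def]
  by (intro borel_measurable_sum borel_measurable_power wedge_measurable) auto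

lemma block_sum_nonneg: "0 \<le> block_sum l x"
  unfolding block_sum_def by (intro sum_nonneg) auto

lemma path_bound: "\<bar>xpath k x\<bar> \<le> real k" "\<bar>ypath k x\<bar> \<le> real k"
proof -
  have "\<bar>\<Sum>i<k. f i\<bar> \<le> real k" if "\<And>i. \<bar>f i\<bar> \<le> 1" for f :: "nat \<Rightarrow> real"
  proof -
    have "\<bar>\<Sum>i<k. f i\<bar> \<le> (\<Sum>i<k. \<bar>f i\<bar>)" by (rule sum_abs)
    also have "\<dots> \<le> (\<Sum>i<k. 1)" by (intro sum_mono that)
    finally show ?thesis by simp
  qed
  then show "\<bar>xpath k x\<bar> \<le> real k" "\<bar>ypath k x\<bar> \<le> real k" by (auto simp: xpath_def ypath_def)
qed

lemma wedge_bound: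
  assumes "r \<le> l" "t \<le> l" "u \<le> l"
  shows "\<bar>wedge r t u x\<bar> \<le> 8 * (real l)\<^sup>2"
proof -
  have d: "\<bar>xpath a x - xpath b x\<bar> \<le> 2 * real l" "\<bar>ypath a x - ypath b x\<bar> \<le> 2 * real l" if "a \<le> l" "b \<le> l" for a b
    using path_bound[of a x] path_bound[of b x] that by (auto simp: abs_le_iff intro: order_trans)
  have "\<bar>wedge r t u x\<bar> \<le> \<bar>xpath t x - xpath r x\<bar> * \<bar>ypath u x - ypath r x\<bar> + \<bar>xpath u x - xpath r x\<bar> * \<bar>ypath t x - ypath r x\<bar>"
    unfolding wedge_def abs_mult[symmetric] by (rule abs_triangle_ineq4)
  also have "\<dots> \<le> 2 * real l * (2 * real l) + 2 * real l * (2 * real l)"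
    by (intro add_mono mult_mono d assms) auto
  finally show ?thesis by (simp add: power2_eq_square)
qed

lemma wedge_integrable:
  assumes "0 < s" "r \<le> l" "t \<le> l" "u \<le> l"
  shows "integrable (walk s l) (\<lambda>x. (wedge r t u x) ^ k)"
  by (rule integrable_walk_bounded[OF assms(1), where B="(8 * (real l)\<^sup>2) ^ k"])
    (use power_mono[OF wedge_bound[OF assms(2-4)] abs_ge_zero, where n=k] assms in \<open>auto simp: power_abs\<close>)

lemma sum_triple_sq_le:
  fixes f :: "nat \<Rightarrow> nat \<Rightarrow> nat \<Rightarrow> real"
  shows "(\<Sum>r<l. \<Sum>t<l. \<Sum>u<l. f r t u)\<^sup>2 \<le> real l ^ 3 * (\<Sum>r<l. \<Sum>t<l. \<Sum>u<l. (f r t u)\<^sup>2)"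
proof -
  have cs: "(\<Sum>i<l. g i)\<^sup>2 \<le> real l * (\<Sum>i<l. (g i)\<^sup>2)" for g :: "nat \<Rightarrow> real"
    using sum_squared_le_sum_of_squares[of g "{..<l}"] by (simp add: mult.commute)
  have "(\<Sum>r<l. \<Sum>t<l. \<Sum>u<l. f r t u)\<^sup>2 \<le> real l * (\<Sum>r<l. (\<Sum>t<l. \<Sum>u<l. f r t u)\<^sup>2)" by (rule cs)
  also have "\<dots> \<le> real l * (\<Sum>r<l. real l * (\<Sum>t<l. (\<Sum>u<l. f r t u)\<^sup>2))"
    by (intro mult_left_mono sum_mono cs) auto
  also have "\<dots> \<le> real l * (\<Sum>r<l. real l * (\<Sum>t<l. real l * (\<Sum>u<l. (f r t u)\<^sup>2)))"
    by (intro mult_left_mono sum_mono cs) auto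
  also have "\<dots> = real l ^ 3 * (\<Sum>r<l. \<Sum>t<l. \<Sum>u<l. (f r t u)\<^sup>2)"
    by (simp add: sum_distrib_left power3_eq_cube mult.assoc)
  finally show ?thesis .
qed

lemma block_sum_integrable:
  assumes "0 < s"
  shows "integrable (walk s l) (block_sum l)" "integrable (walk s l) (\<lambda>x. (block_sum l x)\<^sup>2)"
proof -
  have b: "\<bar>block_sum l x\<bar> \<le> (\<Sum>r<l. \<Sum>t<l. \<Sum>u<l. (8 * (real l)\<^sup>2)\<^sup>2)" for x
  proof -
    have "block_sum l x \<le> (\<Sum>r<l. \<Sum>t<l. \<Sum>u<l. (8 * (real l)\<^sup>2)\<^sup>2)"
      unfolding block_sum_def
    proof (intro sum_mono)
      fix r t u assume "r \<in> {..<l}" "t \<in> {..<l}" "u \<in> {..<l}"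
      then have "\<bar>wedge r t u x\<bar> \<le> 8 * (real l)\<^sup>2" by (intro wedge_bound) auto
      from power_mono[OF this abs_ge_zero, where n=2] show "(wedge r t u x)\<^sup>2 \<le> (8 * (real l)\<^sup>2)\<^sup>2"
        by (simp only: power2_abs)
    qed
    then show ?thesis using block_sum_nonneg[of l x] by simp
  qed
  show "integrable (walk s l) (block_sum l)"
    by (rule integrable_walk_bounded[OF assms]) (use b in auto)
  show "integrable (walk s l) (\<lambda>x. (block_sum l x)\<^sup>2)"
    by (rule integrable_walk_bounded[OF assms, where B="(\<Sum>r<l. \<Sum>t<l. \<Sum>u<l. (8 * (real l)\<^sup>2)\<^sup>2)\<^sup>2"])
      (use power_mono[OF b abs_ge_zero, where n=2] in auto)
qed

text \<open>Only the m^3 triples with r, t and u in the first, fourth and seventh of the seven parts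
  of the block are kept.\<close>

lemma block_sum_mean_lower:
  assumes s: "0 < s" and m: "0 < m" and l: "l = 7 * m"
  shows "2 * real m ^ 5 / (s\<^sup>2)\<^sup>2 * (1 - exp (- s\<^sup>2 * real m / 2)) ^ 3 \<le> (\<integral>x. block_sum l x \<partial>walk s l)"
proof -
  let ?c = "2 * real m ^ 2 / (s\<^sup>2)\<^sup>2 * (1 - exp (- s\<^sup>2 * real m / 2)) ^ 3"
  have nn: "0 \<le> (\<integral>x. (wedge r t u x)\<^sup>2 \<partial>walk s l)" for r t u by simp
  have "2 * real m ^ 5 / (s\<^sup>2)\<^sup>2 * (1 - exp (- s\<^sup>2 * real m / 2)) ^ 3 = (\<Sum>r<m. \<Sum>t\<in>{3*m..<4*m}. \<Sum>u\<in>{6*m..<7*m}. ?c)"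
    by (simp add: eval_nat_numeral)
  also have "\<dots> \<le> (\<Sum>r<m. \<Sum>t\<in>{3*m..<4*m}. \<Sum>u\<in>{6*m..<7*m}. (\<integral>x. (wedge r t u x)\<^sup>2 \<partial>walk s l))"
    by (intro sum_mono walk_wedge_sq_lower s m) (auto simp: l)
  also have "\<dots> \<le> (\<Sum>r<m. \<Sum>t\<in>{3*m..<4*m}. \<Sum>u<l. (\<integral>x. (wedge r t u x)\<^sup>2 \<partial>walk s l))"
    by (intro sum_mono sum_mono2 nn) (auto simp: l)
  also have "\<dots> \<le> (\<Sum>r<m. \<Sum>t<l. \<Sum>u<l. (\<integral>x. (wedge r t u x)\<^sup>2 \<partial>walk s l))"
    by (rule sum_mono, rule sum_mono2) (auto simp: l intro!: sum_nonneg)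
  also have "\<dots> \<le> (\<Sum>r<l. \<Sum>t<l. \<Sum>u<l. (\<integral>x. (wedge r t u x)\<^sup>2 \<partial>walk s l))"
    by (rule sum_mono2) (auto simp: l intro!: sum_nonneg)
  also have "\<dots> = (\<integral>x. block_sum l x \<partial>walk s l)"
  proof -
    have i1: "integrable (walk s l) (\<lambda>x. (wedge r t u x)\<^sup>2)" if "r < l" "t < l" "u < l" for r t u
      using wedge_integrable[OF s, of r l t u 2] that by simp
    have i2: "integrable (walk s l) (\<lambda>x. \<Sum>u<l. (wedge r t u x)\<^sup>2)" if "r < l" "t < l" for r t
      by (rule Bochner_Integration.integrable_sum, rule i1) (use that in auto)
    have i3: "integrable (walk s l) (\<lambda>x. \<Sum>t<l. \<Sum>u<l. (wedge r t u x)\<^sup>2)" if "r < l" for r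
      by (rule Bochner_Integration.integrable_sum, rule i2) (use that in auto)
    show ?thesis unfolding block_sum_def
      by (simp add: Bochner_Integration.integral_sum i1 i2 i3)
  qed
  finally show ?thesis .
qed

lemma block_sum_sq_upper:
  assumes s: "0 < s" and K: "\<And>r t u. r < l \<Longrightarrow> t < l \<Longrightarrow> u < l \<Longrightarrow> (\<integral>x. (wedge r t u x) ^ 4 \<partial>walk s l) \<le> K"
  shows "(\<integral>x. (block_sum l x)\<^sup>2 \<partial>walk s l) \<le> real l ^ 6 * K"
proof -
  have i1: "integrable (walk s l) (\<lambda>x. (wedge r t u x) ^ 4)" if "r < l" "t < l" "u < l" for r t u
    using wedge_integrable[OF s, of r l t u 4] that by simp
  have i2: "integrable (walk s l) (\<lambda>x. \<Sum>u<l. (wedge r t u x) ^ 4)" if "r < l" "t < l" for r t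
    by (rule Bochner_Integration.integrable_sum, rule i1) (use that in auto)
  have i3: "integrable (walk s l) (\<lambda>x. \<Sum>t<l. \<Sum>u<l. (wedge r t u x) ^ 4)" if "r < l" for r
    by (rule Bochner_Integration.integrable_sum, rule i2) (use that in auto)
  have i4: "integrable (walk s l) (\<lambda>x. \<Sum>r<l. \<Sum>t<l. \<Sum>u<l. (wedge r t u x) ^ 4)"
    by (rule Bochner_Integration.integrable_sum, rule i3) auto
  have "(\<integral>x. (block_sum l x)\<^sup>2 \<partial>walk s l) \<le> (\<integral>x. real l ^ 3 * (\<Sum>r<l. \<Sum>t<l. \<Sum>u<l. (wedge r t u x) ^ 4) \<partial>walk s l)"
    using sum_triple_sq_le[of "\<lambda>r t u. (wedge r t u _)\<^sup>2" l]
    by (intro integral_mono block_sum_integrable s integrable_mult_right i4) (simp add: block_sum_def flip: power_mult)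
  also have "\<dots> = real l ^ 3 * (\<Sum>r<l. \<Sum>t<l. \<Sum>u<l. \<integral>x. (wedge r t u x) ^ 4 \<partial>walk s l)"
    by (simp add: Bochner_Integration.integral_sum i1 i2 i3)
  also have "\<dots> \<le> real l ^ 3 * (\<Sum>r<l. \<Sum>t<l. \<Sum>u<l. K)"
    by (intro mult_left_mono sum_mono K) auto
  also have "\<dots> = real l ^ 6 * K" by (simp add: eval_nat_numeral)
  finally show ?thesis .
qed

text \<open>Long blocks: for T h \<ge> 1 the increment bound with H = h gives eighth moments of
  order h^4 for both coordinates, and the wedge is a difference of two products of increments. The
  constant 32 is 4 from the algebraic inequality, times 4 summands, times 2 from the increment
  bound.\<close>

lemma wedge_pow4_upper_long:
  assumes T: "0 < T" "T \<le> real N" and s: "s = sqrt (T / real N)" and h: "h = real l / real N" "1 \<le> T * h"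
    and rtu: "r < l" "t < l" "u < l"
  shows "(sqrt T / real N) ^ 8 * (\<integral>x. (wedge r t u x) ^ 4 \<partial>walk s l) \<le> 32 * fact 8 * exp 24 * h ^ 4"
proof -
  define a where "a = sqrt T / real N"
  have N: "0 < real N" using T by linarith
  have s0: "0 < s" using T N by (simp add: s)
  have h0: "0 \<le> h" by (simp add: h)
  have a0: "0 < a" using T N by (simp add: a_def)
  have H: "1 / T \<le> h" using h T by (simp add: field_simps)
  have mom: "(\<integral>x. (a * (xpath j x - xpath i x)) ^ 8 \<partial>walk s l) \<le> 2 * fact 8 * exp 24 * h ^ 4"
    "(\<integral>x. (a * (ypath j x - ypath i x)) ^ 8 \<partial>walk s l) \<le> 2 * fact 8 * exp 24 * h ^ 4"
    if ij: "i < l" "j < l" for i j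
  proof -
    have d: "f b - f a = (\<Sum>i\<in>{a..<b}. g i)" if "a \<le> b" "\<And>k. f k = (\<Sum>i<k. g i)" for f g :: "nat \<Rightarrow> real" and a b
      using sum_diff_nat_ivl[of 0 a b g] that by (simp add: atLeast0LessThan)
    have *: "(\<integral>x. (a * (xpath j x - xpath i x)) ^ 8 \<partial>walk s l) \<le> 2 * fact 8 * exp 24 * h ^ 4 \<and>
      (\<integral>x. (a * (ypath j x - ypath i x)) ^ 8 \<partial>walk s l) \<le> 2 * fact 8 * exp 24 * h ^ 4" if ij: "i \<le> j" "j < l" for i j
    proof -
      have hh: "(real j - real i) / real N \<le> h" unfolding h using ij by (intro divide_right_mono) auto
      have sq: "(sqrt h) ^ 8 = h ^ 4"
      proof -
        have "(sqrt h) ^ 8 = ((sqrt h)\<^sup>2) ^ 4" by (simp flip: power_mult)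
        then show ?thesis using h0 by simp
      qed
      have x: "(a * (xpath j x - xpath i x)) ^ 8 = \<bar>sqrt T / real N * Re ((- \<i>) * (\<Sum>k\<in>{i..<j}. cis (phase k x)))\<bar> ^ 8" for x
      proof -
        have "xpath j x - xpath i x = (\<Sum>k\<in>{i..<j}. sin (phase k x))"
          by (rule d) (use ij in \<open>auto simp: xpath_def\<close>)
        also have "\<dots> = Re ((- \<i>) * (\<Sum>k\<in>{i..<j}. cis (phase k x)))" by (simp add: times_complex.sel Im_sum)
        finally show ?thesis unfolding a_def by (simp only: power_even_abs[OF even_numeral])
      qed
      have y: "(a * (ypath j x - ypath i x)) ^ 8 = \<bar>sqrt T / real N * Re (1 * (\<Sum>k\<in>{i..<j}. cis (phase k x)))\<bar> ^ 8" for x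
      proof -
        have "- ypath j x - - ypath i x = (\<Sum>k\<in>{i..<j}. cos (phase k x))"
          by (rule d[of i j "\<lambda>k. - ypath k x"]) (use ij in \<open>auto simp: ypath_def\<close>)
        also have "\<dots> = Re (1 * (\<Sum>k\<in>{i..<j}. cis (phase k x)))" by (simp add: Re_sum)
        finally have e: "ypath j x - ypath i x = - Re (1 * (\<Sum>k\<in>{i..<j}. cis (phase k x)))" by linarith
        show ?thesis unfolding a_def e mult_minus_right
          by (simp only: uminus_power_if even_numeral if_True power_even_abs[OF even_numeral])
      qed
      show ?thesis unfolding x y
        using walk_increment_moment[OF T s _ ij(1) less_imp_le[OF ij(2)] hh H, of "- \<i>" 8]
          walk_increment_moment[OF T s _ ij(1) less_imp_le[OF ij(2)] hh H, of 1 8] unfolding sq by simp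
    qed
    have sw: "(a * (xpath j x - xpath i x)) ^ 8 = (a * (xpath i x - xpath j x)) ^ 8"
       "(a * (ypath j x - ypath i x)) ^ 8 = (a * (ypath i x - ypath j x)) ^ 8" for x
      unfolding power_mult_distrib by (metis abs_minus_commute even_numeral power_even_abs)+
    show "(\<integral>x. (a * (xpath j x - xpath i x)) ^ 8 \<partial>walk s l) \<le> 2 * fact 8 * exp 24 * h ^ 4"
      "(\<integral>x. (a * (ypath j x - ypath i x)) ^ 8 \<partial>walk s l) \<le> 2 * fact 8 * exp 24 * h ^ 4"
      using *[of i j] *[of j i] ij unfolding sw[of _] by (cases "i \<le> j"; simp add: sw)+
  qed
  have int: "integrable (walk s l) (\<lambda>x. (a * (xpath j x - xpath i x)) ^ 8)" "integrable (walk s l) (\<lambda>x. (a * (ypath j x - ypath i x)) ^ 8)"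
    if "i < l" "j < l" for i j
  proof -
    have b: "\<bar>a * (xpath j x - xpath i x)\<bar> \<le> a * (2 * real l)" "\<bar>a * (ypath j x - ypath i x)\<bar> \<le> a * (2 * real l)" for x
      using path_bound[of i x] path_bound[of j x] that a0 unfolding abs_mult by (auto simp: abs_le_iff intro!: mult_left_mono)
    show "integrable (walk s l) (\<lambda>x. (a * (xpath j x - xpath i x)) ^ 8)" "integrable (walk s l) (\<lambda>x. (a * (ypath j x - ypath i x)) ^ 8)"
      by (rule integrable_walk_bounded[OF s0, where B="(a * (2 * real l)) ^ 8"];
          use that power_mono[OF b(1) abs_ge_zero, where n=8] power_mono[OF b(2) abs_ge_zero, where n=8] in \<open>auto simp: power_abs\<close>)+
  qed
  have alg: "(p * q - p' * q') ^ 4 \<le> 4 * (p ^ 8 + q ^ 8 + p' ^ 8 + q' ^ 8)" for p q p' q' :: real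
  proof -
    have sq: "(A - B)\<^sup>2 \<le> 2 * (A\<^sup>2 + B\<^sup>2)" "A * B \<le> (A\<^sup>2 + B\<^sup>2) / 2" for A B :: real
      using zero_le_power2[of "A + B"] zero_le_power2[of "A - B"] by (simp_all add: power2_sum power2_diff)
    have s2: "(A + B)\<^sup>2 \<le> 2 * (A\<^sup>2 + B\<^sup>2)" for A B :: real using zero_le_power2[of "A - B"] by (simp add: power2_sum power2_diff)
    have "(p * q - p' * q') ^ 4 = ((p * q - p' * q')\<^sup>2)\<^sup>2" by simp
    also have "\<dots> \<le> (2 * ((p * q)\<^sup>2 + (p' * q')\<^sup>2))\<^sup>2" by (intro power_mono sq(1)) auto
    also have "\<dots> = 4 * ((p * q)\<^sup>2 + (p' * q')\<^sup>2)\<^sup>2" by (subst power_mult_distrib) simp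
    also have "\<dots> \<le> 4 * (2 * (((p * q)\<^sup>2)\<^sup>2 + ((p' * q')\<^sup>2)\<^sup>2))" by (intro mult_left_mono s2) auto
    also have "\<dots> = 8 * (p ^ 4 * q ^ 4 + p' ^ 4 * q' ^ 4)" by (simp add: power_mult_distrib)
    also have "\<dots> \<le> 8 * (((p ^ 4)\<^sup>2 + (q ^ 4)\<^sup>2) / 2 + ((p' ^ 4)\<^sup>2 + (q' ^ 4)\<^sup>2) / 2)" by (intro mult_left_mono add_mono sq(2)) auto
    finally show ?thesis by (simp add: add_divide_distrib)
  qed
  have "(sqrt T / real N) ^ 8 * (\<integral>x. (wedge r t u x) ^ 4 \<partial>walk s l) = (\<integral>x. a ^ 8 * (wedge r t u x) ^ 4 \<partial>walk s l)"
    by (simp add: a_def)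
  also have "\<dots> \<le> (\<integral>x. 4 * ((a * (xpath t x - xpath r x)) ^ 8 + (a * (ypath u x - ypath r x)) ^ 8
     + (a * (xpath u x - xpath r x)) ^ 8 + (a * (ypath t x - ypath r x)) ^ 8) \<partial>walk s l)"
  proof (rule integral_mono)
    show "integrable (walk s l) (\<lambda>x. a ^ 8 * (wedge r t u x) ^ 4)"
      using wedge_integrable[OF s0, of r l t u 4] rtu by simp
    show "integrable (walk s l) (\<lambda>x. 4 * ((a * (xpath t x - xpath r x)) ^ 8 + (a * (ypath u x - ypath r x)) ^ 8
     + (a * (xpath u x - xpath r x)) ^ 8 + (a * (ypath t x - ypath r x)) ^ 8))"
      using rtu by (intro integrable_mult_right Bochner_Integration.integrable_add int)
    fix x
    have "a ^ 8 * (wedge r t u x) ^ 4 = (a * (xpath t x - xpath r x) * (a * (ypath u x - ypath r x)) - a * (xpath u x - xpath r x) * (a * (ypath t x - ypath r x))) ^ 4"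
    proof -
      have "a * A * (a * B) - a * C * (a * E) = a\<^sup>2 * (A * B - C * E)" for A B C E by (simp add: power2_eq_square algebra_simps)
      then show ?thesis by (simp add: wedge_def power_mult_distrib flip: power_mult)
    qed
    also have "\<dots> \<le> 4 * ((a * (xpath t x - xpath r x)) ^ 8 + (a * (ypath u x - ypath r x)) ^ 8
     + (a * (xpath u x - xpath r x)) ^ 8 + (a * (ypath t x - ypath r x)) ^ 8)" by (rule alg)
    finally show "a ^ 8 * (wedge r t u x) ^ 4 \<le> 4 * ((a * (xpath t x - xpath r x)) ^ 8 + (a * (ypath u x - ypath r x)) ^ 8
     + (a * (xpath u x - xpath r x)) ^ 8 + (a * (ypath t x - ypath r x)) ^ 8)" .
  qed
  also have "\<dots> = 4 * ((\<integral>x. (a * (xpath t x - xpath r x)) ^ 8 \<partial>walk s l) + (\<integral>x. (a * (ypath u x - ypath r x)) ^ 8 \<partial>walk s l)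
     + (\<integral>x. (a * (xpath u x - xpath r x)) ^ 8 \<partial>walk s l) + (\<integral>x. (a * (ypath t x - ypath r x)) ^ 8 \<partial>walk s l))"
    using int rtu by (subst integral_mult_right_zero) (simp only: Bochner_Integration.integral_add Bochner_Integration.integrable_add)
  also have "\<dots> \<le> 4 * (2 * fact 8 * exp 24 * h ^ 4 + 2 * fact 8 * exp 24 * h ^ 4 + 2 * fact 8 * exp 24 * h ^ 4 + 2 * fact 8 * exp 24 * h ^ 4)"
    using rtu by (intro mult_left_mono add_mono mom) auto
  finally show ?thesis by (simp add: mult_ac)
qed

text \<open>Short blocks: the sines are bounded by the phase differences themselves, whose fourth
  moments are of order (s^2 l)^2. In the normalisation of the Gram matrix this is of order h^4 (T
  h)^6, which improves on the diffusive order h^4 when T h < 1.\<close>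

lemma wedge_pow4_upper_short:
  assumes s: "0 < s" and rtu: "r < l" "t < l" "u < l"
  shows "(\<integral>x. (wedge r t u x) ^ 4 \<partial>walk s l) \<le> real l ^ 8 * (48 * exp 1 * (s\<^sup>2 * real l)\<^sup>2)"
proof -
  have l: "0 < l" using rtu by simp
  \<comment> \<open>Coefficients in {-1, 0, 1} that express an increment between a and b, in either
    order, as a sum over the whole block.\<close>
  define c where "c = (\<lambda>a b i :: nat. of_bool (i < b) - of_bool (i < a) :: real)"
  have cb: "\<bar>c a b i\<bar> \<le> 1" for a b i by (auto simp: c_def)
  have full: "(\<Sum>i<k. f i) = (\<Sum>i<l. of_bool (i < k) * f i)" if "k \<le> l" for k and f :: "nat \<Rightarrow> real"
    by (rule sum.mono_neutral_cong_left) (use that in auto)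
  have xd: "xpath b x - xpath a x = (\<Sum>i<l. c a b i * sin (phase i x))" if "a \<le> l" "b \<le> l" for a b x
    unfolding xpath_def full[OF that(1)] full[OF that(2)] by (simp only: c_def left_diff_distrib sum_subtractf)
  have yd: "ypath b x - ypath a x = - (\<Sum>i<l. c a b i * cos (phase i x))" if "a \<le> l" "b \<le> l" for a b x
    unfolding ypath_def full[OF that(1)] full[OF that(2)] by (simp only: c_def left_diff_distrib sum_subtractf)
  have le: "\<bar>wedge r t u x\<bar> \<le> (\<Sum>i<l. \<Sum>j<l. \<bar>phase j x - phase i x\<bar>)" for x
  proof -
    have eq: "wedge r t u x = (\<Sum>i<l. \<Sum>j<l. c r t i * c r u j * sin (phase j x - phase i x))"
    proof -
      have "wedge r t u x = (\<Sum>j<l. c r u j * sin (phase j x)) * (\<Sum>i<l. c r t i * cos (phase i x)) - (\<Sum>i<l. c r t i * sin (phase i x)) * (\<Sum>j<l. c r u j * cos (phase j x))"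
        unfolding wedge_def using rtu by (simp add: xd yd)
      also have "\<dots> = (\<Sum>i<l. \<Sum>j<l. c r t i * c r u j * (sin (phase j x) * cos (phase i x))) - (\<Sum>i<l. \<Sum>j<l. c r t i * c r u j * (cos (phase j x) * sin (phase i x)))"
        unfolding sum_product by (subst sum.swap) (simp only: mult_ac)
      finally show ?thesis by (simp add: sin_diff right_diff_distrib sum_subtractf)
    qed
    have "\<bar>\<Sum>i<l. \<Sum>j<l. c r t i * c r u j * sin (phase j x - phase i x)\<bar> \<le> (\<Sum>i<l. \<Sum>j<l. \<bar>c r t i * c r u j * sin (phase j x - phase i x)\<bar>)"
      by (rule order_trans[OF sum_abs sum_mono], rule sum_abs)
    also have "\<dots> \<le> (\<Sum>i<l. \<Sum>j<l. \<bar>phase j x - phase i x\<bar>)"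
    proof (intro sum_mono)
      fix i j
      have "\<bar>c r t i * c r u j * sin (phase j x - phase i x)\<bar> \<le> 1 * 1 * \<bar>phase j x - phase i x\<bar>"
        unfolding abs_mult by (intro mult_mono cb abs_sin_x_le_abs_x) auto
      then show "\<bar>c r t i * c r u j * sin (phase j x - phase i x)\<bar> \<le> \<bar>phase j x - phase i x\<bar>" by simp
    qed
    finally show ?thesis unfolding eq .
  qed
  have cs: "(\<Sum>i<l. g i)\<^sup>2 \<le> real l * (\<Sum>i<l. (g i)\<^sup>2)" for g :: "nat \<Rightarrow> real"
    using sum_squared_le_sum_of_squares[of g "{..<l}"] by (simp add: mult.commute)
  have cs4: "(\<Sum>i<l. g i) ^ 4 \<le> real l ^ 3 * (\<Sum>i<l. (g i) ^ 4)" for g :: "nat \<Rightarrow> real"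
  proof -
    have "(\<Sum>i<l. g i) ^ 4 = ((\<Sum>i<l. g i)\<^sup>2)\<^sup>2" by simp
    also have "\<dots> \<le> (real l * (\<Sum>i<l. (g i)\<^sup>2))\<^sup>2" by (intro power_mono cs) auto
    also have "\<dots> = (real l)\<^sup>2 * (\<Sum>i<l. (g i)\<^sup>2)\<^sup>2" by (simp add: power_mult_distrib)
    also have "\<dots> \<le> (real l)\<^sup>2 * (real l * (\<Sum>i<l. ((g i)\<^sup>2)\<^sup>2))" by (intro mult_left_mono cs) auto
    finally show ?thesis by (simp add: eval_nat_numeral mult_ac)
  qed
  have pt: "(wedge r t u x) ^ 4 \<le> real l ^ 6 * (\<Sum>i<l. \<Sum>j<l. (phase j x - phase i x) ^ 4)" for x
  proof -
    have "(wedge r t u x) ^ 4 = \<bar>wedge r t u x\<bar> ^ 4" by (simp add: power_even_abs)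
    also have "\<dots> \<le> (\<Sum>i<l. \<Sum>j<l. \<bar>phase j x - phase i x\<bar>) ^ 4" by (intro power_mono le) auto
    also have "\<dots> \<le> real l ^ 3 * (\<Sum>i<l. (\<Sum>j<l. \<bar>phase j x - phase i x\<bar>) ^ 4)" by (rule cs4)
    also have "\<dots> \<le> real l ^ 3 * (\<Sum>i<l. real l ^ 3 * (\<Sum>j<l. \<bar>phase j x - phase i x\<bar> ^ 4))"
      by (intro mult_left_mono sum_mono cs4) auto
    also have "\<dots> = real l ^ 6 * (\<Sum>i<l. \<Sum>j<l. (phase j x - phase i x) ^ 4)"
      by (simp add: sum_distrib_left power_even_abs mult.assoc[symmetric] flip: power_add)
    finally show ?thesis .
  qed
  show ?thesis
  proof (rule integral_real_bounded)
    have mm: "(\<lambda>x. ennreal ((phase j x - phase i x) ^ 4)) \<in> borel_measurable (walk s l)" if "i < l" "j < l" for i j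
    proof -
      have [measurable]: "phase i \<in> borel_measurable (walk s l)" "phase j \<in> borel_measurable (walk s l)"
        using that by (auto intro!: phase_measurable)
      show ?thesis by measurable
    qed
    have "(\<integral>\<^sup>+x. ennreal ((wedge r t u x) ^ 4) \<partial>walk s l) \<le> (\<integral>\<^sup>+x. ennreal (real l ^ 6) * (\<Sum>i<l. \<Sum>j<l. ennreal ((phase j x - phase i x) ^ 4)) \<partial>walk s l)"
      using pt by (intro nn_integral_mono) (simp add: sum_ennreal sum_nonneg ennreal_mult[symmetric] ennreal_leI)
    also have "\<dots> = ennreal (real l ^ 6) * (\<integral>\<^sup>+x. (\<Sum>i<l. \<Sum>j<l. ennreal ((phase j x - phase i x) ^ 4)) \<partial>walk s l)"
      by (rule nn_integral_cmult) (intro borel_measurable_sum mm; simp)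
    also have "(\<integral>\<^sup>+x. (\<Sum>i<l. \<Sum>j<l. ennreal ((phase j x - phase i x) ^ 4)) \<partial>walk s l)
      = (\<Sum>i<l. \<Sum>j<l. \<integral>\<^sup>+x. ennreal ((phase j x - phase i x) ^ 4) \<partial>walk s l)"
    proof -
      have "(\<integral>\<^sup>+x. (\<Sum>i<l. \<Sum>j<l. ennreal ((phase j x - phase i x) ^ 4)) \<partial>walk s l)
        = (\<Sum>i<l. \<integral>\<^sup>+x. (\<Sum>j<l. ennreal ((phase j x - phase i x) ^ 4)) \<partial>walk s l)"
        by (rule nn_integral_sum, rule borel_measurable_sum, rule mm) auto
      also have "\<dots> = (\<Sum>i<l. \<Sum>j<l. \<integral>\<^sup>+x. ennreal ((phase j x - phase i x) ^ 4) \<partial>walk s l)"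
        by (rule sum.cong[OF refl], rule nn_integral_sum, rule mm) auto
      finally show ?thesis .
    qed
    also have "ennreal (real l ^ 6) * (\<Sum>i<l. \<Sum>j<l. \<integral>\<^sup>+x. ennreal ((phase j x - phase i x) ^ 4) \<partial>walk s l)
      \<le> ennreal (real l ^ 6) * (\<Sum>i<l. \<Sum>j<l. ennreal (48 * exp 1 * (s\<^sup>2 * real l)\<^sup>2))"
      using l by (intro mult_left_mono sum_mono walk_phase_diff_pow4 s) auto
    also have "\<dots> = ennreal (real l ^ 6 * (real l * (real l * (48 * exp 1 * (s\<^sup>2 * real l)\<^sup>2))))"
      by (simp add: ennreal_mult ennreal_of_nat_eq_real_of_nat)
    also have "real l ^ 6 * (real l * (real l * (48 * exp 1 * (s\<^sup>2 * real l)\<^sup>2))) = real l ^ 8 * (48 * exp 1 * (s\<^sup>2 * real l)\<^sup>2)"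
      by (simp add: eval_nat_numeral mult.assoc)
    finally show "(\<integral>\<^sup>+x. ennreal ((wedge r t u x) ^ 4) \<partial>walk s l) \<le> ennreal (real l ^ 8 * (48 * exp 1 * (s\<^sup>2 * real l)\<^sup>2))" .
  qed simp
qed

text \<open>The constants of the Paley--Zygmund bound: \<open>block_c\<close> comes from the mean and \<open>block_K\<close> from the
  second moment of a block.\<close>

definition block_c :: real where "block_c = 2 / (7 ^ 5 * 28 ^ 3)"
definition block_K :: real where "block_K = 32 * fact 8 * exp 24 + 48 * exp 1"
definition block_p :: real where "block_p = block_c\<^sup>2 / (4 * block_K)"

lemma block_const_pos: "0 < block_c" "0 < block_K" "0 < block_p"
  by (auto simp: block_c_def block_K_def block_p_def add_pos_pos)

text \<open>With V = l^3 h^2 \<tau>^3 the mean of the normalised block sum is at least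
  \<open>block_c\<close> V and its second moment at most \<open>block_K\<close> V^2, for long and
  short blocks alike. Paley--Zygmund then gives a probability that depends on none of T, N and
  m.\<close>

lemma block_small_prob:
  assumes T: "0 < T" "T \<le> real N" and s: "s = sqrt (T / real N)" and m: "0 < m" and l: "l = 7 * m"
    and h: "h = real l / real N" and \<tau>: "\<tau> = min 1 (T * h)"
  shows "measure (walk s l) {x \<in> space (walk s l). (sqrt T / real N) ^ 4 * block_sum l x < block_c / 2 * (real l ^ 3 * h\<^sup>2 * \<tau> ^ 3)} \<le> 1 - block_p"
proof -
  have N: "0 < real N" using T by linarith
  have s0: "0 < s" using T N by (simp add: s)
  have s2: "s\<^sup>2 = T / real N" using T N by (simp add: s)
  have l0: "0 < real l" using m l by simp
  have h0: "0 < h" using l0 N by (simp add: h)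
  have \<tau>0: "0 < \<tau>" "\<tau> \<le> 1" "\<tau> \<le> T * h" using T h0 by (auto simp: \<tau>)
  interpret prob_space "walk s l" using s0 by (rule prob_space_walk)
  define a where "a = sqrt T / real N"
  have a4: "a ^ 4 = T\<^sup>2 / real N ^ 4" using T by (simp add: a_def power_divide power4_eq_xxxx power2_eq_square)
  let ?m = "block_c * (real l ^ 3 * h\<^sup>2 * \<tau> ^ 3)"
  let ?q = "block_K * (real l ^ 3 * h\<^sup>2 * \<tau> ^ 3)\<^sup>2"
  \<comment> \<open>Since m = l / 7, the exponent s^2 m / 2 equals T h / 14, and 1 - exp (- x) \<ge>
    x / 2 on [0, 1] doubles the denominator. Beyond T h = 14 the bound \<tau> \<le> 1 is
    enough.\<close>
  have g: "\<tau> / 28 \<le> 1 - exp (- s\<^sup>2 * real m / 2)"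
  proof -
    have e: "- s\<^sup>2 * real m / 2 = - (T * h / 14)" by (simp add: s2 h l)
    show ?thesis
    proof (cases "T * h \<le> 14")
      case True
      then show ?thesis unfolding e using one_minus_exp_ge[of "T * h / 14"] T h0 \<tau>0 by simp
    next
      case False
      then have "exp (- (T * h / 14)) \<le> exp (- 1)" by simp
      moreover have "1 / 2 \<le> 1 - exp (- 1 :: real)" using one_minus_exp_ge[of 1] by simp
      ultimately show ?thesis unfolding e using \<tau>0 by linarith
    qed
  qed
  have mean: "?m \<le> expectation (\<lambda>x. a ^ 4 * block_sum l x)"
  proof -
    \<comment> \<open>In \<open>block_c\<close> the factor 7^5 comes from m = l / 7 and 28^3 from
      the cube of the preceding estimate.\<close>
    have "?m = a ^ 4 * (2 * real m ^ 5 / (s\<^sup>2)\<^sup>2 * (\<tau> / 28) ^ 3)"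
      unfolding a4 s2 h block_c_def l using T N by (simp add: power_divide power_mult_distrib eval_nat_numeral)
    also have "\<dots> \<le> a ^ 4 * (2 * real m ^ 5 / (s\<^sup>2)\<^sup>2 * (1 - exp (- s\<^sup>2 * real m / 2)) ^ 3)"
      using g \<tau>0 by (intro mult_left_mono power_mono) auto
    also have "\<dots> \<le> a ^ 4 * expectation (block_sum l)"
      by (intro mult_left_mono block_sum_mean_lower s0 m l) auto
    finally show ?thesis by simp
  qed
  have sq: "expectation (\<lambda>x. (a ^ 4 * block_sum l x)\<^sup>2) \<le> ?q"
  proof -
    have e: "expectation (\<lambda>x. (a ^ 4 * block_sum l x)\<^sup>2) = a ^ 8 * expectation (\<lambda>x. (block_sum l x)\<^sup>2)"
      by (simp add: power_mult_distrib flip: power_mult)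
    have a8: "0 \<le> a ^ 8" by simp
    have w: "a ^ 8 * (\<integral>x. (wedge r t u x) ^ 4 \<partial>walk s l) \<le> block_K * (h ^ 4 * \<tau> ^ 6)" if rtu: "r < l" "t < l" "u < l" for r t u
    proof (cases "1 \<le> T * h")
      case True
      then have "\<tau> = 1" by (simp add: \<tau> min_def)
      have "a ^ 8 * (\<integral>x. (wedge r t u x) ^ 4 \<partial>walk s l) \<le> 32 * fact 8 * exp 24 * h ^ 4"
        unfolding a_def by (rule wedge_pow4_upper_long[OF T s h True rtu])
      also have "\<dots> \<le> block_K * h ^ 4" unfolding block_K_def using h0 by (intro mult_right_mono) auto
      finally show ?thesis using \<open>\<tau> = 1\<close> by simp
    next
      case False
      then have \<tau>e: "\<tau> = T * h" by (simp add: \<tau>)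
      have "a ^ 8 * (\<integral>x. (wedge r t u x) ^ 4 \<partial>walk s l) \<le> a ^ 8 * (real l ^ 8 * (48 * exp 1 * (s\<^sup>2 * real l)\<^sup>2))"
        by (intro mult_left_mono wedge_pow4_upper_short s0 rtu a8)
      also have "a ^ 8 * (real l ^ 8 * (48 * exp 1 * (s\<^sup>2 * real l)\<^sup>2)) = (a ^ 4)\<^sup>2 * (real l ^ 8 * (48 * exp 1 * (s\<^sup>2 * real l)\<^sup>2))" by (simp flip: power_mult)
      also have "(a ^ 4)\<^sup>2 * (real l ^ 8 * (48 * exp 1 * (s\<^sup>2 * real l)\<^sup>2)) = 48 * exp 1 * (h ^ 4 * \<tau> ^ 6)"
        unfolding a4 s2 \<tau>e h using N by (simp add: power_divide power_mult_distrib eval_nat_numeral mult_ac)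
      also have "\<dots> \<le> block_K * (h ^ 4 * \<tau> ^ 6)" unfolding block_K_def using h0 \<tau>0 by (intro mult_right_mono) auto
      finally show ?thesis .
    qed
    have a8': "0 < a ^ 8" using T N by (simp add: a_def)
    have "expectation (\<lambda>x. (block_sum l x)\<^sup>2) \<le> real l ^ 6 * (block_K * (h ^ 4 * \<tau> ^ 6) / a ^ 8)"
      by (rule block_sum_sq_upper[OF s0]) (use w a8' in \<open>simp add: pos_le_divide_eq mult.commute\<close>)
    then have "a ^ 8 * expectation (\<lambda>x. (block_sum l x)\<^sup>2) \<le> a ^ 8 * (real l ^ 6 * (block_K * (h ^ 4 * \<tau> ^ 6) / a ^ 8))"
      by (intro mult_left_mono) auto
    also have "\<dots> = ?q" using a8' by (simp add: power_mult_distrib flip: power_mult)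
    finally show ?thesis unfolding e .
  qed
  have "prob {x \<in> space (walk s l). a ^ 4 * block_sum l x < ?m / 2} \<le> 1 - ?m\<^sup>2 / (4 * ?q)"
  proof (rule paley_zygmund[OF _ _ _ _ mean sq])
    show "integrable (walk s l) (\<lambda>x. a ^ 4 * block_sum l x)" using block_sum_integrable[OF s0] by simp
    show "integrable (walk s l) (\<lambda>x. (a ^ 4 * block_sum l x)\<^sup>2)" using block_sum_integrable[OF s0] by (simp add: power_mult_distrib)
    show "0 \<le> a ^ 4 * block_sum l x" for x using block_sum_nonneg by simp
    show "0 < ?m" using block_const_pos l0 h0 \<tau>0 by simp
  qed
  also have "1 - ?m\<^sup>2 / (4 * ?q) = 1 - block_p"
    unfolding block_p_def using block_const_pos l0 h0 \<tau>0 by (simp add: power_mult_distrib)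
  finally show ?thesis by (simp add: a_def)
qed

section \<open>The determinant of the Gram matrix\<close>

text \<open>The discrete counterpart of \<open>C_tilde\<close> and \<open>G_limit\<close>, with the
  integral over r replaced by an average over N grid points.\<close>

definition gram :: "nat \<Rightarrow> (nat \<Rightarrow> real) \<Rightarrow> (nat \<Rightarrow> real) \<Rightarrow> real ^ 3 ^ 3" where
  "gram N X Y = (1 / real N) *\<^sub>R (\<Sum>k<N. outer_square (vector [1, X k, Y k]))"

lemma gram_entries:
  "gram N X Y $ 1 $ 1 = real N / real N"
  "gram N X Y $ 1 $ 2 = (\<Sum>k<N. X k) / real N" "gram N X Y $ 2 $ 1 = (\<Sum>k<N. X k) / real N"
  "gram N X Y $ 1 $ 3 = (\<Sum>k<N. Y k) / real N" "gram N X Y $ 3 $ 1 = (\<Sum>k<N. Y k) / real N"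
  "gram N X Y $ 2 $ 2 = (\<Sum>k<N. (X k)\<^sup>2) / real N"
  "gram N X Y $ 2 $ 3 = (\<Sum>k<N. X k * Y k) / real N" "gram N X Y $ 3 $ 2 = (\<Sum>k<N. X k * Y k) / real N"
  "gram N X Y $ 3 $ 3 = (\<Sum>k<N. (Y k)\<^sup>2) / real N"
  by (simp_all add: gram_def outer_square_def power2_eq_square mult.commute)

text \<open>Cauchy--Binet for the Gram matrix of \<open>1, X, Y\<close>.\<close>

lemma det_gram:
  assumes N: "0 < N"
  shows "6 * real N ^ 3 * det (gram N X Y) =
    (\<Sum>r<N. \<Sum>t<N. \<Sum>u<N. ((X t - X r) * (Y u - Y r) - (X u - X r) * (Y t - Y r))\<^sup>2)"
proof -
  define n where "n = real N"
  define sx where "sx = (\<Sum>k<N. X k)"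
  define sy where "sy = (\<Sum>k<N. Y k)"
  define sxx where "sxx = (\<Sum>k<N. X k * X k)"
  define sxy where "sxy = (\<Sum>k<N. X k * Y k)"
  define syy where "syy = (\<Sum>k<N. Y k * Y k)"
  have n0: "n \<noteq> 0" using N by (simp add: n_def)
  \<comment> \<open>The sums over u, t and r are carried out in this order. Each summand is a
    quadratic polynomial in the current point, so only first and second moments of X and Y
    occur.\<close>
  have quad: "(\<Sum>u<N. (a + b * X u + c * Y u)\<^sup>2) = a\<^sup>2 * n + b\<^sup>2 * sxx + c\<^sup>2 * syy + 2 * a * b * sx + 2 * a * c * sy + 2 * b * c * sxy" for a b c
  proof -
    have "(a + b * X u + c * Y u)\<^sup>2 = a\<^sup>2 + b\<^sup>2 * (X u * X u) + c\<^sup>2 * (Y u * Y u) + (2 * a * b) * X u + (2 * a * c) * Y u + (2 * b * c) * (X u * Y u)" for u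
      by (simp add: power2_eq_square algebra_simps)
    then show ?thesis
      by (simp add: sum.distrib n_def sx_def sy_def sxx_def sxy_def syy_def flip: sum_distrib_left)
  qed
  have bil: "(\<Sum>t<N. a + b * X t + c * Y t + d * (X t * X t) + e * (Y t * Y t) + f * (X t * Y t)) = a * n + b * sx + c * sy + d * sxx + e * syy + f * sxy" for a b c d e f
    by (simp add: sum.distrib n_def sx_def sy_def sxx_def sxy_def syy_def flip: sum_distrib_left)
  have inner: "(\<Sum>u<N. ((X t - X r) * (Y u - Y r) - (X u - X r) * (Y t - Y r))\<^sup>2) =
      (X r * Y t - X t * Y r)\<^sup>2 * n + (Y r - Y t)\<^sup>2 * sxx + (X t - X r)\<^sup>2 * syy + 2 * (X r * Y t - X t * Y r) * (Y r - Y t) * sx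
      + 2 * (X r * Y t - X t * Y r) * (X t - X r) * sy + 2 * (Y r - Y t) * (X t - X r) * sxy" for r t
  proof -
    have "(X t - X r) * (Y u - Y r) - (X u - X r) * (Y t - Y r) = (X r * Y t - X t * Y r) + (Y r - Y t) * X u + (X t - X r) * Y u" for u
      by (simp add: algebra_simps)
    then show ?thesis by (simp only: quad)
  qed
  have mid: "(\<Sum>t<N. \<Sum>u<N. ((X t - X r) * (Y u - Y r) - (X u - X r) * (Y t - Y r))\<^sup>2) =
     2 * (syy * sxx - sxy * sxy + n * 0) * 1 - 2 * (syy * sxx - sxy * sxy)
     + (n * (X r)\<^sup>2 * syy - 2 * n * (X r * Y r) * sxy + n * (Y r)\<^sup>2 * sxx
       + (n * (Y r)\<^sup>2 - 2 * Y r * sy + syy) * sxx + (sxx - 2 * X r * sx + n * (X r)\<^sup>2) * syy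
       + 2 * sx * (X r * (Y r * sy) - X r * syy - (Y r)\<^sup>2 * sx + Y r * sxy)
       + 2 * sy * (X r * sxy - (X r)\<^sup>2 * sy - Y r * sxx + X r * Y r * sx)
       + 2 * sxy * (Y r * sx - n * (X r * Y r) - sxy + X r * sy))" for r
  proof -
    have "(X r * Y t - X t * Y r)\<^sup>2 * n + (Y r - Y t)\<^sup>2 * sxx + (X t - X r)\<^sup>2 * syy + 2 * (X r * Y t - X t * Y r) * (Y r - Y t) * sx
      + 2 * (X r * Y t - X t * Y r) * (X t - X r) * sy + 2 * (Y r - Y t) * (X t - X r) * sxy
      = ((Y r)\<^sup>2 * sxx + (X r)\<^sup>2 * syy - 2 * (X r * Y r) * sxy)
        + (2 * Y r * sxy - 2 * X r * syy - 2 * (Y r)\<^sup>2 * sx + 2 * (X r * Y r) * sy) * X t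
        + (2 * (X r * Y r) * sx - 2 * Y r * sxx - 2 * (X r)\<^sup>2 * sy + 2 * X r * sxy) * Y t
        + ((Y r)\<^sup>2 * n + syy - 2 * Y r * sy) * (X t * X t)
        + ((X r)\<^sup>2 * n + sxx - 2 * X r * sx) * (Y t * Y t)
        + (2 * Y r * sx + 2 * X r * sy - 2 * (X r * Y r) * n - 2 * sxy) * (X t * Y t)" for t
      by (simp add: power2_eq_square algebra_simps)
    then show ?thesis unfolding inner by (simp only: bil) (simp add: power2_eq_square algebra_simps)
  qed
  have outer: "(\<Sum>r<N. \<Sum>t<N. \<Sum>u<N. ((X t - X r) * (Y u - Y r) - (X u - X r) * (Y t - Y r))\<^sup>2)
    = 6 * (n * (sxx * syy - sxy * sxy) - sx * (sx * syy - sxy * sy) + sy * (sx * sxy - sxx * sy))"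
  proof -
    have "2 * (syy * sxx - sxy * sxy + n * 0) * 1 - 2 * (syy * sxx - sxy * sxy)
     + (n * (X r)\<^sup>2 * syy - 2 * n * (X r * Y r) * sxy + n * (Y r)\<^sup>2 * sxx
       + (n * (Y r)\<^sup>2 - 2 * Y r * sy + syy) * sxx + (sxx - 2 * X r * sx + n * (X r)\<^sup>2) * syy
       + 2 * sx * (X r * (Y r * sy) - X r * syy - (Y r)\<^sup>2 * sx + Y r * sxy)
       + 2 * sy * (X r * sxy - (X r)\<^sup>2 * sy - Y r * sxx + X r * Y r * sx)
       + 2 * sxy * (Y r * sx - n * (X r * Y r) - sxy + X r * sy))
      = 2 * (sxx * syy - sxy * sxy) + (4 * sy * sxy - 4 * sx * syy) * X r + (4 * sx * sxy - 4 * sy * sxx) * Y r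
        + (2 * n * syy - 2 * sy * sy) * (X r * X r) + (2 * n * sxx - 2 * sx * sx) * (Y r * Y r) + (4 * sx * sy - 4 * n * sxy) * (X r * Y r)" for r
      by (simp add: power2_eq_square algebra_simps)
    then show ?thesis unfolding mid by (simp only: bil) (simp add: algebra_simps)
  qed
  have "det (gram N X Y) = (n * (sxx * syy - sxy * sxy) - sx * (sx * syy - sxy * sy) + sy * (sx * sxy - sxx * sy)) / n ^ 3"
    unfolding det_3 gram_entries power2_eq_square
    unfolding n_def[symmetric] sx_def[symmetric] sy_def[symmetric] sxx_def[symmetric] sxy_def[symmetric] syy_def[symmetric]
    using n0 by (simp add: field_simps power3_eq_cube)
  then show ?thesis unfolding outer n_def[symmetric] using n0 by simp
qed

text \<open>After time c the path is that of the shifted steps, rotated by the angle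
  \<open>phase c x\<close> and translated, and signed areas are invariant under both. The wedge
  products of a block thus depend only on the steps within it.\<close>

lemma wedge_shift:
  "wedge (c + r) (c + t) (c + u) x = wedge r t u (\<lambda>i. x (c + i))"
proof -
  let ?y = "\<lambda>i. x (c + i)"
  have ph: "phase (c + i) x = phase c x + phase i ?y" for i
    unfolding phase_def by (induction i) auto
  have split: "(\<Sum>i<c + k. f i) = (\<Sum>i<c. f i) + (\<Sum>i<k. f (c + i))" for f :: "nat \<Rightarrow> real" and k
    by (induction k) auto
  have X: "xpath (c + k) x = xpath c x + (cos (phase c x) * xpath k ?y - sin (phase c x) * ypath k ?y)" for k
    unfolding xpath_def ypath_def split ph sin_add by (simp add: sum.distrib sum_distrib_left mult.commute)
  have Y: "ypath (c + k) x = ypath c x + (cos (phase c x) * ypath k ?y + sin (phase c x) * xpath k ?y)" for k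
    unfolding xpath_def ypath_def split ph cos_add by (simp add: sum_subtractf sum_distrib_left mult.commute)
  have rot: "(C * a - S * b) * (C * d + S * e) - (C * e - S * d) * (C * b + S * a) = (C\<^sup>2 + S\<^sup>2) * (a * d - e * b)" for C S a b d e :: real
    by (simp add: power2_eq_square algebra_simps)
  have "wedge (c + r) (c + t) (c + u) x =
    (cos (phase c x) * (xpath t ?y - xpath r ?y) - sin (phase c x) * (ypath t ?y - ypath r ?y)) * (cos (phase c x) * (ypath u ?y - ypath r ?y) + sin (phase c x) * (xpath u ?y - xpath r ?y))
    - (cos (phase c x) * (xpath u ?y - xpath r ?y) - sin (phase c x) * (ypath u ?y - ypath r ?y)) * (cos (phase c x) * (ypath t ?y - ypath r ?y) + sin (phase c x) * (xpath t ?y - xpath r ?y))"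
    unfolding wedge_def X Y by (simp add: algebra_simps)
  also have "\<dots> = wedge r t u ?y"
    unfolding rot wedge_def by simp
  finally show ?thesis .
qed

lemma block_sum_cong:
  assumes "\<And>i. i < l \<Longrightarrow> x i = y i"
  shows "block_sum l x = block_sum l y"
proof -
  have "phase i x = phase i y" if "i \<le> l" for i
    unfolding phase_def using assms that by (intro sum.cong) auto
  then have "xpath i x = xpath i y" "ypath i x = ypath i y" if "i \<le> l" for i
    unfolding xpath_def ypath_def using that by (auto intro!: sum.cong)
  then show ?thesis unfolding block_sum_def wedge_def by (intro sum.cong refl) auto
qed

text \<open>In the Cauchy--Binet sum all squares are nonnegative, and only the triples inside block
  k are kept. The wedge is quadratic in the path, whence the fourth power of the scale a.\<close>

lemma block_sum_le_det:
  assumes N: "N = n * l" "0 < N" and k: "k < n"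
  shows "a ^ 4 * block_sum l (\<lambda>i. x (k * l + i)) \<le> 6 * real N ^ 3 * det (gram N (\<lambda>k. a * xpath k x) (\<lambda>k. a * ypath k x))"
proof -
  let ?W = "\<lambda>r t u. (wedge r t u x)\<^sup>2"
  have kl: "k * l + l \<le> N" using mult_le_mono1[of "Suc k" n l] k N by simp
  have sh: "(\<Sum>r\<in>{k*l..<k*l+l}. g r) = (\<Sum>r<l. g (k * l + r))" for g :: "nat \<Rightarrow> real"
    by (rule sum.reindex_bij_witness[of _ "\<lambda>i. k * l + i" "\<lambda>i. i - k * l"]) auto
  have "block_sum l (\<lambda>i. x (k * l + i)) = (\<Sum>r\<in>{k*l..<k*l+l}. \<Sum>t\<in>{k*l..<k*l+l}. \<Sum>u\<in>{k*l..<k*l+l}. ?W r t u)"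
    unfolding block_sum_def sh wedge_shift ..
  also have "\<dots> \<le> (\<Sum>r\<in>{k*l..<k*l+l}. \<Sum>t\<in>{k*l..<k*l+l}. \<Sum>u<N. ?W r t u)"
    by (intro sum_mono sum_mono2) (use kl in auto)
  also have "\<dots> \<le> (\<Sum>r\<in>{k*l..<k*l+l}. \<Sum>t<N. \<Sum>u<N. ?W r t u)"
    by (rule sum_mono, rule sum_mono2) (use kl in \<open>auto intro!: sum_nonneg\<close>)
  also have "\<dots> \<le> (\<Sum>r<N. \<Sum>t<N. \<Sum>u<N. ?W r t u)"
    by (rule sum_mono2) (use kl in \<open>auto intro!: sum_nonneg\<close>)
  finally have "a ^ 4 * block_sum l (\<lambda>i. x (k * l + i)) \<le> a ^ 4 * (\<Sum>r<N. \<Sum>t<N. \<Sum>u<N. ?W r t u)"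
    by (intro mult_left_mono) auto
  also have "\<dots> = 6 * real N ^ 3 * det (gram N (\<lambda>k. a * xpath k x) (\<lambda>k. a * ypath k x))"
  proof -
    have "a ^ 4 * ?W r t u = ((a * xpath t x - a * xpath r x) * (a * ypath u x - a * ypath r x) - (a * xpath u x - a * xpath r x) * (a * ypath t x - a * ypath r x))\<^sup>2" for r t u
    proof -
      have "(a * A - a * B) * (a * C - a * D) - (a * E - a * B) * (a * F - a * D) = a\<^sup>2 * ((A - B) * (C - D) - (E - B) * (F - D))" for A B C D E F
        by (simp add: power2_eq_square algebra_simps)
      then show ?thesis unfolding wedge_def by (simp add: power_mult_distrib flip: power_mult)
    qed
    then show ?thesis unfolding det_gram[OF N(2)] by (simp only: sum_distrib_left)
  qed
  finally show ?thesis .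
qed

section \<open>Independence of the blocks\<close>

lemma walk_indep_coordinates:
  assumes s: "0 < s" and N: "0 < N"
  shows "prob_space.indep_vars (walk s N) (\<lambda>_. gauss s) (\<lambda>i x. x i) {..<N}"
proof -
  interpret prob_space "walk s N" using s by (rule prob_space_walk)
  have rv: "(\<lambda>x. x i) \<in> measurable (walk s N) (gauss s)" if "i \<in> {..<N}" for i
    unfolding walk_def by (rule measurable_component_singleton[OF that])
  have "distr (walk s N) (PiM {..<N} (\<lambda>_. gauss s)) (\<lambda>x. \<lambda>i\<in>{..<N}. x i) = distr (walk s N) (PiM {..<N} (\<lambda>_. gauss s)) (\<lambda>x. x)"
    by (rule distr_cong) (auto simp: walk_def space_PiM PiE_def extensional_restrict)
  also have "\<dots> = walk s N" unfolding walk_def by (rule distr_id)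
  also have "\<dots> = PiM {..<N} (\<lambda>i. distr (walk s N) (gauss s) (\<lambda>x. x i))"
    unfolding walk_def using s
    by (intro PiM_cong refl distr_PiM_component[symmetric] prob_space_gauss) auto
  finally show ?thesis using N by (subst indep_vars_iff_distr_eq_PiM'[OF _ rv]) auto
qed

text \<open>The blocks use disjoint sets of independent coordinates, and a shift of indices maps the
  steps of each block to the law \<open>walk s l\<close>.\<close>

lemma walk_blocks_prob:
  assumes s: "0 < s" and n: "0 < n" "0 < l"
  shows "measure (walk s (n * l)) {x \<in> space (walk s (n * l)). \<forall>k<n. block_sum l (\<lambda>i. x (k * l + i)) < \<delta>}
    = (measure (walk s l) {x \<in> space (walk s l). block_sum l x < \<delta>}) ^ n"
proof -
  let ?P = "walk s (n * l)"
  interpret prob_space ?P using s by (rule prob_space_walk)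
  define K where "K = (\<lambda>k. {k*l..<k*l+l})"
  define sh where "sh = (\<lambda>k (y :: nat \<Rightarrow> real). \<lambda>i\<in>{..<l}. y (k * l + i))"
  have Ksub: "K k \<subseteq> {..<n * l}" if "k < n" for k
    using mult_le_mono1[of "Suc k" n l] that by (auto simp: K_def)
  have dis: "disjoint_family_on K {..<n}"
  proof -
    have "j div l = k" if "j \<in> K k" for j k
    proof (rule div_nat_eqI)
      show "l * k \<le> j" using that by (simp add: K_def mult.commute)
      show "j < l * Suc k" using that by (simp add: K_def mult.commute)
    qed
    then show ?thesis unfolding disjoint_family_on_def by blast
  qed
  have ind: "indep_vars (\<lambda>k. PiM (K k) (\<lambda>_. gauss s)) (\<lambda>k x. restrict (\<lambda>i. x i) (K k)) {..<n}"
    by (rule indep_vars_restrict[OF walk_indep_coordinates[OF s] _ dis]) (use Ksub n in auto)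
  have shm: "sh k \<in> measurable (PiM (K k) (\<lambda>_. gauss s)) (walk s l)" for k
    unfolding sh_def walk_def
    by (rule measurable_restrict, rule measurable_component_singleton) (auto simp: K_def)
  define A where "A = (\<lambda>k. {y \<in> space (PiM (K k) (\<lambda>_. gauss s)). block_sum l (sh k y) < \<delta>})"
  have Am: "A k \<in> sets (PiM (K k) (\<lambda>_. gauss s))" for k
    unfolding A_def by (rule borel_measurable_less[OF measurable_compose[OF shm block_sum_measurable]]) simp
  have bs: "block_sum l (sh k (restrict x (K k))) = block_sum l (\<lambda>i. x (k * l + i))" for k x
    by (rule block_sum_cong) (auto simp: sh_def K_def)
  have bs2: "block_sum l (sh k x) = block_sum l (\<lambda>i. x (k * l + i))" for k x
    by (rule block_sum_cong) (auto simp: sh_def K_def)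
  have pre: "(\<lambda>x. restrict (\<lambda>i. x i) (K k)) -` A k \<inter> space ?P = {x \<in> space ?P. block_sum l (\<lambda>i. x (k * l + i)) < \<delta>}" if "k < n" for k
    using Ksub[OF that] by (auto simp: A_def bs walk_def space_PiM)
  have "prob (\<Inter>k\<in>{..<n}. (\<lambda>x. restrict (\<lambda>i. x i) (K k)) -` A k \<inter> space ?P)
     = (\<Prod>k<n. prob ((\<lambda>x. restrict (\<lambda>i. x i) (K k)) -` A k \<inter> space ?P))"
    by (rule indep_varsD[OF ind]) (use n Am in auto)
  also have "(\<Inter>k\<in>{..<n}. (\<lambda>x. restrict (\<lambda>i. x i) (K k)) -` A k \<inter> space ?P)
     = {x \<in> space ?P. \<forall>k<n. block_sum l (\<lambda>i. x (k * l + i)) < \<delta>}"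
    using n pre by auto
  also have "(\<Prod>k<n. prob ((\<lambda>x. restrict (\<lambda>i. x i) (K k)) -` A k \<inter> space ?P))
     = (\<Prod>k<n. measure (walk s l) {x \<in> space (walk s l). block_sum l x < \<delta>})"
  proof (rule prod.cong[OF refl])
    fix k assume "k \<in> {..<n}"
    then have k: "k < n" by simp
    then have kl: "k * l + l \<le> n * l" using mult_le_mono1[of "Suc k" n l] by simp
    have d: "distr ?P (walk s l) (sh k) = walk s l"
      unfolding walk_def sh_def using s
      by (intro distr_PiM_reindex[where M="\<lambda>_. gauss s"] prob_space_gauss) (use kl in \<open>auto simp: inj_on_def\<close>)
    have shP: "sh k \<in> measurable ?P (walk s l)"
      unfolding sh_def walk_def
      by (rule measurable_restrict, rule measurable_component_singleton) (use kl in auto)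
    have "measure (walk s l) {x \<in> space (walk s l). block_sum l x < \<delta>} = measure (distr ?P (walk s l) (sh k)) {x \<in> space (walk s l). block_sum l x < \<delta>}"
      unfolding d ..
    also have "\<dots> = prob (sh k -` {x \<in> space (walk s l). block_sum l x < \<delta>} \<inter> space ?P)"
      by (rule measure_distr[OF shP]) measurable
    also have "sh k -` {x \<in> space (walk s l). block_sum l x < \<delta>} \<inter> space ?P = {x \<in> space ?P. block_sum l (\<lambda>i. x (k * l + i)) < \<delta>}"
      using measurable_space[OF shP] by (auto simp: bs2)
    finally show "prob ((\<lambda>x. restrict (\<lambda>i. x i) (K k)) -` A k \<inter> space ?P) = measure (walk s l) {x \<in> space (walk s l). block_sum l x < \<delta>}"
      unfolding pre[OF k] ..
  qed
  finally show ?thesis by simp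
qed

text \<open>A small determinant forces every single block to be small. With l = N / n, h = 1 / n
  and, as T \<ge> 1, \<tau> \<ge> 1 / n, the block threshold l^3 h^2 \<tau>^3 is at least N^3 / n^8;
  this is the origin of the exponent 8. Halving in Paley--Zygmund and the factor 6 N^3 of
  Cauchy--Binet give the 12.\<close>

lemma walk_det_small_prob:
  assumes n: "0 < n" "0 < m" and T: "1 \<le> T" "T \<le> real (n * (7 * m))" and s: "s = sqrt (T / real (n * (7 * m)))"
  defines "N \<equiv> n * (7 * m)"
  shows "measure (walk s N) {x \<in> space (walk s N).
      det (gram N (\<lambda>k. sqrt T / real N * xpath k x) (\<lambda>k. sqrt T / real N * ypath k x)) < block_c / 12 / real n ^ 8}
    \<le> (1 - block_p) ^ n"
proof -
  define l where "l = 7 * m"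
  have Nl: "N = n * l" by (simp add: N_def l_def)
  have N0: "0 < N" "0 < real N" using n by (auto simp: N_def)
  have s0: "0 < s" using T N0 by (simp add: s flip: N_def)
  interpret prob_space "walk s N" using s0 by (rule prob_space_walk)
  define a where "a = sqrt T / real N"
  have a0: "0 < a" using T N0 by (simp add: a_def)
  define h where "h = real l / real N"
  define \<tau> where "\<tau> = min 1 (T * h)"
  have hn: "h = 1 / real n" using n by (simp add: h_def Nl l_def)
  have \<tau>n: "1 / real n \<le> \<tau>"
  proof -
    have "1 * h \<le> T * h" using T n by (intro mult_right_mono) (auto simp: hn)
    then show ?thesis using n by (simp add: \<tau>_def hn)
  qed
  define \<delta> where "\<delta> = block_c / 2 * (real l ^ 3 * h\<^sup>2 * \<tau> ^ 3)"
  have \<delta>: "6 * real N ^ 3 * (block_c / 12 / real n ^ 8) \<le> \<delta>"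
  proof -
    have lN: "real l = real N / real n" using n by (simp add: Nl)
    have "6 * real N ^ 3 * (block_c / 12 / real n ^ 8) = block_c / 2 * (real l ^ 3 * h\<^sup>2 * (1 / real n) ^ 3)"
      unfolding hn lN using n by (simp add: power_divide eval_nat_numeral)
    also have "\<dots> \<le> \<delta>" unfolding \<delta>_def using block_const_pos \<tau>n
      by (intro mult_left_mono power_mono) auto
    finally show ?thesis .
  qed
  have sub: "{x \<in> space (walk s N). det (gram N (\<lambda>k. a * xpath k x) (\<lambda>k. a * ypath k x)) < block_c / 12 / real n ^ 8}
     \<subseteq> {x \<in> space (walk s N). \<forall>k<n. block_sum l (\<lambda>i. x (k * l + i)) < \<delta> / a ^ 4}" (is "?A \<subseteq> ?B")
  proof safe
    fix x k assume d: "det (gram N (\<lambda>k. a * xpath k x) (\<lambda>k. a * ypath k x)) < block_c / 12 / real n ^ 8" and k: "k < n"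
    have "a ^ 4 * block_sum l (\<lambda>i. x (k * l + i)) \<le> 6 * real N ^ 3 * det (gram N (\<lambda>k. a * xpath k x) (\<lambda>k. a * ypath k x))"
      by (rule block_sum_le_det[OF Nl N0(1) k])
    also have "\<dots> < 6 * real N ^ 3 * (block_c / 12 / real n ^ 8)"
      using d N0 by (intro mult_strict_left_mono) auto
    also have "\<dots> \<le> \<delta>" by (rule \<delta>)
    finally show "block_sum l (\<lambda>i. x (k * l + i)) < \<delta> / a ^ 4" using a0 by (simp add: pos_less_divide_eq mult.commute)
  qed
  have Bm: "?B \<in> events"
  proof -
    have "(\<lambda>x. block_sum l (\<lambda>i. x (k * l + i))) \<in> borel_measurable (walk s N)" if "k < n" for k
    proof -
      have kl: "k * l + l \<le> N" using mult_le_mono1[of "Suc k" n l] that Nl by simp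
      have "(\<lambda>x. \<lambda>i\<in>{..<l}. x (k * l + i)) \<in> measurable (walk s N) (walk s l)"
        unfolding walk_def by (rule measurable_restrict, rule measurable_component_singleton) (use kl in auto)
      then have "(\<lambda>x. block_sum l (\<lambda>i\<in>{..<l}. x (k * l + i))) \<in> borel_measurable (walk s N)"
        by (rule measurable_compose[OF _ block_sum_measurable])
      moreover have "block_sum l (\<lambda>i\<in>{..<l}. x (k * l + i)) = block_sum l (\<lambda>i. x (k * l + i))" for x :: "nat \<Rightarrow> real"
        by (rule block_sum_cong) simp
      ultimately show ?thesis by simp
    qed
    then have "{x \<in> space (walk s N). \<forall>k\<in>{..<n}. block_sum l (\<lambda>i. x (k * l + i)) < \<delta> / a ^ 4} \<in> events"
      by (intro sets.sets_Collect_finite_All borel_measurable_less) auto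
    then show ?thesis by (simp only: Ball_def lessThan_iff)
  qed
  have "prob ?A \<le> prob ?B" by (rule finite_measure_mono[OF sub Bm])
  also have "\<dots> = (measure (walk s l) {x \<in> space (walk s l). block_sum l x < \<delta> / a ^ 4}) ^ n"
    unfolding Nl by (rule walk_blocks_prob[OF s0]) (use n in \<open>auto simp: l_def\<close>)
  also have "\<dots> \<le> (1 - block_p) ^ n"
  proof (rule power_mono)
    have "measure (walk s l) {x \<in> space (walk s l). (sqrt T / real N) ^ 4 * block_sum l x < block_c / 2 * (real l ^ 3 * h\<^sup>2 * \<tau> ^ 3)} \<le> 1 - block_p"
      by (rule block_small_prob[OF _ _ _ n(2) l_def h_def \<tau>_def]) (use T s in \<open>auto simp: N_def\<close>)
    moreover have eq: "block_sum l x < \<delta> / a ^ 4 \<longleftrightarrow> a ^ 4 * block_sum l x < \<delta>" for x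
      using a0 by (simp add: pos_less_divide_eq mult.commute)
    ultimately show "measure (walk s l) {x \<in> space (walk s l). block_sum l x < \<delta> / a ^ 4} \<le> 1 - block_p"
      unfolding eq unfolding \<delta>_def a_def by (simp only:)
  qed simp
  finally show ?thesis unfolding a_def .
qed

section \<open>Inverse matrices and norms\<close>

text \<open>The adjugate, written as in Cramer's rule so that the formula for the inverse is
  immediate.\<close>

definition cofactor_matrix :: "real ^ 3 ^ 3 \<Rightarrow> real ^ 3 ^ 3" where
  "cofactor_matrix A = (\<chi> k j. det (\<chi> i l. if l = k then axis j 1 $ i else A $ i $ l))"

lemma mul_matrix_inv:
  fixes A :: "real ^ 3 ^ 3"
  assumes "invertible A"
  shows "A ** matrix_inv A = mat 1"
  using assms unfolding invertible_def matrix_inv_def by (rule someI2_ex) simp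

lemma matrix_inv_cofactor:
  fixes A :: "real ^ 3 ^ 3"
  assumes "det A \<noteq> 0"
  shows "matrix_inv A = (1 / det A) *\<^sub>R cofactor_matrix A"
proof -
  have inv: "A ** matrix_inv A = mat 1"
    using assms by (intro mul_matrix_inv) (simp add: invertible_det_nz)
  have "matrix_inv A $ k $ j = det (\<chi> i l. if l = k then axis j 1 $ i else A $ i $ l) / det A" for k j
  proof -
    have "A *v (matrix_inv A *v axis j 1) = axis j 1"
      by (simp add: matrix_vector_mul_assoc inv)
    then have "matrix_inv A *v axis j 1 = (\<chi> k. det (\<chi> i l. if l = k then axis j 1 $ i else A $ i $ l) / det A)"
      unfolding cramer[OF assms] .
    moreover have "(matrix_inv A *v axis j 1) $ k = matrix_inv A $ k $ j"
      by (simp add: matrix_vector_mult_basis column_def)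
    ultimately show ?thesis by simp
  qed
  then show ?thesis by (simp add: vec_eq_iff cofactor_matrix_def)
qed

lemma continuous_det [continuous_intros]:
  fixes f :: "'a::topological_space \<Rightarrow> real ^ 3 ^ 3"
  shows "continuous_on S f \<Longrightarrow> continuous_on S (\<lambda>x. det (f x))"
  unfolding det_3 by (intro continuous_intros)

lemma continuous_cofactor: "continuous_on S cofactor_matrix"
proof -
  have c: "continuous_on S (\<lambda>A. \<chi> i l. if l = k then axis j 1 $ i else A $ i $ l)" for j k :: 3
  proof (intro continuous_on_vec_lambda)
    show "continuous_on S (\<lambda>A. if l = k then axis j 1 $ i else A $ i $ l)" for i l
      by (cases "l = k") (auto intro!: continuous_intros)
  qed
  show ?thesis unfolding cofactor_matrix_def
    by (rule continuous_on_vec_lambda, rule continuous_on_vec_lambda, rule continuous_det, rule c)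
qed

lemma entry_le_norm: "\<bar>A $ i $ j\<bar> \<le> norm (A :: real ^ 3 ^ 3)"
  by (rule order_trans[OF component_le_norm_cart Finite_Cartesian_Product.norm_nth_le])

lemma norm_le_entries:
  fixes A :: "real ^ 3 ^ 3"
  assumes "\<And>i j. \<bar>A $ i $ j\<bar> \<le> B"
  shows "norm (A :: real ^ 3 ^ 3) \<le> 9 * B"
proof -
  have "norm (A $ i) \<le> 3 * B" for i
    using norm_le_l1_cart[of "A $ i"] assms[of i 1] assms[of i 2] assms[of i 3] by (simp add: sum_3)
  moreover have "norm A \<le> (\<Sum>i\<in>UNIV. norm (A $ i))"
    unfolding norm_vec_def by (rule L2_set_le_sum) simp
  ultimately show ?thesis by (simp add: sum_3) (smt (verit))
qed

lemma det_le: "\<bar>det A\<bar> \<le> 6 * norm (A :: real ^ 3 ^ 3) ^ 3"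
proof -
  have p: "\<bar>A $ i $ j * A $ i' $ j' * A $ i'' $ j''\<bar> \<le> norm A ^ 3" for i j i' j' i'' j''
    unfolding abs_mult power3_eq_cube by (intro mult_mono entry_le_norm) auto
  show ?thesis unfolding det_3
    using p[of 1 1 2 2 3 3] p[of 1 2 2 3 3 1] p[of 1 3 2 1 3 2] p[of 1 1 2 3 3 2] p[of 1 2 2 1 3 3] p[of 1 3 2 2 3 1]
    unfolding abs_le_iff by linarith
qed

text \<open>Nine entries, each a 2 by 2 minor and so a difference of two products: 18 = 9 *
  2.\<close>

lemma norm_cofactor_le: "norm (cofactor_matrix A) \<le> 18 * (norm A)\<^sup>2"
proof -
  have p: "\<bar>A $ i $ j * A $ i' $ j'\<bar> \<le> (norm A)\<^sup>2" for i j i' j'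
    unfolding abs_mult power2_eq_square by (intro mult_mono entry_le_norm) auto
  have q: "\<bar>u - v\<bar> \<le> 2 * B" "\<bar>v - u\<bar> \<le> 2 * B" if "\<bar>u\<bar> \<le> B" "\<bar>v\<bar> \<le> B" for u v B :: real
    using that by linarith+
  have e:
    "cofactor_matrix A $ 1 $ 1 = A $ 2 $ 2 * A $ 3 $ 3 - A $ 2 $ 3 * A $ 3 $ 2"
    "cofactor_matrix A $ 1 $ 2 = A $ 1 $ 3 * A $ 3 $ 2 - A $ 1 $ 2 * A $ 3 $ 3"
    "cofactor_matrix A $ 1 $ 3 = A $ 1 $ 2 * A $ 2 $ 3 - A $ 1 $ 3 * A $ 2 $ 2"
    "cofactor_matrix A $ 2 $ 1 = A $ 2 $ 3 * A $ 3 $ 1 - A $ 2 $ 1 * A $ 3 $ 3"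
    "cofactor_matrix A $ 2 $ 2 = A $ 1 $ 1 * A $ 3 $ 3 - A $ 1 $ 3 * A $ 3 $ 1"
    "cofactor_matrix A $ 2 $ 3 = A $ 1 $ 3 * A $ 2 $ 1 - A $ 1 $ 1 * A $ 2 $ 3"
    "cofactor_matrix A $ 3 $ 1 = A $ 2 $ 1 * A $ 3 $ 2 - A $ 2 $ 2 * A $ 3 $ 1"
    "cofactor_matrix A $ 3 $ 2 = A $ 1 $ 2 * A $ 3 $ 1 - A $ 1 $ 1 * A $ 3 $ 2"
    "cofactor_matrix A $ 3 $ 3 = A $ 1 $ 1 * A $ 2 $ 2 - A $ 1 $ 2 * A $ 2 $ 1"
    by (simp_all add: cofactor_matrix_def det_3 axis_def)
  have "\<forall>k j. \<bar>cofactor_matrix A $ k $ j\<bar> \<le> 2 * (norm A)\<^sup>2"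
    unfolding forall_3 e by (intro conjI q p)
  then show ?thesis using norm_le_entries[of "cofactor_matrix A" "2 * (norm A)\<^sup>2"] by simp
qed

section \<open>Arbitrary matrix norms and the inverse\<close>

context
  fixes nrm :: "real ^ 3 ^ 3 \<Rightarrow> real"
  assumes nrm: "matrix_norm nrm"
begin

lemma nrm_facts: "0 \<le> nrm A" "nrm A = 0 \<longleftrightarrow> A = 0" "nrm (c *\<^sub>R A) = \<bar>c\<bar> * nrm A" "nrm (A + B) \<le> nrm A + nrm B"
  using nrm by (auto simp: matrix_norm_def)

lemma nrm_upper: obtains K where "0 < K" "\<And>A. nrm A \<le> K * norm A"
proof
  let ?K = "(\<Sum>b\<in>Basis. nrm b) + 1"
  show "0 < ?K" using nrm_facts(1) by (smt (verit) sum_nonneg)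
  fix A :: "real ^ 3 ^ 3"
  have s: "nrm (\<Sum>b\<in>S. f b) \<le> (\<Sum>b\<in>S. nrm (f b))" if "finite S" for S :: "(real ^ 3 ^ 3) set" and f
    using that
  proof induction
    case empty then show ?case using nrm_facts(2)[of 0] by simp
  next
    case (insert x F) then show ?case using nrm_facts(4)[of "f x" "sum f F"] by simp
  qed
  have "nrm A = nrm (\<Sum>b\<in>Basis. (A \<bullet> b) *\<^sub>R b)" by (simp add: euclidean_representation)
  also have "\<dots> \<le> (\<Sum>b\<in>Basis. nrm ((A \<bullet> b) *\<^sub>R b))" by (rule s) simp
  also have "\<dots> \<le> (\<Sum>b\<in>Basis. norm A * nrm b)"
    unfolding nrm_facts(3) by (intro sum_mono mult_right_mono Basis_le_norm nrm_facts(1))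
  also have "\<dots> \<le> ?K * norm A" by (simp add: sum_distrib_left[symmetric] algebra_simps)
  finally show "nrm A \<le> ?K * norm A" .
qed

lemma nrm_continuous: "continuous_on S nrm"
proof -
  obtain K where K: "0 < K" "\<And>A. nrm A \<le> K * norm A" by (rule nrm_upper) blast
  have neg: "nrm (- A) = nrm A" for A using nrm_facts(3)[of "-1" A] by simp
  have d: "\<bar>nrm A - nrm B\<bar> \<le> K * dist A B" for A B
  proof -
    have "nrm A \<le> nrm (A - B) + nrm B" using nrm_facts(4)[of "A - B" B] by simp
    moreover have "nrm B \<le> nrm (B - A) + nrm A" using nrm_facts(4)[of "B - A" A] by simp
    moreover have "nrm (B - A) = nrm (A - B)" using neg[of "A - B"] by simp
    ultimately show ?thesis using K(2)[of "A - B"] by (simp add: dist_norm)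
  qed
  show ?thesis
  proof (rule continuous_on_iff[THEN iffD2], intro ballI allI impI)
    fix A e assume "A \<in> S" "(0::real) < e"
    show "\<exists>d>0. \<forall>x'\<in>S. dist x' A < d \<longrightarrow> dist (nrm x') (nrm A) < e"
    proof (intro exI conjI ballI impI)
      show "0 < e / K" using K \<open>0 < e\<close> by simp
      fix B assume "dist B A < e / K"
      then have "K * dist B A < e" using K by (simp add: field_simps)
      then show "dist (nrm B) (nrm A) < e" using d[of B A] by (simp add: dist_real_def)
    qed
  qed
qed

text \<open>Compactness: on the unit sphere the continuous function \<open>nrm\<close> attains its
  minimum, which is positive.\<close>

lemma nrm_lower: obtains k where "0 < k" "\<And>A. k * norm A \<le> nrm A"
proof -
  have "\<exists>A\<in>sphere 0 1. \<forall>B\<in>sphere (0 :: real ^ 3 ^ 3) 1. nrm A \<le> nrm B"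
    by (rule continuous_attains_inf) (auto simp: nrm_continuous)
  then obtain A0 where A0: "norm A0 = 1" "\<And>B. norm B = 1 \<Longrightarrow> nrm A0 \<le> nrm B" by (auto simp: dist_norm)
  show thesis
  proof
    show "0 < nrm A0" using A0(1) nrm_facts(1,2)[of A0] by (metis less_eq_real_def norm_zero zero_neq_one)
    fix A :: "real ^ 3 ^ 3"
    show "nrm A0 * norm A \<le> nrm A"
    proof (cases "A = 0")
      case False
      have "nrm A0 \<le> nrm ((1 / norm A) *\<^sub>R A)" by (rule A0(2)) (use False in simp)
      then show ?thesis using False by (simp add: nrm_facts(3) field_simps)
    qed (simp add: nrm_facts(1))
  qed
qed

lemma nrm_inv_upper:
  obtains K where "0 < K" "\<And>A. det A \<noteq> 0 \<Longrightarrow> nrm (matrix_inv A) \<le> K * ((norm A)\<^sup>2 / \<bar>det A\<bar>)"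
proof -
  obtain K where K: "0 < K" "\<And>A. nrm A \<le> K * norm A" by (rule nrm_upper) blast
  show thesis
  proof
    show "0 < 18 * K" using K by simp
    fix A :: "real ^ 3 ^ 3" assume d: "det A \<noteq> 0"
    have "nrm (matrix_inv A) = nrm (cofactor_matrix A) / \<bar>det A\<bar>"
      unfolding matrix_inv_cofactor[OF d] nrm_facts(3) by simp
    also have "\<dots> \<le> K * (18 * (norm A)\<^sup>2) / \<bar>det A\<bar>"
      using K by (intro divide_right_mono order_trans[OF K(2)] mult_left_mono norm_cofactor_le) auto
    finally show "nrm (matrix_inv A) \<le> 18 * K * ((norm A)\<^sup>2 / \<bar>det A\<bar>)" by (simp add: mult_ac)
  qed
qed

text \<open>From the product of the determinants of A and its inverse being 1, and the cubic bound
  on determinants. It makes the norm of the inverse blow up towards every singular matrix, which is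
  what the continuity of the truncation needs.\<close>

lemma nrm_inv_lower:
  obtains c where "0 < c" "\<And>A. det A \<noteq> 0 \<Longrightarrow> c \<le> nrm (matrix_inv A) ^ 3 * \<bar>det A\<bar>"
proof -
  obtain k where k: "0 < k" "\<And>A. k * norm A \<le> nrm A" by (rule nrm_lower) blast
  show thesis
  proof
    show "0 < k ^ 3 / 6" using k by simp
    fix A :: "real ^ 3 ^ 3" assume d: "det A \<noteq> 0"
    have "A ** matrix_inv A = mat 1" using d by (intro mul_matrix_inv) (simp add: invertible_det_nz)
    then have "det A * det (matrix_inv A) = 1" by (metis det_I det_mul)
    then have "1 = \<bar>det A\<bar> * \<bar>det (matrix_inv A)\<bar>" by (metis abs_1 abs_mult)
    also have "\<dots> \<le> \<bar>det A\<bar> * (6 * norm (matrix_inv A) ^ 3)" by (intro mult_left_mono det_le) auto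
    finally have "k ^ 3 * 1 \<le> k ^ 3 * (\<bar>det A\<bar> * (6 * norm (matrix_inv A) ^ 3))" using k by (intro mult_left_mono) auto
    also have "\<dots> = 6 * \<bar>det A\<bar> * (k * norm (matrix_inv A)) ^ 3" by (simp add: power_mult_distrib)
    also have "\<dots> \<le> 6 * \<bar>det A\<bar> * nrm (matrix_inv A) ^ 3"
      using k by (intro mult_left_mono power_mono) auto
    finally show "k ^ 3 / 6 \<le> nrm (matrix_inv A) ^ 3 * \<bar>det A\<bar>" by (simp add: mult_ac)
  qed
qed

text \<open>The value K at singular matrices agrees with the value \<infinity> that
  \<open>inverse_moment\<close> gives them, and it is the value that makes the function continuous
  there.\<close>

definition trunc_inv :: "real \<Rightarrow> real \<Rightarrow> real ^ 3 ^ 3 \<Rightarrow> real" where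
  "trunc_inv p K A = (if det A \<noteq> 0 then min K (nrm (matrix_inv A) powr p) else K)"

lemma nrm_inv_pos: "det A \<noteq> 0 \<Longrightarrow> 0 < nrm (matrix_inv A)"
  by (metis abs_eq_0 less_eq_real_def mult_eq_0_iff nrm_facts(1) nrm_inv_lower power_zero_numeral not_less zero_neq_one)

lemma trunc_inv_continuous:
  assumes p: "0 < p" and K: "0 < K"
  shows "continuous_on UNIV (trunc_inv p K)"
  unfolding continuous_on_eq_continuous_at[OF open_UNIV]
proof
  fix A0 :: "real ^ 3 ^ 3"
  have dc: "isCont det A0"
    using continuous_det[of UNIV "\<lambda>x. x"] by (simp add: continuous_on_eq_continuous_at)
  show "isCont (trunc_inv p K) A0"
  proof (cases "det A0 = 0")
    case False
    define S where "S = {A :: real ^ 3 ^ 3. det A \<noteq> 0}"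
    have oS: "open S"
      unfolding S_def by (intro open_Collect_neq continuous_intros)
    have "continuous_on S (\<lambda>A. min K (nrm ((1 / det A) *\<^sub>R cofactor_matrix A) powr p))"
    proof (intro continuous_intros continuous_on_powr)
      show "continuous_on S (\<lambda>A. nrm ((1 / det A) *\<^sub>R cofactor_matrix A))"
        by (intro continuous_on_compose2[OF nrm_continuous[of UNIV]] continuous_intros continuous_cofactor) (auto simp: S_def)
      show "\<forall>A\<in>S. nrm ((1 / det A) *\<^sub>R cofactor_matrix A) \<noteq> 0"
        using nrm_inv_pos matrix_inv_cofactor by (force simp: S_def)
    qed
    moreover have "trunc_inv p K A = min K (nrm ((1 / det A) *\<^sub>R cofactor_matrix A) powr p)" if "A \<in> S" for A
      using that matrix_inv_cofactor[of A] by (simp add: trunc_inv_def S_def)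
    ultimately have "continuous_on S (trunc_inv p K)" by (simp cong: continuous_on_cong)
    then show ?thesis using oS False by (simp add: continuous_on_eq_continuous_at S_def)
  next
    case True
    obtain c where c: "0 < c" "\<And>A. det A \<noteq> 0 \<Longrightarrow> c \<le> nrm (matrix_inv A) ^ 3 * \<bar>det A\<bar>" using nrm_inv_lower by blast
    define R where "R = K powr (1 / p)"
    have R: "0 < R" using K by (simp add: R_def)
    \<comment> \<open>Where |det A| < \<eta>, the lower bound forces an inverse of norm at least R,
      hence of p-th power at least K, so the truncation is constant near a singular matrix.\<close>
    define \<eta> where "\<eta> = c / R ^ 3"
    have \<eta>: "0 < \<eta>" using c R by (simp add: \<eta>_def)
    have "\<forall>\<^sub>F A in at A0. \<bar>det A\<bar> < \<eta>"
    proof -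
      have "((\<lambda>A. det A) \<longlongrightarrow> 0) (at A0)" using dc True by (simp add: isCont_def)
      then have "((\<lambda>A. \<bar>det A\<bar>) \<longlongrightarrow> 0) (at A0)" by (simp add: tendsto_rabs_zero_iff)
      then show ?thesis using \<eta> by (rule order_tendstoD(2))
    qed
    then have "\<forall>\<^sub>F A in at A0. trunc_inv p K A = K"
    proof (rule eventually_mono)
      fix A :: "real ^ 3 ^ 3" assume d: "\<bar>det A\<bar> < \<eta>"
      show "trunc_inv p K A = K"
      proof (cases "det A = 0")
        case False
        have n0: "0 < nrm (matrix_inv A)" using nrm_inv_pos False by blast
        have "c \<le> nrm (matrix_inv A) ^ 3 * \<bar>det A\<bar>" by (rule c(2)[OF False])
        also have "\<dots> \<le> nrm (matrix_inv A) ^ 3 * \<eta>" using d n0 by (intro mult_left_mono) auto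
        finally have "R ^ 3 \<le> nrm (matrix_inv A) ^ 3" using c R by (simp add: \<eta>_def field_simps)
        then have "R \<le> nrm (matrix_inv A)" using n0 R by (simp add: power_mono_iff)
        then have "R powr p \<le> nrm (matrix_inv A) powr p" using R p by (intro powr_mono2) auto
        moreover have "R powr p = K" using K p by (simp add: R_def powr_powr)
        ultimately show ?thesis using False by (simp add: trunc_inv_def)
      qed (simp add: trunc_inv_def)
    qed
    then have "(trunc_inv p K \<longlongrightarrow> K) (at A0)" by (rule tendsto_eventually)
    then show ?thesis using True by (simp add: isCont_def trunc_inv_def)
  qed
qed

end

section \<open>From the random walk to Brownian motion\<close>

lemma integral_grid:
  fixes f :: "real \<Rightarrow> 'a::euclidean_space"
  assumes f: "continuous_on {0..1} f" and N: "0 < N"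
  shows "k \<le> N \<Longrightarrow> integral {0..real k / real N} f = (\<Sum>i<k. integral {real i / real N..real (Suc i) / real N} f)"
proof (induction k)
  case (Suc k)
  have "real (Suc k) / real N \<le> 1" using Suc.prems N by (simp add: field_simps del: of_nat_Suc)
  then have "f integrable_on {0..real (Suc k) / real N}"
    by (intro integrable_continuous_real continuous_on_subset[OF f]) auto
  then have "integral {0..real (Suc k) / real N} f = integral {0..real k / real N} f + integral {real k / real N..real (Suc k) / real N} f"
    by (intro Henstock_Kurzweil_Integration.integral_combine[symmetric] divide_right_mono) auto
  then show ?case using Suc by simp
qed simp

text \<open>Uniform continuity gives the same error e / N for every cell, so the total error is at
  most e whichever k \<le> N is the upper end.\<close>

lemma riemann_sum_uniform:
  fixes f :: "real \<Rightarrow> 'a::euclidean_space"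
  assumes f: "continuous_on {0..1} f" and e: "0 < e"
  shows "\<forall>\<^sub>F N in sequentially. \<forall>k\<le>N. norm ((\<Sum>i<k. f (real i / real N)) /\<^sub>R real N - integral {0..real k / real N} f) \<le> e"
proof -
  have "uniformly_continuous_on {0..1} f" using f by (intro compact_uniformly_continuous) auto
  then obtain d where d: "0 < d" "\<And>x y. x \<in> {0..1} \<Longrightarrow> y \<in> {0..1} \<Longrightarrow> dist y x < d \<Longrightarrow> dist (f y) (f x) < e"
    using e unfolding uniformly_continuous_on_def by metis
  obtain N0 :: nat where N0: "1 / d < real N0" using reals_Archimedean2 by blast
  show ?thesis
  proof (rule eventually_sequentiallyI[of "max 1 N0"], intro allI impI)
    fix N k assume N: "max 1 N0 \<le> N" and k: "k \<le> N"
    have N1: "0 < N" "0 < real N" "1 / d < real N" using N N0 by auto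
    have dN: "1 / real N < d" using N1 d by (simp add: field_simps)
    have piece: "norm ((1 / real N) *\<^sub>R f (real i / real N) - integral {real i / real N..real (Suc i) / real N} f) \<le> e * (1 / real N)" if i: "i < N" for i
    proof -
      let ?a = "real i / real N" and ?b = "real (Suc i) / real N"
      have ab: "0 \<le> ?a" "?a \<le> ?b" "?b \<le> 1" using i N1 by (auto simp: field_simps simp del: of_nat_Suc)
      have ln: "?b - ?a = 1 / real N" by (simp add: diff_divide_distrib[symmetric])
      have fi: "f integrable_on {?a..?b}"
        by (intro integrable_continuous_real continuous_on_subset[OF f]) (use ab in auto)
      have "norm (integral {?a..?b} (\<lambda>x. f ?a - f x)) \<le> integral {?a..?b} (\<lambda>x. e)"
      proof (rule Henstock_Kurzweil_Integration.integral_norm_bound_integral)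
        show "(\<lambda>x. f ?a - f x) integrable_on {?a..?b}" using fi by (intro integrable_diff) auto
        show "(\<lambda>x. e) integrable_on {?a..?b}" by (intro integrable_const_ivl)
        fix x assume x: "x \<in> {?a..?b}"
        have "dist ?a x < d" using x ln dN by (auto simp: dist_real_def)
        moreover have "?a \<le> x" "x \<le> ?b" using x by auto
        then have "x \<in> {0..1}" unfolding atLeastAtMost_iff using ab by (intro conjI; linarith)
        moreover have "?a \<in> {0..1}" unfolding atLeastAtMost_iff using ab by (intro conjI; linarith)
        ultimately have "dist (f ?a) (f x) < e" by (intro d(2))
        then show "norm (f ?a - f x) \<le> e" by (simp add: dist_norm)
      qed
      also have "integral {?a..?b} (\<lambda>x. f ?a - f x) = (1 / real N) *\<^sub>R f ?a - integral {?a..?b} f"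
        using fi ab ln by (subst Henstock_Kurzweil_Integration.integral_diff) auto
      also have "integral {?a..?b} (\<lambda>x. e) = e * (1 / real N)" using ab ln by simp
      finally show ?thesis .
    qed
    have "norm ((\<Sum>i<k. f (real i / real N)) /\<^sub>R real N - integral {0..real k / real N} f)
      = norm (\<Sum>i<k. (1 / real N) *\<^sub>R f (real i / real N) - integral {real i / real N..real (Suc i) / real N} f)"
      unfolding integral_grid[OF f N1(1) k] by (simp add: sum_subtractf scaleR_sum_right inverse_eq_divide)
    also have "\<dots> \<le> (\<Sum>i<k. e * (1 / real N))"
      using k by (intro sum_norm_le piece) auto
    also have "\<dots> \<le> e" using k N1 e by (simp add: field_simps)
    finally show "norm ((\<Sum>i<k. f (real i / real N)) /\<^sub>R real N - integral {0..real k / real N} f) \<le> e" .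
  qed
qed

text \<open>Uniform convergence of functions on the grids of points k / N. It is stable under
  products and implies convergence of averages, so it carries the Riemann sums over to the Gram
  matrices.\<close>

definition grid_close :: "(nat \<Rightarrow> nat \<Rightarrow> 'a::real_normed_vector) \<Rightarrow> (real \<Rightarrow> 'a) \<Rightarrow> bool" where
  "grid_close g G \<longleftrightarrow> (\<forall>e>0. \<forall>\<^sub>F N in sequentially. \<forall>k\<le>N. norm (g N k - G (real k / real N)) \<le> e)"

lemma grid_close_self: "grid_close (\<lambda>N k. G (real k / real N)) G"
  by (simp add: grid_close_def less_imp_le)

lemma grid_close_sum_tendsto:
  fixes G :: "real \<Rightarrow> 'a::euclidean_space"
  assumes g: "grid_close g G" and G: "continuous_on {0..1} G"
  shows "(\<lambda>N. (\<Sum>k<N. g N k) /\<^sub>R real N) \<longlonglongrightarrow> integral {0..1} G"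
proof (rule LIMSEQ_I)
  fix e :: real assume e: "0 < e"
  have e4: "0 < e / 4" using e by simp
  have "\<forall>\<^sub>F N in sequentially. norm ((\<Sum>k<N. g N k) /\<^sub>R real N - integral {0..1} G) < e"
    using g[unfolded grid_close_def, rule_format, OF e4] riemann_sum_uniform[OF G e4] eventually_gt_at_top[of 0]
  proof eventually_elim
    case (elim N)
    have n1: "norm ((\<Sum>i<N. G (real i / real N)) /\<^sub>R real N - integral {0..1} G) \<le> e / 4"
      using elim(2) elim(3) by (auto dest: spec[of _ N])
    have "norm ((\<Sum>k<N. g N k) /\<^sub>R real N - (\<Sum>i<N. G (real i / real N)) /\<^sub>R real N)
      = norm (\<Sum>k<N. g N k - G (real k / real N)) / real N"
      by (simp add: sum_subtractf scaleR_diff_right[symmetric] divide_inverse mult.commute)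
    also have "\<dots> \<le> (\<Sum>k<N. e / 4) / real N"
      using elim(1) by (intro divide_right_mono sum_norm_le) auto
    also have "\<dots> = e / 4" using elim(3) by simp
    finally have "norm ((\<Sum>k<N. g N k) /\<^sub>R real N - (\<Sum>i<N. G (real i / real N)) /\<^sub>R real N) \<le> e / 4" .
    from norm_diff_triangle_le[OF this n1] show ?case using e by simp
  qed
  then show "\<exists>no. \<forall>n\<ge>no. norm ((\<Sum>k<n. g n k) /\<^sub>R real n - integral {0..1} G) < e"
    by (simp add: eventually_sequentially)
qed

lemma grid_close_integral:
  fixes f :: "real \<Rightarrow> real"
  assumes "continuous_on {0..1} f"
  shows "grid_close (\<lambda>N k. (\<Sum>i<k. f (real i / real N)) / real N) (\<lambda>r. integral {0..r} f)"
  unfolding grid_close_def using riemann_sum_uniform[OF assms] by (simp add: divide_inverse mult.commute)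

lemma grid_close_cmult:
  fixes g :: "nat \<Rightarrow> nat \<Rightarrow> real"
  assumes "grid_close g G"
  shows "grid_close (\<lambda>N k. c * g N k) (\<lambda>r. c * G r)"
  unfolding grid_close_def
proof (intro allI impI)
  fix e :: real assume "0 < e"
  then have "0 < e / (\<bar>c\<bar> + 1)" by simp
  with assms have "\<forall>\<^sub>F N in sequentially. \<forall>k\<le>N. norm (g N k - G (real k / real N)) \<le> e / (\<bar>c\<bar> + 1)"
    unfolding grid_close_def by blast
  then show "\<forall>\<^sub>F N in sequentially. \<forall>k\<le>N. norm (c * g N k - c * G (real k / real N)) \<le> e"
  proof (rule eventually_mono, intro allI impI)
    fix N k assume "\<forall>k\<le>N. norm (g N k - G (real k / real N)) \<le> e / (\<bar>c\<bar> + 1)" "k \<le> N"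
    then have "\<bar>g N k - G (real k / real N)\<bar> \<le> e / (\<bar>c\<bar> + 1)" by simp
    then have "\<bar>c\<bar> * \<bar>g N k - G (real k / real N)\<bar> \<le> (\<bar>c\<bar> + 1) * (e / (\<bar>c\<bar> + 1))"
      by (intro mult_mono) auto
    then show "norm (c * g N k - c * G (real k / real N)) \<le> e"
      by (simp add: right_diff_distrib[symmetric] abs_mult)
  qed
qed

lemma grid_close_mult:
  fixes g h :: "nat \<Rightarrow> nat \<Rightarrow> real"
  assumes g: "grid_close g G" and h: "grid_close h H" and G: "continuous_on {0..1} G" and H: "continuous_on {0..1} H"
  shows "grid_close (\<lambda>N k. g N k * h N k) (\<lambda>r. G r * H r)"
proof -
  have "bounded (G ` {0..1})" "bounded (H ` {0..1})"
    using compact_continuous_image[OF G] compact_continuous_image[OF H] by (auto intro: compact_imp_bounded)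
  then obtain A B where A: "\<And>r. r \<in> {0..1} \<Longrightarrow> \<bar>G r\<bar> \<le> A" and B: "\<And>r. r \<in> {0..1} \<Longrightarrow> \<bar>H r\<bar> \<le> B"
    unfolding bounded_iff by (metis image_eqI real_norm_def)
  have A0: "0 \<le> A" "0 \<le> B" using A[of 0] B[of 0] by auto
  show ?thesis unfolding grid_close_def
  proof (intro allI impI)
    fix e :: real assume e: "0 < e"
    define d where "d = min 1 (e / (A + B + 1))"
    have d: "0 < d" "d \<le> 1" using e A0 by (auto simp: d_def)
    have "d \<le> e / (A + B + 1)" by (simp add: d_def)
    then have d3: "d * (A + B + 1) \<le> e" using A0 by (simp add: pos_le_divide_eq)
    show "\<forall>\<^sub>F N in sequentially. \<forall>k\<le>N. norm (g N k * h N k - G (real k / real N) * H (real k / real N)) \<le> e"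
      using g[unfolded grid_close_def, rule_format, OF d(1)] h[unfolded grid_close_def, rule_format, OF d(1)] eventually_gt_at_top[of 0]
    proof eventually_elim
      case (elim N)
      show ?case
      proof (intro allI impI)
        fix k assume k: "k \<le> N"
        let ?r = "real k / real N"
        have r: "?r \<in> {0..1}" using k elim(3) by (simp add: field_simps)
        have gd: "\<bar>g N k - G ?r\<bar> \<le> d" and hd: "\<bar>h N k - H ?r\<bar> \<le> d" using elim k by auto
        have hb: "\<bar>h N k\<bar> \<le> B + 1" using hd B[OF r] d by linarith
        have "\<bar>g N k * h N k - G ?r * H ?r\<bar> = \<bar>(g N k - G ?r) * h N k + G ?r * (h N k - H ?r)\<bar>" by (simp add: algebra_simps)
        also have "\<dots> \<le> \<bar>g N k - G ?r\<bar> * \<bar>h N k\<bar> + \<bar>G ?r\<bar> * \<bar>h N k - H ?r\<bar>"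
          by (metis abs_mult abs_triangle_ineq)
        also have "\<dots> \<le> d * (B + 1) + A * d"
          using gd hd hb A[OF r] d A0 by (intro add_mono mult_mono) auto
        also have "\<dots> \<le> e" using d3 by (simp add: algebra_simps)
        finally show "norm (g N k * h N k - G ?r * H ?r) \<le> e" by simp
      qed
    qed
  qed
qed

text \<open>Along N = n L the coarse point j / n is the grid point with index j L.\<close>

lemma grid_close_subgrid:
  assumes g: "grid_close g G" and n: "0 < n" and j: "j \<le> n"
  shows "(\<lambda>L. g (n * L) (j * L)) \<longlonglongrightarrow> G (real j / real n)"
proof (rule LIMSEQ_I)
  fix e :: real assume e: "0 < e"
  then obtain N0 where N0: "\<And>N k. N \<ge> N0 \<Longrightarrow> k \<le> N \<Longrightarrow> norm (g N k - G (real k / real N)) \<le> e / 2"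
    using g unfolding grid_close_def eventually_sequentially by (metis half_gt_zero)
  show "\<exists>no. \<forall>L\<ge>no. norm (g (n * L) (j * L) - G (real j / real n)) < e"
  proof (intro exI[of _ "max 1 N0"] allI impI)
    fix L assume L: "max 1 N0 \<le> L"
    have "N0 \<le> n * L" using L n by (metis One_nat_def Suc_leI max.bounded_iff mult_le_mono nat_mult_1 order_trans)
    moreover have "j * L \<le> n * L" using j by simp
    ultimately have "norm (g (n * L) (j * L) - G (real (j * L) / real (n * L))) \<le> e / 2" by (rule N0)
    moreover have "real (j * L) / real (n * L) = real j / real n" using L n by simp
    ultimately show "norm (g (n * L) (j * L) - G (real j / real n)) < e" using e by simp
  qed
qed

lemma outer_square_vector_nth: "outer_square (vector [a, b, c]) $ i $ j = vector [a, b, c] $ i * vector [a, b, c] $ j"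
  by (simp add: outer_square_def)

lemma continuous_outer_square:
  assumes "continuous_on S X" "continuous_on S Y"
  shows "continuous_on S (\<lambda>r. outer_square (vector [1, X r, Y r]))"
proof -
  have "continuous_on S (\<lambda>r. (vector [1, X r, Y r] :: real ^ 3) $ i)" for i
    using exhaust_3[of i] assms by auto
  then show ?thesis unfolding outer_square_def by (intro continuous_on_vec_lambda continuous_on_mult)
qed

text \<open>The outer squares converge entrywise by stability under products; their averages tend to
  the Henstock--Kurzweil integral, which is the Lebesgue integral as the limit is
  continuous.\<close>

lemma gram_tendsto:
  assumes x: "grid_close x X" and y: "grid_close y Y" and X: "continuous_on {0..1} X" and Y: "continuous_on {0..1} Y"
  shows "(\<lambda>N. gram N (x N) (y N)) \<longlonglongrightarrow> (LBINT r:{0..1}. outer_square (vector [1, X r, Y r]))"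
proof -
  let ?v = "\<lambda>N k. vector [1, x N k, y N k] :: real ^ 3" and ?V = "\<lambda>r. vector [1, X r, Y r] :: real ^ 3"
  have c1: "grid_close (\<lambda>N k. 1 :: real) (\<lambda>r. 1)" by (simp add: grid_close_def less_imp_le)
  have v: "grid_close (\<lambda>N k. ?v N k $ i) (\<lambda>r. ?V r $ i)" "continuous_on {0..1} (\<lambda>r. ?V r $ i)" for i
    using exhaust_3[of i] x y c1 X Y by auto
  have ent: "grid_close (\<lambda>N k. ?v N k $ i * ?v N k $ j) (\<lambda>r. ?V r $ i * ?V r $ j)" for i j
    by (intro grid_close_mult v)
  have "grid_close (\<lambda>N k. outer_square (?v N k)) (\<lambda>r. outer_square (?V r))"
    unfolding grid_close_def
  proof (intro allI impI)
    fix e :: real assume e: "0 < e"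
    have "\<forall>\<^sub>F N in sequentially. \<forall>i\<in>UNIV. \<forall>j\<in>UNIV. \<forall>k\<le>N. norm (?v N k $ i * ?v N k $ j - ?V (real k / real N) $ i * ?V (real k / real N) $ j) \<le> e / 9"
      by (intro eventually_ball_finite ballI ent[unfolded grid_close_def, rule_format]) (use e in auto)
    then show "\<forall>\<^sub>F N in sequentially. \<forall>k\<le>N. norm (outer_square (?v N k) - outer_square (?V (real k / real N))) \<le> e"
    proof (rule eventually_mono, intro allI impI)
      fix N k assume a: "\<forall>i\<in>UNIV. \<forall>j\<in>UNIV. \<forall>k\<le>N. norm (?v N k $ i * ?v N k $ j - ?V (real k / real N) $ i * ?V (real k / real N) $ j) \<le> e / 9" and k: "k \<le> N"
      have "norm (outer_square (?v N k) - outer_square (?V (real k / real N))) \<le> 9 * (e / 9)"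
        by (rule norm_le_entries) (use a k in \<open>simp add: outer_square_def\<close>)
      then show "norm (outer_square (?v N k) - outer_square (?V (real k / real N))) \<le> e" by simp
    qed
  qed
  from grid_close_sum_tendsto[OF this continuous_outer_square[OF X Y]]
  have "(\<lambda>N. (\<Sum>k<N. outer_square (?v N k)) /\<^sub>R real N) \<longlonglongrightarrow> integral {0..1} (\<lambda>r. outer_square (?V r))" .
  moreover have "integral {0..1} (\<lambda>r. outer_square (?V r)) = (LBINT r:{0..1}. outer_square (?V r))"
    by (intro set_borel_integral_eq_integral(2)[symmetric] borel_integrable_atLeastAtMost' continuous_outer_square X Y)
  ultimately show ?thesis by (simp add: gram_def inverse_eq_divide)
qed

section \<open>Brownian increments as a random walk\<close>

context brownian_motion
begin

text \<open>Restricted to {..<N}, so that the values lie in the space of the product measure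
  \<open>walk\<close>.\<close>

definition incr :: "real \<Rightarrow> nat \<Rightarrow> 'a \<Rightarrow> nat \<Rightarrow> real" where
  "incr T N \<omega> = (\<lambda>i\<in>{..<N}. sqrt T * (B (real (Suc i) / real N) \<omega> - B (real i / real N) \<omega>))"

lemma increment_measurable:
  assumes "i < N"
  shows "(\<lambda>\<omega>. sqrt T * (B (real (Suc i) / real N) \<omega> - B (real i / real N) \<omega>)) \<in> borel_measurable M"
proof -
  have "real (Suc i) / real N \<in> {0..1}" "real i / real N \<in> {0..1}" using assms by (auto simp: field_simps)
  then show ?thesis by (intro borel_measurable_times borel_measurable_diff random_variable) auto
qed

lemma incr_distr:
  assumes T: "0 < T" and N: "0 < N"
  shows "distr M (walk (sqrt (T / real N)) N) (incr T N) = walk (sqrt (T / real N)) N"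
proof -
  let ?s = "sqrt (T / real N)"
  let ?X = "\<lambda>i \<omega>. sqrt T * (B (real (Suc i) / real N) \<omega> - B (real i / real N) \<omega>)"
  have s0: "0 < ?s" using T N by simp
  have ind0: "indep_vars (\<lambda>_. borel) (\<lambda>i \<omega>. B (real (Suc i) / real N) \<omega> - B (real i / real N) \<omega>) {..<N}"
    by (rule independent_increments[of N "\<lambda>i. real i / real N"]) (use N in \<open>auto simp: mono_on_def divide_right_mono\<close>)
  have ind: "indep_vars (\<lambda>_. borel) ?X {..<N}"
    by (rule indep_vars_compose2[OF ind0, of "\<lambda>_. (*) (sqrt T)"]) auto
  have rv: "?X i \<in> borel_measurable M" if "i \<in> {..<N}" for i using increment_measurable that by simp
  have comp: "distr M borel (?X i) = gauss ?s" if i: "i < N" for i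
  proof -
    have "distributed M lborel (\<lambda>\<omega>. B (real (Suc i) / real N) \<omega> - B (real i / real N) \<omega>) (normal_density 0 (sqrt (real (Suc i) / real N - real i / real N)))"
      by (rule gaussian_increments) (use i N in \<open>auto simp: field_simps\<close>)
    also have "real (Suc i) / real N - real i / real N = 1 / real N" by (simp add: diff_divide_distrib[symmetric])
    finally have "distributed M lborel (\<lambda>\<omega>. B (real (Suc i) / real N) \<omega> - B (real i / real N) \<omega>) (normal_density 0 (sqrt (1 / real N)))" .
    from normal_density_affine[OF this, of "sqrt T" 0] T N
    have "distributed M lborel (?X i) (normal_density 0 ?s)" by (simp add: real_sqrt_divide)
    from distributed_distr_eq_density[OF this] have "distr M lborel (?X i) = gauss ?s" by (simp add: gauss_def)
    moreover have "distr M borel (?X i) = distr M lborel (?X i)" by (rule distr_cong) auto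
    ultimately show ?thesis by simp
  qed
  have "distr M (PiM {..<N} (\<lambda>_. borel)) (\<lambda>\<omega>. \<lambda>i\<in>{..<N}. ?X i \<omega>) = PiM {..<N} (\<lambda>i. distr M borel (?X i))"
    using indep_vars_iff_distr_eq_PiM'[of "{..<N}" ?X "\<lambda>_. borel"] ind rv N by auto
  also have "\<dots> = walk ?s N" unfolding walk_def by (intro PiM_cong refl) (rule comp, simp)
  finally have "distr M (PiM {..<N} (\<lambda>_. borel)) (incr T N) = walk ?s N" by (simp add: incr_def[abs_def])
  moreover have "distr M (PiM {..<N} (\<lambda>_. borel)) (incr T N) = distr M (walk ?s N) (incr T N)"
    by (rule distr_cong) (auto simp: sets_walk)
  ultimately show ?thesis by simp
qed

lemma incr_measurable: "incr T N \<in> measurable M (walk s N)"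
proof -
  have "incr T N \<in> measurable M (PiM {..<N} (\<lambda>_. borel))"
    unfolding incr_def[abs_def] by (rule measurable_restrict, rule increment_measurable) simp
  then show ?thesis by (subst measurable_cong_sets[OF refl sets_walk])
qed

lemma incr_integral:
  fixes f :: "_ \<Rightarrow> 'b::{banach, second_countable_topology}"
  assumes "0 < T" "0 < N" "f \<in> borel_measurable (walk (sqrt (T / real N)) N)"
  shows "(\<integral>\<omega>. f (incr T N \<omega>) \<partial>M) = (\<integral>x. f x \<partial>walk (sqrt (T / real N)) N)"
  using integral_distr[OF incr_measurable assms(3), of T] incr_distr[OF assms(1,2)] by simp

text \<open>The value B 0 is kept, as it vanishes only almost surely.\<close>

lemma phase_incr:
  assumes "k \<le> N"
  shows "phase k (incr T N \<omega>) = sqrt T * (B (real k / real N) \<omega> - B 0 \<omega>)"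
  using assms
proof (induction k)
  case (Suc k)
  have i: "incr T N \<omega> k = sqrt T * (B (real (Suc k) / real N) \<omega> - B (real k / real N) \<omega>)"
    using Suc.prems by (simp add: incr_def)
  have IH: "phase k (incr T N \<omega>) = sqrt T * (B (real k / real N) \<omega> - B 0 \<omega>)" using Suc by simp
  show ?case unfolding phase_Suc i IH by (simp add: algebra_simps del: of_nat_Suc)
qed (simp add: phase_def)

text \<open>On paths that start at 0 this is the left Riemann sum, up to time k / N, of the second
  entry of \<open>I_tilde\<close>. Being a function of finitely many increments it is
  measurable.\<close>

definition xgrid :: "real \<Rightarrow> nat \<Rightarrow> nat \<Rightarrow> 'a \<Rightarrow> real" where
  "xgrid T N k \<omega> = sqrt T / real N * xpath k (incr T N \<omega>)"

definition ygrid :: "real \<Rightarrow> nat \<Rightarrow> nat \<Rightarrow> 'a \<Rightarrow> real" where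
  "ygrid T N k \<omega> = sqrt T / real N * ypath k (incr T N \<omega>)"

definition xlim :: "real \<Rightarrow> real \<Rightarrow> 'a \<Rightarrow> real" where
  "xlim T r \<omega> = sqrt T * integral {0..r} (\<lambda>s. sin (sqrt T * B s \<omega>))"

definition ylim :: "real \<Rightarrow> real \<Rightarrow> 'a \<Rightarrow> real" where
  "ylim T r \<omega> = sqrt T * - integral {0..r} (\<lambda>s. cos (sqrt T * B s \<omega>))"

definition good :: "'a \<Rightarrow> bool" where
  "good \<omega> \<longleftrightarrow> B 0 \<omega> = 0 \<and> continuous_on {0..1} (\<lambda>t. B t \<omega>)"

lemma AE_good: "AE \<omega> in M. good \<omega>"
  using start continuous_paths unfolding good_def by eventually_elim simp

lemma grid_measurable:
  assumes "k \<le> N"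
  shows "xgrid T N k \<in> borel_measurable M" "ygrid T N k \<in> borel_measurable M"
  unfolding xgrid_def[abs_def] ygrid_def[abs_def]
  by (intro borel_measurable_times borel_measurable_const measurable_compose[OF incr_measurable[of T N 1]] path_measurable; use assms in simp)+

lemma good_grid_close:
  assumes "good \<omega>"
  shows "grid_close (\<lambda>N k. xgrid T N k \<omega>) (\<lambda>r. xlim T r \<omega>)" "grid_close (\<lambda>N k. ygrid T N k \<omega>) (\<lambda>r. ylim T r \<omega>)"
    "continuous_on {0..1} (\<lambda>r. xlim T r \<omega>)" "continuous_on {0..1} (\<lambda>r. ylim T r \<omega>)"
proof -
  have B0: "B 0 \<omega> = 0" and Bc: "continuous_on {0..1} (\<lambda>t. B t \<omega>)" using assms by (auto simp: good_def)
  have cs: "continuous_on {0..1} (\<lambda>s. sin (sqrt T * B s \<omega>))" "continuous_on {0..1} (\<lambda>s. cos (sqrt T * B s \<omega>))"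
    by (intro continuous_intros Bc)+
  have gc: "grid_close g G" if g: "grid_close f G" "\<And>N k. k \<le> N \<Longrightarrow> g N k = f N k" for f g :: "nat \<Rightarrow> nat \<Rightarrow> real" and G
    using g(1) unfolding grid_close_def by (simp add: g(2))
  show "grid_close (\<lambda>N k. xgrid T N k \<omega>) (\<lambda>r. xlim T r \<omega>)"
    unfolding xlim_def
    by (rule gc[OF grid_close_cmult[OF grid_close_integral[OF cs(1)], of "sqrt T"]])
       (auto simp: xgrid_def xpath_def phase_incr B0)
  show "grid_close (\<lambda>N k. ygrid T N k \<omega>) (\<lambda>r. ylim T r \<omega>)"
    unfolding ylim_def
    using gc[OF grid_close_cmult[OF grid_close_integral[OF cs(2)], of "- sqrt T"], of "\<lambda>N k. ygrid T N k \<omega>"]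
    by (auto simp: ygrid_def ypath_def phase_incr B0)
  show "continuous_on {0..1} (\<lambda>r. xlim T r \<omega>)" "continuous_on {0..1} (\<lambda>r. ylim T r \<omega>)"
    unfolding xlim_def ylim_def
    by (intro continuous_intros indefinite_integral_continuous_1 integrable_continuous_real cs)+
qed

lemma good_C_tilde:
  assumes "good \<omega>"
  shows "(\<lambda>N. gram N (\<lambda>k. xgrid T N k \<omega>) (\<lambda>k. ygrid T N k \<omega>)) \<longlonglongrightarrow> C_tilde B T \<omega>"
proof -
  have Bc: "continuous_on {0..1} (\<lambda>t. B t \<omega>)" using assms by (auto simp: good_def)
  have e: "I_tilde B T r \<omega> = vector [1, xlim T r \<omega>, ylim T r \<omega>]" if "r \<in> {0..1}" for r
  proof -
    have "continuous_on {0..r} (\<lambda>t. B t \<omega>)" using that by (intro continuous_on_subset[OF Bc]) auto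
    then have "set_integrable lborel {0..r} (\<lambda>s. sin (sqrt T * B s \<omega>))" "set_integrable lborel {0..r} (\<lambda>s. cos (sqrt T * B s \<omega>))"
      by (auto intro!: borel_integrable_atLeastAtMost' continuous_intros)
    then show ?thesis
      by (simp add: I_tilde_def xlim_def ylim_def set_borel_integral_eq_integral)
  qed
  have "C_tilde B T \<omega> = (LBINT r:{0..1}. outer_square (vector [1, xlim T r \<omega>, ylim T r \<omega>]))"
    unfolding C_tilde_def by (rule set_lebesgue_integral_cong) (auto simp: e)
  then show ?thesis using gram_tendsto[OF good_grid_close[OF assms]] by simp
qed

end

section \<open>Uniform inverse moments\<close>

lemma block_p_le_1: "block_p \<le> 1"
proof -
  have c: "0 < block_c" "block_c \<le> 1" by (simp_all add: block_c_def)
  have "1 \<le> (48 :: real) * exp 1" using exp_ge_add_one_self[of 1] by simp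
  moreover have "0 \<le> 32 * fact 8 * exp (24::real)" by simp
  ultimately have K: "1 \<le> block_K" unfolding block_K_def by linarith
  have "block_c\<^sup>2 \<le> 1" using c by (simp add: power_le_one)
  then show ?thesis unfolding block_p_def using K by (simp add: divide_le_eq)
qed

lemma power_mean_le:
  fixes x :: "nat \<Rightarrow> real"
  assumes N: "0 < N" and x: "\<And>k. 0 \<le> x k"
  shows "((\<Sum>k<N. x k) / real N) ^ p \<le> (\<Sum>k<N. x k ^ p) / real N"
proof -
  have c: "convex_on {0..} (\<lambda>x::real. x ^ p)" 
    by (cases "even p") (auto intro: convex_power_odd convex_on_subset[OF convex_power_even])
  have "(\<Sum>k<N. (1 / real N) *\<^sub>R x k) ^ p \<le> (\<Sum>k<N. (1 / real N) * x k ^ p)"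
    by (rule convex_on_sum[OF _ _ c]) (use N x in auto)
  then show ?thesis by (simp add: sum_divide_distrib)
qed

lemma norm_outer_square_le: "norm (outer_square (vector [1, x, y])) \<le> 9 * (1 + x\<^sup>2 + y\<^sup>2)"
proof (rule norm_le_entries)
  fix i j :: 3
  let ?v = "vector [1, x, y] :: real ^ 3"
  have v: "(?v $ i)\<^sup>2 \<le> 1 + x\<^sup>2 + y\<^sup>2" for i using exhaust_3[of i] by auto
  have "\<bar>?v $ i * ?v $ j\<bar> \<le> ((?v $ i)\<^sup>2 + (?v $ j)\<^sup>2) / 2"
  proof -
    have "\<bar>a * b\<bar> \<le> (a\<^sup>2 + b\<^sup>2) / 2" for a b :: real
      using zero_le_power2[of "a + b"] zero_le_power2[of "a - b"] by (simp add: abs_le_iff power2_sum power2_diff)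
    then show ?thesis .
  qed
  also have "\<dots> \<le> ((1 + x\<^sup>2 + y\<^sup>2) + (1 + x\<^sup>2 + y\<^sup>2)) / 2"
    by (intro divide_right_mono add_mono v) simp
  finally show "\<bar>outer_square ?v $ i $ j\<bar> \<le> 1 + x\<^sup>2 + y\<^sup>2"
    unfolding outer_square_vector_nth by simp
qed

lemma three_power_le:
  fixes a b :: real
  assumes "0 \<le> a" "0 \<le> b"
  shows "(1 + a + b) ^ p \<le> 3 ^ p * (1 + a ^ p + b ^ p)"
proof -
  define m where "m = max 1 (max a b)"
  have m: "0 \<le> m" "m ^ p \<le> 1 + a ^ p + b ^ p" using assms by (auto simp: m_def max_def)
  have "(1 + a + b) ^ p \<le> (3 * m) ^ p" using assms by (intro power_mono) (auto simp: m_def)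
  also have "\<dots> \<le> 3 ^ p * (1 + a ^ p + b ^ p)" unfolding power_mult_distrib using m by (intro mult_left_mono) auto
  finally show ?thesis .
qed

text \<open>Jensen for the average over k. The 27 is 9 from the matrix entries times 3 from the
  three summands 1, X^2 and Y^2.\<close>

lemma norm_gram_power_le:
  assumes N: "0 < N"
  shows "norm (gram N X Y) ^ p \<le> 27 ^ p * (\<Sum>k<N. 1 + X k ^ (2 * p) + Y k ^ (2 * p)) / real N"
proof -
  have "norm (gram N X Y) \<le> (\<Sum>k<N. 9 * (1 + (X k)\<^sup>2 + (Y k)\<^sup>2)) / real N"
  proof -
    have "norm (\<Sum>k<N. outer_square (vector [1, X k, Y k])) \<le> (\<Sum>k<N. 9 * (1 + (X k)\<^sup>2 + (Y k)\<^sup>2))"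
      by (intro sum_norm_le norm_outer_square_le)
    from divide_right_mono[OF this, of "real N"] show ?thesis unfolding gram_def norm_scaleR by simp
  qed
  then have "norm (gram N X Y) ^ p \<le> ((\<Sum>k<N. 9 * (1 + (X k)\<^sup>2 + (Y k)\<^sup>2)) / real N) ^ p" by (intro power_mono) auto
  also have "\<dots> \<le> (\<Sum>k<N. (9 * (1 + (X k)\<^sup>2 + (Y k)\<^sup>2)) ^ p) / real N"
    by (rule power_mean_le[OF N]) auto
  also have "\<dots> \<le> (\<Sum>k<N. 27 ^ p * (1 + X k ^ (2 * p) + Y k ^ (2 * p))) / real N"
  proof (intro divide_right_mono sum_mono)
    fix k
    have "(9 * (1 + (X k)\<^sup>2 + (Y k)\<^sup>2)) ^ p = 9 ^ p * (1 + (X k)\<^sup>2 + (Y k)\<^sup>2) ^ p" by (rule power_mult_distrib)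
    also have "\<dots> \<le> 9 ^ p * (3 ^ p * (1 + ((X k)\<^sup>2) ^ p + ((Y k)\<^sup>2) ^ p))" by (intro mult_left_mono three_power_le) auto
    also have "\<dots> = 27 ^ p * (1 + X k ^ (2 * p) + Y k ^ (2 * p))"
      by (simp add: power_mult power_mult_distrib[symmetric] mult.assoc[symmetric])
    finally show "(9 * (1 + (X k)\<^sup>2 + (Y k)\<^sup>2)) ^ p \<le> 27 ^ p * (1 + X k ^ (2 * p) + Y k ^ (2 * p))" .
  qed simp
  finally show ?thesis by (simp only: sum_distrib_left)
qed

lemma outer_square_measurable:
  assumes "f \<in> borel_measurable M" "g \<in> borel_measurable M"
  shows "(\<lambda>\<omega>. outer_square (vector [1, f \<omega>, g \<omega>])) \<in> borel_measurable M"
proof -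
  have "continuous_on UNIV (\<lambda>z :: real \<times> real. outer_square (vector [1, fst z, snd z]))"
    by (intro continuous_outer_square continuous_intros)
  then have m: "(\<lambda>z :: real \<times> real. outer_square (vector [1, fst z, snd z])) \<in> borel_measurable borel"
    by (rule borel_measurable_continuous_onI)
  have "(\<lambda>\<omega>. (f \<omega>, g \<omega>)) \<in> borel_measurable M" using assms by (intro borel_measurable_Pair)
  from measurable_compose[OF this m] show ?thesis by simp
qed

lemma gram_measurable:
  assumes "\<And>k. k < N \<Longrightarrow> f k \<in> borel_measurable M" "\<And>k. k < N \<Longrightarrow> g k \<in> borel_measurable M"
  shows "(\<lambda>\<omega>. gram N (\<lambda>k. f k \<omega>) (\<lambda>k. g k \<omega>)) \<in> borel_measurable M"
  unfolding gram_def using assms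
  by (intro borel_measurable_scaleR borel_measurable_const borel_measurable_sum outer_square_measurable) auto

lemma det_measurable: "(det :: real ^ 3 ^ 3 \<Rightarrow> real) \<in> borel_measurable borel"
  by (intro borel_measurable_continuous_onI continuous_det continuous_on_id)

text \<open>Half of the decay rate absorbs the polynomial factor; the other half leaves a geometric
  series with ratio sqrt r.\<close>

lemma summable_power_geometric:
  fixes r :: real
  assumes r: "0 \<le> r" "r < 1"
  shows "summable (\<lambda>n. real (Suc n) ^ k * r ^ n)"
proof (cases "r = 0")
  case True
  then show ?thesis by (intro summable_finite[of "{0}"]) auto
next
  case False
  define a where "a = - ln r / 2"
  have r0: "0 < r" using False r by simp
  have a0: "0 < a" using r0 r by (simp add: a_def)
  have ear: "exp a * r = sqrt r"
  proof -
    have "exp a * exp (ln r) = exp (ln r / 2)" unfolding exp_add[symmetric] by (simp add: a_def)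
    also have "exp (ln r / 2) = sqrt r"
    proof -
      have "ln r / 2 = ln (sqrt r)" using r0 by (simp add: ln_sqrt)
      then show ?thesis using exp_ln[of "sqrt r"] r0 by (simp only: real_sqrt_gt_zero)
    qed
    finally show ?thesis using r0 by simp
  qed
  show ?thesis
  proof (rule summable_comparison_test')
    show "summable (\<lambda>n. fact k / a ^ k * exp a * (exp a * r) ^ n)"
      unfolding ear by (intro summable_mult summable_geometric) (use r r0 in auto)
    fix n
    have "(a * real (Suc n)) ^ k \<le> fact k * exp (a * real (Suc n))" by (rule power_le_fact_exp) (use a0 in auto)
    then have "a ^ k * real (Suc n) ^ k \<le> fact k * exp (a * real (Suc n))" by (simp only: power_mult_distrib)
    then have "real (Suc n) ^ k \<le> (fact k * exp (a * real (Suc n))) / a ^ k"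
      using a0 by (subst pos_le_divide_eq) (simp_all add: mult.commute del: of_nat_Suc)
    then have "real (Suc n) ^ k \<le> fact k / a ^ k * exp (a * real (Suc n))" by simp
    also have "exp (a * real (Suc n)) = exp a * exp a ^ n"
      by (simp add: exp_of_nat_mult[symmetric] exp_add[symmetric] algebra_simps)
    finally have "real (Suc n) ^ k * r ^ n \<le> fact k / a ^ k * (exp a * exp a ^ n) * r ^ n"
      using r by (intro mult_right_mono) auto
    then show "norm (real (Suc n) ^ k * r ^ n) \<le> fact k / a ^ k * exp a * (exp a * r) ^ n"
      using r by (simp add: power_mult_distrib mult_ac del: of_nat_Suc)
  qed
qed

section \<open>Moments of the matrix and of its inverse determinant, uniformly in T\<close>

context brownian_motion
begin

definition CN :: "real \<Rightarrow> nat \<Rightarrow> 'a \<Rightarrow> real ^ 3 ^ 3" where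
  "CN T N \<omega> = gram N (\<lambda>k. xgrid T N k \<omega>) (\<lambda>k. ygrid T N k \<omega>)"

text \<open>A measurable version of \<open>C_tilde\<close>, which need not be measurable off the almost sure event
  of continuous paths.\<close>

definition Cm :: "real \<Rightarrow> 'a \<Rightarrow> real ^ 3 ^ 3" where
  "Cm T \<omega> = lim (\<lambda>N. CN T N \<omega>)"

lemma CN_measurable [measurable]: "CN T N \<in> borel_measurable M"
  unfolding CN_def[abs_def] by (intro gram_measurable grid_measurable) auto

lemma Cm_measurable [measurable]: "Cm T \<in> borel_measurable M"
  unfolding Cm_def[abs_def] by (intro borel_measurable_lim_metric CN_measurable)

lemma good_CN_tendsto: "good \<omega> \<Longrightarrow> (\<lambda>N. CN T N \<omega>) \<longlonglongrightarrow> Cm T \<omega>" "good \<omega> \<Longrightarrow> Cm T \<omega> = C_tilde B T \<omega>"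
proof -
  assume "good \<omega>"
  then have l: "(\<lambda>N. CN T N \<omega>) \<longlonglongrightarrow> C_tilde B T \<omega>" unfolding CN_def by (rule good_C_tilde)
  then show "Cm T \<omega> = C_tilde B T \<omega>" unfolding Cm_def by (rule limI)
  then show "(\<lambda>N. CN T N \<omega>) \<longlonglongrightarrow> Cm T \<omega>" using l by simp
qed

text \<open>Fatou: the condition det < \<delta> is open, so its indicator at the limit matrix is at
  most the lower limit of the indicators along the grids. The grid sizes n (7 m) are those that
  split into n blocks of seven equal parts.\<close>

lemma Cm_det_tail:
  assumes n: "0 < n" and T: "1 \<le> T"
  shows "emeasure M {\<omega> \<in> space M. det (Cm T \<omega>) < block_c / 12 / real n ^ 8} \<le> ennreal ((1 - block_p) ^ n)"
proof -
  define \<delta> where "\<delta> = block_c / 12 / real n ^ 8"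
  define Nm where "Nm = (\<lambda>m. n * (7 * m))"
  have Nlim: "filterlim Nm at_top sequentially"
    unfolding Nm_def using n by (intro filterlim_subseq) (auto simp: strict_mono_def)
  note [measurable] = det_measurable
  let ?A = "\<lambda>D. {\<omega> \<in> space M. det (D \<omega>) < \<delta>}"
  have "emeasure M (?A (Cm T)) = (\<integral>\<^sup>+\<omega>. indicator (?A (Cm T)) \<omega> \<partial>M)" by simp
  also have "\<dots> \<le> (\<integral>\<^sup>+\<omega>. liminf (\<lambda>m. indicator (?A (CN T (Nm m))) \<omega>) \<partial>M)"
  proof (rule nn_integral_mono_AE)
    show "AE \<omega> in M. indicator (?A (Cm T)) \<omega> \<le> liminf (\<lambda>m. indicator (?A (CN T (Nm m))) \<omega> :: ennreal)"
      using AE_good AE_space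
    proof eventually_elim
      case (elim \<omega>)
      show ?case
      proof (cases "det (Cm T \<omega>) < \<delta>")
        case True
        have "(\<lambda>m. CN T (Nm m) \<omega>) \<longlonglongrightarrow> Cm T \<omega>"
          using good_CN_tendsto(1)[OF elim(1)] Nlim by (rule filterlim_compose)
        moreover have "isCont det (Cm T \<omega>)"
          using continuous_det[of UNIV "\<lambda>x. x"] by (simp add: continuous_on_eq_continuous_at)
        ultimately have "(\<lambda>m. det (CN T (Nm m) \<omega>)) \<longlonglongrightarrow> det (Cm T \<omega>)" by (rule isCont_tendsto_compose[rotated])
        then have "\<forall>\<^sub>F m in sequentially. det (CN T (Nm m) \<omega>) < \<delta>" using True by (rule order_tendstoD(2))
        then have "\<forall>\<^sub>F m in sequentially. (1 :: ennreal) \<le> indicator (?A (CN T (Nm m))) \<omega>"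
          by (rule eventually_mono) (use elim in simp)
        then have "1 \<le> liminf (\<lambda>m. indicator (?A (CN T (Nm m))) \<omega> :: ennreal)" by (rule Liminf_bounded)
        then show ?thesis by (auto simp: indicator_def)
      qed simp
    qed
  qed
  also have "\<dots> \<le> liminf (\<lambda>m. \<integral>\<^sup>+\<omega>. indicator (?A (CN T (Nm m))) \<omega> \<partial>M)"
    by (rule nn_integral_liminf) measurable
  also have "\<dots> \<le> liminf (\<lambda>m. ennreal ((1 - block_p) ^ n))"
  proof (rule Liminf_mono)
    have "filterlim (\<lambda>m. real (Nm m)) at_top sequentially"
      using filterlim_real_sequentially Nlim by (rule filterlim_compose)
    then have "\<forall>\<^sub>F m in sequentially. T \<le> real (Nm m)" by (simp add: filterlim_at_top)
    then show "\<forall>\<^sub>F m in sequentially. (\<integral>\<^sup>+\<omega>. indicator (?A (CN T (Nm m))) \<omega> \<partial>M) \<le> ennreal ((1 - block_p) ^ n)"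
      using eventually_gt_at_top[of 0]
    proof eventually_elim
      case (elim m)
      let ?N = "Nm m" and ?s = "sqrt (T / real (Nm m))"
      have N0: "0 < ?N" using n elim by (simp add: Nm_def)
      have T0: "0 < T" using T by simp
      let ?S = "{x \<in> space (walk ?s ?N). det (gram ?N (\<lambda>k. sqrt T / real ?N * xpath k x) (\<lambda>k. sqrt T / real ?N * ypath k x)) < \<delta>}"
      have gm: "(\<lambda>x. gram ?N (\<lambda>k. sqrt T / real ?N * xpath k x) (\<lambda>k. sqrt T / real ?N * ypath k x)) \<in> borel_measurable (walk ?s ?N)"
        by (rule gram_measurable) auto
      have Sm: "?S \<in> sets (walk ?s ?N)"
        by (rule borel_measurable_less[OF measurable_compose[OF gm det_measurable]]) simp
      have eqA: "?A (CN T ?N) = incr T ?N -` ?S \<inter> space M"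
        using measurable_space[OF incr_measurable[of T ?N ?s]] by (auto simp: CN_def xgrid_def ygrid_def)
      have "(\<integral>\<^sup>+\<omega>. indicator (?A (CN T ?N)) \<omega> \<partial>M) = emeasure M (?A (CN T ?N))" by simp
      also have "\<dots> = emeasure M (incr T ?N -` ?S \<inter> space M)" unfolding eqA ..
      also have "\<dots> = emeasure (distr M (walk ?s ?N) (incr T ?N)) ?S"
        using Sm by (simp add: emeasure_distr incr_measurable)
      also have "\<dots> = emeasure (walk ?s ?N) ?S" by (simp add: incr_distr[OF T0 N0])
      also have "\<dots> = ennreal (measure (walk ?s ?N) ?S)"
      proof -
        interpret W: prob_space "walk ?s ?N" by (rule prob_space_walk) (use T0 N0 in simp)
        show ?thesis by (rule W.emeasure_eq_measure)
      qed
      also have "\<dots> \<le> ennreal ((1 - block_p) ^ n)"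
        unfolding \<delta>_def using walk_det_small_prob[OF n elim(2) T _ refl] elim(1) by (intro ennreal_leI) (simp add: Nm_def)
      finally show ?case .
    qed
  qed
  also have "\<dots> = ennreal ((1 - block_p) ^ n)" by (rule Liminf_const) simp
  finally show ?thesis unfolding \<delta>_def .
qed

text \<open>The increment bound from time 0 with H = 1, which is admissible because T \<ge> 1 and
  the whole time span is at most 1.\<close>

lemma grid_moment:
  assumes T: "1 \<le> T" "T \<le> real N" and k: "k \<le> N"
  shows "(\<integral>\<omega>. \<bar>xgrid T N k \<omega>\<bar> ^ p \<partial>M) \<le> 2 * fact p * exp 24" "(\<integral>\<omega>. \<bar>ygrid T N k \<omega>\<bar> ^ p \<partial>M) \<le> 2 * fact p * exp 24"
proof -
  have T0: "0 < T" and N0: "0 < N" using T by (auto intro: Nat.gr0I)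
  let ?s = "sqrt (T / real N)"
  have s0: "0 < ?s" using T0 N0 by simp
  have H: "(real k - real 0) / real N \<le> 1" "1 / T \<le> 1" using T k N0 by auto
  have "(\<integral>\<omega>. \<bar>xgrid T N k \<omega>\<bar> ^ p \<partial>M) = (\<integral>x. \<bar>sqrt T / real N * xpath k x\<bar> ^ p \<partial>walk ?s N)"
    unfolding xgrid_def by (rule incr_integral[OF T0 N0], intro borel_measurable_power borel_measurable_abs borel_measurable_times borel_measurable_const path_measurable) (use k in simp)
  also have "\<dots> = (\<integral>x. \<bar>sqrt T / real N * Re ((- \<i>) * (\<Sum>j\<in>{0..<k}. cis (phase j x)))\<bar> ^ p \<partial>walk ?s N)"
    by (simp add: xpath_def times_complex.sel Im_sum atLeast0LessThan)
  also have "\<dots> \<le> 2 * fact p * exp 24 * (sqrt 1) ^ p"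
    by (rule walk_increment_moment[OF T0 T(2) refl _ _ k H]) auto
  finally show "(\<integral>\<omega>. \<bar>xgrid T N k \<omega>\<bar> ^ p \<partial>M) \<le> 2 * fact p * exp 24" by simp
  have "(\<integral>\<omega>. \<bar>ygrid T N k \<omega>\<bar> ^ p \<partial>M) = (\<integral>x. \<bar>sqrt T / real N * ypath k x\<bar> ^ p \<partial>walk ?s N)"
    unfolding ygrid_def by (rule incr_integral[OF T0 N0], intro borel_measurable_power borel_measurable_abs borel_measurable_times borel_measurable_const path_measurable) (use k in simp)
  also have "\<dots> = (\<integral>x. \<bar>sqrt T / real N * Re ((- 1) * (\<Sum>j\<in>{0..<k}. cis (phase j x)))\<bar> ^ p \<partial>walk ?s N)"
    by (simp add: ypath_def Re_sum atLeast0LessThan)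
  also have "\<dots> \<le> 2 * fact p * exp 24 * (sqrt 1) ^ p"
    by (rule walk_increment_moment[OF T0 T(2) refl _ _ k H]) auto
  finally show "(\<integral>\<omega>. \<bar>ygrid T N k \<omega>\<bar> ^ p \<partial>M) \<le> 2 * fact p * exp 24" by simp
qed

lemma grid_bounded:
  assumes "k \<le> N"
  shows "\<bar>xgrid T N k \<omega>\<bar> \<le> \<bar>sqrt T / real N\<bar> * real N" "\<bar>ygrid T N k \<omega>\<bar> \<le> \<bar>sqrt T / real N\<bar> * real N"
  unfolding xgrid_def ygrid_def abs_mult
  by (intro mult_left_mono order_trans[OF path_bound(1)] order_trans[OF path_bound(2)]; use assms in simp)+

lemma grid_power_integrable:
  assumes "k \<le> N"
  shows "integrable M (\<lambda>\<omega>. xgrid T N k \<omega> ^ p)" "integrable M (\<lambda>\<omega>. ygrid T N k \<omega> ^ p)"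
proof -
  show "integrable M (\<lambda>\<omega>. xgrid T N k \<omega> ^ p)"
    by (rule integrable_const_bound[of _ "(\<bar>sqrt T / real N\<bar> * real N) ^ p"])
      (use grid_measurable[OF assms] power_mono[OF grid_bounded(1)[OF assms] abs_ge_zero, where n=p] in \<open>auto simp: power_abs\<close>)
  show "integrable M (\<lambda>\<omega>. ygrid T N k \<omega> ^ p)"
    by (rule integrable_const_bound[of _ "(\<bar>sqrt T / real N\<bar> * real N) ^ p"])
      (use grid_measurable[OF assms] power_mono[OF grid_bounded(2)[OF assms] abs_ge_zero, where n=p] in \<open>auto simp: power_abs\<close>)
qed

lemma CN_moment:
  assumes T: "1 \<le> T" "T \<le> real N"
  shows "(\<integral>\<^sup>+\<omega>. ennreal (norm (CN T N \<omega>) ^ p) \<partial>M) \<le> ennreal (27 ^ p * (1 + 4 * fact (2 * p) * exp 24))"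
proof -
  have N0: "0 < N" using T by (auto intro: Nat.gr0I)
  let ?f = "\<lambda>\<omega>. 27 ^ p * (\<Sum>k<N. 1 + xgrid T N k \<omega> ^ (2 * p) + ygrid T N k \<omega> ^ (2 * p)) / real N"
  have i: "integrable M (\<lambda>\<omega>. 1 + xgrid T N k \<omega> ^ (2 * p) + ygrid T N k \<omega> ^ (2 * p))" if "k < N" for k
    using grid_power_integrable[of k N T "2 * p"] that by simp
  have nn: "0 \<le> ?f \<omega>" for \<omega> by (intro divide_nonneg_nonneg mult_nonneg_nonneg sum_nonneg) (auto simp: power_mult)
  have "(\<integral>\<^sup>+\<omega>. ennreal (norm (CN T N \<omega>) ^ p) \<partial>M) \<le> (\<integral>\<^sup>+\<omega>. ennreal (?f \<omega>) \<partial>M)"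
    unfolding CN_def by (intro nn_integral_mono ennreal_leI norm_gram_power_le N0)
  also have "\<dots> = ennreal (\<integral>\<omega>. ?f \<omega> \<partial>M)"
    by (intro nn_integral_eq_integral integrable_divide integrable_mult_right Bochner_Integration.integrable_sum i AE_I2 nn) auto
  also have "\<dots> \<le> ennreal (27 ^ p * (1 + 4 * fact (2 * p) * exp 24))"
  proof (intro ennreal_leI)
    have "(\<integral>\<omega>. ?f \<omega> \<partial>M) = 27 ^ p * (\<Sum>k<N. \<integral>\<omega>. 1 + xgrid T N k \<omega> ^ (2 * p) + ygrid T N k \<omega> ^ (2 * p) \<partial>M) / real N"
      by (subst integral_divide_zero, subst integral_mult_right_zero, subst Bochner_Integration.integral_sum) (auto intro: i)
    also have "\<dots> \<le> 27 ^ p * (\<Sum>k<N. 1 + 4 * fact (2 * p) * exp 24) / real N"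
    proof (intro divide_right_mono mult_left_mono sum_mono)
      fix k assume "k \<in> {..<N}"
      then have k: "k \<le> N" by simp
      have "(\<integral>\<omega>. 1 + xgrid T N k \<omega> ^ (2 * p) + ygrid T N k \<omega> ^ (2 * p) \<partial>M)
        = 1 + (\<integral>\<omega>. xgrid T N k \<omega> ^ (2 * p) \<partial>M) + (\<integral>\<omega>. ygrid T N k \<omega> ^ (2 * p) \<partial>M)"
        using grid_power_integrable[OF k, of T "2 * p"] by (simp add: prob_space)
      also have "\<dots> \<le> 1 + 2 * fact (2 * p) * exp 24 + 2 * fact (2 * p) * exp 24"
        using grid_moment[OF T k, of "2 * p"] by (simp add: power_even_abs)
      finally show "(\<integral>\<omega>. 1 + xgrid T N k \<omega> ^ (2 * p) + ygrid T N k \<omega> ^ (2 * p) \<partial>M) \<le> 1 + 4 * fact (2 * p) * exp 24" by simp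
    qed auto
    also have "\<dots> = 27 ^ p * (1 + 4 * fact (2 * p) * exp 24)" using N0 by simp
    finally show "(\<integral>\<omega>. ?f \<omega> \<partial>M) \<le> 27 ^ p * (1 + 4 * fact (2 * p) * exp 24)" .
  qed
  finally show ?thesis .
qed

lemma Cm_moment:
  assumes T: "1 \<le> T"
  shows "(\<integral>\<^sup>+\<omega>. ennreal (norm (Cm T \<omega>) ^ p) \<partial>M) \<le> ennreal (27 ^ p * (1 + 4 * fact (2 * p) * exp 24))"
proof -
  have "(\<integral>\<^sup>+\<omega>. ennreal (norm (Cm T \<omega>) ^ p) \<partial>M) = (\<integral>\<^sup>+\<omega>. liminf (\<lambda>N. ennreal (norm (CN T N \<omega>) ^ p)) \<partial>M)"
  proof (rule nn_integral_cong_AE)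
    show "AE \<omega> in M. ennreal (norm (Cm T \<omega>) ^ p) = liminf (\<lambda>N. ennreal (norm (CN T N \<omega>) ^ p))"
      using AE_good
    proof eventually_elim
      case (elim \<omega>)
      have "(\<lambda>N. ennreal (norm (CN T N \<omega>) ^ p)) \<longlonglongrightarrow> ennreal (norm (Cm T \<omega>) ^ p)"
        by (intro tendsto_ennrealI tendsto_power tendsto_norm good_CN_tendsto(1)[OF elim])
      then show ?case by (intro lim_imp_Liminf[symmetric]) simp
    qed
  qed
  also have "\<dots> \<le> liminf (\<lambda>N. \<integral>\<^sup>+\<omega>. ennreal (norm (CN T N \<omega>) ^ p) \<partial>M)"
    by (rule nn_integral_liminf) measurable
  also have "\<dots> \<le> liminf (\<lambda>N. ennreal (27 ^ p * (1 + 4 * fact (2 * p) * exp 24)))"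
  proof (rule Liminf_mono)
    have "\<forall>\<^sub>F N in sequentially. T \<le> real N" using filterlim_real_sequentially by (simp add: filterlim_at_top)
    then show "\<forall>\<^sub>F N in sequentially. (\<integral>\<^sup>+\<omega>. ennreal (norm (CN T N \<omega>) ^ p) \<partial>M) \<le> ennreal (27 ^ p * (1 + 4 * fact (2 * p) * exp 24))"
      by (rule eventually_mono) (rule CN_moment[OF T])
  qed
  also have "\<dots> = ennreal (27 ^ p * (1 + 4 * fact (2 * p) * exp 24))" by (rule Liminf_const) simp
  finally show ?thesis .
qed

text \<open>At fixed T the tail bound holds for every n, and its right-hand side tends to
  zero.\<close>

lemma Cm_det_pos:
  assumes T: "1 \<le> T"
  shows "AE \<omega> in M. 0 < det (Cm T \<omega>)"
proof -
  note [measurable] = det_measurable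
  let ?A = "{\<omega> \<in> space M. \<not> 0 < det (Cm T \<omega>)}"
  have le0: "emeasure M ?A \<le> ennreal ((1 - block_p) ^ n)" if "0 < n" for n
  proof -
    have "emeasure M ?A \<le> emeasure M {\<omega> \<in> space M. det (Cm T \<omega>) < block_c / 12 / real n ^ 8}"
    proof (rule emeasure_mono)
      have "0 < block_c / 12 / real n ^ 8" using block_const_pos that by simp
      then show "?A \<subseteq> {\<omega> \<in> space M. det (Cm T \<omega>) < block_c / 12 / real n ^ 8}" by auto
    qed measurable
    also have "\<dots> \<le> ennreal ((1 - block_p) ^ n)" by (rule Cm_det_tail[OF that T])
    finally show ?thesis .
  qed
  have le: "\<forall>\<^sub>F n in sequentially. emeasure M ?A \<le> ennreal ((1 - block_p) ^ n)"
    using eventually_gt_at_top[of "0::nat"] by (rule eventually_mono) (rule le0)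
  have "(\<lambda>n. ennreal ((1 - block_p) ^ n)) \<longlonglongrightarrow> ennreal 0"
    using block_const_pos(3) block_p_le_1 by (intro tendsto_ennrealI LIMSEQ_power_zero) auto
  from tendsto_lowerbound[OF this le] have "emeasure M ?A = 0" by simp
  then show ?thesis by (subst AE_iff_measurable[OF _ refl]) auto
qed

text \<open>The outcomes are sorted into layers between consecutive thresholds \<delta> n. A layer
  costs a power of n times an exponentially small probability, and the resulting sum does not
  involve T.\<close>

lemma Cm_det_inverse_moment:
  obtains C :: real where "0 \<le> C" "\<And>T. 1 \<le> T \<Longrightarrow> (\<integral>\<^sup>+\<omega>. ennreal ((1 / det (Cm T \<omega>)) ^ q) \<partial>M) \<le> ennreal C"
proof -
  note [measurable] = det_measurable
  define \<delta> where "\<delta> n = block_c / 12 / real n ^ 8" for n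
  define a where "a = (\<lambda>n. (12 / block_c) ^ q * (real (Suc n) ^ (8 * q) * (1 - block_p) ^ n))"
  have p01: "0 \<le> 1 - block_p" "1 - block_p < 1" using block_p_le_1 block_const_pos by auto
  have c0: "0 < block_c" by (rule block_const_pos)
  have a: "summable a" "0 \<le> a n" for n
    unfolding a_def using p01 c0 by (auto intro!: summable_mult summable_power_geometric simp del: of_nat_Suc)
  have \<delta>pos: "0 < \<delta> (Suc n)" for n using c0 by (simp add: \<delta>_def)
  have \<delta>pow: "(1 / \<delta> (Suc n)) ^ q = (12 / block_c) ^ q * real (Suc n) ^ (8 * q)" for n
    by (simp add: \<delta>_def power_mult_distrib[symmetric] power_mult del: of_nat_Suc)
  show thesis
  proof (rule that[of "suminf a"])
    show "0 \<le> suminf a" using a by (intro suminf_nonneg)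
    fix T :: real assume T: "1 \<le> T"
    \<comment> \<open>Index 0 needs its own value: division by zero makes \<delta> 0 equal to 0,
      whereas the first layer has to contain all outcomes with determinant at least \<delta>
      1.\<close>
    define E where "E = (\<lambda>n. if n = 0 then space M else {\<omega> \<in> space M. det (Cm T \<omega>) < \<delta> n})"
    have Em: "E n \<in> events" for n unfolding E_def by auto
    have Ep: "emeasure M (E n) \<le> ennreal ((1 - block_p) ^ n)" for n
      using Cm_det_tail[of n T] T by (auto simp: E_def \<delta>_def emeasure_space_1)
    have "(\<integral>\<^sup>+\<omega>. ennreal ((1 / det (Cm T \<omega>)) ^ q) \<partial>M) \<le> (\<integral>\<^sup>+\<omega>. (\<Sum>n. ennreal ((1 / \<delta> (Suc n)) ^ q) * indicator (E n) \<omega>) \<partial>M)"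
    proof (rule nn_integral_mono_AE)
      show "AE \<omega> in M. ennreal ((1 / det (Cm T \<omega>)) ^ q) \<le> (\<Sum>n. ennreal ((1 / \<delta> (Suc n)) ^ q) * indicator (E n) \<omega>)"
        using Cm_det_pos[OF T] AE_space
      proof eventually_elim
        case (elim \<omega>)
        let ?D = "det (Cm T \<omega>)"
        have "(\<lambda>n. \<delta> (Suc n)) \<longlonglongrightarrow> 0"
          unfolding \<delta>_def by real_asymp
        then have "\<forall>\<^sub>F n in sequentially. \<delta> (Suc n) < ?D" using elim(1) by (rule order_tendstoD(2))
        then have ex: "\<exists>n. \<delta> (Suc n) \<le> ?D" unfolding eventually_sequentially by (meson le_refl less_imp_le)
        \<comment> \<open>Minimality puts the determinant below \<delta> m when m > 0, so the
          outcome lies in \<open>E m\<close>, while \<delta> (m + 1) bounds the determinant from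
          below.\<close>
        define m where "m = (LEAST n. \<delta> (Suc n) \<le> ?D)"
        have m: "\<delta> (Suc m) \<le> ?D" unfolding m_def using ex by (rule LeastI_ex)
        have "\<omega> \<in> E m"
        proof (cases m)
          case (Suc k)
          then have "\<not> \<delta> (Suc k) \<le> ?D" using not_less_Least[of k "\<lambda>n. \<delta> (Suc n) \<le> ?D"] by (simp add: m_def)
          then show ?thesis using elim Suc by (simp add: E_def)
        qed (use elim in \<open>simp add: E_def\<close>)
        moreover have "(1 / ?D) ^ q \<le> (1 / \<delta> (Suc m)) ^ q"
          using m \<delta>pos[of m] elim by (intro power_mono divide_left_mono) auto
        ultimately have "ennreal ((1 / ?D) ^ q) \<le> (\<Sum>n\<in>{m}. ennreal ((1 / \<delta> (Suc n)) ^ q) * indicator (E n) \<omega>)"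
          by (simp add: ennreal_leI)
        also have "\<dots> \<le> (\<Sum>n. ennreal ((1 / \<delta> (Suc n)) ^ q) * indicator (E n) \<omega>)"
          by (rule sum_le_suminf) auto
        finally show ?case .
      qed
    qed
    also have "\<dots> = (\<Sum>n. \<integral>\<^sup>+\<omega>. ennreal ((1 / \<delta> (Suc n)) ^ q) * indicator (E n) \<omega> \<partial>M)"
      by (rule nn_integral_suminf) (use Em in auto)
    also have "\<dots> = (\<Sum>n. ennreal ((1 / \<delta> (Suc n)) ^ q) * emeasure M (E n))"
      using Em by (simp add: nn_integral_cmult_indicator)
    also have "\<dots> \<le> (\<Sum>n. ennreal (a n))"
    proof (rule suminf_le)
      fix n
      have "ennreal ((1 / \<delta> (Suc n)) ^ q) * emeasure M (E n) \<le> ennreal ((1 / \<delta> (Suc n)) ^ q) * ennreal ((1 - block_p) ^ n)"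
        by (intro mult_left_mono Ep) simp
      also have "\<dots> = ennreal ((1 / \<delta> (Suc n)) ^ q * (1 - block_p) ^ n)"
        using \<delta>pos[of n] p01 by (intro ennreal_mult[symmetric]) auto
      finally show "ennreal ((1 / \<delta> (Suc n)) ^ q) * emeasure M (E n) \<le> ennreal (a n)"
        unfolding \<delta>pow a_def by (simp add: mult.assoc del: of_nat_Suc)
    qed auto
    also have "\<dots> = ennreal (suminf a)" using a by (intro suminf_ennreal2) auto
    finally show "(\<integral>\<^sup>+\<omega>. ennreal ((1 / det (Cm T \<omega>)) ^ q) \<partial>M) \<le> ennreal (suminf a)" .
  qed
qed

text \<open>The adjugate bound combined with a b \<le> a^2 + b^2, which separates the moments of the
  matrix from those of its inverse determinant.\<close>

lemma Cm_inverse_moment: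
  assumes nrm: "matrix_norm nrm"
  obtains C :: real where "0 \<le> C" "\<And>T. 1 \<le> T \<Longrightarrow> (\<integral>\<^sup>+\<omega>. ennreal (nrm (matrix_inv (Cm T \<omega>)) ^ q) \<partial>M) \<le> ennreal C"
proof -
  note [measurable] = det_measurable
  obtain K where K: "0 < K" "\<And>A. det A \<noteq> 0 \<Longrightarrow> nrm (matrix_inv A) \<le> K * ((norm A)\<^sup>2 / \<bar>det A\<bar>)"
    using nrm_inv_upper[OF nrm] by blast
  obtain C where C: "0 \<le> C" "\<And>T. 1 \<le> T \<Longrightarrow> (\<integral>\<^sup>+\<omega>. ennreal ((1 / det (Cm T \<omega>)) ^ (2 * q)) \<partial>M) \<le> ennreal C"
    by (rule Cm_det_inverse_moment) blast
  define C' where "C' = (27 :: real) ^ (4 * q) * (1 + 4 * fact (2 * (4 * q)) * exp 24)"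
  have C'0: "0 \<le> C'" by (simp add: C'_def)
  show thesis
  proof (rule that[of "K ^ q * (C' + C)"])
    show "0 \<le> K ^ q * (C' + C)" using K C C'0 by simp
    fix T :: real assume T: "1 \<le> T"
    have "(\<integral>\<^sup>+\<omega>. ennreal (nrm (matrix_inv (Cm T \<omega>)) ^ q) \<partial>M) \<le>
      (\<integral>\<^sup>+\<omega>. ennreal (K ^ q) * (ennreal (norm (Cm T \<omega>) ^ (4 * q)) + ennreal ((1 / det (Cm T \<omega>)) ^ (2 * q))) \<partial>M)"
    proof (rule nn_integral_mono_AE)
      show "AE \<omega> in M. ennreal (nrm (matrix_inv (Cm T \<omega>)) ^ q) \<le> ennreal (K ^ q) * (ennreal (norm (Cm T \<omega>) ^ (4 * q)) + ennreal ((1 / det (Cm T \<omega>)) ^ (2 * q)))"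
        using Cm_det_pos[OF T]
      proof eventually_elim
        case (elim \<omega>)
        let ?D = "det (Cm T \<omega>)" and ?n = "norm (Cm T \<omega>)"
        have "nrm (matrix_inv (Cm T \<omega>)) ^ q \<le> (K * (?n\<^sup>2 / ?D)) ^ q"
          using K(2)[of "Cm T \<omega>"] elim nrm by (intro power_mono) (auto simp: matrix_norm_def)
        also have "\<dots> = K ^ q * ((?n\<^sup>2) ^ q * (1 / ?D) ^ q)" by (simp add: power_mult_distrib power_divide)
        also have "\<dots> \<le> K ^ q * (?n ^ (4 * q) + (1 / ?D) ^ (2 * q))"
        proof (intro mult_left_mono)
          have ab: "A * B \<le> A\<^sup>2 + B\<^sup>2" if "0 \<le> A" "0 \<le> B" for A B :: real
          proof -
            have "2 * (A * B) \<le> A\<^sup>2 + B\<^sup>2" using zero_le_power2[of "A - B"] by (simp add: power2_diff)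
            moreover have "0 \<le> A * B" using that by simp
            ultimately show ?thesis by linarith
          qed
          have "(?n\<^sup>2) ^ q * (1 / ?D) ^ q \<le> ((?n\<^sup>2) ^ q)\<^sup>2 + ((1 / ?D) ^ q)\<^sup>2"
            by (rule ab) (use elim in auto)
          moreover have "((?n\<^sup>2) ^ q)\<^sup>2 = ?n ^ (4 * q)"
            unfolding power_mult[symmetric] by (intro arg_cong[where f="power ?n"]) simp
          moreover have "((1 / ?D) ^ q)\<^sup>2 = (1 / ?D) ^ (2 * q)"
            unfolding power_mult[symmetric] by (intro arg_cong[where f="power (1 / ?D)"]) simp
          ultimately show "(?n\<^sup>2) ^ q * (1 / ?D) ^ q \<le> ?n ^ (4 * q) + (1 / ?D) ^ (2 * q)" by (simp only:)
        qed (use K in simp)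
        finally show ?case using K elim
          by (subst ennreal_plus[symmetric], simp, simp, subst ennreal_mult[symmetric]) (auto intro: ennreal_leI)
      qed
    qed
    also have "\<dots> = ennreal (K ^ q) * ((\<integral>\<^sup>+\<omega>. ennreal (norm (Cm T \<omega>) ^ (4 * q)) \<partial>M) + (\<integral>\<^sup>+\<omega>. ennreal ((1 / det (Cm T \<omega>)) ^ (2 * q)) \<partial>M))"
      by (subst nn_integral_cmult, measurable) (subst nn_integral_add, auto)
    also have "\<dots> \<le> ennreal (K ^ q) * (ennreal C' + ennreal C)"
      unfolding C'_def by (intro mult_left_mono add_mono Cm_moment C T) auto
    also have "\<dots> = ennreal (K ^ q * (C' + C))"
      using K C C'0 by (subst ennreal_plus[symmetric], simp, simp, subst ennreal_mult[symmetric]) auto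
    finally show "(\<integral>\<^sup>+\<omega>. ennreal (nrm (matrix_inv (Cm T \<omega>)) ^ q) \<partial>M) \<le> ennreal (K ^ q * (C' + C))" .
  qed
qed

end

section \<open>Convergence of finite-dimensional distributions\<close>

definition lin :: "nat \<Rightarrow> (nat \<Rightarrow> real) \<Rightarrow> (nat \<Rightarrow> real) \<Rightarrow> (nat \<Rightarrow> real) \<Rightarrow> (nat \<Rightarrow> real) \<Rightarrow> real" where
  "lin n a b X Y = (\<Sum>j<n. a j * X j + b j * Y j)"

lemma lin_add_cmult: "lin n (\<lambda>j. a j + g * a' j) (\<lambda>j. b j + g * b' j) X Y = lin n a b X Y + g * lin n a' b' X Y"
  by (simp add: lin_def sum.distrib sum_distrib_left algebra_simps)

lemma lin_measurable [measurable (raw)]: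
  assumes "\<And>j. X j \<in> borel_measurable M" "\<And>j. Y j \<in> borel_measurable M"
  shows "(\<lambda>\<omega>. lin n a b (\<lambda>j. X j \<omega>) (\<lambda>j. Y j \<omega>)) \<in> borel_measurable M"
  unfolding lin_def using assms by measurable

text \<open>Products of Gaussian functions of affine functionals of the path at n points.
  Exponentials of minus a nonnegative quadratic functional of these values take this form.\<close>

fun gfac :: "nat \<Rightarrow> ((nat \<Rightarrow> real) \<times> (nat \<Rightarrow> real) \<times> real) list \<Rightarrow> (nat \<Rightarrow> real) \<Rightarrow> (nat \<Rightarrow> real) \<Rightarrow> real" where
  "gfac n [] X Y = 1"
| "gfac n ((a, b, d) # fs) X Y = exp (- (lin n a b X Y + d)\<^sup>2 / 2) * gfac n fs X Y"

lemma gfac_bounds: "0 \<le> gfac n fs X Y" "gfac n fs X Y \<le> 1"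
proof (induction fs)
  case (Cons f fs)
  obtain a b d where f: "f = (a, b, d)" by (cases f)
  { case 1 show ?case using Cons by (simp add: f) }
  { case 2 show ?case using Cons mult_mono[of "exp (- (lin n a b X Y + d)\<^sup>2 / 2)" 1 "gfac n fs X Y" 1] by (simp add: f) }
qed auto

lemma gfac_measurable [measurable (raw)]:
  assumes "\<And>j. X j \<in> borel_measurable M" "\<And>j. Y j \<in> borel_measurable M"
  shows "(\<lambda>\<omega>. gfac n fs (\<lambda>j. X j \<omega>) (\<lambda>j. Y j \<omega>)) \<in> borel_measurable M"
proof (induction fs)
  case (Cons f fs)
  obtain a b d where f: "f = (a, b, d)" by (cases f)
  note [measurable] = Cons assms
  show ?case unfolding f gfac.simps by measurable
qed simp

text \<open>Hubbard--Stratonovich: \<open>exp (- x\<^sup>2 / 2)\<close> is the mean of \<open>cis (g x)\<close> over a standard Gaussian \<open>g\<close>,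
  which trades a Gaussian factor for a random linear phase.\<close>

lemma gfac_linearise:
  fixes X Y :: "nat \<Rightarrow> 'a \<Rightarrow> real"
  assumes P: "prob_space M" and XY [measurable]: "\<And>j. X j \<in> borel_measurable M" "\<And>j. Y j \<in> borel_measurable M"
  shows "(\<integral>\<omega>. cis (lin n a b (\<lambda>j. X j \<omega>) (\<lambda>j. Y j \<omega>)) * of_real (gfac n ((a', b', d) # fs) (\<lambda>j. X j \<omega>) (\<lambda>j. Y j \<omega>)) \<partial>M)
    = (\<integral>g. cis (g * d) * (\<integral>\<omega>. cis (lin n (\<lambda>j. a j + g * a' j) (\<lambda>j. b j + g * b' j) (\<lambda>j. X j \<omega>) (\<lambda>j. Y j \<omega>))
        * of_real (gfac n fs (\<lambda>j. X j \<omega>) (\<lambda>j. Y j \<omega>)) \<partial>M) \<partial>gauss 1)"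
proof -
  interpret P: prob_space M by (rule P)
  interpret G: prob_space "gauss 1" by (rule prob_space_gauss) simp
  interpret pp: pair_prob_space "gauss 1" M ..
  let ?l = "\<lambda>\<omega>. lin n a b (\<lambda>j. X j \<omega>) (\<lambda>j. Y j \<omega>)" and ?l' = "\<lambda>\<omega>. lin n a' b' (\<lambda>j. X j \<omega>) (\<lambda>j. Y j \<omega>)"
  let ?g = "\<lambda>\<omega>. gfac n fs (\<lambda>j. X j \<omega>) (\<lambda>j. Y j \<omega>)"
  let ?F = "\<lambda>g \<omega>. cis (g * d) * (cis (?l \<omega> + g * ?l' \<omega>) * of_real (?g \<omega>))"
  have [measurable]: "?l \<in> borel_measurable M" "?l' \<in> borel_measurable M" "?g \<in> borel_measurable M"
    by (intro lin_measurable gfac_measurable XY)+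
  have e: "of_real (exp (- x\<^sup>2 / 2)) = (\<integral>g. cis (x * g) \<partial>gauss 1)" for x
    using gauss_cis[of 1 x] by simp
  have "cis (?l \<omega>) * of_real (gfac n ((a', b', d) # fs) (\<lambda>j. X j \<omega>) (\<lambda>j. Y j \<omega>)) = (\<integral>g. ?F g \<omega> \<partial>gauss 1)" for \<omega>
  proof -
    have F: "?F g \<omega> = (cis (?l \<omega>) * of_real (?g \<omega>)) * cis ((?l' \<omega> + d) * g)" for g
    proof -
      have "cis (g * d) * cis (?l \<omega> + g * ?l' \<omega>) = cis (?l \<omega>) * cis ((?l' \<omega> + d) * g)"
        by (simp add: cis_mult algebra_simps)
      then have "(cis (g * d) * cis (?l \<omega> + g * ?l' \<omega>)) * of_real (?g \<omega>) = (cis (?l \<omega>) * cis ((?l' \<omega> + d) * g)) * of_real (?g \<omega>)"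
        by (rule arg_cong)
      then show ?thesis unfolding mult.assoc mult.commute[of "of_real (?g \<omega>)"] .
    qed
    show ?thesis unfolding F gfac.simps of_real_mult e by simp
  qed
  then have "(\<integral>\<omega>. cis (?l \<omega>) * of_real (gfac n ((a', b', d) # fs) (\<lambda>j. X j \<omega>) (\<lambda>j. Y j \<omega>)) \<partial>M)
    = (\<integral>\<omega>. (\<integral>g. ?F g \<omega> \<partial>gauss 1) \<partial>M)" by simp
  also have "\<dots> = (\<integral>g. (\<integral>\<omega>. ?F g \<omega> \<partial>M) \<partial>gauss 1)"
  proof (rule pp.Fubini_integral)
    have "\<bar>?g \<omega>\<bar> \<le> 1" for \<omega> using gfac_bounds[of n fs "\<lambda>j. X j \<omega>" "\<lambda>j. Y j \<omega>"] by simp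
    then show "integrable (gauss 1 \<Otimes>\<^sub>M M) (case_prod ?F)"
      by (intro pp.P.integrable_const_bound[of _ 1]) (auto simp: norm_mult)
  qed
  finally show ?thesis unfolding lin_add_cmult by simp
qed

text \<open>The factor \<open>cis (lin n a b ..)\<close> is carried along so that the induction
  closes: linearising one Gaussian factor changes a and b into a + g a' and b + g b', and dominated
  convergence handles the average over g.\<close>

lemma gfac_convergence:
  fixes X Y :: "real \<Rightarrow> nat \<Rightarrow> 'a \<Rightarrow> real" and U V :: "nat \<Rightarrow> 'b \<Rightarrow> real"
  assumes PM: "prob_space M" and PN: "prob_space N"
    and XY [measurable]: "\<And>T j. X T j \<in> borel_measurable M" "\<And>T j. Y T j \<in> borel_measurable M"
    and UV [measurable]: "\<And>j. U j \<in> borel_measurable N" "\<And>j. V j \<in> borel_measurable N"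
    and conv: "\<And>a b. ((\<lambda>T. \<integral>\<omega>. cis (lin n a b (\<lambda>j. X T j \<omega>) (\<lambda>j. Y T j \<omega>)) \<partial>M) \<longlongrightarrow> (\<integral>\<omega>. cis (lin n a b (\<lambda>j. U j \<omega>) (\<lambda>j. V j \<omega>)) \<partial>N)) at_top"
  shows "((\<lambda>T. \<integral>\<omega>. cis (lin n a b (\<lambda>j. X T j \<omega>) (\<lambda>j. Y T j \<omega>)) * of_real (gfac n fs (\<lambda>j. X T j \<omega>) (\<lambda>j. Y T j \<omega>)) \<partial>M)
     \<longlongrightarrow> (\<integral>\<omega>. cis (lin n a b (\<lambda>j. U j \<omega>) (\<lambda>j. V j \<omega>)) * of_real (gfac n fs (\<lambda>j. U j \<omega>) (\<lambda>j. V j \<omega>)) \<partial>N)) at_top"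
proof (induction fs arbitrary: a b)
  case Nil
  then show ?case using conv by simp
next
  case (Cons f fs)
  obtain a' b' d where f: "f = (a', b', d)" by (cases f)
  interpret M: prob_space M by (rule PM)
  interpret N: prob_space N by (rule PN)
  interpret G: prob_space "gauss 1" by (rule prob_space_gauss) simp
  let ?A = "\<lambda>T g. \<integral>\<omega>. cis (lin n (\<lambda>j. a j + g * a' j) (\<lambda>j. b j + g * b' j) (\<lambda>j. X T j \<omega>) (\<lambda>j. Y T j \<omega>))
        * of_real (gfac n fs (\<lambda>j. X T j \<omega>) (\<lambda>j. Y T j \<omega>)) \<partial>M"
  let ?B = "\<lambda>g. \<integral>\<omega>. cis (lin n (\<lambda>j. a j + g * a' j) (\<lambda>j. b j + g * b' j) (\<lambda>j. U j \<omega>) (\<lambda>j. V j \<omega>))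
        * of_real (gfac n fs (\<lambda>j. U j \<omega>) (\<lambda>j. V j \<omega>)) \<partial>N"
  have mA: "?A T \<in> borel_measurable (gauss 1)" for T
    unfolding lin_add_cmult by measurable
  have mB: "?B \<in> borel_measurable (gauss 1)"
    unfolding lin_add_cmult by measurable
  have bA: "norm (?A T g) \<le> 1" for T g
  proof -
    have "norm (?A T g) \<le> (\<integral>\<omega>. 1 \<partial>M)"
      using gfac_bounds by (intro norm_integral_le M.integrable_const_bound[of _ 1]) (auto simp: norm_mult)
    then show ?thesis by (simp add: M.prob_space)
  qed
  have "((\<lambda>T. \<integral>g. cis (g * d) * ?A T g \<partial>gauss 1) \<longlongrightarrow> (\<integral>g. cis (g * d) * ?B g \<partial>gauss 1)) at_top"
  proof (rule integral_dominated_convergence_at_top[where w="\<lambda>_. 1"])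
    show "(\<lambda>g. cis (g * d) * ?B g) \<in> borel_measurable (gauss 1)" using mB by measurable
    show "(\<lambda>g. cis (g * d) * ?A T g) \<in> borel_measurable (gauss 1)" for T using mA by measurable
    show "AE g in gauss 1. ((\<lambda>T. cis (g * d) * ?A T g) \<longlongrightarrow> cis (g * d) * ?B g) at_top"
      by (intro AE_I2 tendsto_mult_left Cons)
    show "\<forall>\<^sub>F T in at_top. AE g in gauss 1. norm (cis (g * d) * ?A T g) \<le> 1"
      using bA by (intro always_eventually allI AE_I2) (simp add: norm_mult)
  qed simp
  then show ?case unfolding f gfac_linearise[OF PM XY] gfac_linearise[OF PN UV] .
qed

corollary gfac_expectation_convergence:
  fixes X Y :: "real \<Rightarrow> nat \<Rightarrow> 'a \<Rightarrow> real" and U V :: "nat \<Rightarrow> 'b \<Rightarrow> real"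
  assumes "prob_space M" "prob_space N"
    and "\<And>T j. X T j \<in> borel_measurable M" "\<And>T j. Y T j \<in> borel_measurable M"
    and "\<And>j. U j \<in> borel_measurable N" "\<And>j. V j \<in> borel_measurable N"
    and "\<And>a b. ((\<lambda>T. \<integral>\<omega>. cis (lin n a b (\<lambda>j. X T j \<omega>) (\<lambda>j. Y T j \<omega>)) \<partial>M) \<longlongrightarrow> (\<integral>\<omega>. cis (lin n a b (\<lambda>j. U j \<omega>) (\<lambda>j. V j \<omega>)) \<partial>N)) at_top"
  shows "((\<lambda>T. \<integral>\<omega>. gfac n fs (\<lambda>j. X T j \<omega>) (\<lambda>j. Y T j \<omega>) \<partial>M) \<longlongrightarrow> (\<integral>\<omega>. gfac n fs (\<lambda>j. U j \<omega>) (\<lambda>j. V j \<omega>) \<partial>N)) at_top"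
  using tendsto_Re[OF gfac_convergence[OF assms, of "\<lambda>_. 0" "\<lambda>_. 0" fs]] by (simp add: lin_def)

text \<open>Summation by parts: the coefficient with which increment k enters a linear combination
  of partial sums with coefficients a.\<close>

definition tail_sum :: "nat \<Rightarrow> (nat \<Rightarrow> real) \<Rightarrow> nat \<Rightarrow> real" where
  "tail_sum n a k = (\<Sum>j<n. of_bool (k < j) * a j)"

lemma sum_tail_sum:
  "(\<Sum>j<n. a j * (\<Sum>k<j. f k)) = (\<Sum>k<n. tail_sum n a k * f k)" for f :: "nat \<Rightarrow> real"
proof -
  have "(\<Sum>j<n. a j * (\<Sum>k<j. f k)) = (\<Sum>j<n. \<Sum>k<n. of_bool (k < j) * a j * f k)"
  proof (intro sum.cong refl)
    fix j assume "j \<in> {..<n}"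
    then have "(\<Sum>k<j. f k) = (\<Sum>k<n. of_bool (k < j) * f k)"
      by (intro sum.mono_neutral_cong_left) auto
    then show "a j * (\<Sum>k<j. f k) = (\<Sum>k<n. of_bool (k < j) * a j * f k)"
      by (simp only: sum_distrib_left mult_ac)
  qed
  also have "\<dots> = (\<Sum>k<n. tail_sum n a k * f k)"
    unfolding tail_sum_def sum_distrib_right by (rule sum.swap)
  finally show ?thesis .
qed

section \<open>Characteristic functions of the coarse path\<close>

context brownian_motion
begin

lemma brownian_fdd_cis:
  assumes n: "0 < n"
  shows "(\<integral>\<omega>. cis (\<Sum>j<n. a j * (sqrt 2 * B (real j / real n) \<omega>)) \<partial>M) = of_real (exp (- (1 / real n) * (\<Sum>k<n. (tail_sum n a k)\<^sup>2)))"
proof -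
  \<comment> \<open>Taking T = 2 in \<open>incr\<close> yields the increments of sqrt 2 times the
    Brownian motion.\<close>
  let ?s = "sqrt (2 / real n)"
  have s0: "0 < ?s" using n by simp
  have m: "(\<lambda>x. cis (\<Sum>k<n. tail_sum n a k * x k)) \<in> borel_measurable (walk ?s n)" by measurable
  have "(\<integral>\<omega>. cis (\<Sum>j<n. a j * (sqrt 2 * B (real j / real n) \<omega>)) \<partial>M) = (\<integral>\<omega>. cis (\<Sum>k<n. tail_sum n a k * incr 2 n \<omega> k) \<partial>M)"
  proof (rule integral_cong_AE)
    show "(\<lambda>\<omega>. cis (\<Sum>j<n. a j * (sqrt 2 * B (real j / real n) \<omega>))) \<in> borel_measurable M"
      by (intro measurable_compose[OF _ cis_measurable] borel_measurable_sum borel_measurable_times borel_measurable_const random_variable)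
        (use n in auto)
    show "(\<lambda>\<omega>. cis (\<Sum>k<n. tail_sum n a k * incr 2 n \<omega> k)) \<in> borel_measurable M"
      by (rule measurable_compose[OF incr_measurable m])
    show "AE \<omega> in M. cis (\<Sum>j<n. a j * (sqrt 2 * B (real j / real n) \<omega>)) = cis (\<Sum>k<n. tail_sum n a k * incr 2 n \<omega> k)"
      using start
    proof eventually_elim
      case (elim \<omega>)
      have "(\<Sum>j<n. a j * (sqrt 2 * B (real j / real n) \<omega>)) = (\<Sum>j<n. a j * phase j (incr 2 n \<omega>))"
        using elim by (intro sum.cong refl) (simp add: phase_incr)
      then show ?case unfolding phase_def sum_tail_sum by simp
    qed
  qed
  also have "\<dots> = (\<integral>x. cis (\<Sum>k<n. tail_sum n a k * x k) \<partial>walk ?s n)"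
    by (rule incr_integral[OF _ n m]) simp
  also have "\<dots> = of_real (exp (- (?s\<^sup>2 / 2) * (\<Sum>k<n. (tail_sum n a k)\<^sup>2)))" by (rule walk_cis[OF s0])
  also have "?s\<^sup>2 / 2 = 1 / real n" using n by simp
  finally show ?thesis .
qed

text \<open>A measurable version of \<open>xlim T\<close> at time j / n; the value 0 for j \<ge> n
  is a default that keeps it measurable for every index.\<close>

definition xcoarse :: "nat \<Rightarrow> real \<Rightarrow> nat \<Rightarrow> 'a \<Rightarrow> real" where
  "xcoarse n T j \<omega> = (if j < n then lim (\<lambda>L. xgrid T (n * L) (j * L) \<omega>) else 0)"

definition ycoarse :: "nat \<Rightarrow> real \<Rightarrow> nat \<Rightarrow> 'a \<Rightarrow> real" where
  "ycoarse n T j \<omega> = (if j < n then lim (\<lambda>L. ygrid T (n * L) (j * L) \<omega>) else 0)"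

lemma coarse_measurable [measurable]: "xcoarse n T j \<in> borel_measurable M" "ycoarse n T j \<in> borel_measurable M"
proof -
  show "xcoarse n T j \<in> borel_measurable M"
    unfolding xcoarse_def[abs_def] by (cases "j < n") (auto intro!: borel_measurable_lim_metric grid_measurable)
  show "ycoarse n T j \<in> borel_measurable M"
    unfolding ycoarse_def[abs_def] by (cases "j < n") (auto intro!: borel_measurable_lim_metric grid_measurable)
qed

lemma good_coarse_tendsto:
  assumes g: "good \<omega>" and j: "j < n"
  shows "(\<lambda>L. xgrid T (n * L) (j * L) \<omega>) \<longlonglongrightarrow> xcoarse n T j \<omega>" "(\<lambda>L. ygrid T (n * L) (j * L) \<omega>) \<longlonglongrightarrow> ycoarse n T j \<omega>"
proof -
  have n: "0 < n" "j \<le> n" using j by auto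
  have 1: "(\<lambda>L. xgrid T (n * L) (j * L) \<omega>) \<longlonglongrightarrow> xlim T (real j / real n) \<omega>"
    by (rule grid_close_subgrid[OF good_grid_close(1)[OF g] n])
  have 2: "(\<lambda>L. ygrid T (n * L) (j * L) \<omega>) \<longlonglongrightarrow> ylim T (real j / real n) \<omega>"
    by (rule grid_close_subgrid[OF good_grid_close(2)[OF g] n])
  show "(\<lambda>L. xgrid T (n * L) (j * L) \<omega>) \<longlonglongrightarrow> xcoarse n T j \<omega>"
    using 1 limI[OF 1] j by (simp add: xcoarse_def)
  show "(\<lambda>L. ygrid T (n * L) (j * L) \<omega>) \<longlonglongrightarrow> ycoarse n T j \<omega>"
    using 2 limI[OF 2] j by (simp add: ycoarse_def)
qed

text \<open>With S and C the sums of sines and cosines over a block, Re ((- b - \<i> a) (C + \<i>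
  S)) = a S - b C; this is the origin of the complex weights.\<close>

lemma grid_lin:
  "lin n a b (\<lambda>j. xgrid T (n * L) (j * L) \<omega>) (\<lambda>j. ygrid T (n * L) (j * L) \<omega>) =
    sqrt T / real (n * L) * (\<Sum>k<n. Re ((Complex (- tail_sum n b k) (- tail_sum n a k)) * (\<Sum>i\<in>{k*L..<k*L+L}. cis (phase i (incr T (n * L) \<omega>)))))"
proof -
  let ?x = "incr T (n * L) \<omega>"
  define S where "S = (\<lambda>k. \<Sum>i\<in>{k*L..<k*L+L}. sin (phase i ?x))"
  define C where "C = (\<lambda>k. \<Sum>i\<in>{k*L..<k*L+L}. cos (phase i ?x))"
  have x: "xpath (j * L) ?x = (\<Sum>k<j. S k)" for j unfolding xpath_def S_def by (rule sum.nat_group[symmetric])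
  have y: "ypath (j * L) ?x = - (\<Sum>k<j. C k)" for j unfolding ypath_def C_def by (simp only: sum.nat_group[symmetric])
  have dist: "\<alpha> * (c * p) + \<beta> * (c * - q) = c * (\<alpha> * p - \<beta> * q)" for \<alpha> \<beta> c p q :: real
    by (simp add: algebra_simps)
  have "lin n a b (\<lambda>j. xgrid T (n * L) (j * L) \<omega>) (\<lambda>j. ygrid T (n * L) (j * L) \<omega>) =
     sqrt T / real (n * L) * ((\<Sum>j<n. a j * (\<Sum>k<j. S k)) - (\<Sum>j<n. b j * (\<Sum>k<j. C k)))"
    unfolding lin_def xgrid_def ygrid_def x y dist sum_distrib_left[symmetric] sum_subtractf ..
  also have "\<dots> = sqrt T / real (n * L) * (\<Sum>k<n. tail_sum n a k * S k - tail_sum n b k * C k)"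
    unfolding sum_tail_sum by (simp add: sum_subtractf)
  also have "(\<Sum>k<n. tail_sum n a k * S k - tail_sum n b k * C k) =
    (\<Sum>k<n. Re ((Complex (- tail_sum n b k) (- tail_sum n a k)) * (\<Sum>i\<in>{k*L..<k*L+L}. cis (phase i ?x))))"
    by (intro sum.cong refl) (simp add: times_complex.sel Re_sum Im_sum S_def C_def)
  finally show ?thesis .
qed

text \<open>Order of the limits: at fixed T the number L of grid points per coarse cell tends to
  infinity, which removes the mesh and sends \<open>var_ratio\<close> to 1; the remaining error C /
  sqrt T is then sent to zero.\<close>

lemma coarse_fdd_convergence:
  assumes n: "0 < n"
  shows "((\<lambda>T. \<integral>\<omega>. cis (lin n a b (\<lambda>j. xcoarse n T j \<omega>) (\<lambda>j. ycoarse n T j \<omega>)) \<partial>M)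
    \<longlongrightarrow> of_real (exp (- (1 / real n) * ((\<Sum>k<n. (tail_sum n a k)\<^sup>2) + (\<Sum>k<n. (tail_sum n b k)\<^sup>2))))) at_top"
proof -
  \<comment> \<open>Zero beyond n, since \<open>walk_fdd_clt\<close> takes a bound valid for all
    weights.\<close>
  define \<xi> where "\<xi> = (\<lambda>k. if k < n then Complex (- tail_sum n b k) (- tail_sum n a k) else 0)"
  define \<Xi> where "\<Xi> = (\<Sum>k<n. norm (\<xi> k))"
  have \<Xi>: "norm (\<xi> k) \<le> \<Xi>" for k
  proof (cases "k < n")
    case True
    then show ?thesis unfolding \<Xi>_def by (intro member_le_sum) auto
  next
    case False
    then show ?thesis unfolding \<Xi>_def by (simp add: \<xi>_def sum_nonneg)
  qed
  define V where "V = (\<Sum>k<n. (norm (\<xi> k))\<^sup>2)"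
  have V: "V = (\<Sum>k<n. (tail_sum n a k)\<^sup>2) + (\<Sum>k<n. (tail_sum n b k)\<^sup>2)"
    unfolding V_def by (simp add: \<xi>_def cmod_power2 sum.distrib add.commute)
  define C where "C = 4 * \<Xi>\<^sup>2 + 384 * \<Xi> ^ 3 + 512 * \<Xi> ^ 4 + 8 * real n * \<Xi>"
  let ?E = "\<lambda>T. \<integral>\<omega>. cis (lin n a b (\<lambda>j. xcoarse n T j \<omega>) (\<lambda>j. ycoarse n T j \<omega>)) \<partial>M"
  let ?EL = "\<lambda>T L. \<integral>\<omega>. cis (lin n a b (\<lambda>j. xgrid T (n * L) (j * L) \<omega>) (\<lambda>j. ygrid T (n * L) (j * L) \<omega>)) \<partial>M"
  let ?l = "complex_of_real (exp (- (1 / real n) * V))"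
  have bound: "norm (?E T - ?l) \<le> C / sqrt T" if T: "1 \<le> T" for T
  proof (rule LIMSEQ_le_const2)
    have mL: "(\<lambda>\<omega>. cis (lin n a b (\<lambda>j. xgrid T (n * L) (j * L) \<omega>) (\<lambda>j. ygrid T (n * L) (j * L) \<omega>))) \<in> borel_measurable M" for L
      unfolding lin_def
      by (intro measurable_compose[OF _ cis_measurable] borel_measurable_sum borel_measurable_add borel_measurable_times borel_measurable_const grid_measurable) auto
    have "(\<lambda>L. ?EL T L) \<longlonglongrightarrow> ?E T"
    proof (rule integral_dominated_convergence[where w="\<lambda>_. 1"])
      show "AE \<omega> in M. (\<lambda>L. cis (lin n a b (\<lambda>j. xgrid T (n * L) (j * L) \<omega>) (\<lambda>j. ygrid T (n * L) (j * L) \<omega>)))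
          \<longlonglongrightarrow> cis (lin n a b (\<lambda>j. xcoarse n T j \<omega>) (\<lambda>j. ycoarse n T j \<omega>))"
        using AE_good
      proof eventually_elim
        case (elim \<omega>)
        have "(\<lambda>L. lin n a b (\<lambda>j. xgrid T (n * L) (j * L) \<omega>) (\<lambda>j. ygrid T (n * L) (j * L) \<omega>)) \<longlonglongrightarrow> lin n a b (\<lambda>j. xcoarse n T j \<omega>) (\<lambda>j. ycoarse n T j \<omega>)"
          unfolding lin_def by (intro tendsto_sum tendsto_add tendsto_mult_left good_coarse_tendsto elim) auto
        then show ?case by (intro tendsto_cis)
      qed
    qed (use mL in auto)
    moreover have "(\<lambda>L. complex_of_real (exp (- (var_ratio (T / real (n * L)) / real n * V)))) \<longlonglongrightarrow> ?l"
    proof -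
      have "filterlim (\<lambda>L. T / real (n * L)) (at_right 0) sequentially"
        using n T by real_asymp
      then have "(\<lambda>L. var_ratio (T / real (n * L))) \<longlonglongrightarrow> 1"
        by (rule filterlim_compose[OF var_ratio_tendsto])
      then have "(\<lambda>L. exp (- (var_ratio (T / real (n * L)) / real n * V))) \<longlonglongrightarrow> exp (- (1 / real n * V))"
        by (intro tendsto_intros) (use n in auto)
      then show ?thesis by (intro tendsto_of_real) simp
    qed
    ultimately show "(\<lambda>L. norm (?EL T L - complex_of_real (exp (- (var_ratio (T / real (n * L)) / real n * V))))) \<longlonglongrightarrow> norm (?E T - ?l)"
      by (auto intro!: tendsto_norm tendsto_diff)
    obtain L0 :: nat where L0: "T \<le> real L0" using real_arch_simple by blast
    show "\<exists>L1. \<forall>L\<ge>L1. norm (?EL T L - complex_of_real (exp (- (var_ratio (T / real (n * L)) / real n * V)))) \<le> C / sqrt T"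
    proof (intro exI[of _ "max 1 L0"] allI impI)
      fix L assume L: "max 1 L0 \<le> L"
      then have L0': "0 < L" by simp
      have "real L0 \<le> real (n * L)" using L n by (simp del: of_nat_mult) (metis (no_types) Suc_leI le_trans mult_le_mono nat_mult_1 One_nat_def)
      then have TN: "T \<le> real (n * L)" using L0 by linarith
      let ?f = "\<lambda>x. cis (sqrt T / real (n * L) * (\<Sum>k<n. Re (\<xi> k * (\<Sum>i\<in>{k*L..<k*L+L}. cis (phase i x)))))"
      have mf: "?f \<in> borel_measurable (walk (sqrt (T / real (n * L))) (n * L))"
      proof -
        have "(\<lambda>x. \<Sum>i\<in>{k*L..<k*L+L}. cis (phase i x)) \<in> borel_measurable (walk (sqrt (T / real (n * L))) (n * L))" if "k < n" for k
        proof (intro borel_measurable_sum measurable_compose[OF phase_measurable' cis_measurable])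
          fix i assume "i \<in> {k*L..<k*L+L}"
          moreover have "Suc k * L \<le> n * L" using that by (intro mult_le_mono1) simp
          ultimately show "i \<le> n * L" by simp
        qed
        then have "(\<lambda>x. Re (\<xi> k * (\<Sum>i\<in>{k*L..<k*L+L}. cis (phase i x)))) \<in> borel_measurable (walk (sqrt (T / real (n * L))) (n * L))" if "k < n" for k
          using that by (intro measurable_compose[OF _ borel_measurable_Re] borel_measurable_times) auto
        then show ?thesis by (intro measurable_compose[OF _ cis_measurable] borel_measurable_times borel_measurable_sum) auto
      qed
      have "?EL T L = (\<integral>\<omega>. ?f (incr T (n * L) \<omega>) \<partial>M)"
        unfolding grid_lin by (simp add: \<xi>_def)
      also have "\<dots> = (\<integral>x. ?f x \<partial>walk (sqrt (T / real (n * L))) (n * L))"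
        by (rule incr_integral[OF _ _ mf]) (use T n L0' in auto)
      finally show "norm (?EL T L - complex_of_real (exp (- (var_ratio (T / real (n * L)) / real n * V)))) \<le> C / sqrt T"
        unfolding C_def V_def using walk_fdd_clt[OF n L0' T TN refl \<Xi>] by (simp only:)
    qed
  qed
  have "((\<lambda>T. ?E T - ?l) \<longlongrightarrow> 0) at_top"
  proof (rule Lim_null_comparison)
    show "\<forall>\<^sub>F T in at_top. norm (?E T - ?l) \<le> C / sqrt T"
      using eventually_ge_at_top[of 1] by (rule eventually_mono) (rule bound)
    show "((\<lambda>T. C / sqrt T) \<longlongrightarrow> 0) at_top" by real_asymp
  qed
  then have "(?E \<longlongrightarrow> ?l) at_top" by (rule LIM_zero_cancel)
  then show ?thesis unfolding V .
qed

end

text \<open>Independence of the two processes factorises the characteristic function into those of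
  the single Brownian motions. The result is the limit found for the phase integrals.\<close>

lemma limit_fdd_cis:
  assumes W1: "brownian_motion N W1" and W2: "brownian_motion N W2" and ind: "indep_processes N W1 W2" and n: "0 < n"
  shows "(\<integral>\<omega>. cis (lin n a b (\<lambda>j. sqrt 2 * W1 (real j / real n) \<omega>) (\<lambda>j. sqrt 2 * W2 (real j / real n) \<omega>)) \<partial>N)
    = of_real (exp (- (1 / real n) * ((\<Sum>k<n. (tail_sum n a k)\<^sup>2) + (\<Sum>k<n. (tail_sum n b k)\<^sup>2))))"
proof -
  interpret W1: brownian_motion N W1 by (rule W1)
  interpret W2: brownian_motion N W2 by (rule W2)
  let ?P = "PiM {0..1::real} (\<lambda>_. borel :: real measure)"
  let ?F = "\<lambda>a x. cis (\<Sum>j<n. a j * (sqrt 2 * x (real j / real n)))"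
  have r: "real j / real n \<in> {0..1}" if "j < n" for j using that by auto
  have Fm: "?F a \<in> borel_measurable ?P" for a
    by (intro measurable_compose[OF _ cis_measurable] borel_measurable_sum borel_measurable_times borel_measurable_const measurable_component_singleton r) auto
  have "prob_space.indep_var N borel (\<lambda>\<omega>. ?F a (\<lambda>t\<in>{0..1}. W1 t \<omega>)) borel (\<lambda>\<omega>. ?F b (\<lambda>t\<in>{0..1}. W2 t \<omega>))"
    using W1.indep_var_compose[OF ind[unfolded indep_processes_def] Fm[of a] Fm[of b]] by (simp add: comp_def)
  moreover have "?F a (\<lambda>t\<in>{0..1}. W t \<omega>) = ?F a (\<lambda>t. W t \<omega>)" for a \<omega> and W :: "real \<Rightarrow> 'a \<Rightarrow> real"
    using r by (intro arg_cong[where f=cis] sum.cong refl) auto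
  ultimately have iv: "prob_space.indep_var N borel (\<lambda>\<omega>. ?F a (\<lambda>t. W1 t \<omega>)) borel (\<lambda>\<omega>. ?F b (\<lambda>t. W2 t \<omega>))" by (simp only:)
  have int: "integrable N (\<lambda>\<omega>. ?F c (\<lambda>t. W t \<omega>))" if "brownian_motion N W" for c W
  proof -
    interpret W: brownian_motion N W by (rule that)
    show ?thesis
    proof (rule W1.integrable_const_bound[of _ 1])
      show "(\<lambda>\<omega>. ?F c (\<lambda>t. W t \<omega>)) \<in> borel_measurable N"
        by (intro measurable_compose[OF _ cis_measurable] borel_measurable_sum borel_measurable_times borel_measurable_const W.random_variable r) auto
    qed simp
  qed
  have "(\<integral>\<omega>. cis (lin n a b (\<lambda>j. sqrt 2 * W1 (real j / real n) \<omega>) (\<lambda>j. sqrt 2 * W2 (real j / real n) \<omega>)) \<partial>N)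
     = (\<integral>\<omega>. ?F a (\<lambda>t. W1 t \<omega>) * ?F b (\<lambda>t. W2 t \<omega>) \<partial>N)"
    by (simp add: lin_def sum.distrib cis_mult)
  also have "\<dots> = (\<integral>\<omega>. ?F a (\<lambda>t. W1 t \<omega>) \<partial>N) * (\<integral>\<omega>. ?F b (\<lambda>t. W2 t \<omega>) \<partial>N)"
    by (rule W1.indep_var_lebesgue_integral[OF iv int[OF W1] int[OF W2]])
  also have "\<dots> = of_real (exp (- (1 / real n) * (\<Sum>k<n. (tail_sum n a k)\<^sup>2))) * of_real (exp (- (1 / real n) * (\<Sum>k<n. (tail_sum n b k)\<^sup>2)))"
    unfolding W1.brownian_fdd_cis[OF n] W2.brownian_fdd_cis[OF n] ..
  also have "\<dots> = of_real (exp (- (1 / real n) * ((\<Sum>k<n. (tail_sum n a k)\<^sup>2) + (\<Sum>k<n. (tail_sum n b k)\<^sup>2))))"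
    unfolding of_real_mult[symmetric] exp_add[symmetric] by (simp only: distrib_left)
  finally show ?thesis .
qed

section \<open>Weak convergence of Gram matrices\<close>

text \<open>The tool for every interchange of limits below: for each e an approximation that itself
  converges, is eventually within e of f and has its limit within e of l.\<close>

lemma tendsto_approx:
  fixes f :: "'a \<Rightarrow> real"
  assumes "\<And>e. 0 < e \<Longrightarrow> \<exists>h l'. (h \<longlongrightarrow> l') F \<and> (\<forall>\<^sub>F x in F. \<bar>f x - h x\<bar> \<le> e) \<and> \<bar>l - l'\<bar> \<le> e"
  shows "(f \<longlongrightarrow> l) F"
proof (rule tendstoI)
  fix e :: real assume "0 < e"
  then obtain h l' where h: "(h \<longlongrightarrow> l') F" "\<forall>\<^sub>F x in F. \<bar>f x - h x\<bar> \<le> e / 4" "\<bar>l - l'\<bar> \<le> e / 4"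
    using assms[of "e / 4"] by auto
  have "\<forall>\<^sub>F x in F. dist (h x) l' < e / 4" using h(1) \<open>0 < e\<close> by (intro tendstoD) auto
  then show "\<forall>\<^sub>F x in F. dist (f x) l < e"
    using h(2)
  proof eventually_elim
    case (elim x)
    then show ?case using h(3) \<open>0 < e\<close> unfolding dist_real_def by linarith
  qed
qed

text \<open>\<open>form2 i j C\<close> is the quadratic form of \<open>C\<close> at \<open>e\<^sub>i + e\<^sub>j\<close>; these values determine a symmetric matrix.\<close>

definition form2 :: "3 \<Rightarrow> 3 \<Rightarrow> real ^ 3 ^ 3 \<Rightarrow> real" where
  "form2 i j C = C $ i $ i + C $ i $ j + C $ j $ i + C $ j $ j"

text \<open>Weaker than positive semidefiniteness, but closed, satisfied by all Gram matrices, and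
  enough to bound \<open>exp_forms\<close> and to invert it on bounded parts.\<close>

definition nonneg_forms :: "(real ^ 3 ^ 3) set" where
  "nonneg_forms = {C. \<forall>i j. C $ i $ j = C $ j $ i \<and> 0 \<le> form2 i j C}"

text \<open>The coefficients are natural numbers so that \<open>exp (- quad \<kappa> C)\<close> is a
  monomial in the entries of \<open>exp_forms C\<close>.\<close>

definition quad :: "(3 \<Rightarrow> 3 \<Rightarrow> nat) \<Rightarrow> real ^ 3 ^ 3 \<Rightarrow> real" where
  "quad \<kappa> C = (\<Sum>i\<in>UNIV. \<Sum>j\<in>UNIV. real (\<kappa> i j) * form2 i j C)"

definition exp_forms :: "real ^ 3 ^ 3 \<Rightarrow> real ^ 3 ^ 3" where
  "exp_forms C = (\<chi> i j. exp (- form2 i j C))"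

definition entry_monom :: "(3 \<Rightarrow> 3 \<Rightarrow> nat) \<Rightarrow> real ^ 3 ^ 3 \<Rightarrow> real" where
  "entry_monom \<kappa> v = (\<Prod>i\<in>UNIV. \<Prod>j\<in>UNIV. v $ i $ j ^ \<kappa> i j)"

text \<open>The polynomials in the nine entries, generated as sums of monomials: linear statements
  about integrals then follow by induction from the monomial case.\<close>

inductive entry_poly :: "(real ^ 3 ^ 3 \<Rightarrow> real) \<Rightarrow> bool" where
  monom: "entry_poly (\<lambda>v. c * entry_monom \<kappa> v)"
| add: "entry_poly f \<Longrightarrow> entry_poly g \<Longrightarrow> entry_poly (\<lambda>v. f v + g v)"

text \<open>An inverse of \<open>exp_forms\<close>: logarithms return the values of
  \<open>form2\<close>, and polarisation the entries, where \<open>form2 i i C\<close> is four times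
  the diagonal entry. The cut-off at exp (- R) keeps the logarithm continuous on the whole
  space.\<close>

definition recover :: "real \<Rightarrow> real ^ 3 ^ 3 \<Rightarrow> real ^ 3 ^ 3" where
  "recover R v = (let w = (\<lambda>i j. - ln (max (v $ i $ j) (exp (- R)))) in \<chi> i j. (w i j - w i i / 4 - w j j / 4) / 2)"

lemma form2_le: "form2 i j C \<le> 4 * norm C"
  unfolding form2_def using entry_le_norm[of C i i] entry_le_norm[of C i j] entry_le_norm[of C j i] entry_le_norm[of C j j] by linarith

lemma continuous_form2 [continuous_intros]: "continuous_on S f \<Longrightarrow> continuous_on S (\<lambda>x. form2 i j (f x))"
  unfolding form2_def by (intro continuous_intros)

lemma continuous_quad: "continuous_on S (quad \<kappa>)"
  unfolding quad_def by (intro continuous_intros)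

lemma quad_nonneg: "C \<in> nonneg_forms \<Longrightarrow> 0 \<le> quad \<kappa> C"
  unfolding quad_def nonneg_forms_def by (intro sum_nonneg) auto

lemma closed_nonneg_forms: "closed nonneg_forms"
proof -
  have "nonneg_forms = (\<Inter>i. \<Inter>j. {C. C $ i $ j = C $ j $ i} \<inter> {C. 0 \<le> form2 i j C})" by (auto simp: nonneg_forms_def)
  also have "closed \<dots>" by (intro closed_INT ballI closed_Int closed_Collect_eq closed_Collect_le continuous_intros)
  finally show ?thesis .
qed

lemma continuous_exp_forms: "continuous_on S exp_forms"
  unfolding exp_forms_def by (intro continuous_on_vec_lambda continuous_intros)

lemma continuous_recover: "continuous_on S (recover R)"
proof -
  have "max (x :: real) (exp (- R)) \<noteq> 0" for x by (metis exp_gt_zero less_max_iff_disj less_irrefl)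
  then show ?thesis unfolding recover_def Let_def by (intro continuous_on_vec_lambda continuous_intros) auto
qed

lemma recover_exp_forms:
  assumes C: "C \<in> nonneg_forms" and R: "\<And>i j. form2 i j C \<le> R"
  shows "recover R (exp_forms C) = C"
proof -
  have w: "- ln (max (exp_forms C $ i $ j) (exp (- R))) = form2 i j C" for i j
    using R[of i j] by (simp add: exp_forms_def max_def)
  have s: "C $ i $ j = C $ j $ i" for i j using C by (simp add: nonneg_forms_def)
  show ?thesis unfolding recover_def Let_def w vec_eq_iff using s by (simp add: form2_def)
qed

lemma norm_exp_forms:
  assumes "C \<in> nonneg_forms"
  shows "exp_forms C \<in> cball 0 9"
proof -
  have "\<bar>exp_forms C $ i $ j\<bar> \<le> 1" for i j using assms by (simp add: exp_forms_def nonneg_forms_def)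
  from norm_le_entries[OF this] show ?thesis by simp
qed

lemma entry_monom_exp_forms: "entry_monom \<kappa> (exp_forms C) = exp (- quad \<kappa> C)"
  unfolding entry_monom_def quad_def exp_forms_def
  by (simp add: exp_sum[symmetric] sum_negf[symmetric] exp_of_nat_mult[symmetric])

lemma entry_monom_mult: "entry_monom \<kappa> v * entry_monom \<kappa>' v = entry_monom (\<lambda>i j. \<kappa> i j + \<kappa>' i j) v"
  unfolding entry_monom_def by (simp add: prod.distrib power_add)

lemma entry_poly_mult: "entry_poly f \<Longrightarrow> entry_poly g \<Longrightarrow> entry_poly (\<lambda>v. f v * g v)"
proof (induction rule: entry_poly.induct)
  case (monom c \<kappa>)
  from monom show ?case
  proof (induction rule: entry_poly.induct)
    case (monom d \<kappa>')
    have "c * entry_monom \<kappa> v * (d * entry_monom \<kappa>' v) = (c * d) * entry_monom (\<lambda>i j. \<kappa> i j + \<kappa>' i j) v" for v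
      unfolding entry_monom_mult[symmetric] by simp
    then show ?case by (simp only: entry_poly.monom)
  next
    case (add f g)
    then show ?case by (simp only: distrib_left entry_poly.add)
  qed
next
  case (add f1 f2)
  then show ?case by (simp only: distrib_right entry_poly.add)
qed

lemma entry_poly_continuous: "entry_poly f \<Longrightarrow> continuous_on S f"
  by (induction rule: entry_poly.induct) (auto simp: entry_monom_def intro!: continuous_intros)

lemma entry_poly_const: "entry_poly (\<lambda>v. c)"
  using entry_poly.monom[of c "\<lambda>_ _. 0"] by (simp add: entry_monom_def)

lemma entry_poly_entry: "entry_poly (\<lambda>v. v $ i $ j)"
proof -
  have "entry_monom (\<lambda>i' j'. of_bool (i' = i \<and> j' = j)) v = v $ i $ j" for v
  proof -
    have "(\<Prod>j'\<in>UNIV. v $ i' $ j' ^ of_bool (i' = i \<and> j' = j)) = (if i' = i then v $ i $ j else 1)" for i'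
    proof (cases "i' = i")
      case True
      have "(\<Prod>j'\<in>UNIV. v $ i $ j' ^ of_bool (j' = j)) = (\<Prod>j'\<in>UNIV. if j' = j then v $ i $ j' else 1)"
        by (intro prod.cong) auto
      then show ?thesis using True by simp
    qed simp
    then show ?thesis unfolding entry_monom_def by simp
  qed
  then show ?thesis using entry_poly.monom[of 1 "\<lambda>i' j'. of_bool (i' = i \<and> j' = j)"] by simp
qed

text \<open>The ball of radius 9 contains all values of \<open>exp_forms\<close> on
  \<open>nonneg_forms\<close>.\<close>

lemma entry_poly_dense:
  assumes "continuous_on UNIV f" "0 < e"
  obtains g where "entry_poly g" "\<And>v. v \<in> cball 0 9 \<Longrightarrow> \<bar>f v - g v\<bar> < e"
proof -
  have "\<exists>g. entry_poly g \<and> (\<forall>v\<in>cball 0 9. \<bar>f v - g v\<bar> < e)"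
  proof (rule Stone_Weierstrass_HOL)
    show "\<exists>h. entry_poly h \<and> h v \<noteq> h w" if vw: "v \<in> cball 0 9 \<and> w \<in> cball 0 9 \<and> v \<noteq> w" for v w
    proof -
      obtain i j where "v $ i $ j \<noteq> w $ i $ j" using vw by (metis vec_eq_iff)
      then show ?thesis by (intro exI[of _ "\<lambda>v. v $ i $ j"] conjI entry_poly_entry)
    qed
  qed (use assms in \<open>auto intro: entry_poly_const entry_poly_continuous entry_poly.add entry_poly_mult continuous_on_subset\<close>)
  then show thesis using that by blast
qed

text \<open>Convergence of the Laplace transforms gives convergence of expectations of all polynomials in the
  bounded variables \<open>exp (- form2 i j C)\<close>, hence by Stone--Weierstrass and tightness weak convergence.\<close>

lemma laplace_weak_convergence:
  fixes A :: "real \<Rightarrow> 'a \<Rightarrow> real ^ 3 ^ 3" and Z :: "'b \<Rightarrow> real ^ 3 ^ 3" and f :: "real ^ 3 ^ 3 \<Rightarrow> real"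
  assumes PM: "prob_space M" and PN: "prob_space N"
    and A [measurable]: "\<And>T. A T \<in> borel_measurable M" and Z [measurable]: "Z \<in> borel_measurable N"
    and cone: "\<And>T. 1 \<le> T \<Longrightarrow> AE \<omega> in M. A T \<omega> \<in> nonneg_forms" "AE \<omega> in N. Z \<omega> \<in> nonneg_forms"
    and tight: "0 \<le> D" "\<And>T. 1 \<le> T \<Longrightarrow> (\<integral>\<^sup>+\<omega>. ennreal (norm (A T \<omega>)) \<partial>M) \<le> ennreal D"
    and lap: "\<And>\<kappa>. ((\<lambda>T. \<integral>\<omega>. exp (- quad \<kappa> (A T \<omega>)) \<partial>M) \<longlongrightarrow> (\<integral>\<omega>. exp (- quad \<kappa> (Z \<omega>)) \<partial>N)) at_top"
    and f: "continuous_on UNIV f" "\<And>C. 0 \<le> f C" "\<And>C. f C \<le> K"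
  shows "((\<lambda>T. \<integral>\<omega>. f (A T \<omega>) \<partial>M) \<longlongrightarrow> (\<integral>\<omega>. f (Z \<omega>) \<partial>N)) at_top"
proof -
  interpret M: prob_space M by (rule PM)
  interpret N: prob_space N by (rule PN)
  have K0: "0 \<le> K" using f(2,3) order_trans by blast
  have cm: "h \<in> borel_measurable borel" if "continuous_on UNIV h" for h :: "real ^ 3 ^ 3 \<Rightarrow> real"
    using that by (rule borel_measurable_continuous_onI)
  have [measurable]: "exp_forms \<in> borel_measurable borel" "quad \<kappa> \<in> borel_measurable borel" "recover R \<in> borel_measurable borel" for \<kappa> R
    by (intro borel_measurable_continuous_onI continuous_exp_forms continuous_quad continuous_recover)+
  have [measurable]: "f \<in> borel_measurable borel" by (intro cm f)
  have expi: "integrable \<Omega> (\<lambda>\<omega>. exp (- quad \<kappa> (X \<omega>)))" if "prob_space \<Omega>" "X \<in> borel_measurable \<Omega>" "AE \<omega> in \<Omega>. X \<omega> \<in> nonneg_forms" for \<Omega> :: "'c measure" and X \<kappa>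
  proof -
    interpret \<Omega>: prob_space \<Omega> by (rule that)
    note [measurable] = that(2)
    have "AE \<omega> in \<Omega>. norm (exp (- quad \<kappa> (X \<omega>))) \<le> 1" using that(3) by eventually_elim (simp add: quad_nonneg)
    then show ?thesis by (rule \<Omega>.integrable_const_bound) simp
  qed
  have polyi: "integrable \<Omega> (\<lambda>\<omega>. g (exp_forms (X \<omega>)))" if "entry_poly g" "prob_space \<Omega>" "X \<in> borel_measurable \<Omega>" "AE \<omega> in \<Omega>. X \<omega> \<in> nonneg_forms" for \<Omega> :: "'c measure" and X g
    using that(1) by (induction rule: entry_poly.induct) (auto simp: entry_monom_exp_forms intro!: expi that)
  have poly: "((\<lambda>T. \<integral>\<omega>. g (exp_forms (A T \<omega>)) \<partial>M) \<longlongrightarrow> (\<integral>\<omega>. g (exp_forms (Z \<omega>)) \<partial>N)) at_top" if "entry_poly g" for g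
    using that
  proof (induction rule: entry_poly.induct)
    case (monom c \<kappa>)
    show ?case unfolding entry_monom_exp_forms by (simp add: tendsto_mult_left lap)
  next
    case (add g h)
    have "\<forall>\<^sub>F T in at_top. (\<integral>\<omega>. g (exp_forms (A T \<omega>)) \<partial>M) + (\<integral>\<omega>. h (exp_forms (A T \<omega>)) \<partial>M) = (\<integral>\<omega>. g (exp_forms (A T \<omega>)) + h (exp_forms (A T \<omega>)) \<partial>M)"
      using eventually_ge_at_top[of 1]
    proof eventually_elim
      case (elim T)
      then show ?case using add by (intro Bochner_Integration.integral_add[symmetric] polyi PM A cone) auto
    qed
    moreover have "(\<integral>\<omega>. g (exp_forms (Z \<omega>)) + h (exp_forms (Z \<omega>)) \<partial>N) = (\<integral>\<omega>. g (exp_forms (Z \<omega>)) \<partial>N) + (\<integral>\<omega>. h (exp_forms (Z \<omega>)) \<partial>N)"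
      using add by (intro Bochner_Integration.integral_add polyi PN Z cone) auto
    ultimately show ?case using tendsto_add[OF add.IH] by (simp add: tendsto_cong)
  qed
  have fi: "integrable \<Omega> (\<lambda>\<omega>. f (h (X \<omega>)))" if "prob_space \<Omega>" "h \<in> borel_measurable borel" "X \<in> borel_measurable \<Omega>" for \<Omega> :: "'c measure" and X h
  proof -
    interpret \<Omega>: prob_space \<Omega> by (rule that)
    note [measurable] = that(2,3)
    show ?thesis by (rule \<Omega>.integrable_const_bound[of _ K]) (use f in auto)
  qed
  \<comment> \<open>Composed with \<open>recover R\<close>, the test function is continuous in the
    bounded variable \<open>exp_forms\<close>, so it is uniformly close to a polynomial in
    it.\<close>
  have comp: "((\<lambda>T. \<integral>\<omega>. f (recover R (exp_forms (A T \<omega>))) \<partial>M) \<longlongrightarrow> (\<integral>\<omega>. f (recover R (exp_forms (Z \<omega>))) \<partial>N)) at_top" for R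
  proof (rule tendsto_approx)
    fix e :: real assume e: "0 < e"
    have "continuous_on UNIV (\<lambda>v. f (recover R v))"
      using continuous_on_compose2[OF f(1) continuous_recover] by simp
    then obtain g where g: "entry_poly g" "\<And>v. v \<in> cball 0 9 \<Longrightarrow> \<bar>f (recover R v) - g v\<bar> < e"
      using entry_poly_dense[OF _ e] by blast
    have close: "\<bar>(\<integral>\<omega>. f (recover R (exp_forms (X \<omega>))) \<partial>\<Omega>) - (\<integral>\<omega>. g (exp_forms (X \<omega>)) \<partial>\<Omega>)\<bar> \<le> e"
      if "prob_space \<Omega>" "X \<in> borel_measurable \<Omega>" "AE \<omega> in \<Omega>. X \<omega> \<in> nonneg_forms" for \<Omega> :: "'c measure" and X
    proof -
      interpret \<Omega>: prob_space \<Omega> by (rule that)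
      have i1: "integrable \<Omega> (\<lambda>\<omega>. f (recover R (exp_forms (X \<omega>))))" by (rule fi[of \<Omega> "\<lambda>x. recover R (exp_forms x)" X]) (use that in auto)
      have i2: "integrable \<Omega> (\<lambda>\<omega>. g (exp_forms (X \<omega>)))" by (rule polyi[OF g(1) that])
      have "\<bar>\<integral>\<omega>. f (recover R (exp_forms (X \<omega>))) - g (exp_forms (X \<omega>)) \<partial>\<Omega>\<bar> \<le> (\<integral>\<omega>. \<bar>f (recover R (exp_forms (X \<omega>))) - g (exp_forms (X \<omega>))\<bar> \<partial>\<Omega>)"
        by (rule integral_abs_bound)
      also have "\<dots> \<le> (\<integral>\<omega>. e \<partial>\<Omega>)"
      proof (rule integral_mono_AE)
        show "AE \<omega> in \<Omega>. \<bar>f (recover R (exp_forms (X \<omega>))) - g (exp_forms (X \<omega>))\<bar> \<le> e"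
          using that(3) by eventually_elim (intro less_imp_le g(2) norm_exp_forms)
      qed (use i1 i2 in auto)
      finally show ?thesis using i1 i2 by (simp add: \<Omega>.prob_space)
    qed
    show "\<exists>h l'. (h \<longlongrightarrow> l') at_top \<and> (\<forall>\<^sub>F T in at_top. \<bar>(\<integral>\<omega>. f (recover R (exp_forms (A T \<omega>))) \<partial>M) - h T\<bar> \<le> e) \<and> \<bar>(\<integral>\<omega>. f (recover R (exp_forms (Z \<omega>))) \<partial>N) - l'\<bar> \<le> e"
    proof (intro exI conjI)
      show "((\<lambda>T. \<integral>\<omega>. g (exp_forms (A T \<omega>)) \<partial>M) \<longlongrightarrow> (\<integral>\<omega>. g (exp_forms (Z \<omega>)) \<partial>N)) at_top" by (rule poly[OF g(1)])
      show "\<forall>\<^sub>F T in at_top. \<bar>(\<integral>\<omega>. f (recover R (exp_forms (A T \<omega>))) \<partial>M) - (\<integral>\<omega>. g (exp_forms (A T \<omega>)) \<partial>M)\<bar> \<le> e"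
        using eventually_ge_at_top[of 1] by eventually_elim (intro close PM A cone)
      show "\<bar>(\<integral>\<omega>. f (recover R (exp_forms (Z \<omega>))) \<partial>N) - (\<integral>\<omega>. g (exp_forms (Z \<omega>)) \<partial>N)\<bar> \<le> e"
        by (intro close PN Z cone)
    qed
  qed
  \<comment> \<open>Off this event every \<open>form2 i j C\<close> is at most R, and
    \<open>recover R\<close> returns the matrix exactly.\<close>
  define bad where "bad R C = (of_bool (R < 4 * norm C) :: real)" for R and C :: "real ^ 3 ^ 3"
  have bad_m [measurable]: "bad R \<in> borel_measurable borel" for R unfolding bad_def by measurable
  have cut: "\<bar>(\<integral>\<omega>. f (X \<omega>) \<partial>\<Omega>) - (\<integral>\<omega>. f (recover R (exp_forms (X \<omega>))) \<partial>\<Omega>)\<bar> \<le> K * (\<integral>\<omega>. bad R (X \<omega>) \<partial>\<Omega>)"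
    if "prob_space \<Omega>" "X \<in> borel_measurable \<Omega>" "AE \<omega> in \<Omega>. X \<omega> \<in> nonneg_forms" for \<Omega> :: "'c measure" and X R
  proof -
    interpret \<Omega>: prob_space \<Omega> by (rule that)
    note [measurable] = that(2)
    have i1: "integrable \<Omega> (\<lambda>\<omega>. f (recover R (exp_forms (X \<omega>))))" by (rule fi[of \<Omega> "\<lambda>x. recover R (exp_forms x)" X]) (use that in auto)
    have i2: "integrable \<Omega> (\<lambda>\<omega>. f (X \<omega>))" by (rule fi[of \<Omega> "\<lambda>x. x" X]) (use that in auto)
    have i3: "integrable \<Omega> (\<lambda>\<omega>. bad R (X \<omega>))" by (rule \<Omega>.integrable_const_bound[of _ 1]) (auto simp: bad_def)
    have "\<bar>\<integral>\<omega>. f (X \<omega>) - f (recover R (exp_forms (X \<omega>))) \<partial>\<Omega>\<bar> \<le> (\<integral>\<omega>. \<bar>f (X \<omega>) - f (recover R (exp_forms (X \<omega>)))\<bar> \<partial>\<Omega>)"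
      by (rule integral_abs_bound)
    also have "\<dots> \<le> (\<integral>\<omega>. K * bad R (X \<omega>) \<partial>\<Omega>)"
    proof (rule integral_mono_AE)
      show "AE \<omega> in \<Omega>. \<bar>f (X \<omega>) - f (recover R (exp_forms (X \<omega>)))\<bar> \<le> K * bad R (X \<omega>)"
        using that(3)
      proof eventually_elim
        case (elim \<omega>)
        show ?case
        proof (cases "R < 4 * norm (X \<omega>)")
          case True
          then show ?thesis using f(2)[of "X \<omega>"] f(3)[of "X \<omega>"] f(2)[of "recover R (exp_forms (X \<omega>))"] f(3)[of "recover R (exp_forms (X \<omega>))"]
            by (simp add: bad_def abs_le_iff)
        next
          case False
          then have "form2 i j (X \<omega>) \<le> R" for i j using form2_le[of i j "X \<omega>"] by linarith
          then show ?thesis using False by (simp add: recover_exp_forms[OF elim] bad_def)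
        qed
      qed
    qed (use i1 i2 i3 in auto)
    finally show ?thesis using i1 i2 by simp
  qed
  \<comment> \<open>Markov's inequality, uniformly in T.\<close>
  have badA: "(\<integral>\<omega>. bad R (A T \<omega>) \<partial>M) \<le> 4 * D / R" if R: "0 < R" and T: "1 \<le> T" for R T
  proof -
    have i: "integrable M (\<lambda>\<omega>. norm (A T \<omega>))"
      by (rule integrableI_bounded) (use tight(2)[OF T] in \<open>auto simp: order_le_less_trans[OF _ ennreal_less_top]\<close>)
    have i2: "integrable M (\<lambda>\<omega>. bad R (A T \<omega>))"
      by (rule M.integrable_const_bound[of _ 1]) (auto simp: bad_def)
    have "bad R C \<le> 4 / R * norm C" for C using R by (simp add: bad_def field_simps)
    then have "(\<integral>\<omega>. bad R (A T \<omega>) \<partial>M) \<le> (\<integral>\<omega>. 4 / R * norm (A T \<omega>) \<partial>M)"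
      using i by (intro integral_mono[OF i2] integrable_mult_right)
    also have "\<dots> = 4 / R * (\<integral>\<omega>. norm (A T \<omega>) \<partial>M)" by (rule integral_mult_right_zero)
    also have "\<dots> \<le> 4 / R * D"
      using R integral_real_bounded[OF tight(1) tight(2)[OF T]] by (intro mult_left_mono) auto
    finally show ?thesis by simp
  qed
  \<comment> \<open>For the limit, finiteness of the norm and dominated convergence are enough,
    without a rate.\<close>
  have badZ: "(\<lambda>m. \<integral>\<omega>. bad (real m) (Z \<omega>) \<partial>N) \<longlonglongrightarrow> (\<integral>\<omega>. 0 \<partial>N)"
  proof (rule integral_dominated_convergence[where w="\<lambda>_. 1"])
    show "AE \<omega> in N. (\<lambda>m. bad (real m) (Z \<omega>)) \<longlonglongrightarrow> 0"
    proof (rule AE_I2, rule tendsto_eventually)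
      fix \<omega>
      obtain m0 :: nat where "4 * norm (Z \<omega>) \<le> real m0" using real_arch_simple by blast
      then show "\<forall>\<^sub>F m in sequentially. bad (real m) (Z \<omega>) = 0"
        by (intro eventually_sequentiallyI[of m0]) (auto simp: bad_def)
    qed
  qed (auto simp: bad_def)
  show ?thesis
  proof (rule tendsto_approx)
    fix e :: real assume e: "0 < e"
    have "\<forall>\<^sub>F m in sequentially. K * (4 * D / real m) < e"
      using e by (intro order_tendstoD(2)[of _ 0]) real_asymp
    moreover have "\<forall>\<^sub>F m in sequentially. K * (\<integral>\<omega>. bad (real m) (Z \<omega>) \<partial>N) < e"
      using tendsto_mult_left[OF badZ, of K] e by (intro order_tendstoD(2)[of _ 0]) auto
    ultimately have "\<forall>\<^sub>F m in sequentially. 0 < real m \<and> K * (4 * D / real m) < e \<and> K * (\<integral>\<omega>. bad (real m) (Z \<omega>) \<partial>N) < e"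
      using eventually_gt_at_top[of 0] by eventually_elim simp
    then obtain m where m: "0 < real m" "K * (4 * D / real m) < e" "K * (\<integral>\<omega>. bad (real m) (Z \<omega>) \<partial>N) < e"
      unfolding eventually_sequentially by blast
    show "\<exists>h l'. (h \<longlongrightarrow> l') at_top \<and> (\<forall>\<^sub>F T in at_top. \<bar>(\<integral>\<omega>. f (A T \<omega>) \<partial>M) - h T\<bar> \<le> e) \<and> \<bar>(\<integral>\<omega>. f (Z \<omega>) \<partial>N) - l'\<bar> \<le> e"
    proof (intro exI conjI)
      show "((\<lambda>T. \<integral>\<omega>. f (recover m (exp_forms (A T \<omega>))) \<partial>M) \<longlongrightarrow> (\<integral>\<omega>. f (recover m (exp_forms (Z \<omega>))) \<partial>N)) at_top"
        by (rule comp)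
      show "\<forall>\<^sub>F T in at_top. \<bar>(\<integral>\<omega>. f (A T \<omega>) \<partial>M) - (\<integral>\<omega>. f (recover m (exp_forms (A T \<omega>))) \<partial>M)\<bar> \<le> e"
        using eventually_ge_at_top[of 1]
      proof eventually_elim
        case (elim T)
        have "\<bar>(\<integral>\<omega>. f (A T \<omega>) \<partial>M) - (\<integral>\<omega>. f (recover m (exp_forms (A T \<omega>))) \<partial>M)\<bar> \<le> K * (\<integral>\<omega>. bad m (A T \<omega>) \<partial>M)"
          by (rule cut[OF PM A cone(1)[OF elim]])
        also have "\<dots> \<le> K * (4 * D / real m)" by (intro mult_left_mono badA elim m K0)
        finally show ?case using m by simp
      qed
      show "\<bar>(\<integral>\<omega>. f (Z \<omega>) \<partial>N) - (\<integral>\<omega>. f (recover m (exp_forms (Z \<omega>))) \<partial>N)\<bar> \<le> e"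
        using cut[OF PN Z cone(2), of "real m"] m(3) by simp
    qed
  qed
qed

text \<open>The value of \<open>quad \<kappa>\<close> at the outer square of v = (1, x, y), where
  \<open>form2 i j\<close> is the square of the sum of the entries i and j of v.\<close>

definition coarse_form :: "(3 \<Rightarrow> 3 \<Rightarrow> nat) \<Rightarrow> real \<Rightarrow> real \<Rightarrow> real" where
  "coarse_form \<kappa> x y = (\<Sum>i\<in>UNIV. \<Sum>j\<in>UNIV. real (\<kappa> i j) * ((vector [1, x, y] :: real ^ 3) $ i + (vector [1, x, y] :: real ^ 3) $ j)\<^sup>2)"

lemma form2_gram:
  "form2 i j (gram N X Y) = (\<Sum>k<N. ((vector [1, X k, Y k] :: real ^ 3) $ i + (vector [1, X k, Y k] :: real ^ 3) $ j)\<^sup>2) / real N"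
proof -
  let ?v = "\<lambda>k. vector [1, X k, Y k] :: real ^ 3"
  have e: "gram N X Y $ i $ j = (\<Sum>k<N. ?v k $ i * ?v k $ j) / real N" for i j
    by (simp add: gram_def outer_square_def divide_inverse mult.commute)
  show ?thesis unfolding form2_def e
    by (simp add: add_divide_distrib[symmetric] sum.distrib[symmetric] power2_eq_square algebra_simps)
qed

lemma gram_nonneg_forms: "gram N X Y \<in> nonneg_forms"
  unfolding nonneg_forms_def
proof (intro CollectI allI conjI)
  show "gram N X Y $ i $ j = gram N X Y $ j $ i" for i j by (simp add: gram_def outer_square_def mult.commute)
  show "0 \<le> form2 i j (gram N X Y)" for i j unfolding form2_gram by (intro divide_nonneg_nonneg sum_nonneg) auto
qed

lemma quad_gram: "quad \<kappa> (gram N X Y) = (\<Sum>k<N. coarse_form \<kappa> (X k) (Y k)) / real N"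
proof -
  have "quad \<kappa> (gram N X Y) = (\<Sum>i\<in>UNIV. \<Sum>j\<in>UNIV. \<Sum>k<N. real (\<kappa> i j) * ((vector [1, X k, Y k] :: real ^ 3) $ i + (vector [1, X k, Y k] :: real ^ 3) $ j)\<^sup>2 / real N)"
    unfolding quad_def form2_gram by (simp only: sum_divide_distrib sum_distrib_left times_divide_eq_right)
  also have "\<dots> = (\<Sum>k<N. coarse_form \<kappa> (X k) (Y k) / real N)"
    unfolding coarse_form_def sum_divide_distrib by (subst sum.swap[of _ "{..<N}"])+ (rule refl)
  finally show ?thesis by (simp add: sum_divide_distrib)
qed

text \<open>Difference of squares and Young's inequality with a free parameter h: squared
  differences are weighted by 1 / h and sizes by h. For differences of mean square 1 / n the choice
  h = 1 / sqrt n balances both.\<close>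

lemma coarse_form_diff:
  assumes h: "0 < h"
  shows "\<bar>coarse_form \<kappa> x y - coarse_form \<kappa> x' y'\<bar> \<le>
    (\<Sum>i\<in>UNIV. \<Sum>j\<in>UNIV. real (\<kappa> i j)) * (4 / h * ((x - x')\<^sup>2 + (y - y')\<^sup>2) + 4 * h * (2 + x\<^sup>2 + y\<^sup>2 + x'\<^sup>2 + y'\<^sup>2))"
proof -
  let ?v = "vector [1, x, y] :: real ^ 3" and ?w = "vector [1, x', y'] :: real ^ 3"
  let ?R = "4 / h * ((x - x')\<^sup>2 + (y - y')\<^sup>2) + 4 * h * (2 + x\<^sup>2 + y\<^sup>2 + x'\<^sup>2 + y'\<^sup>2)"
  have d: "(?v $ i - ?w $ i)\<^sup>2 \<le> (x - x')\<^sup>2 + (y - y')\<^sup>2" for i using exhaust_3[of i] by auto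
  have sv: "(?v $ i)\<^sup>2 \<le> 1 + x\<^sup>2 + y\<^sup>2" "(?w $ i)\<^sup>2 \<le> 1 + x'\<^sup>2 + y'\<^sup>2" for i using exhaust_3[of i] by auto
  have sq: "(a + b)\<^sup>2 \<le> 2 * a\<^sup>2 + 2 * b\<^sup>2" for a b :: real
    using zero_le_power2[of "a - b"] by (simp add: power2_sum power2_diff)
  have young: "\<bar>p * q\<bar> \<le> p\<^sup>2 / h + h / 4 * q\<^sup>2" for p q :: real
  proof -
    have "0 \<le> (\<bar>p\<bar> - h / 2 * \<bar>q\<bar>)\<^sup>2 / h" using h by simp
    also have "\<dots> = p\<^sup>2 / h - \<bar>p * q\<bar> + h / 4 * q\<^sup>2" using h by (simp add: power2_diff power_mult_distrib power_divide abs_mult field_simps power2_eq_square)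
    finally show ?thesis by linarith
  qed
  have t: "\<bar>(?v $ i + ?v $ j)\<^sup>2 - (?w $ i + ?w $ j)\<^sup>2\<bar> \<le> ?R" for i j
  proof -
    define p where "p = (?v $ i - ?w $ i) + (?v $ j - ?w $ j)"
    define q where "q = (?v $ i + ?v $ j) + (?w $ i + ?w $ j)"
    have pq: "(?v $ i + ?v $ j)\<^sup>2 - (?w $ i + ?w $ j)\<^sup>2 = p * q" by (simp add: p_def q_def power2_eq_square algebra_simps)
    have pp: "p\<^sup>2 \<le> 4 * ((x - x')\<^sup>2 + (y - y')\<^sup>2)"
    proof -
      have "p\<^sup>2 \<le> 2 * ((x - x')\<^sup>2 + (y - y')\<^sup>2) + 2 * ((x - x')\<^sup>2 + (y - y')\<^sup>2)"
        unfolding p_def by (intro order_trans[OF sq add_mono] mult_left_mono d) auto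
      then show ?thesis by simp
    qed
    have qq: "q\<^sup>2 \<le> 16 * (2 + x\<^sup>2 + y\<^sup>2 + x'\<^sup>2 + y'\<^sup>2)"
    proof -
      have a1: "(?v $ i + ?v $ j)\<^sup>2 \<le> 2 * (1 + x\<^sup>2 + y\<^sup>2) + 2 * (1 + x\<^sup>2 + y\<^sup>2)"
        by (intro order_trans[OF sq add_mono] mult_left_mono sv) auto
      have a2: "(?w $ i + ?w $ j)\<^sup>2 \<le> 2 * (1 + x'\<^sup>2 + y'\<^sup>2) + 2 * (1 + x'\<^sup>2 + y'\<^sup>2)"
        by (intro order_trans[OF sq add_mono] mult_left_mono sv) auto
      have "q\<^sup>2 \<le> 2 * (2 * (1 + x\<^sup>2 + y\<^sup>2) + 2 * (1 + x\<^sup>2 + y\<^sup>2)) + 2 * (2 * (1 + x'\<^sup>2 + y'\<^sup>2) + 2 * (1 + x'\<^sup>2 + y'\<^sup>2))"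
        unfolding q_def by (rule order_trans[OF sq add_mono[OF mult_left_mono[OF a1] mult_left_mono[OF a2]]]) auto
      also have "\<dots> \<le> 16 * (2 + x\<^sup>2 + y\<^sup>2 + x'\<^sup>2 + y'\<^sup>2)" by simp
      finally show ?thesis .
    qed
    have "\<bar>p * q\<bar> \<le> 4 * ((x - x')\<^sup>2 + (y - y')\<^sup>2) / h + h / 4 * (16 * (2 + x\<^sup>2 + y\<^sup>2 + x'\<^sup>2 + y'\<^sup>2))"
      using h by (intro order_trans[OF young add_mono] divide_right_mono mult_left_mono pp qq) auto
    also have "\<dots> = ?R" by simp
    finally show ?thesis unfolding pq .
  qed
  have "\<bar>coarse_form \<kappa> x y - coarse_form \<kappa> x' y'\<bar> = \<bar>\<Sum>i\<in>UNIV. \<Sum>j\<in>UNIV. real (\<kappa> i j) * ((?v $ i + ?v $ j)\<^sup>2 - (?w $ i + ?w $ j)\<^sup>2)\<bar>"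
    unfolding coarse_form_def by (simp only: sum_subtractf right_diff_distrib)
  also have "\<dots> \<le> (\<Sum>i\<in>UNIV. \<Sum>j\<in>UNIV. \<bar>real (\<kappa> i j) * ((?v $ i + ?v $ j)\<^sup>2 - (?w $ i + ?w $ j)\<^sup>2)\<bar>)"
    by (rule order_trans[OF sum_abs sum_mono[OF sum_abs]])
  also have "\<dots> \<le> (\<Sum>i\<in>UNIV. \<Sum>j\<in>UNIV. real (\<kappa> i j) * ?R)"
    unfolding abs_mult by (intro sum_mono mult_mono t) auto
  also have "\<dots> = (\<Sum>i\<in>UNIV. \<Sum>j\<in>UNIV. real (\<kappa> i j)) * ?R" by (simp only: sum_distrib_right)
  finally show ?thesis .
qed

text \<open>The quadratic functional is a sum of 9 n squares of affine functions, one for each grid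
  point and each pair of matrix indices, and each square becomes one Gaussian factor.\<close>

lemma exp_quad_gram_eq_gfac:
  assumes n: "0 < n"
  obtains fs where "\<And>X Y. exp (- quad \<kappa> (gram n X Y)) = gfac n fs X Y"
proof -
  have prodf: "gfac n (map \<phi> xs) X Y = exp (- (\<Sum>x\<leftarrow>xs. (case \<phi> x of (a, b, d) \<Rightarrow> (lin n a b X Y + d)\<^sup>2 / 2)))" for \<phi> X Y and xs :: "(nat \<times> 3 \<times> 3) list"
    by (induction xs) (auto simp: exp_add[symmetric] split: prod.splits)
  \<comment> \<open>The 2 under the root cancels the 1 / 2 in the exponent of \<open>gfac\<close>.
    The axes 2 and 3 pick the coefficients of X k and Y k, the axis 1 the constant.\<close>
  define \<phi> where "\<phi> = (\<lambda>(k :: nat, i :: 3, j :: 3). let c = sqrt (2 * real (\<kappa> i j) / real n) in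
     ((\<lambda>m. if m = k then c * (axis 2 1 $ i + axis 2 1 $ j) else 0), (\<lambda>m. if m = k then c * (axis 3 1 $ i + axis 3 1 $ j) else 0), c * (axis 1 1 $ i + axis 1 1 $ j :: real)))"
  let ?S = "{..<n} \<times> (UNIV :: 3 set) \<times> (UNIV :: 3 set)"
  obtain xs where xs: "set xs = ?S" "distinct xs" using finite_distinct_list[of ?S] by auto
  have trm: "(case \<phi> (k, i, j) of (a, b, d) \<Rightarrow> (lin n a b X Y + d)\<^sup>2 / 2) = real (\<kappa> i j) * ((vector [1, X k, Y k] :: real ^ 3) $ i + (vector [1, X k, Y k] :: real ^ 3) $ j)\<^sup>2 / real n"
    if k: "k < n" for k i j X Y
  proof -
    define c where "c = sqrt (2 * real (\<kappa> i j) / real n)"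
    have c2: "c\<^sup>2 = 2 * real (\<kappa> i j) / real n" by (simp add: c_def)
    have v: "(vector [1, X k, Y k] :: real ^ 3) $ l = axis 1 1 $ l + axis 2 1 $ l * X k + axis 3 1 $ l * Y k" for l
      using exhaust_3[of l] by (auto simp: axis_def)
    have l: "lin n (\<lambda>m. if m = k then \<alpha> else 0) (\<lambda>m. if m = k then \<beta> else 0) X Y = \<alpha> * X k + \<beta> * Y k" for \<alpha> \<beta>
      unfolding lin_def using k by (simp add: sum.distrib if_distrib[of "\<lambda>z. z * _"] cong: if_cong)
    have "(case \<phi> (k, i, j) of (a, b, d) \<Rightarrow> (lin n a b X Y + d)\<^sup>2 / 2) =
       (c * ((vector [1, X k, Y k] :: real ^ 3) $ i + (vector [1, X k, Y k] :: real ^ 3) $ j))\<^sup>2 / 2"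
      unfolding \<phi>_def Let_def prod.case c_def[symmetric] l v by (simp add: algebra_simps)
    then show ?thesis unfolding power_mult_distrib c2 by simp
  qed
  have "gfac n (map \<phi> xs) X Y = exp (- quad \<kappa> (gram n X Y))" for X Y
  proof -
    have "(\<Sum>x\<leftarrow>xs. (case \<phi> x of (a, b, d) \<Rightarrow> (lin n a b X Y + d)\<^sup>2 / 2)) = (\<Sum>x\<in>?S. (case \<phi> x of (a, b, d) \<Rightarrow> (lin n a b X Y + d)\<^sup>2 / 2))"
      unfolding sum_list_distinct_conv_sum_set[OF xs(2)] xs(1) ..
    also have "\<dots> = (\<Sum>(k, i, j)\<in>?S. real (\<kappa> i j) * ((vector [1, X k, Y k] :: real ^ 3) $ i + (vector [1, X k, Y k] :: real ^ 3) $ j)\<^sup>2 / real n)"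
      by (intro sum.cong refl) (use trm in auto)
    also have "\<dots> = quad \<kappa> (gram n X Y)"
      unfolding quad_gram coarse_form_def sum_divide_distrib sum.cartesian_product by (simp add: split_def)
    finally show ?thesis unfolding prodf by simp
  qed
  then show thesis using that by metis
qed

context brownian_motion
begin

lemma grid_increment_moment:
  assumes T: "1 \<le> T" "T \<le> real N" and rt: "r \<le> t" "t \<le> N" and H: "(real t - real r) / real N \<le> H" "1 / T \<le> H"
  shows "(\<integral>\<omega>. (xgrid T N t \<omega> - xgrid T N r \<omega>)\<^sup>2 \<partial>M) \<le> 4 * exp 24 * H" "(\<integral>\<omega>. (ygrid T N t \<omega> - ygrid T N r \<omega>)\<^sup>2 \<partial>M) \<le> 4 * exp 24 * H"
proof -
  have T0: "0 < T" and N0: "0 < N" using T by (auto intro: Nat.gr0I)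
  have H0: "0 \<le> H" using H(2) T0 by (smt (verit) zero_le_divide_1_iff)
  let ?s = "sqrt (T / real N)"
  have r: "r \<le> N" using rt by simp
  have m: "(\<lambda>x. sqrt T / real N * xpath t x) \<in> borel_measurable (walk ?s N)" "(\<lambda>x. sqrt T / real N * xpath r x) \<in> borel_measurable (walk ?s N)"
    "(\<lambda>x. sqrt T / real N * ypath t x) \<in> borel_measurable (walk ?s N)" "(\<lambda>x. sqrt T / real N * ypath r x) \<in> borel_measurable (walk ?s N)"
    by (intro borel_measurable_times borel_measurable_const path_measurable; use rt r in simp)+
  have split: "(\<Sum>j<t. f j) - (\<Sum>j<r. f j) = (\<Sum>j\<in>{r..<t}. f j)" for f :: "nat \<Rightarrow> real"
    using rt sum_diff_nat_ivl[of 0 r t f] by (simp add: atLeast0LessThan)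
  have "(\<integral>\<omega>. (xgrid T N t \<omega> - xgrid T N r \<omega>)\<^sup>2 \<partial>M) = (\<integral>x. (sqrt T / real N * xpath t x - sqrt T / real N * xpath r x)\<^sup>2 \<partial>walk ?s N)"
    unfolding xgrid_def by (rule incr_integral[OF T0 N0]) (intro borel_measurable_power borel_measurable_diff m)
  also have "\<dots> = (\<integral>x. \<bar>sqrt T / real N * Re ((- \<i>) * (\<Sum>j\<in>{r..<t}. cis (phase j x)))\<bar> ^ 2 \<partial>walk ?s N)"
    unfolding right_diff_distrib[symmetric] xpath_def split power2_abs by (simp add: times_complex.sel Im_sum)
  also have "\<dots> \<le> 2 * fact 2 * exp 24 * (sqrt H) ^ 2"
    by (rule walk_increment_moment[OF T0 T(2) refl _ rt H]) simp
  finally show "(\<integral>\<omega>. (xgrid T N t \<omega> - xgrid T N r \<omega>)\<^sup>2 \<partial>M) \<le> 4 * exp 24 * H" using H0 by simp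
  have "(\<integral>\<omega>. (ygrid T N t \<omega> - ygrid T N r \<omega>)\<^sup>2 \<partial>M) = (\<integral>x. (sqrt T / real N * ypath t x - sqrt T / real N * ypath r x)\<^sup>2 \<partial>walk ?s N)"
    unfolding ygrid_def by (rule incr_integral[OF T0 N0]) (intro borel_measurable_power borel_measurable_diff m)
  also have "\<dots> = (\<integral>x. \<bar>sqrt T / real N * Re ((- 1) * (\<Sum>j\<in>{r..<t}. cis (phase j x)))\<bar> ^ 2 \<partial>walk ?s N)"
  proof (rule Bochner_Integration.integral_cong[OF refl])
    fix x
    have eq: "sqrt T / real N * ypath t x - sqrt T / real N * ypath r x = - (sqrt T / real N * ((\<Sum>j<t. cos (phase j x)) - (\<Sum>j<r. cos (phase j x))))"
      by (simp add: ypath_def algebra_simps)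
    show "(sqrt T / real N * ypath t x - sqrt T / real N * ypath r x)\<^sup>2 = \<bar>sqrt T / real N * Re ((- 1) * (\<Sum>j\<in>{r..<t}. cis (phase j x)))\<bar> ^ 2"
      unfolding power2_abs eq split by (simp add: Re_sum)
  qed
  also have "\<dots> \<le> 2 * fact 2 * exp 24 * (sqrt H) ^ 2"
    by (rule walk_increment_moment[OF T0 T(2) refl _ rt H]) simp
  finally show "(\<integral>\<omega>. (ygrid T N t \<omega> - ygrid T N r \<omega>)\<^sup>2 \<partial>M) \<le> 4 * exp 24 * H" using H0 by simp
qed

text \<open>The condition n \<le> T gives 1 / T \<le> 1 / n, so the increment bound holds with H = 1
  / n, the coarse mesh. Of the constant, 8 + 64 exp 24 comes from the sizes and 32 exp 24 from the
  squared differences.\<close>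

lemma fine_coarse_grid:
  assumes n: "0 < n" and T: "1 \<le> T" "real n \<le> T" "T \<le> real (n * L)"
  shows "\<bar>(\<integral>\<omega>. exp (- quad \<kappa> (CN T (n * L) \<omega>)) \<partial>M) - (\<integral>\<omega>. exp (- quad \<kappa> (gram n (\<lambda>j. xgrid T (n * L) (j * L) \<omega>) (\<lambda>j. ygrid T (n * L) (j * L) \<omega>))) \<partial>M)\<bar>
     \<le> (\<Sum>i\<in>UNIV. \<Sum>j\<in>UNIV. real (\<kappa> i j)) * ((8 + 96 * exp 24) / sqrt (real n))"
proof -
  let ?N = "n * L" and ?h = "1 / sqrt (real n)"
  let ?K = "\<Sum>i\<in>UNIV. \<Sum>j\<in>UNIV. real (\<kappa> i j)"
  have L: "0 < L" using T by (intro Nat.gr0I) auto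
  have h: "0 < ?h" using n by simp
  define x where "x k \<omega> = xgrid T ?N k \<omega>" for k \<omega>
  define y where "y k \<omega> = ygrid T ?N k \<omega>" for k \<omega>
  \<comment> \<open>Rounding down to the coarse grid: averaging over k < n L at the rounded indices
    reproduces the coarse Gram matrix exactly.\<close>
  define c where "c k = (k div L) * L" for k
  have c: "c k \<le> k" "c k \<le> ?N" "k - c k \<le> L" if "k < ?N" for k
  proof -
    show "c k \<le> k" by (simp add: c_def)
    then show "c k \<le> ?N" using that by simp
    have "k - c k = k mod L" by (simp add: c_def minus_div_mult_eq_mod)
    then show "k - c k \<le> L" using L by (simp add: less_imp_le)
  qed
  define e where "e k \<omega> = ?K * (4 / ?h * ((x k \<omega> - x (c k) \<omega>)\<^sup>2 + (y k \<omega> - y (c k) \<omega>)\<^sup>2) + 4 * ?h * (2 + (x k \<omega>)\<^sup>2 + (y k \<omega>)\<^sup>2 + (x (c k) \<omega>)\<^sup>2 + (y (c k) \<omega>)\<^sup>2))" for k \<omega>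
  let ?g = "\<lambda>\<omega>. gram n (\<lambda>j. x (j * L) \<omega>) (\<lambda>j. y (j * L) \<omega>)"
  have coarse: "quad \<kappa> (?g \<omega>) = (\<Sum>k<?N. coarse_form \<kappa> (x (c k) \<omega>) (y (c k) \<omega>)) / real ?N" for \<omega>
  proof -
    have "(\<Sum>k<n * L. coarse_form \<kappa> (x (c k) \<omega>) (y (c k) \<omega>)) = (\<Sum>j<n. \<Sum>k\<in>{j*L..<j*L+L}. coarse_form \<kappa> (x (c k) \<omega>) (y (c k) \<omega>))"
      by (rule sum.nat_group[symmetric])
    also have "\<dots> = (\<Sum>j<n. \<Sum>k\<in>{j*L..<j*L+L}. coarse_form \<kappa> (x (j * L) \<omega>) (y (j * L) \<omega>))"
    proof (intro sum.cong refl)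
      fix j k assume "k \<in> {j*L..<j*L+L}"
      then have "k div L = j" by (intro div_nat_eqI) (auto simp: mult.commute)
      then show "coarse_form \<kappa> (x (c k) \<omega>) (y (c k) \<omega>) = coarse_form \<kappa> (x (j * L) \<omega>) (y (j * L) \<omega>)" by (simp add: c_def)
    qed
    also have "\<dots> = real L * (\<Sum>j<n. coarse_form \<kappa> (x (j * L) \<omega>) (y (j * L) \<omega>))" by (simp add: sum_distrib_left)
    finally show ?thesis unfolding quad_gram using L by simp
  qed
  have fine: "quad \<kappa> (CN T ?N \<omega>) = (\<Sum>k<?N. coarse_form \<kappa> (x k \<omega>) (y k \<omega>)) / real ?N" for \<omega>
    unfolding CN_def quad_gram x_def y_def ..
  have lip: "\<bar>exp (- a) - exp (- b)\<bar> \<le> \<bar>a - b\<bar>" if "0 \<le> a" "0 \<le> b" for a b :: real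
  proof -
    have *: "exp (- b) - exp (- a) \<le> a - b" if "0 \<le> b" "b \<le> a" for a b :: real
    proof -
      have "exp (- b) * (1 - exp (- (a - b))) \<le> 1 * (a - b)"
      proof (rule mult_mono)
        show "1 - exp (- (a - b)) \<le> a - b" using exp_ge_add_one_self[of "- (a - b)"] by linarith
      qed (use that in auto)
      moreover have "exp (- a) = exp (- b) * exp (- (a - b))" by (simp add: exp_add[symmetric])
      ultimately show ?thesis by (simp add: algebra_simps)
    qed
    show ?thesis using *[of b a] *[of a b] that by (cases "a \<le> b") (auto simp: abs_if)
  qed
  have pw: "\<bar>exp (- quad \<kappa> (CN T ?N \<omega>)) - exp (- quad \<kappa> (?g \<omega>))\<bar> \<le> (\<Sum>k<?N. e k \<omega>) / real ?N" for \<omega>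
  proof -
    have "\<bar>exp (- quad \<kappa> (CN T ?N \<omega>)) - exp (- quad \<kappa> (?g \<omega>))\<bar> \<le> \<bar>quad \<kappa> (CN T ?N \<omega>) - quad \<kappa> (?g \<omega>)\<bar>"
      by (intro lip quad_nonneg) (simp_all add: CN_def gram_nonneg_forms)
    also have "\<dots> = \<bar>\<Sum>k<?N. coarse_form \<kappa> (x k \<omega>) (y k \<omega>) - coarse_form \<kappa> (x (c k) \<omega>) (y (c k) \<omega>)\<bar> / real ?N"
      unfolding fine coarse by (simp add: diff_divide_distrib[symmetric] sum_subtractf)
    also have "\<dots> \<le> (\<Sum>k<?N. e k \<omega>) / real ?N"
      unfolding e_def by (intro divide_right_mono order_trans[OF sum_abs] sum_mono coarse_form_diff h) auto
    finally show ?thesis .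
  qed
  have sqi: "integrable M (\<lambda>\<omega>. (x k \<omega>)\<^sup>2)" "integrable M (\<lambda>\<omega>. (y k \<omega>)\<^sup>2)" if "k \<le> ?N" for k
    unfolding x_def y_def by (rule grid_power_integrable[OF that])+
  have mxy: "x k \<in> borel_measurable M" "y k \<in> borel_measurable M" if "k \<le> ?N" for k
    unfolding x_def[abs_def] y_def[abs_def] by (rule grid_measurable[OF that])+
  have dsq: "integrable M (\<lambda>\<omega>. (x k \<omega> - x l \<omega>)\<^sup>2)" "integrable M (\<lambda>\<omega>. (y k \<omega> - y l \<omega>)\<^sup>2)" if kl: "k \<le> ?N" "l \<le> ?N" for k l
  proof -
    have dom: "integrable M (\<lambda>\<omega>. (f \<omega> - g \<omega>)\<^sup>2)"
      if "integrable M (\<lambda>\<omega>. (f \<omega>)\<^sup>2)" "integrable M (\<lambda>\<omega>. (g \<omega>)\<^sup>2)" "f \<in> borel_measurable M" "g \<in> borel_measurable M" for f g :: "'a \<Rightarrow> real"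
    proof (rule Bochner_Integration.integrable_bound[of M "\<lambda>\<omega>. 2 * (f \<omega>)\<^sup>2 + 2 * (g \<omega>)\<^sup>2"])
      have "(a - b)\<^sup>2 \<le> 2 * a\<^sup>2 + 2 * b\<^sup>2" for a b :: real
        using zero_le_power2[of "a + b"] by (simp add: power2_sum power2_diff)
      then show "AE \<omega> in M. norm ((f \<omega> - g \<omega>)\<^sup>2) \<le> norm (2 * (f \<omega>)\<^sup>2 + 2 * (g \<omega>)\<^sup>2)" by simp
    qed (use that in auto)
    show "integrable M (\<lambda>\<omega>. (x k \<omega> - x l \<omega>)\<^sup>2)" "integrable M (\<lambda>\<omega>. (y k \<omega> - y l \<omega>)\<^sup>2)"
      by (intro dom sqi mxy kl)+
  qed
  have ei: "integrable M (e k)" if "k < ?N" for k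
    unfolding e_def[abs_def] using that c(2)[OF that]
    by (intro integrable_mult_right Bochner_Integration.integrable_add sqi dsq integrable_const) auto
  have ee: "(\<integral>\<omega>. e k \<omega> \<partial>M) \<le> ?K * ((8 + 96 * exp 24) / sqrt (real n))" if k: "k < ?N" for k
  proof -
    have kN: "k \<le> ?N" using k by simp
    have H: "(real k - real (c k)) / real ?N \<le> 1 / real n"
    proof -
      have "real k - real (c k) \<le> real L" using c(1,3)[OF k] by linarith
      then have "(real k - real (c k)) / real ?N \<le> real L / real ?N" by (rule divide_right_mono) simp
      then show ?thesis using L by simp
    qed
    have H': "1 / T \<le> 1 / real n" using T n by (intro divide_left_mono) auto
    have s: "(\<integral>\<omega>. (x l \<omega>)\<^sup>2 \<partial>M) \<le> 4 * exp 24" "(\<integral>\<omega>. (y l \<omega>)\<^sup>2 \<partial>M) \<le> 4 * exp 24" if "l \<le> ?N" for l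
      using grid_moment[OF T(1,3) that, of 2] unfolding x_def y_def by simp_all
    note d = grid_increment_moment[OF T(1,3) c(1)[OF k] kN H H', folded x_def y_def]
    note ii = sqi[OF kN] sqi[OF c(2)[OF k]] dsq[OF kN c(2)[OF k]]
    have "(\<integral>\<omega>. e k \<omega> \<partial>M) = ?K * (4 / ?h * ((\<integral>\<omega>. (x k \<omega> - x (c k) \<omega>)\<^sup>2 \<partial>M) + (\<integral>\<omega>. (y k \<omega> - y (c k) \<omega>)\<^sup>2 \<partial>M))
       + 4 * ?h * (2 + (\<integral>\<omega>. (x k \<omega>)\<^sup>2 \<partial>M) + (\<integral>\<omega>. (y k \<omega>)\<^sup>2 \<partial>M) + (\<integral>\<omega>. (x (c k) \<omega>)\<^sup>2 \<partial>M) + (\<integral>\<omega>. (y (c k) \<omega>)\<^sup>2 \<partial>M)))"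
      unfolding e_def by (subst integral_mult_right_zero, simp add: ii prob_space)
    also have "\<dots> \<le> ?K * (4 / ?h * (4 * exp 24 * (1 / real n) + 4 * exp 24 * (1 / real n)) + 4 * ?h * (2 + 4 * exp 24 + 4 * exp 24 + 4 * exp 24 + 4 * exp 24))"
      using h by (intro mult_left_mono add_mono d s kN c(2)[OF k] order_refl sum_nonneg) auto
    also have "\<dots> = ?K * ((8 + 96 * exp 24) / sqrt (real n))"
    proof -
      have r: "sqrt (real n) / real n = 1 / sqrt (real n)" using n by (simp add: real_div_sqrt field_simps)
      have "4 / ?h * (4 * exp 24 * (1 / real n) + 4 * exp 24 * (1 / real n)) = 32 * exp 24 * (sqrt (real n) / real n)"
        by (simp add: field_simps)
      also have "\<dots> = 32 * exp 24 * ?h" unfolding r ..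
      finally have "4 / ?h * (4 * exp 24 * (1 / real n) + 4 * exp 24 * (1 / real n)) = 32 * exp 24 * ?h" .
      then show ?thesis by (simp only:) (simp add: add_divide_distrib algebra_simps)
    qed
    finally show ?thesis .
  qed
  have qm [measurable]: "quad \<kappa> \<in> borel_measurable borel" by (intro borel_measurable_continuous_onI continuous_quad)
  have gm [measurable]: "?g \<in> borel_measurable M" by (intro gram_measurable mxy) auto
  have i: "integrable M (\<lambda>\<omega>. exp (- quad \<kappa> (CN T ?N \<omega>)))" "integrable M (\<lambda>\<omega>. exp (- quad \<kappa> (?g \<omega>)))"
  proof -
    have nn: "0 \<le> quad \<kappa> (CN T ?N \<omega>)" "0 \<le> quad \<kappa> (?g \<omega>)" for \<omega>
      by (simp_all add: CN_def quad_nonneg gram_nonneg_forms)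
    show "integrable M (\<lambda>\<omega>. exp (- quad \<kappa> (CN T ?N \<omega>)))" by (rule integrable_const_bound[of _ 1]) (simp_all add: nn)
    show "integrable M (\<lambda>\<omega>. exp (- quad \<kappa> (?g \<omega>)))" by (rule integrable_const_bound[of _ 1]) (simp_all add: nn)
  qed
  have "\<bar>\<integral>\<omega>. exp (- quad \<kappa> (CN T ?N \<omega>)) - exp (- quad \<kappa> (?g \<omega>)) \<partial>M\<bar> \<le> (\<integral>\<omega>. \<bar>exp (- quad \<kappa> (CN T ?N \<omega>)) - exp (- quad \<kappa> (?g \<omega>))\<bar> \<partial>M)"
    by (rule integral_abs_bound)
  also have "\<dots> \<le> (\<integral>\<omega>. (\<Sum>k<?N. e k \<omega>) / real ?N \<partial>M)"
    by (intro integral_mono pw integrable_divide Bochner_Integration.integrable_sum ei integrable_abs Bochner_Integration.integrable_diff i) auto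
  also have "\<dots> = (\<Sum>k<?N. \<integral>\<omega>. e k \<omega> \<partial>M) / real ?N" using ei by (simp del: of_nat_mult)
  also have "\<dots> \<le> (\<Sum>k<?N. ?K * ((8 + 96 * exp 24) / sqrt (real n))) / real ?N"
    by (intro divide_right_mono sum_mono ee) auto
  also have "\<dots> = ?K * ((8 + 96 * exp 24) / sqrt (real n))" using n L by simp
  finally show ?thesis using i by (simp add: x_def y_def)
qed

end

lemma quad_gram_tendsto:
  assumes "\<And>j. j < n \<Longrightarrow> (\<lambda>L. X L j) \<longlonglongrightarrow> X' j" "\<And>j. j < n \<Longrightarrow> (\<lambda>L. Y L j) \<longlonglongrightarrow> Y' j" and n: "0 < n"
  shows "(\<lambda>L. quad \<kappa> (gram n (X L) (Y L))) \<longlonglongrightarrow> quad \<kappa> (gram n X' Y')"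
proof -
  have v: "(\<lambda>L. (vector [1, X L j, Y L j] :: real ^ 3) $ i) \<longlonglongrightarrow> (vector [1, X' j, Y' j] :: real ^ 3) $ i" if "j < n" for i j
    using exhaust_3[of i] assms(1,2)[OF that] by auto
  show ?thesis unfolding quad_gram coarse_form_def
    by (intro tendsto_divide tendsto_sum tendsto_mult_left tendsto_power tendsto_add v tendsto_const) (use n in auto)
qed

lemma quad_tendsto: "X \<longlonglongrightarrow> C \<Longrightarrow> (\<lambda>L. quad \<kappa> (X L)) \<longlonglongrightarrow> quad \<kappa> C"
  by (rule continuous_on_tendsto_compose[OF continuous_quad[of UNIV]]) auto

lemma quad_measurable [measurable]: "quad \<kappa> \<in> borel_measurable borel"
  by (intro borel_measurable_continuous_onI continuous_quad)

context brownian_motion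
begin

text \<open>The comparison of grids has a bound independent of L, so it survives the limit of L to
  infinity, and it is uniform in T \<ge> n.\<close>

lemma laplace_coarse:
  assumes n: "0 < n" and T: "1 \<le> T" "real n \<le> T"
  shows "\<bar>(\<integral>\<omega>. exp (- quad \<kappa> (Cm T \<omega>)) \<partial>M) - (\<integral>\<omega>. exp (- quad \<kappa> (gram n (\<lambda>j. xcoarse n T j \<omega>) (\<lambda>j. ycoarse n T j \<omega>))) \<partial>M)\<bar>
     \<le> (\<Sum>i\<in>UNIV. \<Sum>j\<in>UNIV. real (\<kappa> i j)) * ((8 + 96 * exp 24) / sqrt (real n))"
proof (rule LIMSEQ_le_const2)
  let ?g = "\<lambda>L \<omega>. gram n (\<lambda>j. xgrid T (n * L) (j * L) \<omega>) (\<lambda>j. ygrid T (n * L) (j * L) \<omega>)"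
  let ?c = "\<lambda>\<omega>. gram n (\<lambda>j. xcoarse n T j \<omega>) (\<lambda>j. ycoarse n T j \<omega>)"
  have gm [measurable]: "?g L \<in> borel_measurable M" for L by (intro gram_measurable grid_measurable) auto
  have cm [measurable]: "?c \<in> borel_measurable M" by (intro gram_measurable coarse_measurable)
  have le1: "norm (exp (- quad \<kappa> (gram N X Y))) \<le> 1" for N X Y
    using quad_nonneg[OF gram_nonneg_forms] by simp
  have sub: "filterlim (\<lambda>L. n * L) sequentially sequentially"
    using n by (intro filterlim_subseq) (auto simp: strict_mono_def)
  have "(\<lambda>L. \<integral>\<omega>. exp (- quad \<kappa> (CN T (n * L) \<omega>)) \<partial>M) \<longlonglongrightarrow> (\<integral>\<omega>. exp (- quad \<kappa> (Cm T \<omega>)) \<partial>M)"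
  proof (rule integral_dominated_convergence[where w="\<lambda>_. 1"])
    show "AE \<omega> in M. (\<lambda>L. exp (- quad \<kappa> (CN T (n * L) \<omega>))) \<longlonglongrightarrow> exp (- quad \<kappa> (Cm T \<omega>))"
      using AE_good
    proof eventually_elim
      case (elim \<omega>)
      show ?case by (intro tendsto_exp tendsto_minus quad_tendsto filterlim_compose[OF good_CN_tendsto(1)[OF elim] sub])
    qed
    show "AE \<omega> in M. norm (exp (- quad \<kappa> (CN T (n * L) \<omega>))) \<le> 1" for L unfolding CN_def by (intro AE_I2 le1)
  qed auto
  moreover have "(\<lambda>L. \<integral>\<omega>. exp (- quad \<kappa> (?g L \<omega>)) \<partial>M) \<longlonglongrightarrow> (\<integral>\<omega>. exp (- quad \<kappa> (?c \<omega>)) \<partial>M)"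
  proof (rule integral_dominated_convergence[where w="\<lambda>_. 1"])
    show "AE \<omega> in M. (\<lambda>L. exp (- quad \<kappa> (?g L \<omega>))) \<longlonglongrightarrow> exp (- quad \<kappa> (?c \<omega>))"
      using AE_good
    proof eventually_elim
      case (elim \<omega>)
      show ?case by (intro tendsto_exp tendsto_minus quad_gram_tendsto good_coarse_tendsto elim n)
    qed
    show "AE \<omega> in M. norm (exp (- quad \<kappa> (?g L \<omega>))) \<le> 1" for L by (intro AE_I2 le1)
  qed auto
  ultimately show "(\<lambda>L. \<bar>(\<integral>\<omega>. exp (- quad \<kappa> (CN T (n * L) \<omega>)) \<partial>M) - (\<integral>\<omega>. exp (- quad \<kappa> (?g L \<omega>)) \<partial>M)\<bar>)
    \<longlonglongrightarrow> \<bar>(\<integral>\<omega>. exp (- quad \<kappa> (Cm T \<omega>)) \<partial>M) - (\<integral>\<omega>. exp (- quad \<kappa> (?c \<omega>)) \<partial>M)\<bar>"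
    by (intro tendsto_rabs tendsto_diff)
  obtain L0 :: nat where L0: "T \<le> real L0" using real_arch_simple by blast
  show "\<exists>L1. \<forall>L\<ge>L1. \<bar>(\<integral>\<omega>. exp (- quad \<kappa> (CN T (n * L) \<omega>)) \<partial>M) - (\<integral>\<omega>. exp (- quad \<kappa> (?g L \<omega>)) \<partial>M)\<bar>
     \<le> (\<Sum>i\<in>UNIV. \<Sum>j\<in>UNIV. real (\<kappa> i j)) * ((8 + 96 * exp 24) / sqrt (real n))"
  proof (intro exI[of _ L0] allI impI)
    fix L assume "L0 \<le> L"
    then have "L0 \<le> n * L" using n by (metis Suc_leI One_nat_def mult_le_mono nat_mult_1)
    then have "T \<le> real (n * L)" using L0 by (meson of_nat_le_iff order_trans)
    then show "\<bar>(\<integral>\<omega>. exp (- quad \<kappa> (CN T (n * L) \<omega>)) \<partial>M) - (\<integral>\<omega>. exp (- quad \<kappa> (?g L \<omega>)) \<partial>M)\<bar>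
     \<le> (\<Sum>i\<in>UNIV. \<Sum>j\<in>UNIV. real (\<kappa> i j)) * ((8 + 96 * exp 24) / sqrt (real n))"
      by (rule fine_coarse_grid[OF n T])
  qed
qed

lemma Cm_nonneg_forms: "AE \<omega> in M. Cm T \<omega> \<in> nonneg_forms"
  using AE_good
proof eventually_elim
  case (elim \<omega>)
  show ?case
    by (rule closed_sequentially[OF closed_nonneg_forms _ good_CN_tendsto(1)[OF elim]]) (simp add: CN_def gram_nonneg_forms)
qed

end

section \<open>The limit matrix and its Laplace transforms\<close>

definition limit_gram :: "(real \<Rightarrow> 'a \<Rightarrow> real) \<Rightarrow> (real \<Rightarrow> 'a \<Rightarrow> real) \<Rightarrow> nat \<Rightarrow> 'a \<Rightarrow> real ^ 3 ^ 3" where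
  "limit_gram W1 W2 n \<omega> = gram n (\<lambda>j. sqrt 2 * W1 (real j / real n) \<omega>) (\<lambda>j. sqrt 2 * W2 (real j / real n) \<omega>)"

text \<open>A measurable version of \<open>G_limit\<close>, equal to it almost surely by continuity
  of the paths.\<close>

definition Gm :: "(real \<Rightarrow> 'a \<Rightarrow> real) \<Rightarrow> (real \<Rightarrow> 'a \<Rightarrow> real) \<Rightarrow> 'a \<Rightarrow> real ^ 3 ^ 3" where
  "Gm W1 W2 \<omega> = lim (\<lambda>n. limit_gram W1 W2 n \<omega>)"

context
  fixes N :: "'b measure" and W1 W2 :: "real \<Rightarrow> 'b \<Rightarrow> real"
  assumes W1: "brownian_motion N W1" and W2: "brownian_motion N W2"
begin

lemma prob_space_limit: "prob_space N"
  using W1 by (simp add: brownian_motion_def)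

lemma limit_coordinate_measurable:
  assumes "j < n"
  shows "(\<lambda>\<omega>. sqrt 2 * W1 (real j / real n) \<omega>) \<in> borel_measurable N" "(\<lambda>\<omega>. sqrt 2 * W2 (real j / real n) \<omega>) \<in> borel_measurable N"
proof -
  have "real j / real n \<in> {0..1}" using assms by auto
  then have "W1 (real j / real n) \<in> borel_measurable N" "W2 (real j / real n) \<in> borel_measurable N"
    by (blast intro: brownian_motion.random_variable[OF W1] brownian_motion.random_variable[OF W2])+
  then show "(\<lambda>\<omega>. sqrt 2 * W1 (real j / real n) \<omega>) \<in> borel_measurable N" "(\<lambda>\<omega>. sqrt 2 * W2 (real j / real n) \<omega>) \<in> borel_measurable N"
    by simp_all
qed

lemma limit_gram_measurable: "limit_gram W1 W2 n \<in> borel_measurable N"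
  unfolding limit_gram_def[abs_def] by (intro gram_measurable limit_coordinate_measurable)

lemma Gm_measurable: "Gm W1 W2 \<in> borel_measurable N"
  unfolding Gm_def[abs_def] by (intro borel_measurable_lim_metric limit_gram_measurable)

lemma limit_gram_tendsto: "AE \<omega> in N. (\<lambda>n. limit_gram W1 W2 n \<omega>) \<longlonglongrightarrow> G_limit W1 W2 \<omega>"
  using brownian_motion.continuous_paths[OF W1] brownian_motion.continuous_paths[OF W2]
proof eventually_elim
  case (elim \<omega>)
  show ?case unfolding limit_gram_def G_limit_def I_infinity_def
    by (rule gram_tendsto[OF grid_close_self grid_close_self]) (intro continuous_intros elim)+
qed

lemma Gm_eq: "AE \<omega> in N. Gm W1 W2 \<omega> = G_limit W1 W2 \<omega>"
  using limit_gram_tendsto unfolding Gm_def by eventually_elim (rule limI)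

lemma Gm_nonneg_forms: "AE \<omega> in N. Gm W1 W2 \<omega> \<in> nonneg_forms"
  using limit_gram_tendsto Gm_eq
proof eventually_elim
  case (elim \<omega>)
  show ?case unfolding elim(2)
    by (rule closed_sequentially[OF closed_nonneg_forms _ elim(1)]) (simp add: limit_gram_def gram_nonneg_forms)
qed

lemma laplace_limit_gram: "(\<lambda>n. \<integral>\<omega>. exp (- quad \<kappa> (limit_gram W1 W2 n \<omega>)) \<partial>N) \<longlonglongrightarrow> (\<integral>\<omega>. exp (- quad \<kappa> (Gm W1 W2 \<omega>)) \<partial>N)"
proof -
  interpret N: prob_space N by (rule prob_space_limit)
  note [measurable] = limit_gram_measurable Gm_measurable
  show ?thesis
  proof (rule integral_dominated_convergence[where w="\<lambda>_. 1"])
    show "AE \<omega> in N. (\<lambda>n. exp (- quad \<kappa> (limit_gram W1 W2 n \<omega>))) \<longlonglongrightarrow> exp (- quad \<kappa> (Gm W1 W2 \<omega>))"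
      using limit_gram_tendsto Gm_eq
    proof eventually_elim
      case (elim \<omega>)
      show ?case unfolding elim(2) by (intro tendsto_exp tendsto_minus quad_tendsto elim(1))
    qed
    show "AE \<omega> in N. norm (exp (- quad \<kappa> (limit_gram W1 W2 n \<omega>))) \<le> 1" for n
      using quad_nonneg[OF gram_nonneg_forms] by (intro AE_I2) (simp add: limit_gram_def)
  qed auto
qed

text \<open>Three approximations: the matrix by its coarse version, uniformly in T \<ge> n; the
  coarse version by its limit as T tends to infinity at fixed n; and the coarse limit matrix by the
  full one as n tends to infinity.\<close>

lemma laplace_convergence:
  assumes B: "brownian_motion M B" and ind: "indep_processes N W1 W2"
  shows "((\<lambda>T. \<integral>\<omega>. exp (- quad \<kappa> (brownian_motion.Cm B T \<omega>)) \<partial>M) \<longlongrightarrow> (\<integral>\<omega>. exp (- quad \<kappa> (Gm W1 W2 \<omega>)) \<partial>N)) at_top"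
proof -
  interpret B: brownian_motion M B by (rule B)
  interpret N: prob_space N by (rule prob_space_limit)
  have coarse: "((\<lambda>T. \<integral>\<omega>. exp (- quad \<kappa> (gram n (\<lambda>j. B.xcoarse n T j \<omega>) (\<lambda>j. B.ycoarse n T j \<omega>))) \<partial>M)
     \<longlongrightarrow> (\<integral>\<omega>. exp (- quad \<kappa> (limit_gram W1 W2 n \<omega>)) \<partial>N)) at_top" if n: "0 < n" for n
  proof -
    obtain fs where fs: "\<And>X Y. exp (- quad \<kappa> (gram n X Y)) = gfac n fs X Y" using exp_quad_gram_eq_gfac[OF n] by blast
    define U where "U j \<omega> = (if j < n then sqrt 2 * W1 (real j / real n) \<omega> else 0)" for j \<omega>
    define V where "V j \<omega> = (if j < n then sqrt 2 * W2 (real j / real n) \<omega> else 0)" for j \<omega>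
    have UVm: "U j \<in> borel_measurable N" "V j \<in> borel_measurable N" for j
      unfolding U_def[abs_def] V_def[abs_def] by (cases "j < n"; simp add: limit_coordinate_measurable[simplified])+
    have UV: "limit_gram W1 W2 n \<omega> = gram n (\<lambda>j. U j \<omega>) (\<lambda>j. V j \<omega>)" for \<omega>
      unfolding limit_gram_def gram_def U_def V_def by simp
    have lin: "lin n a b (\<lambda>j. U j \<omega>) (\<lambda>j. V j \<omega>) = lin n a b (\<lambda>j. sqrt 2 * W1 (real j / real n) \<omega>) (\<lambda>j. sqrt 2 * W2 (real j / real n) \<omega>)" for a b \<omega>
      unfolding lin_def U_def V_def by simp
    show ?thesis unfolding UV fs
    proof (rule gfac_expectation_convergence)
      show "((\<lambda>T. \<integral>\<omega>. cis (lin n a b (\<lambda>j. B.xcoarse n T j \<omega>) (\<lambda>j. B.ycoarse n T j \<omega>)) \<partial>M)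
         \<longlongrightarrow> (\<integral>\<omega>. cis (lin n a b (\<lambda>j. U j \<omega>) (\<lambda>j. V j \<omega>)) \<partial>N)) at_top" for a b
        unfolding lin limit_fdd_cis[OF W1 W2 ind n] by (rule B.coarse_fdd_convergence[OF n])
    qed (use UVm B.coarse_measurable in \<open>auto intro: N.prob_space_axioms B.prob_space_axioms\<close>)
  qed
  let ?K = "\<Sum>i\<in>UNIV. \<Sum>j\<in>UNIV. real (\<kappa> i j)"
  show ?thesis
  proof (rule tendsto_approx)
    fix e :: real assume e: "0 < e"
    have "(\<lambda>n. ?K * ((8 + 96 * exp 24) / sqrt (real n))) \<longlonglongrightarrow> ?K * 0" by (intro tendsto_mult_left) real_asymp
    then have "\<forall>\<^sub>F n in sequentially. ?K * ((8 + 96 * exp 24) / sqrt (real n)) < e"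
      using e by (intro order_tendstoD(2)) auto
    moreover have "\<forall>\<^sub>F n in sequentially. dist (\<integral>\<omega>. exp (- quad \<kappa> (limit_gram W1 W2 n \<omega>)) \<partial>N) (\<integral>\<omega>. exp (- quad \<kappa> (Gm W1 W2 \<omega>)) \<partial>N) < e"
      using laplace_limit_gram e by (rule tendstoD)
    ultimately have "\<forall>\<^sub>F n in sequentially. 0 < n \<and> ?K * ((8 + 96 * exp 24) / sqrt (real n)) < e \<and>
        dist (\<integral>\<omega>. exp (- quad \<kappa> (limit_gram W1 W2 n \<omega>)) \<partial>N) (\<integral>\<omega>. exp (- quad \<kappa> (Gm W1 W2 \<omega>)) \<partial>N) < e"
      using eventually_gt_at_top[of 0] by eventually_elim simp
    then obtain n where n: "0 < n" "?K * ((8 + 96 * exp 24) / sqrt (real n)) < e"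
        "dist (\<integral>\<omega>. exp (- quad \<kappa> (limit_gram W1 W2 n \<omega>)) \<partial>N) (\<integral>\<omega>. exp (- quad \<kappa> (Gm W1 W2 \<omega>)) \<partial>N) < e"
      unfolding eventually_sequentially by blast
    show "\<exists>h l'. (h \<longlongrightarrow> l') at_top \<and> (\<forall>\<^sub>F T in at_top. \<bar>(\<integral>\<omega>. exp (- quad \<kappa> (B.Cm T \<omega>)) \<partial>M) - h T\<bar> \<le> e) \<and> \<bar>(\<integral>\<omega>. exp (- quad \<kappa> (Gm W1 W2 \<omega>)) \<partial>N) - l'\<bar> \<le> e"
    proof (intro exI conjI)
      show "((\<lambda>T. \<integral>\<omega>. exp (- quad \<kappa> (gram n (\<lambda>j. B.xcoarse n T j \<omega>) (\<lambda>j. B.ycoarse n T j \<omega>))) \<partial>M)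
        \<longlongrightarrow> (\<integral>\<omega>. exp (- quad \<kappa> (limit_gram W1 W2 n \<omega>)) \<partial>N)) at_top" by (rule coarse[OF n(1)])
      show "\<forall>\<^sub>F T in at_top. \<bar>(\<integral>\<omega>. exp (- quad \<kappa> (B.Cm T \<omega>)) \<partial>M) -
          (\<integral>\<omega>. exp (- quad \<kappa> (gram n (\<lambda>j. B.xcoarse n T j \<omega>) (\<lambda>j. B.ycoarse n T j \<omega>))) \<partial>M)\<bar> \<le> e"
        using eventually_ge_at_top[of 1] eventually_ge_at_top[of "real n"]
      proof eventually_elim
        case (elim T)
        show ?case using B.laplace_coarse[OF n(1) elim, of \<kappa>] n(2) by linarith
      qed
      show "\<bar>(\<integral>\<omega>. exp (- quad \<kappa> (Gm W1 W2 \<omega>)) \<partial>N) - (\<integral>\<omega>. exp (- quad \<kappa> (limit_gram W1 W2 n \<omega>)) \<partial>N)\<bar> \<le> e"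
        using n(3) by (simp add: dist_real_def abs_minus_commute)
    qed
  qed
qed

end

section \<open>Convergence of the inverse moments\<close>

text \<open>The integrand of \<open>inverse_moment\<close> as a function of the matrix
  alone.\<close>

definition inverse_cost :: "(real ^ 3 ^ 3 \<Rightarrow> real) \<Rightarrow> real \<Rightarrow> real ^ 3 ^ 3 \<Rightarrow> ennreal" where
  "inverse_cost nrm p A = (if invertible A then ennreal (nrm (matrix_inv A) powr p) else \<infinity>)"

context
  fixes nrm :: "real ^ 3 ^ 3 \<Rightarrow> real"
  assumes nrm: "matrix_norm nrm"
begin

lemma trunc_inv_bounds:
  assumes "0 < K"
  shows "0 \<le> trunc_inv nrm p K A" "trunc_inv nrm p K A \<le> K" "ennreal (trunc_inv nrm p K A) \<le> inverse_cost nrm p A"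
  using assms by (auto simp: trunc_inv_def[OF nrm] inverse_cost_def invertible_det_nz intro!: ennreal_leI)

text \<open>Monotone truncation. For p > 0 it exhibits the cost as a supremum of continuous
  functions, whence its measurability and the use of monotone convergence.\<close>

lemma inverse_cost_eq_SUP: "inverse_cost nrm p A = (SUP m. ennreal (trunc_inv nrm p (real (Suc m)) A))"
proof (rule antisym)
  show "(SUP m. ennreal (trunc_inv nrm p (real (Suc m)) A)) \<le> inverse_cost nrm p A"
    by (intro SUP_least trunc_inv_bounds(3)) simp
  show "inverse_cost nrm p A \<le> (SUP m. ennreal (trunc_inv nrm p (real (Suc m)) A))"
  proof (cases "invertible A")
    case True
    obtain m :: nat where "nrm (matrix_inv A) powr p \<le> real m" using real_arch_simple by blast
    then have "inverse_cost nrm p A \<le> ennreal (trunc_inv nrm p (real (Suc m)) A)"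
      using True by (simp add: inverse_cost_def trunc_inv_def[OF nrm] invertible_det_nz)
    then show ?thesis by (rule SUP_upper2[OF UNIV_I])
  next
    case False
    have "top = (SUP m. of_nat m :: ennreal)" by (simp add: ennreal_SUP_of_nat_eq_top)
    also have "\<dots> \<le> (SUP m. ennreal (trunc_inv nrm p (real (Suc m)) A))"
    proof (intro SUP_mono bexI)
      fix m
      have "of_nat m \<le> ennreal (real (Suc m))" by (simp add: ennreal_of_nat_eq_real_of_nat ennreal_leI)
      then show "of_nat m \<le> ennreal (trunc_inv nrm p (real (Suc m)) A)" using False by (simp add: trunc_inv_def[OF nrm] invertible_det_nz)
    qed simp
    finally show ?thesis by (rule order_trans[OF top_greatest])
  qed
qed

lemma trunc_inv_measurable: "0 < p \<Longrightarrow> 0 < K \<Longrightarrow> trunc_inv nrm p K \<in> borel_measurable borel"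
  by (intro borel_measurable_continuous_onI trunc_inv_continuous nrm)

lemma inverse_cost_measurable:
  assumes "0 < p"
  shows "inverse_cost nrm p \<in> borel_measurable borel"
proof -
  note [measurable] = trunc_inv_measurable[OF assms]
  show ?thesis unfolding inverse_cost_eq_SUP[abs_def] by measurable
qed

text \<open>Truncating x at K loses something only where x > K, and there x \<le> x^2 / K; the
  moment of order 2 p therefore controls the loss.\<close>

lemma inverse_cost_le_trunc:
  assumes K: "0 < K" and A: "det A \<noteq> 0"
  shows "inverse_cost nrm p A \<le> ennreal (trunc_inv nrm p K A) + ennreal (1 / K) * inverse_cost nrm (2 * p) A"
proof -
  define x where "x = nrm (matrix_inv A) powr p"
  have x0: "0 \<le> x" by (simp add: x_def)
  have x2: "nrm (matrix_inv A) powr (2 * p) = x\<^sup>2"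
    unfolding x_def power2_eq_square powr_add[symmetric] mult_2 ..
  have "x \<le> min K x + 1 / K * x\<^sup>2"
  proof (cases "x \<le> K")
    case True
    then show ?thesis using K by simp
  next
    case False
    then have "K * x \<le> x * x" using x0 by (intro mult_right_mono) auto
    then have "x \<le> 1 / K * x\<^sup>2" using K by (simp add: field_simps power2_eq_square)
    then show ?thesis using K False by simp
  qed
  then have "ennreal x \<le> ennreal (min K x + 1 / K * x\<^sup>2)" by (rule ennreal_leI)
  also have "\<dots> = ennreal (min K x) + ennreal (1 / K) * ennreal (x\<^sup>2)"
    using K x0 by (subst ennreal_plus) (auto simp: ennreal_mult[symmetric])
  finally show ?thesis using A by (simp add: inverse_cost_def trunc_inv_def[OF nrm] invertible_det_nz x2 flip: x_def)
qed

lemma inverse_moment_eq_SUP: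
  assumes p: "0 < p" and A: "A \<in> borel_measurable M"
  shows "(\<integral>\<^sup>+\<omega>. inverse_cost nrm p (A \<omega>) \<partial>M) = (SUP m. \<integral>\<^sup>+\<omega>. ennreal (trunc_inv nrm p (real (Suc m)) (A \<omega>)) \<partial>M)"
  unfolding inverse_cost_eq_SUP
proof (rule nn_integral_monotone_convergence_SUP)
  show "incseq (\<lambda>m \<omega>. ennreal (trunc_inv nrm p (real (Suc m)) (A \<omega>)))"
    by (auto simp: incseq_def le_fun_def trunc_inv_def[OF nrm] intro!: ennreal_leI)
  show "(\<lambda>\<omega>. ennreal (trunc_inv nrm p (real (Suc m)) (A \<omega>))) \<in> borel_measurable M" for m
    by (intro measurable_compose[OF measurable_compose[OF A trunc_inv_measurable[OF p]] measurable_ennreal]) simp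
qed

end

text \<open>Real exponents reduce to the integer q = \<lceil>p\<rceil> by y^p \<le> 1 + y^q for y
  \<ge> 0. Almost sure invertibility removes the value \<infinity>.\<close>

lemma (in brownian_motion) Cm_inverse_cost_moment:
  assumes nrm: "matrix_norm nrm" and p: "0 < p"
  obtains C :: real where "0 < C" "\<And>T. 1 \<le> T \<Longrightarrow> (\<integral>\<^sup>+\<omega>. inverse_cost nrm p (Cm T \<omega>) \<partial>M) \<le> ennreal C"
proof -
  define q where "q = nat \<lceil>p\<rceil>"
  have q: "p \<le> real q" unfolding q_def by linarith
  obtain C where C: "0 \<le> C" "\<And>T. 1 \<le> T \<Longrightarrow> (\<integral>\<^sup>+\<omega>. ennreal (nrm (matrix_inv (Cm T \<omega>)) ^ q) \<partial>M) \<le> ennreal C"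
    by (rule Cm_inverse_moment[OF nrm, of q]) blast
  show thesis
  proof
    show "0 < 1 + C" using C by simp
    fix T :: real assume T: "1 \<le> T"
    have qm: "(\<lambda>\<omega>. inverse_cost nrm (real q) (Cm T \<omega>)) \<in> borel_measurable M"
      using q p by (intro measurable_compose[OF Cm_measurable inverse_cost_measurable[OF nrm]]) linarith
    have det: "AE \<omega> in M. inverse_cost nrm (real q) (Cm T \<omega>) = ennreal (nrm (matrix_inv (Cm T \<omega>)) ^ q)"
      using Cm_det_pos[OF T]
    proof eventually_elim
      case (elim \<omega>)
      then show ?case using nrm_inv_pos[OF nrm, of "Cm T \<omega>"] by (simp add: inverse_cost_def invertible_det_nz powr_realpow)
    qed
    have "(\<integral>\<^sup>+\<omega>. inverse_cost nrm p (Cm T \<omega>) \<partial>M) \<le> (\<integral>\<^sup>+\<omega>. 1 + inverse_cost nrm (real q) (Cm T \<omega>) \<partial>M)"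
    proof (rule nn_integral_mono)
      fix \<omega>
      have "y powr p \<le> 1 + y powr real q" if "0 \<le> y" for y
      proof (cases "y \<le> 1")
        case True
        have "y powr p \<le> 1 powr p" using that True p by (intro powr_mono2) auto
        then show ?thesis by (simp add: add_increasing2)
      next
        case False
        then have "y powr p \<le> y powr real q" using q by (intro powr_mono) auto
        then show ?thesis by simp
      qed
      from this[OF nrm_facts(1)[OF nrm]] have "ennreal (nrm A powr p) \<le> 1 + ennreal (nrm A powr real q)" for A
        by (metis ennreal_1 ennreal_leI ennreal_plus powr_ge_zero zero_le_one)
      then show "inverse_cost nrm p (Cm T \<omega>) \<le> 1 + inverse_cost nrm (real q) (Cm T \<omega>)"
        by (simp add: inverse_cost_def)
    qed
    also have "\<dots> = 1 + (\<integral>\<^sup>+\<omega>. inverse_cost nrm (real q) (Cm T \<omega>) \<partial>M)"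
      using qm by (subst nn_integral_add) (auto simp: emeasure_space_1)
    also have "(\<integral>\<^sup>+\<omega>. inverse_cost nrm (real q) (Cm T \<omega>) \<partial>M) = (\<integral>\<^sup>+\<omega>. ennreal (nrm (matrix_inv (Cm T \<omega>)) ^ q) \<partial>M)"
      by (rule nn_integral_cong_AE[OF det])
    also have "1 + \<dots> \<le> 1 + ennreal C" by (intro add_left_mono C T)
    also have "\<dots> = ennreal (1 + C)" using C by simp
    finally show "(\<integral>\<^sup>+\<omega>. inverse_cost nrm p (Cm T \<omega>) \<partial>M) \<le> ennreal (1 + C)" .
  qed
qed

lemma trunc_inv_convergence:
  assumes B: "brownian_motion M B" and W1: "brownian_motion N W1" and W2: "brownian_motion N W2"
    and ind: "indep_processes N W1 W2" and nrm: "matrix_norm nrm" and p: "0 < p" and K: "0 < K"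
  shows "((\<lambda>T. \<integral>\<omega>. trunc_inv nrm p K (brownian_motion.Cm B T \<omega>) \<partial>M) \<longlongrightarrow> (\<integral>\<omega>. trunc_inv nrm p K (Gm W1 W2 \<omega>) \<partial>N)) at_top"
proof -
  interpret B: brownian_motion M B by (rule B)
  show ?thesis
  proof (rule laplace_weak_convergence[where K=K])
    show "prob_space M" "prob_space N" by (rule B.prob_space_axioms prob_space_limit[OF W1 W2])+
    show "(\<integral>\<^sup>+\<omega>. ennreal (norm (B.Cm T \<omega>)) \<partial>M) \<le> ennreal (27 ^ 1 * (1 + 4 * fact (2 * 1) * exp 24))" if "1 \<le> T" for T
      using B.Cm_moment[OF that, of 1] by (simp only: power_one_right)
    show "((\<lambda>T. \<integral>\<omega>. exp (- quad \<kappa> (B.Cm T \<omega>)) \<partial>M) \<longlongrightarrow> (\<integral>\<omega>. exp (- quad \<kappa> (Gm W1 W2 \<omega>)) \<partial>N)) at_top" for \<kappa>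
      by (rule laplace_convergence[OF W1 W2 B ind])
  qed (use K trunc_inv_bounds[OF nrm K] in \<open>auto intro: B.Cm_nonneg_forms B.Cm_measurable Gm_measurable[OF W1 W2] Gm_nonneg_forms[OF W1 W2] trunc_inv_continuous[OF nrm p]\<close>)
qed

theorem proposition4p2:
  fixes M :: "'a measure" and B :: "real \<Rightarrow> 'a \<Rightarrow> real"
    and N :: "'b measure" and W1 W2 :: "real \<Rightarrow> 'b \<Rightarrow> real"
    and nrm :: "real ^ 3 ^ 3 \<Rightarrow> real"
  assumes "brownian_motion M B"
    and "brownian_motion N W1"
    and "brownian_motion N W2"
    and "indep_processes N W1 W2"
    and "matrix_norm nrm"
  shows "(\<forall>p>0. \<exists>C>0. \<forall>T\<ge>sqrt 2. inverse_moment M nrm p (C_tilde B T) \<le> ennreal C) \<and>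
         (\<forall>p>0. ((\<lambda>T. inverse_moment M nrm p (C_tilde B T))
            \<longlongrightarrow> inverse_moment N nrm p (G_limit W1 W2)) at_top)"
proof -
  interpret B: brownian_motion M B by (rule assms)
  note W = assms(2,3) and nrm = assms(5)
  interpret N: prob_space N by (rule prob_space_limit[OF W])
  define a where "a p T = (\<integral>\<^sup>+\<omega>. inverse_cost nrm p (B.Cm T \<omega>) \<partial>M)" for p T
  have a: "inverse_moment M nrm p (C_tilde B T) = a p T" for p T
    unfolding inverse_moment_def a_def inverse_cost_def[symmetric]
  proof (rule nn_integral_cong_AE)
    show "AE \<omega> in M. inverse_cost nrm p (C_tilde B T \<omega>) = inverse_cost nrm p (B.Cm T \<omega>)"
      using B.AE_good by eventually_elim (simp add: B.good_CN_tendsto(2))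
  qed
  have g: "inverse_moment N nrm p (G_limit W1 W2) = (\<integral>\<^sup>+\<omega>. inverse_cost nrm p (Gm W1 W2 \<omega>) \<partial>N)" for p
    unfolding inverse_moment_def inverse_cost_def[symmetric]
  proof (rule nn_integral_cong_AE)
    show "AE \<omega> in N. inverse_cost nrm p (G_limit W1 W2 \<omega>) = inverse_cost nrm p (Gm W1 W2 \<omega>)"
      using Gm_eq[OF W] by eventually_elim simp
  qed
  have bound: "\<exists>C>0. \<forall>T\<ge>1. a p T \<le> ennreal C" if "0 < p" for p
    using B.Cm_inverse_cost_moment[OF nrm that] unfolding a_def by metis
  have "(a p \<longlongrightarrow> (\<integral>\<^sup>+\<omega>. inverse_cost nrm p (Gm W1 W2 \<omega>) \<partial>N)) at_top" if p: "0 < p" for p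
  proof -
    obtain C where C: "0 < C" "\<And>T. 1 \<le> T \<Longrightarrow> a p T \<le> ennreal C" using bound[OF p] by blast
    obtain D where D: "0 < D" "\<And>T. 1 \<le> T \<Longrightarrow> a (2 * p) T \<le> ennreal D" using bound[of "2 * p"] p by auto
    let ?f = "\<lambda>m. trunc_inv nrm p (real (Suc m))"
    have fm [measurable]: "?f m \<in> borel_measurable borel" for m by (rule trunc_inv_measurable[OF nrm p]) simp
    note [measurable] = B.Cm_measurable Gm_measurable[OF W]
    have fm' [measurable]: "(\<lambda>\<omega>. ?f m (B.Cm T \<omega>)) \<in> borel_measurable M" "(\<lambda>\<omega>. ?f m (Gm W1 W2 \<omega>)) \<in> borel_measurable N" for m T
      by measurable
    have fb: "0 \<le> ?f m A" "?f m A \<le> real (Suc m)" for m A by (rule trunc_inv_bounds[OF nrm]; simp)+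
    define \<alpha> where "\<alpha> m T = (\<integral>\<omega>. ?f m (B.Cm T \<omega>) \<partial>M)" for m T
    define \<gamma> where "\<gamma> m = (\<integral>\<omega>. ?f m (Gm W1 W2 \<omega>) \<partial>N)" for m
    have \<alpha>: "(\<integral>\<^sup>+\<omega>. ennreal (?f m (B.Cm T \<omega>)) \<partial>M) = ennreal (\<alpha> m T)" "0 \<le> \<alpha> m T" for m T
      unfolding \<alpha>_def using fb fm' by (auto intro!: nn_integral_eq_integral B.integrable_const_bound[of _ "real (Suc m)"] integral_nonneg_AE simp del: of_nat_Suc)
    have \<gamma>: "(\<integral>\<^sup>+\<omega>. ennreal (?f m (Gm W1 W2 \<omega>)) \<partial>N) = ennreal (\<gamma> m)" "0 \<le> \<gamma> m" for m
      unfolding \<gamma>_def using fb fm' by (auto intro!: nn_integral_eq_integral N.integrable_const_bound[of _ "real (Suc m)"] integral_nonneg_AE simp del: of_nat_Suc)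
    have \<gamma>i: "integrable N (\<lambda>\<omega>. ?f m (Gm W1 W2 \<omega>))" for m
      by (rule N.integrable_const_bound[of _ "real (Suc m)"]) (use fb fm' in \<open>auto simp del: of_nat_Suc\<close>)
    have conv: "(\<alpha> m \<longlongrightarrow> \<gamma> m) at_top" for m
      unfolding \<alpha>_def[abs_def] \<gamma>_def by (rule trunc_inv_convergence[OF assms p]) simp
    have upper: "ennreal (\<alpha> m T) \<le> a p T" for m T
      unfolding \<alpha>(1)[symmetric] a_def by (intro nn_integral_mono trunc_inv_bounds(3)[OF nrm]) simp
    \<comment> \<open>The truncation error at level m + 1 is at most D / (m + 1), uniformly in T
      \<ge> 1, with D the bound on the moment of order 2 p.\<close>
    have lower: "a p T \<le> ennreal (\<alpha> m T + D / real (Suc m))" if T: "1 \<le> T" for m T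
    proof -
      have "a p T \<le> (\<integral>\<^sup>+\<omega>. ennreal (?f m (B.Cm T \<omega>)) + ennreal (1 / real (Suc m)) * inverse_cost nrm (2 * p) (B.Cm T \<omega>) \<partial>M)"
        unfolding a_def
      proof (rule nn_integral_mono_AE)
        show "AE \<omega> in M. inverse_cost nrm p (B.Cm T \<omega>) \<le> ennreal (?f m (B.Cm T \<omega>)) + ennreal (1 / real (Suc m)) * inverse_cost nrm (2 * p) (B.Cm T \<omega>)"
          using B.Cm_det_pos[OF T] by eventually_elim (rule inverse_cost_le_trunc[OF nrm], auto)
      qed
      also have "\<dots> = ennreal (\<alpha> m T) + ennreal (1 / real (Suc m)) * a (2 * p) T"
      proof -
        have "(\<lambda>\<omega>. inverse_cost nrm (2 * p) (B.Cm T \<omega>)) \<in> borel_measurable M"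
          using p by (intro measurable_compose[OF B.Cm_measurable inverse_cost_measurable[OF nrm]]) simp
        then show ?thesis unfolding a_def \<alpha>(1)[symmetric]
          by (subst nn_integral_add) (auto simp: nn_integral_cmult simp del: of_nat_Suc)
      qed
      also have "\<dots> \<le> ennreal (\<alpha> m T) + ennreal (1 / real (Suc m)) * ennreal D"
        by (intro add_left_mono mult_left_mono D T) simp
      also have "\<dots> = ennreal (\<alpha> m T + D / real (Suc m))"
        using \<alpha>(2) D(1) by (simp add: ennreal_mult[symmetric] del: of_nat_Suc)
      finally show ?thesis .
    qed
    have g_SUP: "(\<integral>\<^sup>+\<omega>. inverse_cost nrm p (Gm W1 W2 \<omega>) \<partial>N) = (SUP m. ennreal (\<gamma> m))"
      unfolding inverse_moment_eq_SUP[OF nrm p Gm_measurable[OF W]] \<gamma>(1) ..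
    \<comment> \<open>The uniform bound passes to the truncated limits, so the increasing sequence
      \<gamma> converges and the moment of the limit matrix is finite.\<close>
    have \<gamma>C: "\<gamma> m \<le> C" for m
    proof (rule tendsto_upperbound[OF conv])
      show "\<forall>\<^sub>F T in at_top. \<alpha> m T \<le> C"
        using eventually_ge_at_top[of 1]
      proof eventually_elim
        case (elim T)
        show ?case using order_trans[OF upper C(2)[OF elim], of m] C(1) by simp
      qed
    qed simp
    have mono: "incseq \<gamma>"
    proof (rule incseq_SucI)
      fix m
      show "\<gamma> m \<le> \<gamma> (Suc m)" unfolding \<gamma>_def
      proof (rule integral_mono)
        show "?f m (Gm W1 W2 \<omega>) \<le> ?f (Suc m) (Gm W1 W2 \<omega>)" for \<omega> by (auto simp: trunc_inv_def[OF nrm] min_def)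
      qed (rule \<gamma>i)+
    qed
    obtain l where l: "\<gamma> \<longlonglongrightarrow> l" using incseq_convergent[OF mono, of C] \<gamma>C by blast
    have gl: "(\<integral>\<^sup>+\<omega>. inverse_cost nrm p (Gm W1 W2 \<omega>) \<partial>N) = ennreal l"
    proof -
      have "incseq (\<lambda>m. ennreal (\<gamma> m))" using mono by (auto simp: incseq_def intro!: ennreal_leI)
      then have "(\<lambda>m. ennreal (\<gamma> m)) \<longlonglongrightarrow> (SUP m. ennreal (\<gamma> m))" by (rule LIMSEQ_SUP)
      moreover have "(\<lambda>m. ennreal (\<gamma> m)) \<longlonglongrightarrow> ennreal l" by (rule tendsto_ennrealI[OF l])
      ultimately show ?thesis unfolding g_SUP by (rule LIMSEQ_unique)
    qed
    have fin: "ennreal (enn2real (a p T)) = a p T" if "1 \<le> T" for T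
      using C(2)[OF that] by (simp add: order_le_less_trans[OF _ ennreal_less_top])
    \<comment> \<open>Both sides are finite by now, so the comparison is made in the reals and
      transferred back to \<open>ennreal\<close> afterwards.\<close>
    have "((\<lambda>T. enn2real (a p T)) \<longlongrightarrow> l) at_top"
    proof (rule tendsto_approx)
      fix e :: real assume e: "0 < e"
      have "(\<lambda>m. D / real (Suc m)) \<longlonglongrightarrow> 0" by real_asymp
      then have "\<forall>\<^sub>F m in sequentially. D / real (Suc m) < e" using e by (rule order_tendstoD(2))
      moreover have "\<forall>\<^sub>F m in sequentially. dist (\<gamma> m) l < e" by (rule tendstoD[OF l e])
      ultimately have "\<forall>\<^sub>F m in sequentially. D / real (Suc m) < e \<and> dist (\<gamma> m) l < e" by eventually_elim simp
      then obtain m where m: "D / real (Suc m) < e" "dist (\<gamma> m) l < e" unfolding eventually_sequentially by blast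
      show "\<exists>h l'. (h \<longlongrightarrow> l') at_top \<and> (\<forall>\<^sub>F T in at_top. \<bar>enn2real (a p T) - h T\<bar> \<le> e) \<and> \<bar>l - l'\<bar> \<le> e"
      proof (intro exI conjI)
        show "(\<alpha> m \<longlongrightarrow> \<gamma> m) at_top" by (rule conv)
        show "\<forall>\<^sub>F T in at_top. \<bar>enn2real (a p T) - \<alpha> m T\<bar> \<le> e"
          using eventually_ge_at_top[of 1]
        proof eventually_elim
          case (elim T)
          have "\<alpha> m T \<le> enn2real (a p T)"
          proof -
            have "ennreal (\<alpha> m T) \<le> ennreal (enn2real (a p T))" by (subst fin[OF elim]) (rule upper)
            then show ?thesis by (subst (asm) ennreal_le_iff) simp_all
          qed
          moreover have "enn2real (a p T) \<le> \<alpha> m T + D / real (Suc m)"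
            using lower[OF elim, of m] \<alpha>(2)[of m T] D(1) by (intro enn2real_leI) auto
          ultimately show ?case using m(1) by linarith
        qed
        show "\<bar>l - \<gamma> m\<bar> \<le> e" using m(2) by (simp add: dist_real_def abs_minus_commute)
      qed
    qed
    then have "((\<lambda>T. ennreal (enn2real (a p T))) \<longlongrightarrow> ennreal l) at_top" by (rule tendsto_ennrealI)
    moreover have "\<forall>\<^sub>F T in at_top. ennreal (enn2real (a p T)) = a p T"
      using eventually_ge_at_top[of 1] by (rule eventually_mono) (rule fin)
    ultimately show ?thesis unfolding gl by (rule Lim_transform_eventually)
  qed
  moreover have "1 \<le> sqrt 2" by simp
  ultimately show ?thesis unfolding a g using bound by (meson order_trans)
qed

end
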